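(* Fix $\beta\ge0$. Assume $0\le s<d/2$ and $\mu\in L^\infty\cap\mathcal P(\mathbb R^d)$; if $s=0$, assume in addition $$\int_{(\mathbb R^d)^2}|\log|x-y||\,d\mu^{\otimes2}(x,y)<\infty,\qquad\int_{\mathbb R^d}e^{-4\beta h_\mu}\,d\mu<\infty,\qquad\tilde{\mathsf g}\in L^2(\mu^{\otimes2}).$$ Let $\phi_1,\dots,\phi_k\in L^2(\mu)$ be real-valued. Then, for every $\theta=(\theta_1,\dots,\theta_k)\in\mathbb R^k$, $$\lim_{N\to\infty}\mathbb E_{X_N\sim\mathbb Q_{N,\beta}(\mu)}\Big[\exp\Big(\mathrm i\sum_{i=1}^k\theta_iS_N(\phi_i)\Big)\Big]=\exp\Big(-\frac12\sum_{i,j=1}^k\theta_i\theta_j\Sigma_{\beta,\mu}(\phi_i,\phi_j)\Big).$$ Consequently, $(S_N(\phi_1),\dots,S_N(\phi_k))$ converges in law under $\mathbb Q_{N,\beta}(\mu)$ to a centered Gaussian vector with covariance matrix $(\Sigma_{\beta,\mu}(\phi_i,\phi_j))_{i,j=1}^k$. If, in addition, $\phi_1,\dots,\phi_k\in L^\infty(\mu)$, then, for every $\theta\in\mathbb R^k$, $$\lim_{N\to\infty}\mathbb E_{X_N\sim\mathbb Q_{N,\beta}(\mu)}\Big[\exp\Big(\sum_{i=1}^k\theta_iS_N(\phi_i)\Big)\Big]=\exp\Big(\frac12\sum_{i,j=1}^k\theta_i\theta_j\Sigma_{\beta,\mu}(\phi_i,\phi_j)\Big).$$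
   Context: Fix a dimension $d\ge1$. $\mathcal P(\mathbb R^d)$ is the set of Borel probability measures; $\mu\in L^\infty\cap\mathcal P(\mathbb R^d)$ means $\mu$ has a bounded Lebesgue density. For $0\le s<d$ let $\mathsf g(x)=-\log|x|$ if $s=0$ and $\mathsf g(x)=\frac1s|x|^{-s}$ if $0<s<d$. Set $h_\mu(x)=\int\mathsf g(x-y)d\mu(y)$, $I_\mu=\frac12\iint\mathsf g(x-y)d\mu(x)d\mu(y)$, $\tilde{\mathsf g}(x,y)=\mathsf g(x-y)-h_\mu(x)-h_\mu(y)+2I_\mu$. For $X_N=(x_1,\dots,x_N)$: $$\mathsf F_N(X_N,\mu)=\frac1{2N^2}\sum_{i\ne j}\tilde{\mathsf g}(x_i,x_j)-\frac1{N^2}\sum_ih_\mu(x_i)+\frac1NI_\mu,\qquad \mathsf K_{N,\beta}(\mu)=\mathbb E_{\mu^{\otimes N}}[e^{-\beta N\mathsf F_N(X_N,\mu)}],$$ and $d\mathbb Q_{N,\beta}(\mu)(X_N)=\mathsf K_{N,\beta}(\mu)^{-1}e^{-\beta N\mathsf F_N(X_N,\mu)}d\mu^{\otimes N}(X_N)$. Let $\mu_N=\frac1N\sum_i\delta_{x_i}$. For $\phi\in L^2(\mu)$, $$S_N(\phi)=\sqrt N\Big(\int\phi\,d\mu_N-\int\phi\,d\mu\Big),\quad\bar\phi=\phi-\int\phi\,d\mu,\quad\Sigma_{\beta,\mu}(\phi,\psi)=\big\langle\bar\phi,(\mathrm{Id}+\beta T_\mu)^{-1}\bar\psi\big\rangle_{L^2(\mu)},$$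 where $T_\mu f(x)=\int\tilde{\mathsf g}(x,y)f(y)\,d\mu(y)$ is a nonnegative self-adjoint Hilbert--Schmidt operator on $L^2(\mu)$. *)

theory Defs
  imports "HOL-Probability.Probability"
begin

section \<open>Function spaces\<close>

text \<open>Elements of \<open>L\<^sup>2\<close> and \<open>L\<^sup>\<infinity>\<close> are represented by functions, not by classes modulo
  almost everywhere equality.\<close>

definition L2 :: "'b measure \<Rightarrow> ('b \<Rightarrow> real) set" where
  "L2 M = {f \<in> borel_measurable M. integrable M (\<lambda>x. (f x)\<^sup>2)}"

definition Linf :: "'b measure \<Rightarrow> ('b \<Rightarrow> real) set" where
  "Linf M = {f \<in> borel_measurable M. \<exists>C. AE x in M. \<bar>f x\<bar> \<le> C}"

definition L2_inner :: "'b measure \<Rightarrow> ('b \<Rightarrow> real) \<Rightarrow> ('b \<Rightarrow> real) \<Rightarrow> real" where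
  "L2_inner M f g = (\<integral>x. f x * g x \<partial>M)"

definition bounded_density :: "'a::euclidean_space measure \<Rightarrow> bool" where
  "bounded_density \<mu> \<longleftrightarrow>
     (\<exists>\<rho> \<in> Linf lborel. (AE x in lborel. 0 \<le> \<rho> x) \<and> \<mu> = density lborel (\<lambda>x. ennreal (\<rho> x)))"

section \<open>Interaction kernel and energies\<close>

text \<open>The value at \<open>0\<close> is \<open>0\<close>; the diagonal is a null set for
  every product of measures with a density.\<close>

definition gker :: "real \<Rightarrow> 'a::euclidean_space \<Rightarrow> real" where
  "gker s x = (if s = 0 then - ln (norm x) else (1 / s) * norm x powr (- s))"

definition hpot :: "real \<Rightarrow> 'a::euclidean_space measure \<Rightarrow> 'a \<Rightarrow> real" where
  "hpot s \<mu> x = (\<integral>y. gker s (x - y) \<partial>\<mu>)"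

definition Ien :: "real \<Rightarrow> 'a::euclidean_space measure \<Rightarrow> real" where
  "Ien s \<mu> = (1 / 2) * integral\<^sup>L (\<mu> \<Otimes>\<^sub>M \<mu>) (\<lambda>(x, y). gker s (x - y))"

definition gtilde :: "real \<Rightarrow> 'a::euclidean_space measure \<Rightarrow> 'a \<Rightarrow> 'a \<Rightarrow> real" where
  "gtilde s \<mu> x y = gker s (x - y) - hpot s \<mu> x - hpot s \<mu> y + 2 * Ien s \<mu>"

text \<open>A configuration of \<open>N\<close> points is indexed by \<open>{..<N}\<close>.\<close>

definition FN :: "real \<Rightarrow> 'a::euclidean_space measure \<Rightarrow> nat \<Rightarrow> (nat \<Rightarrow> 'a) \<Rightarrow> real" where
  "FN s \<mu> N X =
     1 / (2 * (real N)\<^sup>2) * (\<Sum>i<N. \<Sum>j\<in>{..<N} - {i}. gtilde s \<mu> (X i) (X j))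
     - 1 / (real N)\<^sup>2 * (\<Sum>i<N. hpot s \<mu> (X i))
     + 1 / real N * Ien s \<mu>"

abbreviation iid :: "'a::euclidean_space measure \<Rightarrow> nat \<Rightarrow> (nat \<Rightarrow> 'a) measure" where
  "iid \<mu> N \<equiv> Pi\<^sub>M {..<N} (\<lambda>_. \<mu>)"

definition KN :: "real \<Rightarrow> real \<Rightarrow> 'a::euclidean_space measure \<Rightarrow> nat \<Rightarrow> real" where
  "KN s \<beta> \<mu> N = (\<integral>X. exp (- \<beta> * real N * FN s \<mu> N X) \<partial>(iid \<mu> N))"

definition QN :: "real \<Rightarrow> real \<Rightarrow> 'a::euclidean_space measure \<Rightarrow> nat \<Rightarrow> (nat \<Rightarrow> 'a) measure" where
  "QN s \<beta> \<mu> N =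
     density (iid \<mu> N) (\<lambda>X. ennreal (inverse (KN s \<beta> \<mu> N) * exp (- \<beta> * real N * FN s \<mu> N X)))"

section \<open>Fluctuations and limiting covariance\<close>

definition empirical :: "nat \<Rightarrow> (nat \<Rightarrow> 'a::euclidean_space) \<Rightarrow> 'a measure" where
  "empirical N X = distr (uniform_count_measure {..<N}) borel X"

definition SN :: "'a::euclidean_space measure \<Rightarrow> nat \<Rightarrow> ('a \<Rightarrow> real) \<Rightarrow> (nat \<Rightarrow> 'a) \<Rightarrow> real" where
  "SN \<mu> N \<phi> X = sqrt (real N) * ((\<integral>x. \<phi> x \<partial>(empirical N X)) - (\<integral>x. \<phi> x \<partial>\<mu>))"

lemma integral_empirical:
  fixes \<phi> :: "'a::euclidean_space \<Rightarrow> real"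
  assumes "\<phi> \<in> borel_measurable borel"
  shows "(\<integral>x. \<phi> x \<partial>(empirical N X)) = 1 / real N * (\<Sum>i<N. \<phi> (X i))"
proof -
  have "(\<integral>x. \<phi> x \<partial>(empirical N X)) = (\<integral>i. \<phi> (X i) \<partial>(uniform_count_measure {..<N}))"
    unfolding empirical_def
    by (rule integral_distr) (use assms in \<open>auto simp: measurable_def space_uniform_count_measure
        sets_uniform_count_measure\<close>)
  also have "\<dots> = 1 / real N * (\<Sum>i<N. \<phi> (X i))"
    by (simp add: uniform_count_measure_def lebesgue_integral_point_measure_finite
        sum_divide_distrib)
  finally show ?thesis .
qed

definition centred :: "'b measure \<Rightarrow> ('b \<Rightarrow> real) \<Rightarrow> 'b \<Rightarrow> real" where
  "centred \<mu> \<phi> x = \<phi> x - (\<integral>y. \<phi> y \<partial>\<mu>)"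

definition Top :: "real \<Rightarrow> 'a::euclidean_space measure \<Rightarrow> ('a \<Rightarrow> real) \<Rightarrow> 'a \<Rightarrow> real" where
  "Top s \<mu> f x = (\<integral>y. gtilde s \<mu> x y * f y \<partial>\<mu>)"

text \<open>A representative of \<open>(Id + \<beta> T)\<inverse> \<psi>\<close>. Since \<open>T\<close> is bounded and nonnegative on \<open>L\<^sup>2(\<mu>)\<close> and
  \<open>\<beta> \<ge> 0\<close>, it exists and is unique up to \<open>\<mu>\<close>-almost everywhere equality,
  so the choice does not affect inner products.\<close>

definition resolvent ::
  "real \<Rightarrow> real \<Rightarrow> 'a::euclidean_space measure \<Rightarrow> ('a \<Rightarrow> real) \<Rightarrow> 'a \<Rightarrow> real" where
  "resolvent s \<beta> \<mu> \<psi> = (SOME f. f \<in> L2 \<mu> \<and> (AE x in \<mu>. f x + \<beta> * Top s \<mu> f x = \<psi> x))"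

definition Sigma_cov ::
  "real \<Rightarrow> real \<Rightarrow> 'a::euclidean_space measure \<Rightarrow> ('a \<Rightarrow> real) \<Rightarrow> ('a \<Rightarrow> real) \<Rightarrow> real" where
  "Sigma_cov s \<beta> \<mu> \<phi> \<psi> = L2_inner \<mu> (centred \<mu> \<phi>) (resolvent s \<beta> \<mu> (centred \<mu> \<psi>))"

section \<open>Gaussian vectors and convergence in law\<close>

text \<open>Point masses count as Gaussian laws: the covariance matrix may be singular.\<close>

definition gaussian_real :: "real measure \<Rightarrow> bool" where
  "gaussian_real M \<longleftrightarrow>
     (\<exists>m. M = return borel m \<or>
       (\<exists>\<sigma>>0. M = density lborel (\<lambda>x. ennreal (normal_density m \<sigma> x))))"

definition centred_gaussian :: "(real^'k) measure \<Rightarrow> real^'k^'k \<Rightarrow> bool" where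
  "centred_gaussian \<gamma> C \<longleftrightarrow>
     prob_space \<gamma> \<and> sets \<gamma> = sets borel \<and>
     (\<forall>\<theta>. gaussian_real (distr \<gamma> borel (\<lambda>x. \<theta> \<bullet> x))) \<and>
     (\<forall>i. (\<integral>x. x $ i \<partial>\<gamma>) = 0) \<and>
     (\<forall>i j. (\<integral>x. x $ i * x $ j \<partial>\<gamma>) = C $ i $ j)"

definition conv_in_law :: "(nat \<Rightarrow> 'b::topological_space measure) \<Rightarrow> 'b measure \<Rightarrow> bool" where
  "conv_in_law M \<gamma> \<longleftrightarrow>
     (\<forall>f::'b \<Rightarrow> real. continuous_on UNIV f \<and> bounded (range f) \<longrightarrow>
       (\<lambda>n. \<integral>x. f x \<partial>(M n)) \<longlonglongrightarrow> (\<integral>x. f x \<partial>\<gamma>))"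

end

theory Submission
  imports Defs
begin

text \<open>
  The Gibbs weight is \<open>exp (- U / N)\<close> up to lower order terms, where \<open>U\<close> is the degenerate U-statistic
  of the kernel \<open>\<beta> g\<close>, \<open>g\<close> being the doubly centred interaction. If this kernel is a finite sum
  \<open>\<Sum>\<^sub>k \<psi>\<^sub>k(x) \<psi>\<^sub>k(y)\<close>, then \<open>U / N\<close> is essentially half the sum of the squares of the normalised sums of the
  \<open>\<psi>\<^sub>k\<close>; Hubbard--Stratonovich linearises each square, and the classical central limit theorem together with a
  rank one update of the resolvent per square gives the limit. A general kernel is approximated in \<open>L\<^sup>2\<close>
  by such sums: \<open>U / N\<close> is controlled in \<open>L\<^sup>2\<close> by the \<open>L\<^sup>2\<close> norm of the kernel, and replacing one exponential
  weight by another costs little because the weights are uniformly square integrable.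

  Both the approximation and the uniform bound come from writing the Riesz kernel as a mixture of Gaussians
  \<open>exp (- t\<^sup>2 |z|\<^sup>2)\<close>. Each Gaussian is itself an average of characters, so a kernel with \<open>t\<close> in a compact
  range is a bounded mixture of rank two positive kernels. The range of large \<open>t\<close> is small in \<open>L\<^sup>2\<close>, because
  the density is bounded and \<open>s < d / 2\<close>, and the range of small \<open>t\<close> is small in \<open>L\<^sup>2\<close> by dominated convergence.
  For the uniform bound the part with \<open>t\<close> below a cut-off contributes a nonpositive exponent up to its diagonal,
  and the remaining small tail is estimated through exponential moments of U-statistics.

  Finally, characteristic functions determine convergence in law by Stone--Weierstrass and a uniform first moment
  bound, and the Laplace transforms follow from uniform exponential moments.
\<close>

section \<open>Square integrable functions and U-statistics\<close>

text \<open>The obstacle is the diagonal. The square of a normalised sum contains the squares of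
  \<open>\<psi> k (X i)\<close>, which the U-statistic omits. Their mean is the trace of the
  approximating kernel, which need not stay bounded as the approximation improves, since the
  interaction is only known to be Hilbert--Schmidt. Every estimate is therefore made for the
  Gaussian constant multiplied by the exponential of half the trace. With A the finite rank operator
  this product is det_2(Id + A)^(-1/2), det_2 being the Carleman--Fredholm determinant; it is at
  least 1 and is bounded above through the Hilbert--Schmidt norm. Its limit is never identified,
  because only quotients of transforms are used.

  In the uniform bound the diagonal helps: restored at x for the small t part, it is at most a
  constant minus twice the potential, and this is compensated exactly by the potential term in
  \<open>FN\<close>. What remains is a U-statistic whose kernel is bounded below and has rows that
  are uniformly small in L2; one-sided exponential moments are all that the weight requires.\<close>

abbreviation ipow :: "'b measure \<Rightarrow> nat \<Rightarrow> (nat \<Rightarrow> 'b) measure" where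
  "ipow M n \<equiv> Pi\<^sub>M {..<n} (\<lambda>_. M)"

text \<open>Extended real values let norm estimates be stated before integrability is known;
  membership in \<open>L2\<close> is then read off from finiteness.\<close>

definition sqn :: "'b measure \<Rightarrow> ('b \<Rightarrow> real) \<Rightarrow> ennreal" where
  "sqn M f = (\<integral>\<^sup>+x. ennreal ((f x)\<^sup>2) \<partial>M)"

text \<open>Pairs are grouped by their larger index, so passing from n to \<open>Suc n\<close> adds
  the sum of \<open>K (X i) (X n)\<close> over the earlier points. For a centred kernel these
  increments are martingale differences.\<close>

definition ustat :: "('b \<Rightarrow> 'b \<Rightarrow> real) \<Rightarrow> nat \<Rightarrow> (nat \<Rightarrow> 'b) \<Rightarrow> real" where
  "ustat K n X = (\<Sum>j<n. \<Sum>i<j. K (X i) (X j))"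

lemma sqn_add_le:
  assumes [measurable]: "f \<in> borel_measurable M" "g \<in> borel_measurable M"
  shows "sqn M (\<lambda>x. f x + g x) \<le> 2 * sqn M f + 2 * sqn M g"
proof -
  have "sqn M (\<lambda>x. f x + g x) \<le> (\<integral>\<^sup>+x. 2 * ennreal ((f x)\<^sup>2) + 2 * ennreal ((g x)\<^sup>2) \<partial>M)"
    unfolding sqn_def
  proof (rule nn_integral_mono)
    fix x
    have "(f x + g x)\<^sup>2 \<le> 2 * (f x)\<^sup>2 + 2 * (g x)\<^sup>2"
      using zero_le_power2[of "f x - g x"] by (simp add: power2_eq_square algebra_simps)
    then have "ennreal ((f x + g x)\<^sup>2) \<le> ennreal (2 * (f x)\<^sup>2 + 2 * (g x)\<^sup>2)"
      by (rule ennreal_leI)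
    then show "ennreal ((f x + g x)\<^sup>2) \<le> 2 * ennreal ((f x)\<^sup>2) + 2 * ennreal ((g x)\<^sup>2)"
      by (simp add: ennreal_mult'')
  qed
  also have "\<dots> = 2 * sqn M f + 2 * sqn M g"
    unfolding sqn_def by (subst nn_integral_add) (simp_all add: nn_integral_cmult)
  finally show ?thesis .
qed

lemma sqn_cmult:
  assumes [measurable]: "f \<in> borel_measurable M"
  shows "sqn M (\<lambda>x. c * f x) = ennreal (c\<^sup>2) * sqn M f"
  unfolding sqn_def by (simp add: power_mult_distrib ennreal_mult'' nn_integral_cmult)

lemma sqn_uminus: "sqn M (\<lambda>x. - f x) = sqn M f"
  unfolding sqn_def by simp

lemma sqn_diff_le:
  assumes [measurable]: "f \<in> borel_measurable M" "g \<in> borel_measurable M"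
  shows "sqn M (\<lambda>x. f x - g x) \<le> 2 * sqn M f + 2 * sqn M g"
  using sqn_add_le[of f M "\<lambda>x. - g x"] by (simp add: sqn_uminus)

lemma L2_iff_sqn: "f \<in> L2 M \<longleftrightarrow> f \<in> borel_measurable M \<and> sqn M f < \<infinity>"
  unfolding L2_def sqn_def by (auto simp: integrable_iff_bounded)

lemma sqn_eq_integral: "f \<in> L2 M \<Longrightarrow> sqn M f = ennreal (\<integral>x. (f x)\<^sup>2 \<partial>M)"
  unfolding L2_def sqn_def by (simp add: nn_integral_eq_integral)

lemma L2_D: "f \<in> L2 M \<Longrightarrow> f \<in> borel_measurable M" "f \<in> L2 M \<Longrightarrow> integrable M (\<lambda>x. (f x)\<^sup>2)"
  by (auto simp: L2_def)

lemma L2_cmult: "f \<in> L2 M \<Longrightarrow> (\<lambda>x. c * f x) \<in> L2 M"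
  unfolding L2_def by (auto simp: power_mult_distrib)

lemma L2_add: "f \<in> L2 M \<Longrightarrow> g \<in> L2 M \<Longrightarrow> (\<lambda>x. f x + g x) \<in> L2 M"
  using sqn_add_le[of f M g]
  by (auto simp: L2_iff_sqn ennreal_mult_less_top intro: le_less_trans)

lemma L2_diff: "f \<in> L2 M \<Longrightarrow> g \<in> L2 M \<Longrightarrow> (\<lambda>x. f x - g x) \<in> L2 M"
  using L2_add[of f M "\<lambda>x. (-1) * g x"] L2_cmult[of g M "-1"] by simp

lemma L2_zero: "(\<lambda>x. 0) \<in> L2 M"
  by (simp add: L2_def)

lemma L2_sum: "(\<And>i. i \<in> I \<Longrightarrow> f i \<in> L2 M) \<Longrightarrow> (\<lambda>x. \<Sum>i\<in>I. f i x) \<in> L2 M"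
  by (induction I rule: infinite_finite_induct) (auto simp: L2_zero L2_add)

lemma L2_mult_integrable:
  assumes "f \<in> L2 M" "g \<in> L2 M" shows "integrable M (\<lambda>x. f x * g x)"
proof (rule Bochner_Integration.integrable_bound)
  show "integrable M (\<lambda>x. (f x)\<^sup>2 + (g x)\<^sup>2)" using assms by (auto simp: L2_def)
  show "(\<lambda>x. f x * g x) \<in> borel_measurable M" using assms by (auto simp: L2_def)
  show "AE x in M. norm (f x * g x) \<le> norm ((f x)\<^sup>2 + (g x)\<^sup>2)"
  proof (rule AE_I2)
    fix x
    have "2 * (\<bar>f x\<bar> * \<bar>g x\<bar>) \<le> (f x)\<^sup>2 + (g x)\<^sup>2"
      using zero_le_power2[of "\<bar>f x\<bar> - \<bar>g x\<bar>"] by (simp add: power2_eq_square algebra_simps)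
    then show "norm (f x * g x) \<le> norm ((f x)\<^sup>2 + (g x)\<^sup>2)"
      by (simp add: abs_mult) (smt (verit) mult_nonneg_nonneg abs_ge_zero)
  qed
qed

lemma (in finite_measure) L2_integrable: "f \<in> L2 M \<Longrightarrow> integrable M f"
  by (auto simp: L2_def intro: square_integrable_imp_integrable)

lemma (in finite_measure) L2_const: "(\<lambda>x. c) \<in> L2 M"
  by (simp add: L2_def)

lemma (in finite_measure) L2_bounded:
  "f \<in> borel_measurable M \<Longrightarrow> (\<And>x. \<bar>f x\<bar> \<le> B) \<Longrightarrow> f \<in> L2 M"
  unfolding L2_def
proof (clarsimp, rule integrable_const_bound[where B="B\<^sup>2"])
  assume "\<And>x. \<bar>f x\<bar> \<le> B"
  then have "(f x)\<^sup>2 \<le> B\<^sup>2" for x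
    by (metis abs_ge_zero power2_abs power_mono)
  then show "AE x in M. norm ((f x)\<^sup>2) \<le> B\<^sup>2" by simp
qed simp

lemma L2_inner_cauchy_schwarz:
  assumes "f \<in> L2 M" "g \<in> L2 M"
  shows "(L2_inner M f g)\<^sup>2 \<le> (\<integral>x. (f x)\<^sup>2 \<partial>M) * (\<integral>x. (g x)\<^sup>2 \<partial>M)"
proof -
  have [measurable]: "f \<in> borel_measurable M" "g \<in> borel_measurable M" using assms by (auto simp: L2_def)
  have i: "integrable M (\<lambda>x. \<bar>f x\<bar> * \<bar>g x\<bar>)"
    using integrable_abs[OF L2_mult_integrable[OF assms]] by (simp add: abs_mult)
  have "(\<integral>\<^sup>+x. ennreal \<bar>f x\<bar> * ennreal \<bar>g x\<bar> \<partial>M)\<^sup>2 \<le> (\<integral>\<^sup>+x. ennreal \<bar>f x\<bar> ^ 2 \<partial>M) * (\<integral>\<^sup>+x. ennreal \<bar>g x\<bar> ^ 2 \<partial>M)"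
    by (rule Cauchy_Schwarz_nn_integral) auto
  also have "(\<integral>\<^sup>+x. ennreal \<bar>f x\<bar> * ennreal \<bar>g x\<bar> \<partial>M) = ennreal (\<integral>x. \<bar>f x\<bar> * \<bar>g x\<bar> \<partial>M)"
    using i by (subst nn_integral_eq_integral[symmetric]) (auto simp: ennreal_mult'')
  also have "(\<integral>\<^sup>+x. ennreal \<bar>f x\<bar> ^ 2 \<partial>M) = ennreal (\<integral>x. (f x)\<^sup>2 \<partial>M)"
    using assms by (simp add: ennreal_power sqn_eq_integral[symmetric] sqn_def)
  also have "(\<integral>\<^sup>+x. ennreal \<bar>g x\<bar> ^ 2 \<partial>M) = ennreal (\<integral>x. (g x)\<^sup>2 \<partial>M)"
    using assms by (simp add: ennreal_power sqn_eq_integral[symmetric] sqn_def)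
  finally have "(\<integral>x. \<bar>f x\<bar> * \<bar>g x\<bar> \<partial>M)\<^sup>2 \<le> (\<integral>x. (f x)\<^sup>2 \<partial>M) * (\<integral>x. (g x)\<^sup>2 \<partial>M)"
    by (simp add: ennreal_power ennreal_mult''[symmetric])
  moreover
  have "\<bar>L2_inner M f g\<bar> \<le> (\<integral>x. \<bar>f x\<bar> * \<bar>g x\<bar> \<partial>M)"
    unfolding L2_inner_def using integral_abs_bound[of M "\<lambda>x. f x * g x"] by (simp add: abs_mult)
  then have "(L2_inner M f g)\<^sup>2 \<le> (\<integral>x. \<bar>f x\<bar> * \<bar>g x\<bar> \<partial>M)\<^sup>2"
    using power_mono[of "\<bar>L2_inner M f g\<bar>" _ 2] by simp
  ultimately show ?thesis by (rule order_trans[rotated])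
qed

section \<open>Moments of sums and U-statistics on product spaces\<close>

context prob_space
begin

lemma ipow_prob_space: "prob_space (ipow M n)"
  by (intro prob_space_PiM) (rule prob_space_axioms)

text \<open>Fubini with the newest coordinate integrated innermost, that is, conditioning on the
  first n points. The inductions on the number of points rest on this.\<close>

lemma nn_integral_ipow_Suc:
  assumes "f \<in> borel_measurable (ipow M (Suc n))"
  shows "(\<integral>\<^sup>+X. f X \<partial>ipow M (Suc n)) = (\<integral>\<^sup>+X. \<integral>\<^sup>+x. f (X(n := x)) \<partial>M \<partial>ipow M n)"
proof -
  interpret P: product_sigma_finite "\<lambda>_::nat. M" by unfold_locales
  show ?thesis using P.product_nn_integral_insert[of "{..<n}" n f] assms
    by (simp add: lessThan_Suc)
qed

lemma measurable_fun_upd_ipow [measurable]: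
  "(\<lambda>(X, x). X(n := x)) \<in> measurable (ipow M n \<Otimes>\<^sub>M M) (ipow M (Suc n))"
  unfolding lessThan_Suc by (rule measurable_add_dim)

lemma AE_ipow_Suc:
  assumes [measurable]: "Measurable.pred (ipow M (Suc n)) P"
    and "AE X in ipow M n. AE x in M. P (X(n := x))"
  shows "AE X in ipow M (Suc n). P X"
proof -
  have "(\<integral>\<^sup>+X. indicator {X. \<not> P X} X \<partial>ipow M (Suc n)) =
        (\<integral>\<^sup>+X. \<integral>\<^sup>+x. indicator {X. \<not> P X} (X(n := x)) \<partial>M \<partial>ipow M n)"
    by (rule nn_integral_ipow_Suc) simp
  also have "\<dots> = (\<integral>\<^sup>+X. 0 \<partial>ipow M n)"
    using assms(2)
    by (intro nn_integral_cong_AE, elim eventually_mono) (auto intro!: nn_integral_zero' elim!: eventually_mono)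
  finally have "(\<integral>\<^sup>+X. indicator {X. \<not> P X} X \<partial>ipow M (Suc n)) = 0" by simp
  then have "AE X in ipow M (Suc n). indicator {X. \<not> P X} X = (0::ennreal)"
    by (subst (asm) nn_integral_0_iff_AE) auto
  then show ?thesis by eventually_elim (auto simp: indicator_def split: if_splits)
qed

text \<open>The cross term \<open>2 * c * D x\<close> integrates to zero. When \<open>D\<close> is
  not square integrable the right-hand side is infinite, so the lemma can be applied under a further
  integral without checking integrability.\<close>

lemma nn_integral_sq_add_centred:
  assumes [measurable]: "D \<in> borel_measurable M" and "(\<integral>x. D x \<partial>M) = 0"
  shows "(\<integral>\<^sup>+x. ennreal ((c + D x)\<^sup>2) \<partial>M) \<le> ennreal (c\<^sup>2) + sqn M D"
proof (cases "sqn M D < \<infinity>")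
  case True
  then have D: "D \<in> L2 M" by (simp add: L2_iff_sqn)
  then have i: "integrable M D" "integrable M (\<lambda>x. (D x)\<^sup>2)" by (auto intro: L2_integrable L2_D)
  have "(\<integral>\<^sup>+x. ennreal ((c + D x)\<^sup>2) \<partial>M) = ennreal (\<integral>x. (c\<^sup>2 + 2 * c * D x + (D x)\<^sup>2) \<partial>M)"
  proof (subst nn_integral_eq_integral[symmetric])
    show "integrable M (\<lambda>x. c\<^sup>2 + 2 * c * D x + (D x)\<^sup>2)" using i by auto
    have *: "c\<^sup>2 + 2 * c * D x + (D x)\<^sup>2 = (c + D x)\<^sup>2" for x
      by (simp add: power2_sum)
    then show "AE x in M. 0 \<le> c\<^sup>2 + 2 * c * D x + (D x)\<^sup>2" by simp
    show "(\<integral>\<^sup>+x. ennreal ((c + D x)\<^sup>2) \<partial>M) = (\<integral>\<^sup>+x. ennreal (c\<^sup>2 + 2 * c * D x + (D x)\<^sup>2) \<partial>M)"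
      unfolding * ..
  qed
  also have "(\<integral>x. (c\<^sup>2 + 2 * c * D x + (D x)\<^sup>2) \<partial>M) = c\<^sup>2 + (\<integral>x. (D x)\<^sup>2 \<partial>M)"
    using i assms by (simp add: prob_space)
  finally show ?thesis using D by (simp add: sqn_eq_integral)
next
  case False
  then show ?thesis by (simp add: less_top[symmetric])
qed

lemma nn_integral_iid_sum_sq:
  assumes [measurable]: "f \<in> borel_measurable M" and "(\<integral>x. f x \<partial>M) = 0"
  shows "(\<integral>\<^sup>+X. ennreal ((\<Sum>i<n. f (X i))\<^sup>2) \<partial>ipow M n) \<le> of_nat n * sqn M f"
proof (induction n)
  case 0
  then show ?case by simp
next
  case (Suc n)
  have "(\<integral>\<^sup>+X. ennreal ((\<Sum>i<Suc n. f (X i))\<^sup>2) \<partial>ipow M (Suc n)) =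
     (\<integral>\<^sup>+X. \<integral>\<^sup>+x. ennreal (((\<Sum>i<n. f (X i)) + f x)\<^sup>2) \<partial>M \<partial>ipow M n)"
    by (subst nn_integral_ipow_Suc) auto
  also have "\<dots> \<le> (\<integral>\<^sup>+X. ennreal ((\<Sum>i<n. f (X i))\<^sup>2) + sqn M f \<partial>ipow M n)"
    by (intro nn_integral_mono nn_integral_sq_add_centred assms)
  also have "\<dots> = (\<integral>\<^sup>+X. ennreal ((\<Sum>i<n. f (X i))\<^sup>2) \<partial>ipow M n) + sqn M f"
    using prob_space.emeasure_space_1[OF ipow_prob_space[of n]] by (subst nn_integral_add) auto
  also have "\<dots> \<le> of_nat n * sqn M f + sqn M f"
    using Suc by (intro add_mono) auto
  finally show ?case by (simp add: algebra_simps)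
qed

text \<open>Orthogonality is used in both variables. Given the first n points, the increment
  \<open>\<Sum>i<n. K (X i) y\<close> is centred in y, so the increments are orthogonal; for fixed y
  it is itself a sum of independent centred variables, so its second moment is at most n times that
  of \<open>K\<close>. Summing the integers below n gives at most n^2 / 2, hence
  \<open>ustat K N X / N\<close> is controlled in L2 by the L2 norm of \<open>K\<close>, uniformly
  in N.\<close>

lemma nn_integral_ustat_sq:
  assumes [measurable]: "case_prod K \<in> borel_measurable (M \<Otimes>\<^sub>M M)"
    and c1: "AE x in M. (\<integral>y. K x y \<partial>M) = 0" and c2: "AE y in M. (\<integral>x. K x y \<partial>M) = 0"
    and K2: "sqn (M \<Otimes>\<^sub>M M) (case_prod K) < \<infinity>"
  shows "2 * (\<integral>\<^sup>+X. ennreal ((ustat K n X)\<^sup>2) \<partial>ipow M n) \<le> (of_nat n)\<^sup>2 * sqn (M \<Otimes>\<^sub>M M) (case_prod K)"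
proof (induction n)
  case 0
  then show ?case by (simp add: ustat_def)
next
  case (Suc n)
  interpret PP: pair_prob_space M M ..
  interpret Pn: prob_space "ipow M n" by (rule ipow_prob_space)
  interpret PPn: pair_prob_space "ipow M n" M ..
  let ?Q = "sqn (M \<Otimes>\<^sub>M M) (case_prod K)"
  have um [measurable]: "ustat K m \<in> borel_measurable (ipow M m)" for m
    unfolding ustat_def by measurable
  let ?D = "\<lambda>X y. \<Sum>i<n. K (X i) y"
  have fin: "AE x in M. (\<integral>\<^sup>+y. ennreal ((K x y)\<^sup>2) \<partial>M) < \<infinity>"
  proof -
    have "(\<integral>\<^sup>+x. (\<integral>\<^sup>+y. ennreal ((K x y)\<^sup>2) \<partial>M) \<partial>M) = ?Q"
      unfolding sqn_def by (subst nn_integral_fst[symmetric]) auto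
    then show ?thesis using K2 nn_integral_PInf_AE[of "\<lambda>x. (\<integral>\<^sup>+y. ennreal ((K x y)\<^sup>2) \<partial>M)"]
      by (auto simp: less_top)
  qed
  have i: "AE x in M. integrable M (K x)"
    using fin AE_space
  proof eventually_elim
    case (elim x)
    then have [measurable]: "K x \<in> borel_measurable M" by measurable
    from elim have "K x \<in> L2 M" by (auto simp: L2_iff_sqn sqn_def)
    then show ?case by (rule L2_integrable)
  qed
  have good: "AE X in ipow M n. \<forall>i<n. integrable M (K (X i)) \<and> (\<integral>y. K (X i) y \<partial>M) = 0"
  proof (simp only: AE_all_countable, intro allI)
    fix i show "AE X in ipow M n. i < n \<longrightarrow> integrable M (K (X i)) \<and> (\<integral>y. K (X i) y \<partial>M) = 0"
    proof (cases "i < n")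
      case True
      then show ?thesis
        using AE_PiM_component[of "{..<n}" "\<lambda>_. M" i "\<lambda>x. integrable M (K x) \<and> (\<integral>y. K x y \<partial>M) = 0"] i c1 prob_space_axioms
        by auto
    qed simp
  qed
  have "(\<integral>\<^sup>+X. ennreal ((ustat K (Suc n) X)\<^sup>2) \<partial>ipow M (Suc n)) =
     (\<integral>\<^sup>+X. \<integral>\<^sup>+x. ennreal ((ustat K n X + ?D X x)\<^sup>2) \<partial>M \<partial>ipow M n)"
    by (subst nn_integral_ipow_Suc) (auto simp: ustat_def intro!: nn_integral_cong)
  also have "\<dots> \<le> (\<integral>\<^sup>+X. ennreal ((ustat K n X)\<^sup>2) + sqn M (?D X) \<partial>ipow M n)"
  proof (intro nn_integral_mono_AE)
    show "AE X in ipow M n. (\<integral>\<^sup>+x. ennreal ((ustat K n X + ?D X x)\<^sup>2) \<partial>M) \<le> ennreal ((ustat K n X)\<^sup>2) + sqn M (?D X)"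
      using good AE_space
    proof eventually_elim
      case (elim X)
      then have "(\<integral>y. (\<Sum>i<n. K (X i) y) \<partial>M) = 0" by (subst Bochner_Integration.integral_sum) auto
      moreover have "(\<lambda>y. \<Sum>i<n. K (X i) y) \<in> borel_measurable M"
        using elim by (intro borel_measurable_sum) auto
      ultimately show ?case by (intro nn_integral_sq_add_centred)
    qed
  qed
  also have "\<dots> = (\<integral>\<^sup>+X. ennreal ((ustat K n X)\<^sup>2) \<partial>ipow M n) + (\<integral>\<^sup>+X. sqn M (?D X) \<partial>ipow M n)"
    unfolding sqn_def by (intro nn_integral_add) auto
  also have "(\<integral>\<^sup>+X. sqn M (?D X) \<partial>ipow M n) = (\<integral>\<^sup>+y. (\<integral>\<^sup>+X. ennreal ((?D X y)\<^sup>2) \<partial>ipow M n) \<partial>M)"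
    unfolding sqn_def by (rule PPn.Fubini'[symmetric]) measurable
  also have "\<dots> \<le> (\<integral>\<^sup>+y. of_nat n * sqn M (\<lambda>x. K x y) \<partial>M)"
    using c2 AE_space by (intro nn_integral_mono_AE, eventually_elim) (auto intro!: nn_integral_iid_sum_sq)
  also have "\<dots> = of_nat n * (\<integral>\<^sup>+y. sqn M (\<lambda>x. K x y) \<partial>M)"
    unfolding sqn_def by (rule nn_integral_cmult) measurable
  also have "(\<integral>\<^sup>+y. sqn M (\<lambda>x. K x y) \<partial>M) = ?Q"
    unfolding sqn_def by (subst PP.nn_integral_snd[symmetric]) (auto simp: case_prod_beta)
  finally have *: "(\<integral>\<^sup>+X. ennreal ((ustat K (Suc n) X)\<^sup>2) \<partial>ipow M (Suc n)) \<le>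
     (\<integral>\<^sup>+X. ennreal ((ustat K n X)\<^sup>2) \<partial>ipow M n) + of_nat n * ?Q" by simp
  have "2 * (\<integral>\<^sup>+X. ennreal ((ustat K (Suc n) X)\<^sup>2) \<partial>ipow M (Suc n)) \<le>
     2 * (\<integral>\<^sup>+X. ennreal ((ustat K n X)\<^sup>2) \<partial>ipow M n) + 2 * of_nat n * ?Q"
    using mult_left_mono[OF *, of 2] by (simp add: distrib_left mult.assoc)
  \<comment> \<open>The bound n^2, rather than the exact n * (n - 1), completes to a square and
    needs no subtraction in \<open>ennreal\<close>.\<close>
  also have "\<dots> \<le> (of_nat n)\<^sup>2 * ?Q + 2 * of_nat n * ?Q" using Suc by (intro add_mono) auto
  also have "\<dots> \<le> ((of_nat n)\<^sup>2 + 2 * of_nat n + 1) * ?Q" by (simp add: distrib_right)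
  also have "\<dots> = (of_nat (Suc n))\<^sup>2 * ?Q" by (simp add: power2_eq_square distrib_left distrib_right mult_2 mult_2_right add.assoc)
  finally show ?case .
qed

end

section \<open>Finite rank kernels\<close>

definition L20 :: "'b measure \<Rightarrow> ('b \<Rightarrow> real) set" where
  "L20 M = {f \<in> L2 M. (\<integral>x. f x \<partial>M) = 0}"

definition lin :: "nat \<Rightarrow> ('b \<Rightarrow> real) \<Rightarrow> (nat \<Rightarrow> 'b) \<Rightarrow> real" where
  "lin N f X = (\<Sum>i<N. f (X i)) / sqrt (real N)"

lemma measurable_lin [measurable]:
  assumes [measurable]: "f \<in> borel_measurable M"
  shows "lin N f \<in> borel_measurable (ipow M N)"
  unfolding lin_def by measurable

lemma lin_add: "lin N (\<lambda>x. f x + g x) X = lin N f X + lin N g X"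
  by (simp add: lin_def sum.distrib add_divide_distrib)

lemma lin_cmult: "lin N (\<lambda>x. c * f x) X = c * lin N f X"
  by (simp add: lin_def sum_distrib_left)

lemma L20_L2: "f \<in> L20 M \<Longrightarrow> f \<in> L2 M"
  by (simp add: L20_def)

lemma L2_inner_commute: "L2_inner M f g = L2_inner M g f"
  by (simp add: L2_inner_def mult.commute)

lemma L2_inner_add_left:
  "f \<in> L2 M \<Longrightarrow> g \<in> L2 M \<Longrightarrow> h \<in> L2 M \<Longrightarrow>
    L2_inner M (\<lambda>x. f x + g x) h = L2_inner M f h + L2_inner M g h"
  by (simp add: L2_inner_def distrib_right L2_mult_integrable)

lemma L2_inner_diff_left:
  "f \<in> L2 M \<Longrightarrow> g \<in> L2 M \<Longrightarrow> h \<in> L2 M \<Longrightarrow>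
    L2_inner M (\<lambda>x. f x - g x) h = L2_inner M f h - L2_inner M g h"
  by (simp add: L2_inner_def left_diff_distrib L2_mult_integrable)

lemma L2_inner_cmult_left: "L2_inner M (\<lambda>x. c * f x) h = c * L2_inner M f h"
  by (simp add: L2_inner_def mult.assoc)

lemma L2_inner_sum_left:
  "(\<And>i. i \<in> I \<Longrightarrow> f i \<in> L2 M) \<Longrightarrow> h \<in> L2 M \<Longrightarrow>
    L2_inner M (\<lambda>x. \<Sum>i\<in>I. f i x) h = (\<Sum>i\<in>I. L2_inner M (f i) h)"
  by (simp add: L2_inner_def sum_distrib_right L2_mult_integrable)

lemma L2_inner_add_right:
  "f \<in> L2 M \<Longrightarrow> g \<in> L2 M \<Longrightarrow> h \<in> L2 M \<Longrightarrow>
    L2_inner M h (\<lambda>x. f x + g x) = L2_inner M h f + L2_inner M h g"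
  using L2_inner_add_left[of f M g h] by (simp add: L2_inner_commute)

lemma L2_inner_diff_right:
  "f \<in> L2 M \<Longrightarrow> g \<in> L2 M \<Longrightarrow> h \<in> L2 M \<Longrightarrow>
    L2_inner M h (\<lambda>x. f x - g x) = L2_inner M h f - L2_inner M h g"
  using L2_inner_diff_left[of f M g h] by (simp add: L2_inner_commute)

lemma L2_inner_cmult_right: "L2_inner M h (\<lambda>x. c * f x) = c * L2_inner M h f"
  using L2_inner_cmult_left[of M c f h] by (simp add: L2_inner_commute)

lemma L2_inner_self: "L2_inner M f f = (\<integral>x. (f x)\<^sup>2 \<partial>M)"
  by (simp add: L2_inner_def power2_eq_square)

lemma L2_inner_self_nonneg: "0 \<le> L2_inner M f f"
  by (simp add: L2_inner_self)

text \<open>This is ln (1 + D) >= D - D^2 / 2, halved and exponentiated. It compares one determinant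
  factor \<open>1 + D\<close> with its first order term and leaves a remainder quadratic in
  \<open>D\<close>, which a Hilbert--Schmidt norm can control.\<close>

lemma exp_half_le:
  fixes D :: real assumes "0 \<le> D" shows "exp (D / 2 - D\<^sup>2 / 4) \<le> sqrt (1 + D)"
proof -
  let ?h = "\<lambda>x::real. ln (1 + x) - x + x\<^sup>2 / 2"
  have "?h 0 \<le> ?h D"
  proof (rule DERIV_nonneg_imp_nondecreasing[OF assms])
    fix x :: real assume x: "0 \<le> x" "x \<le> D"
    have "(?h has_real_derivative (1 / (1 + x) - 1 + x)) (at x)"
      using x by (auto intro!: derivative_eq_intros)
    moreover have "1 / (1 + x) - 1 + x = x\<^sup>2 / (1 + x)"
      using x by (simp add: field_simps power2_eq_square)
    ultimately show "\<exists>y. (?h has_real_derivative y) (at x) \<and> 0 \<le> y" using x by auto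
  qed
  then have "D - D\<^sup>2 / 2 \<le> ln (1 + D)" by simp
  then have "exp (D - D\<^sup>2 / 2) \<le> 1 + D"
    using assms by (subst ln_ge_iff[symmetric]) auto
  then have "sqrt (exp (D - D\<^sup>2 / 2)) \<le> sqrt (1 + D)" by simp
  also have "sqrt (exp (D - D\<^sup>2 / 2)) = exp (D / 2 - D\<^sup>2 / 4)"
    by (rule real_sqrt_unique) (simp_all add: power2_eq_square mult_exp_exp)
  finally show ?thesis .
qed

text \<open>Completing the square: against the standard normal density the integrand is a multiple
  of a normal density with mean -B / (1 + D) and variance 1 / (1 + D). In the main use
  \<open>z\<close> is the Hubbard--Stratonovich variable and the quadratic is a resolvent form at a
  function shifted by \<open>z\<close>.\<close>

lemma gaussian_quadratic_integral:
  fixes A B D :: real assumes D: "0 \<le> D"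
  shows "(\<integral>z. exp (- (A + 2 * B * z + D * z\<^sup>2) / 2) \<partial>std_normal_distribution) =
     exp (- (A - B\<^sup>2 / (1 + D)) / 2) / sqrt (1 + D)"
proof -
  define \<sigma> where "\<sigma> = 1 / sqrt (1 + D)"
  define m where "m = - B / (1 + D)"
  have s: "0 < \<sigma>" "\<sigma>\<^sup>2 = 1 / (1 + D)" using D by (auto simp: \<sigma>_def power_divide)
  have "(\<integral>z. exp (- (A + 2 * B * z + D * z\<^sup>2) / 2) \<partial>std_normal_distribution) =
    (\<integral>z. std_normal_density z * exp (- (A + 2 * B * z + D * z\<^sup>2) / 2) \<partial>lborel)"
    by (subst integral_density) auto
  also have "\<dots> = (\<integral>z. exp (- (A - B\<^sup>2 / (1 + D)) / 2) / sqrt (1 + D) * normal_density m \<sigma> z \<partial>lborel)"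
  proof (rule Bochner_Integration.integral_cong[OF refl])
    fix z :: real
    have e: "- (z\<^sup>2 / 2) + - (A + 2 * B * z + D * z\<^sup>2) / 2 =
       - (A - B\<^sup>2 / (1 + D)) / 2 + - ((z - m)\<^sup>2 / (2 * \<sigma>\<^sup>2))"
    proof -
      define E where "E = 1 + D"
      then have E: "D = E - 1" "0 < E" using D by auto
      have "(z - m)\<^sup>2 / (2 * \<sigma>\<^sup>2) = (E * z\<^sup>2 + 2 * B * z + B\<^sup>2 / E) / 2"
        unfolding s m_def E using E(2) by (simp add: field_simps power2_eq_square)
      then show ?thesis unfolding E by (simp add: field_simps)
    qed
    have r: "sqrt (2 * pi * \<sigma>\<^sup>2) = sqrt (2 * pi) / sqrt (1 + D)"
      unfolding s by (simp add: real_sqrt_divide real_sqrt_mult)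
    have "std_normal_density z * exp (- (A + 2 * B * z + D * z\<^sup>2) / 2) =
       1 / sqrt (2 * pi) * exp (- (z\<^sup>2 / 2) + - (A + 2 * B * z + D * z\<^sup>2) / 2)"
      unfolding exp_add by (simp add: std_normal_density_def)
    also have "\<dots> = exp (- (A - B\<^sup>2 / (1 + D)) / 2) / sqrt (1 + D) * normal_density m \<sigma> z"
      unfolding e exp_add normal_density_def r using D by (simp add: field_simps)
    finally show "std_normal_density z * exp (- (A + 2 * B * z + D * z\<^sup>2) / 2) = \<dots>" .
  qed
  also have "\<dots> = exp (- (A - B\<^sup>2 / (1 + D)) / 2) / sqrt (1 + D)"
    using s by simp
  finally show ?thesis .
qed

section \<open>Limits of transforms for finite rank kernels\<close>

context prob_space
begin

lemma L20_zero: "(\<lambda>x. 0) \<in> L20 M" by (simp add: L20_def L2_zero)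

lemma L20_cmult: "f \<in> L20 M \<Longrightarrow> (\<lambda>x. c * f x) \<in> L20 M"
  by (simp add: L20_def L2_cmult)

lemma L20_add: "f \<in> L20 M \<Longrightarrow> g \<in> L20 M \<Longrightarrow> (\<lambda>x. f x + g x) \<in> L20 M"
  by (auto simp: L20_def L2_add L2_integrable)

lemma L20_diff: "f \<in> L20 M \<Longrightarrow> g \<in> L20 M \<Longrightarrow> (\<lambda>x. f x - g x) \<in> L20 M"
  by (auto simp: L20_def L2_diff L2_integrable)

lemma norm_integral_le_const:
  fixes f :: "'a \<Rightarrow> 'c::{banach, second_countable_topology}"
  assumes "f \<in> borel_measurable M" "\<And>x. norm (f x) \<le> B"
  shows "norm (\<integral>x. f x \<partial>M) \<le> B"
proof -
  have "integrable M f" using assms by (intro integrable_const_bound[where B=B]) auto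
  then have "(\<integral>x. norm (f x) \<partial>M) \<le> B" using assms by (intro integral_le_const) auto
  then show ?thesis using integral_norm_bound[of M f] by linarith
qed

text \<open>The sums for different N live on different product spaces, so the law of one point is
  pushed to the line and its characteristic function is raised to the power N. Its second order
  expansion is compared with (1 - \<sigma> / (2 N))^N; the variance \<open>\<sigma>\<close> may
  vanish.\<close>

lemma clt_char:
  assumes f: "f \<in> L20 M"
  shows "(\<lambda>N. \<integral>X. iexp (lin N f X) \<partial>ipow M N) \<longlonglongrightarrow> exp (- (\<integral>x. (f x)\<^sup>2 \<partial>M) / 2)"
proof -
  define \<sigma> where "\<sigma> = (\<integral>x. (f x)\<^sup>2 \<partial>M)"
  define \<mu> where "\<mu> = distr M borel f"
  have fm [measurable]: "f \<in> borel_measurable M" and f2: "integrable M (\<lambda>x. (f x)\<^sup>2)" and f0: "(\<integral>x. f x \<partial>M) = 0"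
    using f by (auto simp: L20_def L2_def)
  have f1: "integrable M f" using f by (auto simp: L20_def intro: L2_integrable)
  interpret \<mu>: real_distribution \<mu> unfolding \<mu>_def by (rule real_distribution_distr) simp
  have [simp]: "integrable \<mu> (\<lambda>x. x)" "\<mu>.expectation (\<lambda>x. x) = 0" "integrable \<mu> (\<lambda>x. x\<^sup>2)"
     "\<mu>.expectation (\<lambda>x. x\<^sup>2) = \<sigma>"
    using f1 f2 f0 by (simp_all add: \<mu>_def \<sigma>_def integrable_distr_eq integral_distr)
  have s0: "0 \<le> \<sigma>" by (simp add: \<sigma>_def)
  let ?a = "\<lambda>n. \<integral>X. iexp (lin n f X) \<partial>ipow M n"
  interpret P: product_sigma_finite "\<lambda>_::nat. M" by unfold_locales
  have a_eq: "?a n = char \<mu> (1 / sqrt (real n)) ^ n" for n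
  proof -
    have "?a n = (\<integral>X. (\<Prod>i<n. iexp (f (X i) / sqrt (real n))) \<partial>ipow M n)"
      by (simp add: lin_def exp_sum[symmetric] sum_divide_distrib sum_distrib_left)
    also have "\<dots> = (\<Prod>i<n. \<integral>x. iexp (f x / sqrt (real n)) \<partial>M)"
      by (rule P.product_integral_prod) (auto intro!: integrable_const_bound[where B=1])
    also have "(\<integral>x. iexp (f x / sqrt (real n)) \<partial>M) = char \<mu> (1 / sqrt (real n))"
      unfolding char_def \<mu>_def by (subst integral_distr) auto
    finally show ?thesis by simp
  qed
  have main: "\<forall>\<^sub>F n in sequentially.
      cmod (?a n - (1 + (- \<sigma> / 2) / n)^n) \<le> 1 / 6 * (LINT x|\<mu>. min (6 * x\<^sup>2) (\<bar>1 / sqrt n\<bar> * \<bar>x\<bar> ^ 3))"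
  proof (rule eventually_sequentiallyI)
    fix n :: nat
    assume "n \<ge> max 1 (nat (ceiling (\<sigma> / 4)))"
    \<comment> \<open>This puts 1 - \<sigma> / (2 n) into [-1, 1], as the comparison of n-th powers
      requires.\<close>
    then have n: "n \<ge> \<sigma> / 4" "n > 0" by linarith+
    let ?t = "1 / sqrt (real n)"
    have "norm (char \<mu> ?t - (1 - ?t^2 * \<sigma> / 2)) \<le> ?t\<^sup>2 / 6 * (LINT x|\<mu>. min (6 * x\<^sup>2) (\<bar>?t\<bar> * \<bar>x\<bar> ^ 3))"
      by (rule \<mu>.char_approx3) auto
    also have "?t^2 * \<sigma> / 2 = \<sigma> / 2 / n" using n by (simp add: power_divide)
    finally have **: "norm (char \<mu> ?t - (1 + (- \<sigma> / 2) / n)) \<le>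
      ?t\<^sup>2 / 6 * (LINT x|\<mu>. min (6 * x\<^sup>2) (\<bar>?t\<bar> * \<bar>x\<bar> ^ 3))" by simp
    have le1: "\<bar>1 + (- \<sigma> / 2) / real n\<bar> \<le> 1"
      using n s0 by (auto simp: field_simps intro!: abs_leI)
    have "norm (?a n - (complex_of_real (1 + (- \<sigma> / 2) / n))^n) \<le>
         n * norm (char \<mu> ?t - (complex_of_real (1 + (- \<sigma> / 2) / n)))"
      unfolding a_eq using le1
      by (intro norm_power_diff \<mu>.cmod_char_le_1) (simp only: norm_of_real)
    also have "\<dots> \<le> n * (?t\<^sup>2 / 6 * (LINT x|\<mu>. min (6 * x\<^sup>2) (\<bar>?t\<bar> * \<bar>x\<bar> ^ 3)))"
      using ** by (intro mult_left_mono) auto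
    also have "\<dots> = 1 / 6 * (LINT x|\<mu>. min (6 * x\<^sup>2) (\<bar>?t\<bar> * \<bar>x\<bar> ^ 3))"
      using n by (simp add: power_divide)
    finally show "cmod (?a n - (1 + (- \<sigma> / 2) / n)^n) \<le>
        1 / 6 * (LINT x|\<mu>. min (6 * x\<^sup>2) (\<bar>?t\<bar> * \<bar>x\<bar> ^ 3))"
      by simp
  qed
  have "\<And>x. (\<lambda>n. min (6 * x\<^sup>2) (\<bar>x\<bar> ^ 3 / \<bar>sqrt (real n)\<bar>)) \<longlonglongrightarrow> 0"
    by (auto simp: min_absorb2
             intro!: tendsto_min[THEN tendsto_eq_rhs] sqrt_at_top[THEN filterlim_compose]
                     filterlim_at_top_imp_at_infinity
                     tendsto_divide_0 filterlim_real_sequentially)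
  then have "(\<lambda>n. LINT x|\<mu>. min (6 * x\<^sup>2) (\<bar>1 / sqrt (real n)\<bar> * \<bar>x\<bar> ^ 3)) \<longlonglongrightarrow> (LINT x|\<mu>. 0)"
    by (intro integral_dominated_convergence [where w = "\<lambda>x. 6 * x^2"]) auto
  then have *: "(\<lambda>n. 1 / 6 * (LINT x|\<mu>. min (6 * x\<^sup>2) (\<bar>1 / sqrt (real n)\<bar> * \<bar>x\<bar> ^ 3))) \<longlonglongrightarrow> 0"
    by (simp only: integral_zero tendsto_mult_right_zero)
  have "(\<lambda>n. complex_of_real ((1 + (- \<sigma> / 2) / n)^n)) \<longlonglongrightarrow> complex_of_real (exp (- \<sigma> / 2))"
    by (rule isCont_tendsto_compose [OF _ tendsto_exp_limit_sequentially]) auto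
  then have "?a \<longlonglongrightarrow> complex_of_real (exp (- \<sigma> / 2))"
    by (rule Lim_transform) (rule Lim_null_comparison [OF main[unfolded of_real_power[symmetric]] *, simplified of_real_add of_real_1])
  then show ?thesis by (simp add: \<sigma>_def exp_of_real)
qed


text \<open>The equation (Id + A) f = \<phi> for the operator A with kernel
  \<open>\<Sum>k<m. \<psi> k x * \<psi> k y\<close>. It is required at every point, which finite
  rank permits, so that solutions can be substituted as functions.\<close>

definition fr_solves :: "(nat \<Rightarrow> 'a \<Rightarrow> real) \<Rightarrow> nat \<Rightarrow> ('a \<Rightarrow> real) \<Rightarrow> ('a \<Rightarrow> real) \<Rightarrow> bool" where
  "fr_solves \<psi> m \<phi> f \<longleftrightarrow> (\<forall>x. f x + (\<Sum>k<m. L2_inner M (\<psi> k) f * \<psi> k x) = \<phi> x)"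

lemma fr_solves_inner:
  assumes "fr_solves \<psi> m \<phi> f" "f \<in> L2 M" "h \<in> L2 M" "\<And>k. k < m \<Longrightarrow> \<psi> k \<in> L2 M"
  shows "L2_inner M \<phi> h = L2_inner M f h + (\<Sum>k<m. L2_inner M (\<psi> k) f * L2_inner M (\<psi> k) h)"
proof -
  have "\<phi> = (\<lambda>x. f x + (\<Sum>k<m. L2_inner M (\<psi> k) f * \<psi> k x))"
    using assms(1) by (auto simp: fr_solves_def)
  then have "L2_inner M \<phi> h = L2_inner M (\<lambda>x. f x + (\<Sum>k<m. L2_inner M (\<psi> k) f * \<psi> k x)) h"
    by simp
  also have "\<dots> = L2_inner M f h + (\<Sum>k<m. L2_inner M (\<psi> k) f * L2_inner M (\<psi> k) h)"
    using assms
    by (subst L2_inner_add_left, (auto intro!: L2_sum L2_cmult)[3], subst L2_inner_sum_left)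
       (auto intro!: L2_cmult simp: L2_inner_cmult_left)
  finally show ?thesis .
qed

lemma fr_solves_symmetric:
  assumes "fr_solves \<psi> m \<phi> f" "f \<in> L2 M" "fr_solves \<psi> m \<eta> g" "g \<in> L2 M" "\<And>k. k < m \<Longrightarrow> \<psi> k \<in> L2 M"
  shows "L2_inner M \<phi> g = L2_inner M \<eta> f"
  using fr_solves_inner[OF assms(1,2,4,5)] fr_solves_inner[OF assms(3,4,2,5)]
  by (simp add: L2_inner_commute mult.commute)

lemma fr_solves_nonneg:
  assumes "fr_solves \<psi> m \<phi> f" "f \<in> L2 M" "\<And>k. k < m \<Longrightarrow> \<psi> k \<in> L2 M"
  shows "L2_inner M f f \<le> L2_inner M \<phi> f"
  using fr_solves_inner[OF assms(1,2,2,3)] by (simp add: sum_nonneg)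

text \<open>Write w = \<phi> - f = A f with A the finite rank operator. The claims are the operator
  inequalities 0 <= Id - (Id + A)^(-1) <= A evaluated at \<phi>; the defect of the second is the
  squared norm of w plus the form of A at w.\<close>

lemma fr_solves_deficit:
  assumes sol: "fr_solves \<psi> m \<phi> f" and f: "f \<in> L2 M" and ph: "\<phi> \<in> L2 M"
    and psi: "\<And>k. k < m \<Longrightarrow> \<psi> k \<in> L2 M"
  shows "L2_inner M \<phi> f \<le> L2_inner M \<phi> \<phi>"
    and "L2_inner M \<phi> \<phi> - L2_inner M \<phi> f \<le> (\<Sum>k<m. (L2_inner M (\<psi> k) \<phi>)\<^sup>2)"
proof -
  define a where "a k = L2_inner M (\<psi> k) f" for k
  define p where "p k = L2_inner M (\<psi> k) \<phi>" for k
  define w where "w x = (\<Sum>k<m. a k * \<psi> k x)" for x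
  have w: "w \<in> L2 M" unfolding w_def by (intro L2_sum L2_cmult) (auto intro: psi)
  have gen: "L2_inner M w h = (\<Sum>k<m. a k * L2_inner M (\<psi> k) h)" if "h \<in> L2 M" for h
    unfolding w_def using that psi by (subst L2_inner_sum_left) (auto intro!: L2_cmult simp: L2_inner_cmult_left)
  have ph_eq: "\<phi> = (\<lambda>x. f x + w x)" using sol by (auto simp: fr_solves_def w_def a_def)
  have pk: "p k = a k + L2_inner M (\<psi> k) w" if "k < m" for k
    unfolding p_def a_def by (subst ph_eq, subst L2_inner_add_right) (auto intro: f w psi that)
  have wf: "L2_inner M w f = (\<Sum>k<m. (a k)\<^sup>2)" by (simp add: gen f a_def power2_eq_square)
  have ww: "L2_inner M w w = (\<Sum>k<m. a k * L2_inner M (\<psi> k) w)" by (simp add: gen w)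
  have diff: "L2_inner M \<phi> \<phi> - L2_inner M \<phi> f = L2_inner M w f + L2_inner M w w"
  proof -
    have "L2_inner M \<phi> \<phi> = L2_inner M \<phi> f + L2_inner M \<phi> w"
      by (subst (2) ph_eq, rule L2_inner_add_right) (auto intro: f w ph)
    moreover have "L2_inner M \<phi> w = L2_inner M f w + L2_inner M w w"
      by (subst ph_eq, rule L2_inner_add_left) (auto intro: f w ph)
    ultimately show ?thesis by (simp add: L2_inner_commute)
  qed
  show "L2_inner M \<phi> f \<le> L2_inner M \<phi> \<phi>"
    using diff wf L2_inner_self_nonneg[of M w] sum_nonneg[of "{..<m}" "\<lambda>k. (a k)\<^sup>2"] by simp
  have "(\<Sum>k<m. (p k)\<^sup>2) - (L2_inner M w f + L2_inner M w w) =
      (\<Sum>k<m. a k * L2_inner M (\<psi> k) w + (L2_inner M (\<psi> k) w)\<^sup>2)"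
    unfolding wf ww sum.distrib[symmetric] sum_subtractf[symmetric]
    by (intro sum.cong) (auto simp: pk power2_eq_square algebra_simps)
  also have "\<dots> = L2_inner M w w + (\<Sum>k<m. (L2_inner M (\<psi> k) w)\<^sup>2)"
    by (simp add: sum.distrib ww)
  also have "\<dots> \<ge> 0" by (intro add_nonneg_nonneg L2_inner_self_nonneg sum_nonneg) auto
  finally show "L2_inner M \<phi> \<phi> - L2_inner M \<phi> f \<le> (\<Sum>k<m. (L2_inner M (\<psi> k) \<phi>)\<^sup>2)"
    unfolding diff p_def by simp
qed

text \<open>An unnormalised characteristic function under the weight given by the complete squares;
  the diagonal terms are still included here.\<close>

definition fr_transform :: "(nat \<Rightarrow> 'a \<Rightarrow> real) \<Rightarrow> nat \<Rightarrow> nat \<Rightarrow> ('a \<Rightarrow> real) \<Rightarrow> complex" where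
  "fr_transform \<psi> m N \<phi> =
     (\<integral>X. iexp (lin N \<phi> X) * complex_of_real (exp (- (\<Sum>k<m. (lin N (\<psi> k) X)\<^sup>2) / 2)) \<partial>ipow M N)"

text \<open>Hubbard--Stratonovich: the Gaussian factor \<open>exp (- s\<^sup>2 / 2)\<close> is the average of \<open>exp (i z s)\<close> over
  a standard normal \<open>z\<close>, so adding a function \<open>\<psi> m\<close> averages the transform over the
  shifts \<open>\<phi> + z \<psi> m\<close>.\<close>

lemma fr_transform_Suc:
  assumes psi: "\<And>k. k < Suc m \<Longrightarrow> \<psi> k \<in> borel_measurable M" and [measurable]: "\<phi> \<in> borel_measurable M"
  shows "(\<lambda>z. fr_transform \<psi> m N (\<lambda>x. \<phi> x + z * \<psi> m x)) \<in> borel_measurable borel" (is ?th1)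
    and "fr_transform \<psi> (Suc m) N \<phi> =
      (\<integral>z. fr_transform \<psi> m N (\<lambda>x. \<phi> x + z * \<psi> m x) \<partial>std_normal_distribution)" (is ?th2)
    and "cmod (fr_transform \<psi> m N (\<lambda>x. \<phi> x + z * \<psi> m x)) \<le> 1" (is ?th3)
proof -
  interpret P: prob_space "ipow M N" by (rule ipow_prob_space)
  interpret Z: prob_space std_normal_distribution by (rule prob_space_normal_density) simp
  interpret PZ: pair_prob_space "ipow M N" std_normal_distribution ..
  have [measurable]: "lin N (\<psi> k) \<in> borel_measurable (ipow M N)" if "k < Suc m" for k
    using psi[OF that] by measurable
  have [measurable]: "\<psi> m \<in> borel_measurable M" by (rule psi) simp
  have [measurable]: "(\<lambda>X. \<Sum>k<m. (lin N (\<psi> k) X)\<^sup>2) \<in> borel_measurable (ipow M N)"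
    by (intro borel_measurable_sum) auto
  let ?g = "\<lambda>X. complex_of_real (exp (- (\<Sum>k<m. (lin N (\<psi> k) X)\<^sup>2) / 2))"
  let ?f = "\<lambda>X z. iexp (lin N \<phi> X + z * lin N (\<psi> m) X) * ?g X"
  have gle: "cmod (?g X) \<le> 1" for X by (simp add: sum_nonneg)
  have fle: "cmod (?f X z) \<le> 1" for X z using gle by (simp add: norm_mult)
  have eq: "fr_transform \<psi> m N (\<lambda>x. \<phi> x + z * \<psi> m x) = (\<integral>X. ?f X z \<partial>ipow M N)" for z
    unfolding fr_transform_def by (simp only: lin_add lin_cmult)
  show ?th1 unfolding eq by measurable
  show ?th3 unfolding eq
    by (rule P.norm_integral_le_const[OF _ fle]) measurable
  have int: "integrable (ipow M N \<Otimes>\<^sub>M std_normal_distribution) (\<lambda>(X, z). ?f X z)"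
  proof (rule PZ.P.integrable_const_bound[where B=1])
    show "AE x in ipow M N \<Otimes>\<^sub>M std_normal_distribution. cmod (case x of (X, z) \<Rightarrow> ?f X z) \<le> 1"
      by (intro AE_I2) (simp only: split_beta fle)
  qed measurable
  have "fr_transform \<psi> (Suc m) N \<phi> = (\<integral>X. (\<integral>z. ?f X z \<partial>std_normal_distribution) \<partial>ipow M N)"
    unfolding fr_transform_def
  proof (rule Bochner_Integration.integral_cong[OF refl])
    fix X
    let ?s = "lin N (\<psi> m) X"
    have "(\<integral>z. ?f X z \<partial>std_normal_distribution) =
        (\<integral>z. (iexp (lin N \<phi> X) * ?g X) * iexp (?s * z) \<partial>std_normal_distribution)"
      by (intro Bochner_Integration.integral_cong) (auto simp: exp_add algebra_simps)
    also have "\<dots> = iexp (lin N \<phi> X) * ?g X * char std_normal_distribution ?s"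
      unfolding char_def by (rule integral_mult_right_zero)
    also have "\<dots> = iexp (lin N \<phi> X) * complex_of_real (exp (- (\<Sum>k<Suc m. (lin N (\<psi> k) X)\<^sup>2) / 2))"
    proof -
      have "- (\<Sum>k<Suc m. (lin N (\<psi> k) X)\<^sup>2) / 2 = - (\<Sum>k<m. (lin N (\<psi> k) X)\<^sup>2) / 2 + - (?s\<^sup>2) / 2"
        by simp
      then show ?thesis
        unfolding char_std_normal_distribution by (simp only: exp_add of_real_mult mult.assoc)
    qed
    finally show "iexp (lin N \<phi> X) * complex_of_real (exp (- (\<Sum>k<Suc m. (lin N (\<psi> k) X)\<^sup>2) / 2)) =
      (\<integral>z. ?f X z \<partial>std_normal_distribution)" ..
  qed
  also have "\<dots> = (\<integral>z. (\<integral>X. ?f X z \<partial>ipow M N) \<partial>std_normal_distribution)"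
    by (rule PZ.Fubini_integral[symmetric]) (rule int)
  finally show ?th2 unfolding eq .
qed


text \<open>The constant \<open>c\<close> is det (Id + A)^(-1/2), and its product with the
  exponential of half the trace is the regularised version; the lower bound 1 and the upper bound
  through the Gram matrix are all that is retained of it. Adding \<open>\<psi> m\<close> multiplies
  the determinant by \<open>1 + D\<close> and changes the inverse by a rank one term; averaging the
  limit at the shifted functions over a Gaussian performs both at once. Solvability belongs to the
  same induction because the step needs the solution \<open>u\<close> for
  \<open>\<psi> m\<close>.\<close>

theorem finite_rank_limit:
  assumes "\<forall>k<m. \<psi> k \<in> L20 M"
  shows "\<exists>c>0. 1 \<le> c * exp ((\<Sum>k<m. L2_inner M (\<psi> k) (\<psi> k)) / 2) \<and>
     c * exp ((\<Sum>k<m. L2_inner M (\<psi> k) (\<psi> k)) / 2) \<le> exp ((\<Sum>k<m. \<Sum>l<m. (L2_inner M (\<psi> k) (\<psi> l))\<^sup>2) / 4) \<and>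
     (\<forall>\<phi>\<in>L20 M. \<exists>f\<in>L20 M. fr_solves \<psi> m \<phi> f) \<and>
     (\<forall>\<phi>\<in>L20 M. \<forall>f\<in>L20 M. fr_solves \<psi> m \<phi> f \<longrightarrow>
       (\<lambda>N. fr_transform \<psi> m N \<phi>) \<longlonglongrightarrow> c * exp (- L2_inner M \<phi> f / 2))"
  using assms
proof (induction m)
  case 0
  have "fr_solves \<psi> 0 \<phi> f \<longleftrightarrow> f = \<phi>" for \<phi> f by (auto simp: fr_solves_def)
  moreover have "(\<lambda>N. fr_transform \<psi> 0 N \<phi>) \<longlonglongrightarrow> exp (- L2_inner M \<phi> \<phi> / 2)" if "\<phi> \<in> L20 M" for \<phi>
    using clt_char[OF that] by (simp add: fr_transform_def L2_inner_self)
  ultimately show ?case by (intro exI[of _ 1]) auto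
next
  case (Suc m)
  let ?b = "L2_inner M"
  have psi: "\<psi> k \<in> L20 M" if "k < Suc m" for k using Suc.prems that by simp
  have all_psi: "\<forall>k<m. \<psi> k \<in> L20 M" using psi by simp
  have psi2: "\<psi> k \<in> L2 M" if "k < Suc m" for k using psi[OF that] by (rule L20_L2)
  have psim: "\<psi> m \<in> L20 M" "\<psi> m \<in> L2 M" using psi psi2 by auto
  obtain c where c: "0 < c" "1 \<le> c * exp ((\<Sum>k<m. ?b (\<psi> k) (\<psi> k)) / 2)"
     "c * exp ((\<Sum>k<m. ?b (\<psi> k) (\<psi> k)) / 2) \<le> exp ((\<Sum>k<m. \<Sum>l<m. (?b (\<psi> k) (\<psi> l))\<^sup>2) / 4)"
    and ex: "\<And>\<phi>. \<phi> \<in> L20 M \<Longrightarrow> \<exists>f\<in>L20 M. fr_solves \<psi> m \<phi> f"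
    and lim: "\<And>\<phi> f. \<phi> \<in> L20 M \<Longrightarrow> f \<in> L20 M \<Longrightarrow> fr_solves \<psi> m \<phi> f \<Longrightarrow>
       (\<lambda>N. fr_transform \<psi> m N \<phi>) \<longlonglongrightarrow> c * exp (- ?b \<phi> f / 2)"
    using Suc.IH[OF all_psi] by (elim exE conjE) blast
  obtain u where u: "u \<in> L20 M" "fr_solves \<psi> m (\<psi> m) u" using ex[OF psim(1)] by auto
  have u2: "u \<in> L2 M" using u(1) by (rule L20_L2)
  \<comment> \<open>By the matrix determinant lemma \<open>1 + D\<close> is the quotient of
    consecutive determinants.\<close>
  define D where "D = ?b (\<psi> m) u"
  have D0: "0 \<le> D"
    unfolding D_def using fr_solves_nonneg[OF u(2) u2] psi2 L2_inner_self_nonneg[of M u] by force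
  have def1: "D \<le> ?b (\<psi> m) (\<psi> m)"
    and def2: "?b (\<psi> m) (\<psi> m) - D \<le> (\<Sum>k<m. (?b (\<psi> k) (\<psi> m))\<^sup>2)"
    unfolding D_def by (rule fr_solves_deficit[OF u(2) u2 psim(2)]; simp add: psi2)+
  define c' where "c' = c / sqrt (1 + D)"
  have c'0: "0 < c'" unfolding c'_def using c D0 by simp
  have fac1: "1 \<le> exp (?b (\<psi> m) (\<psi> m) / 2) / sqrt (1 + D)"
  proof -
    have "sqrt (1 + D) \<le> sqrt (exp (?b (\<psi> m) (\<psi> m)))"
      using def1 exp_ge_add_one_self[of "?b (\<psi> m) (\<psi> m)"] by (intro real_sqrt_le_mono) linarith
    also have "\<dots> = exp (?b (\<psi> m) (\<psi> m) / 2)"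
      by (rule real_sqrt_unique) (simp_all add: power2_eq_square mult_exp_exp)
    finally show ?thesis using D0 by simp
  qed
  \<comment> \<open>The first order discrepancy \<open>?b (\<psi> m) (\<psi> m) - D\<close> is
    bounded by the new off-diagonal Gram entries. Each of these occurs twice in the symmetric double
    sum, which accounts for the factor 2 over the 4.\<close>
  have fac2: "exp (?b (\<psi> m) (\<psi> m) / 2) / sqrt (1 + D) \<le>
      exp (((\<Sum>k<m. (?b (\<psi> k) (\<psi> m))\<^sup>2) * 2 + (?b (\<psi> m) (\<psi> m))\<^sup>2) / 4)"
  proof -
    have "exp (?b (\<psi> m) (\<psi> m) / 2) / sqrt (1 + D) \<le> exp (?b (\<psi> m) (\<psi> m) / 2) / exp (D / 2 - D\<^sup>2 / 4)"
      using exp_half_le[OF D0] D0 by (intro divide_left_mono) auto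
    also have "\<dots> = exp ((?b (\<psi> m) (\<psi> m) - D) / 2 + D\<^sup>2 / 4)"
      by (simp add: exp_diff[symmetric] diff_divide_distrib)
    also have "\<dots> \<le> exp (((\<Sum>k<m. (?b (\<psi> k) (\<psi> m))\<^sup>2) * 2 + (?b (\<psi> m) (\<psi> m))\<^sup>2) / 4)"
      using def2 power_mono[OF def1 D0, of 2] by (simp add: field_simps)
    finally show ?thesis .
  qed
  have sumS: "(\<Sum>k<Suc m. \<Sum>l<Suc m. (?b (\<psi> k) (\<psi> l))\<^sup>2) =
     (\<Sum>k<m. \<Sum>l<m. (?b (\<psi> k) (\<psi> l))\<^sup>2) + ((\<Sum>k<m. (?b (\<psi> k) (\<psi> m))\<^sup>2) * 2 + (?b (\<psi> m) (\<psi> m))\<^sup>2)"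
  proof -
    have "(\<Sum>l<m. (?b (\<psi> m) (\<psi> l))\<^sup>2) = (\<Sum>k<m. (?b (\<psi> k) (\<psi> m))\<^sup>2)"
      by (simp add: L2_inner_commute)
    then show ?thesis by (simp add: sum.distrib)
  qed
  have ceq: "c' * exp ((\<Sum>k<Suc m. ?b (\<psi> k) (\<psi> k)) / 2) =
     (c * exp ((\<Sum>k<m. ?b (\<psi> k) (\<psi> k)) / 2)) * (exp (?b (\<psi> m) (\<psi> m) / 2) / sqrt (1 + D))"
    by (simp add: c'_def add_divide_distrib exp_add)
  have b1: "1 \<le> c' * exp ((\<Sum>k<Suc m. ?b (\<psi> k) (\<psi> k)) / 2)"
    unfolding ceq using mult_mono[OF c(2) fac1] by (simp add: c(1) less_imp_le)
  have b2: "c' * exp ((\<Sum>k<Suc m. ?b (\<psi> k) (\<psi> k)) / 2) \<le> exp ((\<Sum>k<Suc m. \<Sum>l<Suc m. (?b (\<psi> k) (\<psi> l))\<^sup>2) / 4)"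
    unfolding ceq sumS
  proof (rule order_trans[OF mult_mono[OF c(3) fac2]])
    have "exp (a / 4) * exp (b / 4) = exp ((a + b) / 4)" for a b :: real
      by (simp add: exp_add[symmetric] add_divide_distrib)
    then show "exp ((\<Sum>k<m. \<Sum>l<m. (?b (\<psi> k) (\<psi> l))\<^sup>2) / 4) *
        exp (((\<Sum>k<m. (?b (\<psi> k) (\<psi> m))\<^sup>2) * 2 + (?b (\<psi> m) (\<psi> m))\<^sup>2) / 4)
      \<le> exp (((\<Sum>k<m. \<Sum>l<m. (?b (\<psi> k) (\<psi> l))\<^sup>2) +
          ((\<Sum>k<m. (?b (\<psi> k) (\<psi> m))\<^sup>2) * 2 + (?b (\<psi> m) (\<psi> m))\<^sup>2)) / 4)"
      by (simp only:)
  qed (use D0 in auto)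
  have ex': "\<exists>f\<in>L20 M. fr_solves \<psi> (Suc m) \<phi> f" if ph: "\<phi> \<in> L20 M" for \<phi>
  proof -
    obtain f0 where f0: "f0 \<in> L20 M" "fr_solves \<psi> m \<phi> f0" using ex[OF ph] by auto
    have f02: "f0 \<in> L2 M" using f0(1) by (rule L20_L2)
    \<comment> \<open>Sherman--Morrison: the multiple of \<open>u\<close> to be removed is fixed by
      requiring \<open>?b (\<psi> m) f = \<alpha>\<close>.\<close>
    define \<alpha> where "\<alpha> = ?b (\<psi> m) f0 / (1 + D)"
    define f where "f x = f0 x - \<alpha> * u x" for x
    have f: "f \<in> L20 M" unfolding f_def by (intro L20_diff L20_cmult f0 u)
    have bf: "?b (\<psi> k) f = ?b (\<psi> k) f0 - \<alpha> * ?b (\<psi> k) u" if "k < Suc m" for k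
      unfolding f_def using psi2[OF that] f02 u2
      by (subst L2_inner_diff_right) (auto simp: L2_inner_cmult_right L2_cmult)
    have bm: "?b (\<psi> m) f = \<alpha>"
      using D0 by (simp add: bf D_def[symmetric]) (simp add: \<alpha>_def field_simps)
    have "fr_solves \<psi> (Suc m) \<phi> f"
      unfolding fr_solves_def
    proof
      fix x
      have e: "(\<Sum>k<Suc m. ?b (\<psi> k) f * \<psi> k x) =
          (\<Sum>k<m. (?b (\<psi> k) f0 - \<alpha> * ?b (\<psi> k) u) * \<psi> k x) + \<alpha> * \<psi> m x"
        by (subst sum.lessThan_Suc, subst bm) (simp add: bf)
      have "f x + (\<Sum>k<Suc m. ?b (\<psi> k) f * \<psi> k x) =
        (f0 x + (\<Sum>k<m. ?b (\<psi> k) f0 * \<psi> k x)) - \<alpha> * (u x + (\<Sum>k<m. ?b (\<psi> k) u * \<psi> k x)) + \<alpha> * \<psi> m x"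
        unfolding e by (simp add: left_diff_distrib sum_subtractf sum_distrib_left f_def algebra_simps)
      also have "\<dots> = \<phi> x" using f0(2) u(2) by (simp add: fr_solves_def)
      finally show "f x + (\<Sum>k<Suc m. ?b (\<psi> k) f * \<psi> k x) = \<phi> x" .
    qed
    then show ?thesis using f by blast
  qed
  have lim': "(\<lambda>N. fr_transform \<psi> (Suc m) N \<phi>) \<longlonglongrightarrow> c' * exp (- ?b \<phi> f / 2)"
    if ph: "\<phi> \<in> L20 M" and f: "f \<in> L20 M" and sol: "fr_solves \<psi> (Suc m) \<phi> f" for \<phi> f
  proof -
    have ph2: "\<phi> \<in> L2 M" and f2: "f \<in> L2 M" using ph f by (auto intro: L20_L2)
    have [measurable]: "\<phi> \<in> borel_measurable M" using ph2 by (rule L2_D)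
    define \<alpha> where "\<alpha> = ?b (\<psi> m) f"
    \<comment> \<open>The update is undone: adding back the multiple of \<open>u\<close> turns the
      given solution of rank \<open>Suc m\<close> into one of rank m, to which the induction
      hypothesis applies.\<close>
    define f0 where "f0 x = f x + \<alpha> * u x" for x
    have f0: "f0 \<in> L20 M" unfolding f0_def by (intro L20_add L20_cmult f u)
    have f02: "f0 \<in> L2 M" using f0 by (rule L20_L2)
    have bf: "?b g f0 = ?b g f + \<alpha> * ?b g u" if "g \<in> L2 M" for g
      unfolding f0_def using that f2 u2
      by (subst L2_inner_add_right) (auto simp: L2_inner_cmult_right L2_cmult)
    have sol0: "fr_solves \<psi> m \<phi> f0"
      unfolding fr_solves_def
    proof
      fix x
      have "f0 x + (\<Sum>k<m. ?b (\<psi> k) f0 * \<psi> k x) = 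
        (f x + (\<Sum>k<Suc m. ?b (\<psi> k) f * \<psi> k x)) + \<alpha> * (u x + (\<Sum>k<m. ?b (\<psi> k) u * \<psi> k x)) - \<alpha> * \<psi> m x"
        by (simp add: bf psi2 distrib_right sum.distrib sum_distrib_left \<alpha>_def[symmetric] f0_def algebra_simps)
      also have "\<dots> = \<phi> x" using sol u(2) by (simp add: fr_solves_def)
      finally show "f0 x + (\<Sum>k<m. ?b (\<psi> k) f0 * \<psi> k x) = \<phi> x" .
    qed
    define B where "B = ?b (\<psi> m) f0"
    have B_sym: "?b \<phi> u = B"
      unfolding B_def by (rule fr_solves_symmetric[OF sol0 f02 u(2) u2]) (auto intro: psi2)
    have B\<alpha>: "B = \<alpha> * (1 + D)"
      unfolding B_def by (simp add: bf psim \<alpha>_def[symmetric] D_def algebra_simps)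
    let ?q = "\<lambda>z. ?b \<phi> f0 + 2 * B * z + D * z\<^sup>2"
    have conv: "(\<lambda>N. fr_transform \<psi> m N (\<lambda>x. \<phi> x + z * \<psi> m x)) \<longlonglongrightarrow> complex_of_real (c * exp (- ?q z / 2))" for z
    proof -
      have 1: "(\<lambda>x. \<phi> x + z * \<psi> m x) \<in> L20 M" "(\<lambda>x. f0 x + z * u x) \<in> L20 M"
        by (intro L20_add L20_cmult ph f0 psim u)+
      have bb: "?b (\<psi> k) (\<lambda>x. f0 x + z * u x) = ?b (\<psi> k) f0 + z * ?b (\<psi> k) u" if "k < Suc m" for k
        using psi2[OF that] f02 u2
        by (subst L2_inner_add_right) (auto simp: L2_inner_cmult_right L2_cmult)
      have 2: "fr_solves \<psi> m (\<lambda>x. \<phi> x + z * \<psi> m x) (\<lambda>x. f0 x + z * u x)"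
        unfolding fr_solves_def
      proof
        fix x
        have "f0 x + z * u x + (\<Sum>k<m. ?b (\<psi> k) (\<lambda>x. f0 x + z * u x) * \<psi> k x) =
          (f0 x + (\<Sum>k<m. ?b (\<psi> k) f0 * \<psi> k x)) + z * (u x + (\<Sum>k<m. ?b (\<psi> k) u * \<psi> k x))"
          by (simp add: bb distrib_right sum.distrib sum_distrib_left algebra_simps)
        also have "\<dots> = \<phi> x + z * \<psi> m x" using sol0 u(2) by (simp add: fr_solves_def)
        finally show "f0 x + z * u x + (\<Sum>k<m. ?b (\<psi> k) (\<lambda>x. f0 x + z * u x) * \<psi> k x) = \<phi> x + z * \<psi> m x" .
      qed
      have "?b (\<lambda>x. \<phi> x + z * \<psi> m x) (\<lambda>x. f0 x + z * u x) =
         ?b \<phi> (\<lambda>x. f0 x + z * u x) + z * ?b (\<psi> m) (\<lambda>x. f0 x + z * u x)"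
        using 1 ph2 psim by (subst L2_inner_add_left) (auto simp: L2_inner_cmult_left L2_cmult intro: L20_L2)
      also have "?b \<phi> (\<lambda>x. f0 x + z * u x) = ?b \<phi> f0 + z * ?b \<phi> u"
        using ph2 f02 u2 by (subst L2_inner_add_right) (auto simp: L2_inner_cmult_right L2_cmult)
      finally have "?b (\<lambda>x. \<phi> x + z * \<psi> m x) (\<lambda>x. f0 x + z * u x) = ?q z"
        by (simp add: bb B_sym D_def[symmetric] B_def[symmetric] algebra_simps power2_eq_square)
      with lim[OF 1 2] show ?thesis by simp
    qed
    interpret Z: prob_space std_normal_distribution by (rule prob_space_normal_density) simp
    note step = fr_transform_Suc[of m \<psi> \<phi>, OF L2_D(1)[OF psi2]]
    have "(\<lambda>N. \<integral>z. fr_transform \<psi> m N (\<lambda>x. \<phi> x + z * \<psi> m x) \<partial>std_normal_distribution) \<longlonglongrightarrow>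
       (\<integral>z. complex_of_real (c * exp (- ?q z / 2)) \<partial>std_normal_distribution)"
    proof (rule integral_dominated_convergence[where w="\<lambda>_. 1"])
      show "(\<lambda>z. fr_transform \<psi> m N (\<lambda>x. \<phi> x + z * \<psi> m x)) \<in> borel_measurable std_normal_distribution" for N
        using step(1)[of N] by simp
      show "AE z in std_normal_distribution. cmod (fr_transform \<psi> m N (\<lambda>x. \<phi> x + z * \<psi> m x)) \<le> 1" for N
        by (intro AE_I2 step(3)) auto
      show "AE z in std_normal_distribution. (\<lambda>N. fr_transform \<psi> m N (\<lambda>x. \<phi> x + z * \<psi> m x))
          \<longlonglongrightarrow> complex_of_real (c * exp (- ?q z / 2))"
        by (intro AE_I2 conv)
    qed auto
    also have "(\<lambda>N. \<integral>z. fr_transform \<psi> m N (\<lambda>x. \<phi> x + z * \<psi> m x) \<partial>std_normal_distribution) =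
       (\<lambda>N. fr_transform \<psi> (Suc m) N \<phi>)"
      by (intro ext step(2)[symmetric]) auto
    also have "(\<integral>z. complex_of_real (c * exp (- ?q z / 2)) \<partial>std_normal_distribution) =
        complex_of_real (c * (exp (- (?b \<phi> f0 - B\<^sup>2 / (1 + D)) / 2) / sqrt (1 + D)))"
      using gaussian_quadratic_integral[OF D0, of "?b \<phi> f0" B] by simp
    \<comment> \<open>Since \<open>?b \<phi> f0 = ?b \<phi> f + \<alpha> * B\<close> and
      \<open>B = \<alpha> * (1 + D)\<close>, the two correction terms cancel.\<close>
    also have "?b \<phi> f0 - B\<^sup>2 / (1 + D) = ?b \<phi> f"
      using D0 unfolding bf[OF ph2] B_sym B\<alpha> by (simp add: power2_eq_square field_simps)
    finally show ?thesis by (simp add: c'_def)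
  qed
  show ?case
    using c'0 b1 b2 ex' lim' by (intro exI[of _ c']) blast
qed

end

section \<open>Degenerate Gibbs measures\<close>

text \<open>Cauchy--Schwarz for arbitrary measurable functions: if the product is not integrable,
  its Bochner integral is 0 and the bound is trivial.\<close>

lemma L2_inner_sq_le_sqn:
  assumes [measurable]: "f \<in> borel_measurable M" "g \<in> borel_measurable M"
  shows "ennreal ((\<integral>x. f x * g x \<partial>M)\<^sup>2) \<le> sqn M f * sqn M g"
proof (cases "integrable M (\<lambda>x. f x * g x)")
  case True
  have "ennreal \<bar>\<integral>x. f x * g x \<partial>M\<bar> \<le> (\<integral>\<^sup>+x. ennreal \<bar>f x\<bar> * ennreal \<bar>g x\<bar> \<partial>M)"
    using integral_norm_bound_ennreal[OF True] by (simp add: abs_mult ennreal_mult'')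
  then have "(ennreal \<bar>\<integral>x. f x * g x \<partial>M\<bar>)\<^sup>2 \<le> (\<integral>\<^sup>+x. ennreal \<bar>f x\<bar> * ennreal \<bar>g x\<bar> \<partial>M)\<^sup>2"
    by (rule power_mono) simp
  also have "\<dots> \<le> (\<integral>\<^sup>+x. ennreal \<bar>f x\<bar> ^ 2 \<partial>M) * (\<integral>\<^sup>+x. ennreal \<bar>g x\<bar> ^ 2 \<partial>M)"
    by (rule Cauchy_Schwarz_nn_integral) auto
  finally show ?thesis by (simp add: sqn_def ennreal_power)
next
  case False
  then show ?thesis by (simp add: not_integrable_integral_eq)
qed

text \<open>A mean value estimate with both exponentials on the right: once the product is split,
  only square integrability of the two weights and of the difference of their exponents
  enters.\<close>

lemma abs_exp_diff_le: "\<bar>exp a - exp b\<bar> \<le> \<bar>a - b\<bar> * (exp a + exp b)" for a b :: real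
proof -
  have "exp b - exp a \<le> \<bar>a - b\<bar> * (exp a + exp b)" if "a \<le> b" for a b :: real
  proof -
    have "1 - exp (a - b) \<le> b - a" using exp_ge_add_one_self[of "a - b"] by linarith
    then have "exp b * (1 - exp (a - b)) \<le> exp b * (b - a)" by (intro mult_left_mono) auto
    then have "exp b - exp a \<le> (b - a) * exp b" by (simp add: right_diff_distrib mult_exp_exp algebra_simps)
    also have "\<dots> \<le> (b - a) * (exp a + exp b)" using that by (intro mult_left_mono) auto
    finally show ?thesis using that by simp
  qed
  from this[of a b] this[of b a] show ?thesis
    by (cases "a \<le> b") (auto simp: abs_minus_commute add.commute)
qed

lemma integral_case_prod_sq:
  fixes J :: "_ \<Rightarrow> _ \<Rightarrow> real"
  shows "(\<integral>z. (case_prod J z)\<^sup>2 \<partial>Q) = (\<integral>(x, y). (J x y)\<^sup>2 \<partial>Q)"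
  by (rule Bochner_Integration.integral_cong) auto

lemma mult_le_mult_self_imp_le:
  fixes a b :: real
  assumes "a * a \<le> b * a" "0 \<le> a" "0 \<le> b" shows "a \<le> b"
  using assms by (cases "a = 0") (auto simp: mult_le_cancel_right)

section \<open>Kernels, their forms and their operators\<close>

definition tens :: "('b \<Rightarrow> real) \<Rightarrow> ('b \<Rightarrow> real) \<Rightarrow> 'b \<times> 'b \<Rightarrow> real" where
  "tens g f = (\<lambda>(x, y). g x * f y)"

context prob_space
begin

lemma tens_L2:
  assumes "g \<in> L2 M" "f \<in> L2 M"
  shows "tens g f \<in> L2 (M \<Otimes>\<^sub>M M)"
    and "(\<integral>z. (tens g f z)\<^sup>2 \<partial>(M \<Otimes>\<^sub>M M)) = (\<integral>x. (g x)\<^sup>2 \<partial>M) * (\<integral>x. (f x)\<^sup>2 \<partial>M)"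
proof -
  interpret PP: pair_prob_space M M ..
  have [measurable]: "g \<in> borel_measurable M" "f \<in> borel_measurable M" using assms by (auto dest: L2_D)
  have sq: "(tens g f z)\<^sup>2 = (case z of (x, y) \<Rightarrow> (g x)\<^sup>2 * (f y)\<^sup>2)" for z
    by (simp add: tens_def split_beta power_mult_distrib)
  have i: "integrable (M \<Otimes>\<^sub>M M) (\<lambda>(x, y). (g x)\<^sup>2 * (f y)\<^sup>2)"
  proof (rule PP.Fubini_integrable)
    show "AE x in M. integrable M (\<lambda>y. case (x, y) of (x, y) \<Rightarrow> (g x)\<^sup>2 * (f y)\<^sup>2)"
      using L2_D(2)[OF assms(2)] by auto
    show "integrable M (\<lambda>x. \<integral>y. norm (case (x, y) of (x, y) \<Rightarrow> (g x)\<^sup>2 * (f y)\<^sup>2) \<partial>M)"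
      using L2_D(2)[OF assms(1)] by auto
  qed measurable
  show "tens g f \<in> L2 (M \<Otimes>\<^sub>M M)"
    unfolding L2_def using i by (simp add: sq) (simp add: tens_def)
  show "(\<integral>z. (tens g f z)\<^sup>2 \<partial>(M \<Otimes>\<^sub>M M)) = (\<integral>x. (g x)\<^sup>2 \<partial>M) * (\<integral>x. (f x)\<^sup>2 \<partial>M)"
    unfolding sq using PP.integral_fst'[OF i] by simp
qed

text \<open>The form is an inner product over the product space, so Cauchy--Schwarz there gives the
  Hilbert--Schmidt bound directly. Fubini relates it to the operator \<open>kop\<close> in
  \<open>kform_eq_inner\<close>.\<close>

definition kform :: "('a \<Rightarrow> 'a \<Rightarrow> real) \<Rightarrow> ('a \<Rightarrow> real) \<Rightarrow> ('a \<Rightarrow> real) \<Rightarrow> real" where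
  "kform J g f = L2_inner (M \<Otimes>\<^sub>M M) (case_prod J) (tens g f)"

definition kop :: "('a \<Rightarrow> 'a \<Rightarrow> real) \<Rightarrow> ('a \<Rightarrow> real) \<Rightarrow> 'a \<Rightarrow> real" where
  "kop J f x = (\<integral>y. J x y * f y \<partial>M)"

abbreviation L2k :: "('a \<Rightarrow> 'a \<Rightarrow> real) set" where
  "L2k \<equiv> {J. case_prod J \<in> L2 (M \<Otimes>\<^sub>M M)}"

lemma kform_bound:
  assumes "J \<in> L2k" "g \<in> L2 M" "f \<in> L2 M"
  shows "(kform J g f)\<^sup>2 \<le> (\<integral>z. (case_prod J z)\<^sup>2 \<partial>(M \<Otimes>\<^sub>M M)) * ((\<integral>x. (g x)\<^sup>2 \<partial>M) * (\<integral>x. (f x)\<^sup>2 \<partial>M))"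
  unfolding kform_def using assms tens_L2[OF assms(2,3)]
  by (auto intro!: order_trans[OF L2_inner_cauchy_schwarz])

lemma measurable_kop [measurable]:
  assumes [measurable]: "case_prod J \<in> borel_measurable (M \<Otimes>\<^sub>M M)" "f \<in> borel_measurable M"
  shows "kop J f \<in> borel_measurable M"
  unfolding kop_def by measurable

text \<open>Cauchy--Schwarz on each row, integrated over the rows: the operator norm is at most the
  Hilbert--Schmidt norm.\<close>

lemma sqn_kop_le:
  assumes [measurable]: "case_prod J \<in> borel_measurable (M \<Otimes>\<^sub>M M)" "f \<in> borel_measurable M"
  shows "sqn M (kop J f) \<le> sqn (M \<Otimes>\<^sub>M M) (case_prod J) * sqn M f"
proof -
  have "sqn M (kop J f) \<le> (\<integral>\<^sup>+x. sqn M (J x) * sqn M f \<partial>M)"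
    unfolding sqn_def[of M "kop J f"] kop_def
    by (intro nn_integral_mono L2_inner_sq_le_sqn) auto
  also have "\<dots> = (\<integral>\<^sup>+x. sqn M (J x) \<partial>M) * sqn M f"
    unfolding sqn_def[of M "J _"] by (rule nn_integral_multc) measurable
  also have "(\<integral>\<^sup>+x. sqn M (J x) \<partial>M) = sqn (M \<Otimes>\<^sub>M M) (case_prod J)"
    unfolding sqn_def by (subst nn_integral_fst[symmetric]) (auto simp: split_beta)
  finally show ?thesis .
qed

lemma kop_L2: "J \<in> L2k \<Longrightarrow> f \<in> L2 M \<Longrightarrow> kop J f \<in> L2 M"
  using sqn_kop_le[of J f] by (auto simp: L2_iff_sqn ennreal_mult_less_top less_top intro: le_less_trans)

lemma kform_eq_inner:
  assumes J: "J \<in> L2k" and g: "g \<in> L2 M" and f: "f \<in> L2 M"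
  shows "kform J g f = L2_inner M g (kop J f)"
proof -
  interpret PP: pair_prob_space M M ..
  have i: "integrable (M \<Otimes>\<^sub>M M) (\<lambda>z. case_prod J z * tens g f z)"
    using J by (intro L2_mult_integrable tens_L2 g f) auto
  have "kform J g f = (\<integral>x. \<integral>y. J x y * (g x * f y) \<partial>M \<partial>M)"
    unfolding kform_def L2_inner_def using PP.integral_fst'[OF i] by (simp add: tens_def)
  also have "\<dots> = (\<integral>x. g x * kop J f x \<partial>M)"
    unfolding kop_def by (simp add: mult.left_commute)
  finally show ?thesis by (simp add: L2_inner_def)
qed

lemma kform_symmetric:
  assumes J: "J \<in> L2k" and sym: "\<And>x y. J x y = J y x" and g: "g \<in> L2 M" and f: "f \<in> L2 M"
  shows "kform J g f = kform J f g"
proof -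
  interpret PP: pair_prob_space M M ..
  have i: "integrable (M \<Otimes>\<^sub>M M) (\<lambda>z. case_prod J z * tens f g z)"
    using J by (intro L2_mult_integrable tens_L2 g f) auto
  have sw: "(\<integral>(x, y). case_prod J (y, x) * tens f g (y, x) \<partial>(M \<Otimes>\<^sub>M M)) = (\<integral>z. case_prod J z * tens f g z \<partial>(M \<Otimes>\<^sub>M M))"
    by (rule PP.integral_product_swap) (use i in auto)
  have "kform J f g = (\<integral>z. (case z of (x, y) \<Rightarrow> J y x * (f y * g x)) \<partial>(M \<Otimes>\<^sub>M M))"
    unfolding kform_def L2_inner_def sw[symmetric] by (simp add: tens_def)
  also have "\<dots> = kform J g f"
    unfolding kform_def L2_inner_def
    by (intro Bochner_Integration.integral_cong) (auto simp: tens_def sym)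
  finally show ?thesis ..
qed

definition sosk :: "(nat \<Rightarrow> 'a \<Rightarrow> real) \<Rightarrow> nat \<Rightarrow> 'a \<Rightarrow> 'a \<Rightarrow> real" where
  "sosk \<psi> m x y = (\<Sum>k<m. \<psi> k x * \<psi> k y)"

lemma sosk_L2k: "(\<And>k. k < m \<Longrightarrow> \<psi> k \<in> L2 M) \<Longrightarrow> sosk \<psi> m \<in> L2k"
proof -
  assume "\<And>k. k < m \<Longrightarrow> \<psi> k \<in> L2 M"
  then have "(\<lambda>z. \<Sum>k<m. tens (\<psi> k) (\<psi> k) z) \<in> L2 (M \<Otimes>\<^sub>M M)"
    by (intro L2_sum tens_L2) auto
  then show ?thesis by (simp add: sosk_def tens_def split_beta')
qed

lemma kform_sosk:
  assumes psi: "\<And>k. k < m \<Longrightarrow> \<psi> k \<in> L2 M" and g: "g \<in> L2 M" and f: "f \<in> L2 M"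
  shows "kform (sosk \<psi> m) g f = (\<Sum>k<m. L2_inner M (\<psi> k) g * L2_inner M (\<psi> k) f)"
proof -
  have k: "kop (sosk \<psi> m) f = (\<lambda>x. \<Sum>k<m. L2_inner M (\<psi> k) f * \<psi> k x)"
  proof
    fix x
    have "kop (sosk \<psi> m) f x = (\<integral>y. (\<Sum>k<m. \<psi> k x * (\<psi> k y * f y)) \<partial>M)"
      by (simp add: kop_def sosk_def sum_distrib_right mult.assoc)
    also have "\<dots> = (\<Sum>k<m. \<integral>y. \<psi> k x * (\<psi> k y * f y) \<partial>M)"
      by (rule Bochner_Integration.integral_sum) (auto intro!: integrable_mult_right L2_mult_integrable psi f)
    finally show "kop (sosk \<psi> m) f x = (\<Sum>k<m. L2_inner M (\<psi> k) f * \<psi> k x)"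
      by (simp add: L2_inner_def mult.commute)
  qed
  have "kform (sosk \<psi> m) g f = L2_inner M (\<lambda>x. \<Sum>k<m. L2_inner M (\<psi> k) f * \<psi> k x) g"
    using assms by (subst kform_eq_inner) (auto simp: k L2_inner_commute intro!: sosk_L2k[simplified])
  also have "\<dots> = (\<Sum>k<m. L2_inner M (\<psi> k) g * L2_inner M (\<psi> k) f)"
    using assms by (subst L2_inner_sum_left) (auto intro!: L2_cmult sum.cong simp: L2_inner_cmult_left)
  finally show ?thesis .
qed

text \<open>The Hilbert--Schmidt norm of the kernel is that of the Gram matrix, the quantity that
  bounds the regularised constant in \<open>finite_rank_limit\<close>.\<close>

lemma integral_sosk_sq:
  assumes psi: "\<And>k. k < m \<Longrightarrow> \<psi> k \<in> L2 M"
  shows "(\<integral>z. (case_prod (sosk \<psi> m) z)\<^sup>2 \<partial>(M \<Otimes>\<^sub>M M)) = (\<Sum>k<m. \<Sum>l<m. (L2_inner M (\<psi> k) (\<psi> l))\<^sup>2)"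
proof -
  have e: "case_prod (sosk \<psi> m) = (\<lambda>z. \<Sum>k<m. tens (\<psi> k) (\<psi> k) z)"
    by (auto simp: sosk_def tens_def)
  have "(\<integral>z. (case_prod (sosk \<psi> m) z)\<^sup>2 \<partial>(M \<Otimes>\<^sub>M M)) = L2_inner (M \<Otimes>\<^sub>M M) (\<lambda>z. \<Sum>k<m. tens (\<psi> k) (\<psi> k) z) (case_prod (sosk \<psi> m))"
    unfolding L2_inner_self[symmetric] by (simp only: e)
  also have "\<dots> = (\<Sum>l<m. kform (sosk \<psi> m) (\<psi> l) (\<psi> l))"
    using psi sosk_L2k[of m \<psi>]
    by (subst L2_inner_sum_left) (auto intro!: tens_L2 simp: kform_def L2_inner_commute)
  also have "\<dots> = (\<Sum>l<m. \<Sum>k<m. (L2_inner M (\<psi> k) (\<psi> l))\<^sup>2)"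
    using psi by (intro sum.cong) (auto simp: kform_sosk power2_eq_square)
  also have "\<dots> = (\<Sum>k<m. \<Sum>l<m. (L2_inner M (\<psi> k) (\<psi> l))\<^sup>2)" by (rule sum.swap)
  finally show ?thesis .
qed

lemma kform_diff:
  assumes "J \<in> L2k" "J' \<in> L2k" "g \<in> L2 M" "f \<in> L2 M"
  shows "kform (\<lambda>x y. J x y - J' x y) g f = kform J g f - kform J' g f"
    and "(\<lambda>x y. J x y - J' x y) \<in> L2k"
proof -
  have e: "(\<lambda>(x, y). J x y - J' x y) = (\<lambda>z. case_prod J z - case_prod J' z)" by auto
  show "kform (\<lambda>x y. J x y - J' x y) g f = kform J g f - kform J' g f"
    unfolding kform_def e using assms by (intro L2_inner_diff_left tens_L2) auto
  show "(\<lambda>x y. J x y - J' x y) \<in> L2k" 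
    unfolding mem_Collect_eq e using assms by (intro L2_diff) auto
qed

lemma abs_kform_le:
  assumes J: "J \<in> L2k" and e: "(\<integral>z. (case_prod J z)\<^sup>2 \<partial>(M \<Otimes>\<^sub>M M)) \<le> \<epsilon>\<^sup>2" "0 \<le> \<epsilon>" and g: "g \<in> L2 M" and f: "f \<in> L2 M"
  shows "\<bar>kform J g f\<bar> \<le> \<epsilon> * (sqrt (\<integral>x. (g x)\<^sup>2 \<partial>M) * sqrt (\<integral>x. (f x)\<^sup>2 \<partial>M))"
proof -
  have "(kform J g f)\<^sup>2 \<le> \<epsilon>\<^sup>2 * ((\<integral>x. (g x)\<^sup>2 \<partial>M) * (\<integral>x. (f x)\<^sup>2 \<partial>M))"
    using kform_bound[OF J g f] e by (elim order_trans) (intro mult_right_mono, auto)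
  also have "\<dots> = (\<epsilon> * (sqrt (\<integral>x. (g x)\<^sup>2 \<partial>M) * sqrt (\<integral>x. (f x)\<^sup>2 \<partial>M)))\<^sup>2"
    by (simp add: power_mult_distrib)
  finally show ?thesis by (rule abs_le_square_iff[THEN iffD2, THEN order_trans]) (use e in auto)
qed

end


section \<open>Abstract Gibbs weights and the resolvent equation\<close>

definition gibbs_exponent :: "'b measure \<Rightarrow> ('b \<Rightarrow> 'b \<Rightarrow> real) \<Rightarrow> ('b \<Rightarrow> real) \<Rightarrow> nat \<Rightarrow> (nat \<Rightarrow> 'b) \<Rightarrow> real" where
  "gibbs_exponent M K H N X =
     - ustat K N X / real N + (\<Sum>i<N. H (X i)) / real N - (\<integral>x. H x \<partial>M) / 2"

text \<open>This is all that is kept of the Riesz interaction; in the application \<open>K\<close>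
  and \<open>H\<close> are \<open>\<beta>\<close> times the centred kernel and the potential. The
  approximants must be bounded so that their squares lie in L2 and the diagonal averages
  concentrate; being sums of squares, they also force \<open>K\<close> to be nonnegative. The 2 in
  \<open>exp_bound\<close> expresses that the weights are uniformly square integrable.\<close>

locale degenerate_gibbs = prob_space M for M :: "'a measure" +
  fixes K :: "'a \<Rightarrow> 'a \<Rightarrow> real" and H :: "'a \<Rightarrow> real" and C :: real
  assumes K_L2: "case_prod K \<in> L2 (M \<Otimes>\<^sub>M M)"
    and K_sym: "\<And>x y. K x y = K y x"
    and K_centred: "AE x in M. (\<integral>y. K x y \<partial>M) = 0"
    and H_L2: "H \<in> L2 M"
    and approx: "\<And>\<epsilon>. 0 < \<epsilon> \<Longrightarrow> \<exists>m \<psi>. (\<forall>k<m. \<psi> k \<in> L20 M \<and> (\<exists>B. \<forall>x. \<bar>\<psi> k x\<bar> \<le> B)) \<and>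
        (\<integral>(x, y). (K x y - sosk \<psi> m x y)\<^sup>2 \<partial>(M \<Otimes>\<^sub>M M)) \<le> \<epsilon>\<^sup>2"
    and exp_bound: "\<And>N. (\<integral>\<^sup>+X. ennreal (exp (2 * gibbs_exponent M K H N X)) \<partial>ipow M N) \<le> ennreal C"
begin

abbreviation nrm :: "('a \<Rightarrow> real) \<Rightarrow> real" where
  "nrm f \<equiv> sqrt (\<integral>x. (f x)\<^sup>2 \<partial>M)"

lemma K_L2k: "K \<in> L2k" using K_L2 by simp

lemma approx_kform:
  assumes psi: "\<And>k. k < m \<Longrightarrow> \<psi> k \<in> L20 M"
    and e: "(\<integral>(x, y). (K x y - sosk \<psi> m x y)\<^sup>2 \<partial>(M \<Otimes>\<^sub>M M)) \<le> \<epsilon>\<^sup>2" "0 \<le> \<epsilon>"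
    and g: "g \<in> L2 M" and f: "f \<in> L2 M"
  shows "\<bar>kform K g f - (\<Sum>k<m. L2_inner M (\<psi> k) g * L2_inner M (\<psi> k) f)\<bar> \<le> \<epsilon> * (nrm g * nrm f)"
proof -
  have psi2: "\<psi> k \<in> L2 M" if "k < m" for k using psi[OF that] by (rule L20_L2)
  have s: "sosk \<psi> m \<in> L2k" by (rule sosk_L2k) (rule psi2)
  have "\<bar>kform (\<lambda>x y. K x y - sosk \<psi> m x y) g f\<bar> \<le> \<epsilon> * (nrm g * nrm f)"
    by (rule abs_kform_le[OF kform_diff(2)[OF K_L2k s g f] _ e(2) g f]) (use e in \<open>simp only: integral_case_prod_sq\<close>)
  then show ?thesis
    using kform_sosk[of m \<psi>, OF psi2 g f] by (simp add: kform_diff(1)[OF K_L2k s g f])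
qed

text \<open>Nonnegativity passes from sums of squares to their L2 limit.\<close>

lemma kform_nonneg:
  assumes f: "f \<in> L2 M" shows "0 \<le> kform K f f"
proof (rule ccontr)
  assume "\<not> 0 \<le> kform K f f"
  \<comment> \<open>Chosen so that the approximation error is at most half the absolute value of the
    supposed negative form.\<close>
  define \<epsilon> where "\<epsilon> = - kform K f f / (2 * ((nrm f)\<^sup>2 + 1))"
  have e: "0 < \<epsilon>" using \<open>\<not> 0 \<le> kform K f f\<close> by (simp add: \<epsilon>_def add_nonneg_pos divide_neg_pos)
  obtain m \<psi> where m: "\<forall>k<m. \<psi> k \<in> L20 M \<and> (\<exists>B. \<forall>x. \<bar>\<psi> k x\<bar> \<le> B)"
      "(\<integral>(x, y). (K x y - sosk \<psi> m x y)\<^sup>2 \<partial>(M \<Otimes>\<^sub>M M)) \<le> \<epsilon>\<^sup>2"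
    using approx[OF e] by blast
  have "\<bar>kform K f f - (\<Sum>k<m. L2_inner M (\<psi> k) f * L2_inner M (\<psi> k) f)\<bar> \<le> \<epsilon> * (nrm f * nrm f)"
    using m e by (intro approx_kform f) auto
  moreover have "0 \<le> (\<Sum>k<m. L2_inner M (\<psi> k) f * L2_inner M (\<psi> k) f)" by (intro sum_nonneg) auto
  moreover have "\<epsilon> * (nrm f * nrm f) \<le> \<epsilon> * ((nrm f)\<^sup>2 + 1)" using e by (simp add: power2_eq_square)
  moreover have "\<epsilon> * ((nrm f)\<^sup>2 + 1) = - kform K f f / 2"
    unfolding \<epsilon>_def by (simp add: add_nonneg_eq_0_iff field_simps)
  ultimately show False using \<open>\<not> 0 \<le> kform K f f\<close> by linarith
qed

lemma L2_inner_AE_cong: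
  assumes "AE x in M. f x = g x" "f \<in> borel_measurable M" "g \<in> borel_measurable M" "h \<in> borel_measurable M"
  shows "L2_inner M f h = L2_inner M g h"
  unfolding L2_inner_def using assms by (intro integral_cong_AE) auto

definition solves :: "('a \<Rightarrow> real) \<Rightarrow> ('a \<Rightarrow> real) \<Rightarrow> bool" where
  "solves \<phi> f \<longleftrightarrow> f \<in> L2 M \<and> (AE x in M. f x + kop K f x = \<phi> x)"

lemma solves_inner:
  assumes "solves \<phi> f" "\<phi> \<in> L2 M" "h \<in> L2 M"
  shows "L2_inner M \<phi> h = L2_inner M f h + kform K h f"
proof -
  have f: "f \<in> L2 M" using assms by (simp add: solves_def)
  have k: "kop K f \<in> L2 M" by (intro kop_L2 K_L2k f)
  have "L2_inner M \<phi> h = L2_inner M (\<lambda>x. f x + kop K f x) h"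
    using assms f k L2_D(1)[OF L2_add[OF f k]]
    by (intro L2_inner_AE_cong) (auto simp: solves_def intro: L2_D elim!: eventually_mono)
  also have "\<dots> = L2_inner M f h + L2_inner M h (kop K f)"
    using assms f k by (subst L2_inner_add_left) (auto simp: L2_inner_commute)
  finally show ?thesis using kform_eq_inner[OF K_L2k assms(3) f] by simp
qed

text \<open>The inverse of Id plus a nonnegative operator is a contraction. The bound is independent
  of the rank, so the approximants may vary.\<close>

lemma fr_solves_norm_le:
  assumes psi: "\<And>k. k < m \<Longrightarrow> \<psi> k \<in> L20 M" and sol: "fr_solves \<psi> m \<phi> f" and f: "f \<in> L2 M" and ph: "\<phi> \<in> L2 M"
  shows "nrm f \<le> nrm \<phi>"
proof -
  have psi2: "\<psi> k \<in> L2 M" if "k < m" for k using psi[OF that] by (rule L20_L2)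
  have 1: "(nrm f)\<^sup>2 \<le> L2_inner M \<phi> f"
    using fr_solves_nonneg[OF sol f psi2] by (simp add: L2_inner_self)
  have "(L2_inner M \<phi> f)\<^sup>2 \<le> (nrm \<phi> * nrm f)\<^sup>2"
    using L2_inner_cauchy_schwarz[OF ph f] by (simp add: power_mult_distrib)
  then have "L2_inner M \<phi> f \<le> nrm \<phi> * nrm f"
    by (rule power2_le_imp_le) auto
  with 1 have "nrm f * nrm f \<le> nrm \<phi> * nrm f" by (simp add: power2_eq_square)
  then show ?thesis by (rule mult_le_mult_self_imp_le) auto
qed

text \<open>Second resolvent identity: testing each equation against the other solution leaves the
  difference of the two forms at the pair of solutions. It is of order \<open>\<epsilon>\<close>
  because \<open>f'\<close> is bounded in norm by \<open>\<phi>\<close>.\<close>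

lemma solves_approx:
  assumes psi: "\<And>k. k < m \<Longrightarrow> \<psi> k \<in> L20 M"
    and e: "(\<integral>(x, y). (K x y - sosk \<psi> m x y)\<^sup>2 \<partial>(M \<Otimes>\<^sub>M M)) \<le> \<epsilon>\<^sup>2" "0 \<le> \<epsilon>"
    and sol: "fr_solves \<psi> m \<phi> f'" and f': "f' \<in> L2 M" and ph: "\<phi> \<in> L2 M" and f: "solves \<phi> f"
  shows "\<bar>L2_inner M \<phi> f - L2_inner M \<phi> f'\<bar> \<le> \<epsilon> * (nrm f * nrm \<phi>)"
proof -
  have psi2: "\<psi> k \<in> L2 M" if "k < m" for k using psi[OF that] by (rule L20_L2)
  have f2: "f \<in> L2 M" using f by (simp add: solves_def)
  have 1: "L2_inner M \<phi> f' = L2_inner M f f' + kform K f f'"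
    using solves_inner[OF f ph f'] kform_symmetric[OF K_L2k K_sym f' f2] by simp
  have 2: "L2_inner M \<phi> f = L2_inner M f f' + (\<Sum>k<m. L2_inner M (\<psi> k) f * L2_inner M (\<psi> k) f')"
    using fr_solves_inner[OF sol f' f2 psi2] by (simp add: L2_inner_commute mult.commute)
  have "\<bar>L2_inner M \<phi> f - L2_inner M \<phi> f'\<bar> \<le> \<epsilon> * (nrm f * nrm f')"
    using approx_kform[of m \<psi>, OF psi e f2 f'] unfolding 1 2 by simp
  also have "\<dots> \<le> \<epsilon> * (nrm f * nrm \<phi>)"
    using e fr_solves_norm_le[of m \<psi>, OF psi sol f' ph] by (intro mult_left_mono) auto
  finally show ?thesis .
qed

lemma AE_K_L2: "AE x in M. K x \<in> L2 M"
proof -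
  have [measurable]: "case_prod K \<in> borel_measurable (M \<Otimes>\<^sub>M M)" using K_L2 by (rule L2_D)
  have "(\<integral>\<^sup>+x. sqn M (K x) \<partial>M) = sqn (M \<Otimes>\<^sub>M M) (case_prod K)"
    unfolding sqn_def by (subst nn_integral_fst[symmetric]) (auto simp: split_beta)
  also have "\<dots> \<noteq> \<infinity>" using K_L2 by (simp add: L2_iff_sqn)
  finally have "AE x in M. sqn M (K x) \<noteq> \<infinity>"
    unfolding sqn_def by (intro nn_integral_PInf_AE) auto
  with AE_space show ?thesis
  proof eventually_elim
    case (elim x)
    then have "K x \<in> borel_measurable M" by measurable
    with elim show ?case by (simp add: L2_iff_sqn less_top)
  qed
qed

text \<open>The finite rank solutions are Cauchy in L2, but a pointwise representative of their
  limit is wanted. Their images under \<open>K\<close> supply one: at every x whose row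
  \<open>K x\<close> is in L2, \<open>kop K (f n) x\<close> converges by Cauchy--Schwarz. With
  \<open>v\<close> this limit, \<open>\<phi> - v\<close> is the L2 limit of the solutions and solves
  the equation.\<close>

theorem solves_exists:
  assumes ph: "\<phi> \<in> L20 M"
  shows "\<exists>f. solves \<phi> f"
proof -
  have ph2: "\<phi> \<in> L2 M" using ph by (rule L20_L2)
  have [measurable]: "case_prod K \<in> borel_measurable (M \<Otimes>\<^sub>M M)" using K_L2 by (rule L2_D)
  define \<epsilon> where "\<epsilon> n = 1 / real (Suc n)" for n
  have e0: "0 < \<epsilon> n" for n by (simp add: \<epsilon>_def)
  have elim0: "\<epsilon> \<longlonglongrightarrow> 0" unfolding \<epsilon>_def using LIMSEQ_inverse_real_of_nat by (simp add: inverse_eq_divide)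
  define P where "P n m \<psi> f \<longleftrightarrow> (\<forall>k<m. \<psi> k \<in> L20 M) \<and>
        (\<integral>(x, y). (K x y - sosk \<psi> m x y)\<^sup>2 \<partial>(M \<Otimes>\<^sub>M M)) \<le> (\<epsilon> n)\<^sup>2 \<and> f \<in> L20 M \<and> fr_solves \<psi> m \<phi> f"
    for n m \<psi> f
  have "\<exists>t. P n (fst t) (fst (snd t)) (snd (snd t))" for n
  proof -
    obtain m \<psi> where m: "\<forall>k<m. \<psi> k \<in> L20 M"
        "(\<integral>(x, y). (K x y - sosk \<psi> m x y)\<^sup>2 \<partial>(M \<Otimes>\<^sub>M M)) \<le> (\<epsilon> n)\<^sup>2"
      using approx[OF e0[of n]] by blast
    then obtain f where "f \<in> L20 M" "fr_solves \<psi> m \<phi> f"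
      using finite_rank_limit[OF m(1)] ph by blast
    then have "P n m \<psi> f" using m unfolding P_def by blast
    then show ?thesis by (intro exI[of _ "(m, \<psi>, f)"]) simp
  qed
  then obtain t where t: "\<And>n. P n (fst (t n)) (fst (snd (t n))) (snd (snd (t n)))" by metis
  define m \<psi> f where "m n = fst (t n)" and "\<psi> n = fst (snd (t n))" and "f n = snd (snd (t n))" for n
  have P: "P n (m n) (\<psi> n) (f n)" for n using t by (simp add: m_def \<psi>_def f_def)
  have m: "\<psi> n k \<in> L20 M" if "k < m n" for n k using P[of n] that by (simp add: P_def)
  have ap: "(\<integral>(x, y). (K x y - sosk (\<psi> n) (m n) x y)\<^sup>2 \<partial>(M \<Otimes>\<^sub>M M)) \<le> (\<epsilon> n)\<^sup>2" for n
    using P[of n] unfolding P_def by blast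
  have f0: "f n \<in> L20 M" and sol: "fr_solves (\<psi> n) (m n) \<phi> (f n)" for n
    using P[of n] unfolding P_def by blast+
  have m2: "\<psi> n k \<in> L2 M" if "k < m n" for n k using m[OF that] by (rule L20_L2)
  have f: "f n \<in> L2 M" for n using f0 by (rule L20_L2)
  have [measurable]: "f n \<in> borel_measurable M" for n using f by (rule L2_D)
  let ?kn = "\<lambda>n g h. \<Sum>k<m n. L2_inner M (\<psi> n k) g * L2_inner M (\<psi> n k) h"
  have fle: "nrm (f n) \<le> nrm \<phi>" for n using fr_solves_norm_le[of "m n" "\<psi> n", OF m sol f ph2] by simp
  have cauchy: "nrm (\<lambda>x. f n x - f l x) \<le> (\<epsilon> n + \<epsilon> l) * nrm \<phi>" for n l
  proof -
    define d where "d x = f n x - f l x" for x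
    have d: "d \<in> L2 M" unfolding d_def by (intro L2_diff f)
    have 1: "L2_inner M \<phi> d = L2_inner M (f n) d + ?kn n (f n) d"
      using fr_solves_inner[OF sol f d m2, of n] by simp
    have 2: "L2_inner M \<phi> d = L2_inner M (f l) d + ?kn l (f l) d"
      using fr_solves_inner[OF sol f d m2, of l] by simp
    have 3: "?kn n (f n) d = ?kn n (f l) d + ?kn n d d"
    proof -
      have "f n = (\<lambda>x. f l x + d x)" by (auto simp: d_def)
      then have "L2_inner M (\<psi> n k) (f n) = L2_inner M (\<psi> n k) (f l) + L2_inner M (\<psi> n k) d" if "k < m n" for k
        using L2_inner_add_right[OF f d m2[OF that], of l] by simp
      then show ?thesis by (simp add: sum.distrib[symmetric] distrib_right)
    qed
    have 4: "L2_inner M (f n) d - L2_inner M (f l) d = L2_inner M d d"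
      unfolding d_def by (rule L2_inner_diff_left[symmetric]) (auto intro!: f L2_diff)
    have 5: "0 \<le> ?kn n d d" by (intro sum_nonneg) auto
    have 6: "\<bar>kform K (f l) d - ?kn n (f l) d\<bar> \<le> \<epsilon> n * (nrm (f l) * nrm d)"
      by (rule approx_kform[OF m ap less_imp_le[OF e0] f d])
    have 7: "\<bar>kform K (f l) d - ?kn l (f l) d\<bar> \<le> \<epsilon> l * (nrm (f l) * nrm d)"
      by (rule approx_kform[OF m ap less_imp_le[OF e0] f d])
    have "(nrm d)\<^sup>2 = L2_inner M d d" by (simp add: L2_inner_self)
    also have "\<dots> \<le> (\<epsilon> n + \<epsilon> l) * (nrm (f l) * nrm d)"
      using 1 2 3 4 5 6 7 by (simp add: distrib_right)
    also have "\<dots> \<le> (\<epsilon> n + \<epsilon> l) * (nrm \<phi> * nrm d)"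
      using e0[of n] e0[of l] fle[of l] by (intro mult_left_mono mult_right_mono) auto
    finally have "nrm d * nrm d \<le> ((\<epsilon> n + \<epsilon> l) * nrm \<phi>) * nrm d" by (simp add: power2_eq_square mult.assoc)
    then have "nrm d \<le> (\<epsilon> n + \<epsilon> l) * nrm \<phi>"
      by (rule mult_le_mult_self_imp_le) (use e0[of n] e0[of l] in \<open>auto intro!: mult_nonneg_nonneg\<close>)
    then show ?thesis by (simp add: d_def)
  qed
  \<comment> \<open>\<open>lim\<close> yields a measurable function on the whole space, which is the
    actual limit wherever the sequence converges.\<close>
  define v where "v x = lim (\<lambda>n. kop K (f n) x)" for x
  have vm [measurable]: "v \<in> borel_measurable M" unfolding v_def by measurable
  have kdiff: "kop K f1 x - kop K f2 x = (\<integral>y. K x y * (f1 y - f2 y) \<partial>M)"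
    if "K x \<in> L2 M" "f1 \<in> L2 M" "f2 \<in> L2 M" for x f1 f2
    unfolding kop_def using that by (simp add: right_diff_distrib L2_mult_integrable)
  have kle: "\<bar>kop K f1 x - kop K f2 x\<bar> \<le> nrm (K x) * nrm (\<lambda>y. f1 y - f2 y)"
    if "K x \<in> L2 M" "f1 \<in> L2 M" "f2 \<in> L2 M" for x f1 f2
  proof -
    have "\<bar>kop K f1 x - kop K f2 x\<bar>\<^sup>2 \<le> (nrm (K x) * nrm (\<lambda>y. f1 y - f2 y))\<^sup>2"
      using L2_inner_cauchy_schwarz[OF that(1) L2_diff[OF that(2,3)]] kdiff[OF that]
      by (simp add: L2_inner_def power_mult_distrib)
    then show ?thesis by (rule power2_le_imp_le) auto
  qed
  have conv: "AE x in M. (\<lambda>n. kop K (f n) x) \<longlonglongrightarrow> v x"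
    using AE_K_L2
  proof eventually_elim
    case (elim x)
    have b: "\<bar>kop K (f n) x - kop K (f l) x\<bar> \<le> (\<epsilon> n + \<epsilon> l) * (nrm (K x) * nrm \<phi>)" for n l
      using kle[OF elim f f, of n l] mult_left_mono[OF cauchy[of n l], of "nrm (K x)"] by (simp add: ac_simps)
    have "Cauchy (\<lambda>n. kop K (f n) x)"
    proof (rule metric_CauchyI)
      fix e :: real assume "0 < e"
      have "(\<lambda>n. \<epsilon> n * (nrm (K x) * nrm \<phi>)) \<longlonglongrightarrow> 0 * (nrm (K x) * nrm \<phi>)" by (intro tendsto_intros elim0)
      then have "\<forall>\<^sub>F n in sequentially. \<epsilon> n * (nrm (K x) * nrm \<phi>) < e / 2"
        by (rule order_tendstoD) (use \<open>0 < e\<close> in auto)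
      then obtain n0 where n0: "\<And>n. n \<ge> n0 \<Longrightarrow> \<epsilon> n * (nrm (K x) * nrm \<phi>) < e / 2"
        by (auto simp: eventually_sequentially)
      have "dist (kop K (f n) x) (kop K (f l) x) < e" if "n \<ge> n0" "l \<ge> n0" for n l
        using b[of n l] n0[OF that(1)] n0[OF that(2)] by (simp add: dist_real_def distrib_right)
      then show "\<exists>M. \<forall>m\<ge>M. \<forall>n\<ge>M. dist (kop K (f m) x) (kop K (f n) x) < e" by blast
    qed
    then show ?case unfolding v_def by (simp add: Cauchy_convergent_iff convergent_LIMSEQ_iff)
  qed
  have sqn_eq: "sqn M g = ennreal ((nrm g)\<^sup>2)" if "g \<in> L2 M" for g
    using that by (simp add: sqn_eq_integral)
  have KS: "sqn (M \<Otimes>\<^sub>M M) (case_prod K) < \<infinity>" using K_L2 by (simp add: L2_iff_sqn)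
  have vdiff: "sqn M (\<lambda>x. v x - kop K (f n) x) \<le> sqn (M \<Otimes>\<^sub>M M) (case_prod K) * ennreal ((\<epsilon> n * nrm \<phi>)\<^sup>2)" for n
  proof -
    have "AE x in M. ennreal ((v x - kop K (f n) x)\<^sup>2) \<le> sqn M (K x) * ennreal ((\<epsilon> n * nrm \<phi>)\<^sup>2)"
      using AE_K_L2 conv
    proof eventually_elim
      case (elim x)
      have "(\<lambda>l. (\<epsilon> n + \<epsilon> l) * (nrm (K x) * nrm \<phi>)) \<longlonglongrightarrow> (\<epsilon> n + 0) * (nrm (K x) * nrm \<phi>)"
        by (intro tendsto_intros elim0)
      moreover have "(\<lambda>l. \<bar>kop K (f l) x - kop K (f n) x\<bar>) \<longlonglongrightarrow> \<bar>v x - kop K (f n) x\<bar>"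
        by (intro tendsto_intros elim)
      moreover have "\<bar>kop K (f l) x - kop K (f n) x\<bar> \<le> (\<epsilon> n + \<epsilon> l) * (nrm (K x) * nrm \<phi>)" for l
        using kle[OF elim(1) f f, of l n] mult_left_mono[OF cauchy[of l n], of "nrm (K x)"] by (simp add: ac_simps)
      ultimately have "\<bar>v x - kop K (f n) x\<bar> \<le> (\<epsilon> n + 0) * (nrm (K x) * nrm \<phi>)"
        by (intro LIMSEQ_le) auto
      then have "\<bar>v x - kop K (f n) x\<bar>\<^sup>2 \<le> ((\<epsilon> n + 0) * (nrm (K x) * nrm \<phi>))\<^sup>2" by (intro power_mono) auto
      then have "ennreal ((v x - kop K (f n) x)\<^sup>2) \<le> ennreal ((nrm (K x))\<^sup>2 * (\<epsilon> n * nrm \<phi>)\<^sup>2)"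
        by (intro ennreal_leI) (simp add: power_mult_distrib ac_simps)
      also have "\<dots> = sqn M (K x) * ennreal ((\<epsilon> n * nrm \<phi>)\<^sup>2)"
        unfolding sqn_eq[OF elim(1)] by (rule ennreal_mult) auto
      finally show ?case .
    qed
    then have "sqn M (\<lambda>x. v x - kop K (f n) x) \<le> (\<integral>\<^sup>+x. sqn M (K x) * ennreal ((\<epsilon> n * nrm \<phi>)\<^sup>2) \<partial>M)"
      unfolding sqn_def[of M "\<lambda>x. v x - _ x"] by (rule nn_integral_mono_AE)
    also have "\<dots> = (\<integral>\<^sup>+x. sqn M (K x) \<partial>M) * ennreal ((\<epsilon> n * nrm \<phi>)\<^sup>2)"
      unfolding sqn_def[of M "K _"] by (rule nn_integral_multc) measurable
    also have "(\<integral>\<^sup>+x. sqn M (K x) \<partial>M) = sqn (M \<Otimes>\<^sub>M M) (case_prod K)"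
      unfolding sqn_def by (subst nn_integral_fst[symmetric]) (auto simp: split_beta)
    finally show ?thesis .
  qed
  have vd: "(\<lambda>x. v x - kop K (f n) x) \<in> L2 M" for n
    using vdiff[of n] KS by (auto simp: L2_iff_sqn ennreal_mult_less_top less_top intro: le_less_trans)
  have v: "v \<in> L2 M" using L2_add[OF vd[of 0] kop_L2[OF K_L2k f, of 0]] by simp
  define g where "g x = \<phi> x - v x" for x
  have g: "g \<in> L2 M" unfolding g_def by (intro L2_diff ph2 v)
  have [measurable]: "g \<in> borel_measurable M" using g by (rule L2_D)
  have gdiff: "sqn M (\<lambda>x. f n x - g x) \<le> ennreal ((\<epsilon> n)\<^sup>2) * (2 * (sqn (M \<Otimes>\<^sub>M M) (case_prod K) + 1) * ennreal ((nrm \<phi>)\<^sup>2))" for n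
  proof -
    define J where "J x y = K x y - sosk (\<psi> n) (m n) x y" for x y
    have Jk: "J \<in> L2k" unfolding J_def by (rule kform_diff(2)[OF K_L2k sosk_L2k[OF m2] f f]) auto
    have [measurable]: "case_prod J \<in> borel_measurable (M \<Otimes>\<^sub>M M)" using Jk by (auto dest: L2_D)
    \<comment> \<open>With \<open>J\<close> the kernel error, the n-th equation reads
      \<open>f n = \<phi> - kop K (f n) + kop J (f n)\<close>, so the distance to \<open>g\<close>
      consists of two terms that are both small.\<close>
    have eqs: "AE x in M. f n x - g x = (v x - kop K (f n) x) + kop J (f n) x"
      using AE_K_L2
    proof eventually_elim
      case (elim x)
      have "kop J (f n) x = kop K (f n) x - (\<Sum>k<m n. L2_inner M (\<psi> n k) (f n) * \<psi> n k x)"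
      proof -
        have "(\<integral>y. sosk (\<psi> n) (m n) x y * f n y \<partial>M) = (\<integral>y. (\<Sum>k<m n. \<psi> n k x * (\<psi> n k y * f n y)) \<partial>M)"
          by (simp add: sosk_def sum_distrib_right mult.assoc)
        also have "\<dots> = (\<Sum>k<m n. L2_inner M (\<psi> n k) (f n) * \<psi> n k x)"
          by (subst Bochner_Integration.integral_sum)
             (auto intro!: integrable_mult_right L2_mult_integrable m2 f simp: L2_inner_def mult.commute)
        finally have s: "(\<integral>y. sosk (\<psi> n) (m n) x y * f n y \<partial>M) = (\<Sum>k<m n. L2_inner M (\<psi> n k) (f n) * \<psi> n k x)" .
        have "integrable M (\<lambda>y. sosk (\<psi> n) (m n) x y * f n y)"
          unfolding sosk_def sum_distrib_right mult.assoc
          by (auto intro!: integrable_mult_right L2_mult_integrable m2 f)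
        then show ?thesis
          unfolding kop_def J_def left_diff_distrib s[symmetric]
          by (intro Bochner_Integration.integral_diff L2_mult_integrable[OF elim f]) assumption
      qed
      moreover have "f n x + (\<Sum>k<m n. L2_inner M (\<psi> n k) (f n) * \<psi> n k x) = \<phi> x"
        using sol[of n] by (simp add: fr_solves_def)
      ultimately show ?case by (simp add: g_def)
    qed
    have "sqn M (\<lambda>x. f n x - g x) = sqn M (\<lambda>x. (v x - kop K (f n) x) + kop J (f n) x)"
      unfolding sqn_def by (intro nn_integral_cong_AE) (use eqs in \<open>auto elim!: eventually_mono\<close>)
    also have "\<dots> \<le> 2 * sqn M (\<lambda>x. v x - kop K (f n) x) + 2 * sqn M (kop J (f n))"
      by (rule sqn_add_le) measurable
    also have "\<dots> \<le> 2 * (sqn (M \<Otimes>\<^sub>M M) (case_prod K) * ennreal ((\<epsilon> n * nrm \<phi>)\<^sup>2)) + 2 * (ennreal ((\<epsilon> n)\<^sup>2) * ennreal ((nrm \<phi>)\<^sup>2))"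
    proof (intro add_mono mult_left_mono vdiff)
      have "sqn M (kop J (f n)) \<le> sqn (M \<Otimes>\<^sub>M M) (case_prod J) * sqn M (f n)"
        by (rule sqn_kop_le) measurable
      also have "\<dots> \<le> ennreal ((\<epsilon> n)\<^sup>2) * ennreal ((nrm \<phi>)\<^sup>2)"
      proof (rule mult_mono)
        show "sqn (M \<Otimes>\<^sub>M M) (case_prod J) \<le> ennreal ((\<epsilon> n)\<^sup>2)"
          using Jk ap[of n] by (subst sqn_eq_integral) (auto intro!: ennreal_leI simp: J_def integral_case_prod_sq simp del: case_prod_beta)
        show "sqn M (f n) \<le> ennreal ((nrm \<phi>)\<^sup>2)"
          unfolding sqn_eq[OF f] by (intro ennreal_leI power_mono fle) auto
      qed auto
      finally show "sqn M (kop J (f n)) \<le> ennreal ((\<epsilon> n)\<^sup>2) * ennreal ((nrm \<phi>)\<^sup>2)" .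
    qed auto
    also have "\<dots> = ennreal ((\<epsilon> n)\<^sup>2) * (2 * (sqn (M \<Otimes>\<^sub>M M) (case_prod K) + 1) * ennreal ((nrm \<phi>)\<^sup>2))"
      by (simp add: power_mult_distrib ennreal_mult distrib_left distrib_right ac_simps)
    finally show ?thesis .
  qed
  have glim: "(\<lambda>n. nrm (\<lambda>x. f n x - g x)) \<longlonglongrightarrow> 0"
  proof -
    define S where "S = enn2real (2 * (sqn (M \<Otimes>\<^sub>M M) (case_prod K) + 1) * ennreal ((nrm \<phi>)\<^sup>2))"
    have S: "2 * (sqn (M \<Otimes>\<^sub>M M) (case_prod K) + 1) * ennreal ((nrm \<phi>)\<^sup>2) = ennreal S"
    proof -
      have "2 * (sqn (M \<Otimes>\<^sub>M M) (case_prod K) + 1) * ennreal ((nrm \<phi>)\<^sup>2) \<noteq> \<top>"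
        using KS by (auto simp: ennreal_mult_eq_top_iff)
      then show ?thesis unfolding S_def by (simp add: less_top del: ennreal_enn2real_if)
    qed
    have S0: "0 \<le> S" by (simp add: S_def)
    have "(nrm (\<lambda>x. f n x - g x))\<^sup>2 \<le> (\<epsilon> n)\<^sup>2 * S" for n
      using gdiff[of n] S0 unfolding S sqn_eq[OF L2_diff[OF f g]]
      by (subst (asm) ennreal_mult[symmetric]) auto
    then have sqle: "(nrm (\<lambda>x. f n x - g x))\<^sup>2 \<le> (\<epsilon> n * sqrt S)\<^sup>2" for n using S0 by (simp add: power_mult_distrib)
    have le: "nrm (\<lambda>x. f n x - g x) \<le> \<epsilon> n * sqrt S" for n
      by (rule power2_le_imp_le[OF sqle]) (use e0[of n] S0 in simp)
    have "(\<lambda>n. \<epsilon> n * sqrt S) \<longlonglongrightarrow> 0 * sqrt S" by (rule tendsto_mult[OF elim0 tendsto_const])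
    then have l0: "(\<lambda>n. \<epsilon> n * sqrt S) \<longlonglongrightarrow> 0" by simp
    have le': "\<forall>\<^sub>F n in sequentially. norm (nrm (\<lambda>x. f n x - g x)) \<le> \<epsilon> n * sqrt S"
      using le by (intro always_eventually allI) simp
    show ?thesis by (rule Lim_null_comparison[OF le' l0])
  qed
  \<comment> \<open>Continuity of \<open>kop K\<close> along the convergence just proved identifies
    \<open>v\<close> with the image of \<open>g\<close>, and this is the equation.\<close>
  have "AE x in M. kop K g x = v x"
    using AE_K_L2 conv
  proof eventually_elim
    case (elim x)
    have "(\<lambda>n. nrm (K x) * nrm (\<lambda>y. f n y - g y)) \<longlonglongrightarrow> nrm (K x) * 0" by (intro tendsto_intros glim)
    then have l0: "(\<lambda>n. nrm (K x) * nrm (\<lambda>y. f n y - g y)) \<longlonglongrightarrow> 0" by simp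
    have le': "\<forall>\<^sub>F n in sequentially. norm (kop K (f n) x - kop K g x) \<le> nrm (K x) * nrm (\<lambda>y. f n y - g y)"
      unfolding real_norm_def by (intro always_eventually allI kle elim f g)
    have "(\<lambda>n. kop K (f n) x - kop K g x) \<longlonglongrightarrow> 0"
      by (rule Lim_null_comparison[OF le' l0])
    then have "(\<lambda>n. kop K (f n) x) \<longlonglongrightarrow> kop K g x" by (simp add: LIM_zero_iff)
    then show ?case using elim(2) by (rule LIMSEQ_unique)
  qed
  then have "solves \<phi> g" using g by (auto simp: solves_def g_def elim!: eventually_mono)
  then show ?thesis by blast
qed


end

section \<open>Comparison with finite rank weights and the limiting transform\<close>

context degenerate_gibbs
begin

definition gibbs_transform :: "nat \<Rightarrow> ('a \<Rightarrow> real) \<Rightarrow> complex" where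
  "gibbs_transform N \<phi> = (\<integral>X. iexp (lin N \<phi> X) * complex_of_real (exp (gibbs_exponent M K H N X)) \<partial>ipow M N)"

lemma measurable_gibbs_exponent [measurable]: "gibbs_exponent M K H N \<in> borel_measurable (ipow M N)"
proof -
  have [measurable]: "case_prod K \<in> borel_measurable (M \<Otimes>\<^sub>M M)" "H \<in> borel_measurable M"
    using K_L2 H_L2 by (auto dest: L2_D)
  show ?thesis unfolding gibbs_exponent_def ustat_def by measurable
qed

lemma exp_gibbs_L2: "(\<lambda>X. exp (gibbs_exponent M K H N X)) \<in> L2 (ipow M N)"
  unfolding L2_iff_sqn sqn_def exp_double[symmetric]
  using le_less_trans[OF exp_bound[of N]] by auto

text \<open>The square of a normalised sum splits into its diagonal and twice a U-statistic. The
  diagonal is replaced by its mean, the trace, and the deviation is collected with that of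
  \<open>H\<close> in the centred function \<open>G\<close>. Once \<open>G\<close> is square
  integrable its average is of order N^(-1/2), and only the U-statistic of the kernel error
  matters.\<close>

lemma gibbs_exponent_diff:
  assumes psi: "\<And>k. k < m \<Longrightarrow> \<psi> k \<in> L20 M" and N: "0 < N"
  defines "G \<equiv> \<lambda>x. H x - (\<integral>x. H x \<partial>M) + (\<Sum>k<m. (\<psi> k x)\<^sup>2 - L2_inner M (\<psi> k) (\<psi> k)) / 2"
  shows "gibbs_exponent M K H N X -
      (- (\<Sum>k<m. (lin N (\<psi> k) X)\<^sup>2) / 2 + (\<Sum>k<m. L2_inner M (\<psi> k) (\<psi> k)) / 2 + (\<integral>x. H x \<partial>M) / 2) =
      (- 1 / real N) * ustat (\<lambda>x y. K x y - sosk \<psi> m x y) N X + (1 / real N) * (\<Sum>i<N. G (X i))"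
proof -
  have sq: "(\<Sum>i<n. a i)\<^sup>2 = (\<Sum>i<n. (a i)\<^sup>2) + 2 * (\<Sum>j<n. \<Sum>i<j. a i * a j)" for a :: "nat \<Rightarrow> real" and n
    by (induction n) (simp_all add: power2_sum sum_distrib_left sum_distrib_right algebra_simps)
  have lin2: "(lin N (\<psi> k) X)\<^sup>2 = ((\<Sum>i<N. (\<psi> k (X i))\<^sup>2) + 2 * (\<Sum>j<N. \<Sum>i<j. \<psi> k (X i) * \<psi> k (X j))) / real N" for k
    unfolding lin_def using N by (simp add: power_divide sq)
  have us: "ustat (\<lambda>x y. K x y - sosk \<psi> m x y) N X = ustat K N X - (\<Sum>k<m. \<Sum>j<N. \<Sum>i<j. \<psi> k (X i) * \<psi> k (X j))"
  proof -
    have "(\<Sum>j<N. \<Sum>i<j. sosk \<psi> m (X i) (X j)) = (\<Sum>j<N. \<Sum>k<m. \<Sum>i<j. \<psi> k (X i) * \<psi> k (X j))"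
      unfolding sosk_def by (intro sum.cong refl sum.swap)
    also have "\<dots> = (\<Sum>k<m. \<Sum>j<N. \<Sum>i<j. \<psi> k (X i) * \<psi> k (X j))" by (rule sum.swap)
    finally show ?thesis by (simp add: ustat_def sum_subtractf)
  qed
  define A where "A = (\<Sum>k<m. \<Sum>j<N. \<Sum>i<j. \<psi> k (X i) * \<psi> k (X j))"
  define B where "B = (\<Sum>k<m. \<Sum>i<N. (\<psi> k (X i))\<^sup>2)"
  define T where "T = (\<Sum>k<m. L2_inner M (\<psi> k) (\<psi> k))"
  define h where "h = (\<integral>x. H x \<partial>M)"
  have S: "(\<Sum>k<m. (lin N (\<psi> k) X)\<^sup>2) = (B + 2 * A) / real N"
    unfolding lin2 A_def B_def by (simp add: sum_divide_distrib[symmetric] sum.distrib sum_distrib_left)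
  have GS: "(\<Sum>i<N. G (X i)) = (\<Sum>i<N. H (X i)) - real N * h + (B - real N * T) / 2"
  proof -
    have "(\<Sum>i<N. \<Sum>k<m. (\<psi> k (X i))\<^sup>2) = B" unfolding B_def by (rule sum.swap)
    then show ?thesis
      unfolding G_def by (simp add: sum.distrib sum_subtractf sum_divide_distrib[symmetric] h_def T_def)
  qed
  show ?thesis
    unfolding gibbs_exponent_def us S GS A_def[symmetric] T_def[symmetric] h_def[symmetric]
    using N by (simp add: field_simps)
qed

text \<open>Both weights are bounded in L2 and their exponents differ by about
  \<open>\<epsilon>\<close> in L2, so the weights differ by a multiple of \<open>\<epsilon>\<close>
  in L1. Two dependences matter. The factor \<open>D\<close> is independent of the approximant,
  whose trace enters only through the regularised constant. The constant \<open>c\<close> may depend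
  on \<open>\<epsilon>\<close> but not on \<open>\<phi>\<close>, so it can cancel in a
  quotient.\<close>

theorem gibbs_transform_approx:
  assumes e: "0 < \<epsilon>" "\<epsilon> \<le> 1"
  defines "D \<equiv> \<bar>C\<bar> + exp (2 * (\<integral>z. (case_prod K z)\<^sup>2 \<partial>(M \<Otimes>\<^sub>M M)) + 2 + (\<integral>x. H x \<partial>M)) + 3"
  shows "\<exists>c. exp ((\<integral>x. H x \<partial>M) / 2) \<le> c \<and>
     c \<le> exp ((\<integral>z. (case_prod K z)\<^sup>2 \<partial>(M \<Otimes>\<^sub>M M)) / 2 + 1 / 2 + (\<integral>x. H x \<partial>M) / 2) \<and>
     (\<forall>\<phi>\<in>L20 M. \<forall>f. solves \<phi> f \<longrightarrow> (\<exists>q\<ge>0. \<bar>q - L2_inner M \<phi> f\<bar> \<le> \<epsilon> * (nrm f * nrm \<phi>) \<and>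
       (\<forall>\<^sub>F N in sequentially. cmod (gibbs_transform N \<phi> - complex_of_real (c * exp (- q / 2))) \<le> \<epsilon> * D)))"
proof -
  have Km [measurable]: "case_prod K \<in> borel_measurable (M \<Otimes>\<^sub>M M)" "H \<in> borel_measurable M"
    using K_L2 H_L2 by (auto dest: L2_D)
  obtain m \<psi> where mm: "\<forall>k<m. \<psi> k \<in> L20 M \<and> (\<exists>B. \<forall>x. \<bar>\<psi> k x\<bar> \<le> B)"
      and ap: "(\<integral>(x, y). (K x y - sosk \<psi> m x y)\<^sup>2 \<partial>(M \<Otimes>\<^sub>M M)) \<le> \<epsilon>\<^sup>2"
    using approx[OF e(1)] by blast
  have psi: "\<psi> k \<in> L20 M" if "k < m" for k using mm that by blast
  have psi2: "\<psi> k \<in> L2 M" if "k < m" for k using psi[OF that] by (rule L20_L2)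
  have psim [measurable]: "\<psi> k \<in> borel_measurable M" if "k < m" for k using psi2[OF that] by (rule L2_D)
  define T where "T = (\<Sum>k<m. L2_inner M (\<psi> k) (\<psi> k))"
  define h where "h = (\<integral>x. H x \<partial>M)"
  define S where "S = (\<Sum>k<m. \<Sum>l<m. (L2_inner M (\<psi> k) (\<psi> l))\<^sup>2)"
  define KK where "KK = (\<integral>z. (case_prod K z)\<^sup>2 \<partial>(M \<Otimes>\<^sub>M M))"
  define J where "J x y = K x y - sosk \<psi> m x y" for x y
  have sos: "sosk \<psi> m \<in> L2k" by (rule sosk_L2k) (rule psi2)
  have Jk: "J \<in> L2k" unfolding J_def by (rule kform_diff(2)[OF K_L2k sos L2_zero L2_zero])
  have Jm [measurable]: "case_prod J \<in> borel_measurable (M \<Otimes>\<^sub>M M)" using Jk by (auto dest: L2_D)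
  have Jsq: "sqn (M \<Otimes>\<^sub>M M) (case_prod J) \<le> ennreal (\<epsilon>\<^sup>2)"
    using Jk ap by (subst sqn_eq_integral) (auto intro!: ennreal_leI simp: J_def integral_case_prod_sq simp del: case_prod_beta)
  have KK0: "0 \<le> KK" unfolding KK_def by simp
  \<comment> \<open>The Gram matrix of the approximant is controlled by \<open>K\<close> alone,
    uniformly in \<open>\<epsilon> \<le> 1\<close>.\<close>
  have S_le: "S \<le> 2 * KK + 2"
  proof -
    have "ennreal S = sqn (M \<Otimes>\<^sub>M M) (case_prod (sosk \<psi> m))"
      using sos integral_sosk_sq[of m \<psi>, OF psi2] by (simp add: sqn_eq_integral S_def)
    also have "case_prod (sosk \<psi> m) = (\<lambda>z. case_prod K z - case_prod J z)" by (auto simp: J_def)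
    also have "sqn (M \<Otimes>\<^sub>M M) (\<lambda>z. case_prod K z - case_prod J z) \<le> 2 * sqn (M \<Otimes>\<^sub>M M) (case_prod K) + 2 * sqn (M \<Otimes>\<^sub>M M) (case_prod J)"
      by (rule sqn_diff_le) measurable
    also have "\<dots> \<le> 2 * ennreal KK + 2 * ennreal (\<epsilon>\<^sup>2)"
      using K_L2 Jsq by (intro add_mono mult_left_mono) (auto simp: sqn_eq_integral KK_def)
    also have "\<dots> = ennreal (2 * KK + 2 * \<epsilon>\<^sup>2)"
      by (simp add: ennreal_mult'' ennreal_plus KK0)
    finally have "S \<le> 2 * KK + 2 * \<epsilon>\<^sup>2" by (subst (asm) ennreal_le_iff) (auto simp: KK_def)
    also have "\<epsilon>\<^sup>2 \<le> 1" using e by (simp add: power_le_one)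
    finally show ?thesis by simp
  qed
  define Y' where "Y' N X = - (\<Sum>k<m. (lin N (\<psi> k) X)\<^sup>2) / 2 + T / 2 + h / 2" for N X
  have Y'm [measurable]: "Y' N \<in> borel_measurable (ipow M N)" for N
  proof -
    have "(\<lambda>X. \<Sum>k<m. (lin N (\<psi> k) X)\<^sup>2) \<in> borel_measurable (ipow M N)"
      by (intro borel_measurable_sum borel_measurable_power measurable_lin psim) auto
    then show ?thesis unfolding Y'_def by measurable
  qed
  define G where "G x = H x - h + (\<Sum>k<m. (\<psi> k x)\<^sup>2 - L2_inner M (\<psi> k) (\<psi> k)) / 2" for x
  have G2: "G \<in> L2 M"
  proof -
    have "(\<lambda>x. (\<psi> k x)\<^sup>2) \<in> L2 M" if k: "k < m" for k
    proof -
      obtain B where B: "\<And>x. \<bar>\<psi> k x\<bar> \<le> B" using mm k by blast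
      have "\<bar>(\<psi> k x)\<^sup>2\<bar> \<le> B\<^sup>2" for x using power_mono[OF B[of x], of 2] by simp
      then show ?thesis using psim[OF k] by (intro L2_bounded) auto
    qed
    then have "(\<lambda>x. (H x - h) + (1 / 2) * (\<Sum>k<m. (\<psi> k x)\<^sup>2 - L2_inner M (\<psi> k) (\<psi> k))) \<in> L2 M"
      by (intro L2_add L2_diff H_L2 L2_const L2_cmult L2_sum) auto
    then show ?thesis by (simp add: G_def[abs_def])
  qed
  have [measurable]: "G \<in> borel_measurable M" using G2 by (rule L2_D)
  have G0: "(\<integral>x. G x \<partial>M) = 0"
  proof -
    have i: "integrable M (\<lambda>x. (\<psi> k x)\<^sup>2 - L2_inner M (\<psi> k) (\<psi> k))" if "k < m" for k
      using psi2[OF that] by (auto dest: L2_D)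
    have z: "(\<integral>x. (\<psi> k x)\<^sup>2 - L2_inner M (\<psi> k) (\<psi> k) \<partial>M) = 0" if "k < m" for k
      using psi2[OF that] by (simp add: L2_inner_self L2_D prob_space)
    let ?s = "\<lambda>x. \<Sum>k<m. (\<psi> k x)\<^sup>2 - L2_inner M (\<psi> k) (\<psi> k)"
    have iS: "integrable M ?s" by (rule Bochner_Integration.integrable_sum) (auto intro: i)
    have zS: "(\<integral>x. ?s x \<partial>M) = 0"
      by (subst Bochner_Integration.integral_sum) (auto intro: i z sum.neutral)
    have iH: "integrable M (\<lambda>x. H x - h)" using L2_integrable[OF H_L2] by auto
    have "(\<integral>x. G x \<partial>M) = (\<integral>x. H x - h \<partial>M) + (\<integral>x. ?s x / 2 \<partial>M)"
      unfolding G_def by (rule Bochner_Integration.integral_add[OF iH integrable_divide_zero]) (rule iS)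
    also have "\<dots> = 0"
      unfolding integral_divide_zero zS using L2_integrable[OF H_L2] by (simp add: prob_space h_def)
    finally show ?thesis .
  qed
  have Jc: "AE x in M. (\<integral>y. J x y \<partial>M) = 0"
    using K_centred AE_K_L2
  proof eventually_elim
    case (elim x)
    have "integrable M (K x)" using elim(2) by (rule L2_integrable)
    moreover have "integrable M (\<lambda>y. sosk \<psi> m x y)"
      unfolding sosk_def using L2_integrable[OF psi2] by (intro Bochner_Integration.integrable_sum integrable_mult_right) auto
    moreover have "(\<integral>y. sosk \<psi> m x y \<partial>M) = 0"
      unfolding sosk_def using L2_integrable[OF psi2] psi
      by (subst Bochner_Integration.integral_sum) (auto simp: L20_def intro!: sum.neutral)
    ultimately show ?case using elim(1) by (simp add: J_def)
  qed
  have Jsym: "J x y = J y x" for x y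
    unfolding J_def using K_sym[of x y] by (simp add: sosk_def mult.commute)
  have Ydiff: "sqn (ipow M N) (\<lambda>X. gibbs_exponent M K H N X - Y' N X) \<le> ennreal (\<epsilon>\<^sup>2) + ennreal (2 / real N * (\<integral>x. (G x)\<^sup>2 \<partial>M))"
    if N: "0 < N" for N
  proof -
    have um [measurable]: "ustat J N \<in> borel_measurable (ipow M N)" unfolding ustat_def by measurable
    have "2 * (\<integral>\<^sup>+X. ennreal ((ustat J N X)\<^sup>2) \<partial>ipow M N) \<le> (of_nat N)\<^sup>2 * sqn (M \<Otimes>\<^sub>M M) (case_prod J)"
      using Jc Jsq by (intro nn_integral_ustat_sq) (auto simp: Jsym[of _ "_::'a"] intro: le_less_trans)
    also have "\<dots> \<le> (of_nat N)\<^sup>2 * ennreal (\<epsilon>\<^sup>2)" using Jsq by (intro mult_left_mono) auto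
    finally have us: "2 * sqn (ipow M N) (ustat J N) \<le> (of_nat N)\<^sup>2 * ennreal (\<epsilon>\<^sup>2)" by (simp add: sqn_def)
    have gs: "sqn (ipow M N) (\<lambda>X. \<Sum>i<N. G (X i)) \<le> of_nat N * sqn M G"
      unfolding sqn_def[of "ipow M N"] by (rule nn_integral_iid_sum_sq) (auto simp: G0)
    have "sqn (ipow M N) (\<lambda>X. gibbs_exponent M K H N X - Y' N X) =
       sqn (ipow M N) (\<lambda>X. (- 1 / real N) * ustat J N X + (1 / real N) * (\<Sum>i<N. G (X i)))"
      unfolding Y'_def T_def h_def J_def G_def by (subst gibbs_exponent_diff[of m \<psi>, OF psi N]) auto
    also have "\<dots> \<le> 2 * sqn (ipow M N) (\<lambda>X. (- 1 / real N) * ustat J N X) + 2 * sqn (ipow M N) (\<lambda>X. (1 / real N) * (\<Sum>i<N. G (X i)))"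
      by (rule sqn_add_le) measurable
    also have "\<dots> = ennreal ((1 / real N)\<^sup>2) * (2 * sqn (ipow M N) (ustat J N)) + ennreal ((1 / real N)\<^sup>2) * (2 * sqn (ipow M N) (\<lambda>X. \<Sum>i<N. G (X i)))"
      by (subst (1 2) sqn_cmult) (auto simp: ac_simps)
    also have "\<dots> \<le> ennreal ((1 / real N)\<^sup>2) * ((of_nat N)\<^sup>2 * ennreal (\<epsilon>\<^sup>2)) + ennreal ((1 / real N)\<^sup>2) * (2 * (of_nat N * sqn M G))"
      by (intro add_mono mult_left_mono us gs) auto
    also have "ennreal ((1 / real N)\<^sup>2) * ((of_nat N)\<^sup>2 * ennreal (\<epsilon>\<^sup>2)) = ennreal (\<epsilon>\<^sup>2)"
      using N by (simp add: ennreal_of_nat_eq_real_of_nat ennreal_power ennreal_mult[symmetric] power_divide)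
    also have "ennreal ((1 / real N)\<^sup>2) * (2 * (of_nat N * sqn M G)) = ennreal (2 / real N * (\<integral>x. (G x)\<^sup>2 \<partial>M))"
    proof -
      have "ennreal ((1 / real N)\<^sup>2) * (2 * (of_nat N * sqn M G)) = ennreal ((1 / real N)\<^sup>2 * (2 * (real N * (\<integral>x. (G x)\<^sup>2 \<partial>M))))"
        unfolding sqn_eq_integral[OF G2] ennreal_of_nat_eq_real_of_nat
        by (subst ennreal_numeral[symmetric]) (simp add: ennreal_mult[symmetric] del: ennreal_numeral)
      also have "(1 / real N)\<^sup>2 * (2 * (real N * (\<integral>x. (G x)\<^sup>2 \<partial>M))) = 2 / real N * (\<integral>x. (G x)\<^sup>2 \<partial>M)"
        using N by (simp add: power2_eq_square)
      finally show ?thesis .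
    qed
    finally show ?thesis .
  qed
  \<comment> \<open>Doubling the exponent of the finite rank weight multiplies each function by sqrt
    2, so its second moment is again given by \<open>finite_rank_limit\<close>.\<close>
  define \<psi>2 where "\<psi>2 k x = sqrt 2 * \<psi> k x" for k x
  have psi22: "\<forall>k<m. \<psi>2 k \<in> L20 M" unfolding \<psi>2_def[abs_def] by (intro allI impI L20_cmult psi)
  obtain c where c: "0 < c" "1 \<le> c * exp (T / 2)" "c * exp (T / 2) \<le> exp (S / 4)"
    and fex: "\<forall>\<phi>\<in>L20 M. \<exists>f\<in>L20 M. fr_solves \<psi> m \<phi> f"
    and flim: "\<forall>\<phi>\<in>L20 M. \<forall>f\<in>L20 M. fr_solves \<psi> m \<phi> f \<longrightarrow>
       (\<lambda>N. fr_transform \<psi> m N \<phi>) \<longlonglongrightarrow> complex_of_real (c * exp (- L2_inner M \<phi> f / 2))"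
    using finite_rank_limit[of m \<psi>] psi unfolding T_def S_def by blast
  have in2: "L2_inner M (\<psi>2 k) (\<psi>2 l) = 2 * L2_inner M (\<psi> k) (\<psi> l)" for k l
    unfolding \<psi>2_def[abs_def] L2_inner_cmult_left L2_inner_cmult_right by simp
  have T2: "(\<Sum>k<m. L2_inner M (\<psi>2 k) (\<psi>2 k)) / 2 = T" by (simp add: in2 T_def sum_distrib_left[symmetric])
  have S2: "(\<Sum>k<m. \<Sum>l<m. (L2_inner M (\<psi>2 k) (\<psi>2 l))\<^sup>2) / 4 = S"
    by (simp add: in2 S_def power_mult_distrib sum_distrib_left[symmetric])
  obtain c2 where c2: "0 < c2" "c2 * exp T \<le> exp S"
    and flim2: "\<forall>\<phi>\<in>L20 M. \<forall>f\<in>L20 M. fr_solves \<psi>2 m \<phi> f \<longrightarrow>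
       (\<lambda>N. fr_transform \<psi>2 m N \<phi>) \<longlonglongrightarrow> complex_of_real (c2 * exp (- L2_inner M \<phi> f / 2))"
    using finite_rank_limit[of m \<psi>2, OF psi22] unfolding T2 S2 by blast
  have lim2: "(\<lambda>N. fr_transform \<psi>2 m N (\<lambda>x. 0)) \<longlonglongrightarrow> complex_of_real c2"
    using flim2[rule_format, of "\<lambda>x. 0" "\<lambda>x. 0"] by (simp add: L20_zero fr_solves_def L2_inner_def)
  have eY'2: "(\<integral>X. exp (2 * Y' N X) \<partial>ipow M N) = exp (T + h) * Re (fr_transform \<psi>2 m N (\<lambda>x. 0))" for N
  proof -
    have 1: "fr_transform \<psi>2 m N (\<lambda>x. 0) = complex_of_real (\<integral>X. exp (- (\<Sum>k<m. (lin N (\<psi>2 k) X)\<^sup>2) / 2) \<partial>ipow M N)"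
      unfolding fr_transform_def by (simp add: lin_def)
    have 2: "2 * Y' N X = (T + h) + - (\<Sum>k<m. (lin N (\<psi>2 k) X)\<^sup>2) / 2" for X
      unfolding Y'_def \<psi>2_def[abs_def] lin_cmult by (simp add: power_mult_distrib sum_distrib_left[symmetric])
    show ?thesis unfolding 1 2 exp_add[of "T + h"] integral_mult_right_zero by simp
  qed
  have Y'le: "Y' N X \<le> T / 2 + h / 2" for N X unfolding Y'_def by (simp add: sum_nonneg)
  have ev1: "\<forall>\<^sub>F N in sequentially. (\<integral>X. exp (2 * Y' N X) \<partial>ipow M N) < exp (2 * KK + 2 + h) + 1"
  proof (rule order_tendstoD)
    have "(\<lambda>N. exp (T + h) * Re (fr_transform \<psi>2 m N (\<lambda>x. 0))) \<longlonglongrightarrow> exp (T + h) * Re (complex_of_real c2)"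
      by (intro tendsto_intros lim2)
    then show "(\<lambda>N. \<integral>X. exp (2 * Y' N X) \<partial>ipow M N) \<longlonglongrightarrow> exp (T + h) * c2" by (simp add: eY'2)
    have "exp (T + h) * c2 \<le> exp S * exp h" using c2 by (simp add: exp_add mult.commute mult.left_commute)
    also have "\<dots> \<le> exp (2 * KK + 2) * exp h" using S_le by (intro mult_right_mono) auto
    also have "\<dots> = exp (2 * KK + 2 + h)" by (simp add: exp_add)
    finally show "exp (T + h) * c2 < exp (2 * KK + 2 + h) + 1" by linarith
  qed
  have ev2: "\<forall>\<^sub>F N in sequentially. 2 / real N * (\<integral>x. (G x)\<^sup>2 \<partial>M) < \<epsilon>\<^sup>2"
  proof (rule order_tendstoD)
    have "(\<lambda>N. 2 / real N * (\<integral>x. (G x)\<^sup>2 \<partial>M)) \<longlonglongrightarrow> 0 * (\<integral>x. (G x)\<^sup>2 \<partial>M)"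
      by (intro tendsto_mult tendsto_const lim_const_over_n)
    then show "(\<lambda>N. 2 / real N * (\<integral>x. (G x)\<^sup>2 \<partial>M)) \<longlonglongrightarrow> 0" by simp
  qed (use e in auto)
  \<comment> \<open>The mean T / 2 of the diagonal and the mean h / 2 left by \<open>H\<close> are
    constants of the comparison exponent \<open>Y'\<close> and are moved into the constant.\<close>
  define c' where "c' = c * exp (T / 2 + h / 2)"
  have main: "\<forall>\<^sub>F N in sequentially. \<forall>\<phi>\<in>L20 M.
     cmod (gibbs_transform N \<phi> - complex_of_real (exp (T / 2 + h / 2)) * fr_transform \<psi> m N \<phi>) \<le> \<epsilon> * (D - 1)"
    using ev1 ev2 eventually_gt_at_top[of 0]
  proof eventually_elim
    case (elim N)
    show ?case
    proof
      fix \<phi> assume ph: "\<phi> \<in> L20 M"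
      interpret P: prob_space "ipow M N" by (rule ipow_prob_space)
      have [measurable]: "\<phi> \<in> borel_measurable M" using ph by (intro L2_D L20_L2)
      let ?Y = "gibbs_exponent M K H N"
      let ?e = "\<lambda>X. exp (?Y X)" and ?e' = "\<lambda>X. exp (Y' N X)"
      have e'L: "?e' \<in> L2 (ipow M N)"
        by (rule P.L2_bounded[where B="exp (T / 2 + h / 2)"]) (use Y'le in auto)
      have eL: "?e \<in> L2 (ipow M N)" by (rule exp_gibbs_L2)
      have ei: "integrable (ipow M N) ?e" "integrable (ipow M N) ?e'"
        using eL e'L by (auto intro: P.L2_integrable)
      have int: "integrable (ipow M N) (\<lambda>X. iexp (lin N \<phi> X) * complex_of_real (f X))"
        if "integrable (ipow M N) f" for f
        by (rule Bochner_Integration.integrable_bound[OF that]) (use that in \<open>auto simp: norm_mult\<close>)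
      have frt: "complex_of_real (exp (T / 2 + h / 2)) * fr_transform \<psi> m N \<phi> = (\<integral>X. iexp (lin N \<phi> X) * complex_of_real (?e' X) \<partial>ipow M N)"
        unfolding fr_transform_def integral_mult_right_zero[symmetric] Y'_def
        by (intro Bochner_Integration.integral_cong refl) (simp add: exp_add[symmetric] exp_diff exp_minus exp_add field_simps exp_of_real[symmetric])
      have "gibbs_transform N \<phi> - complex_of_real (exp (T / 2 + h / 2)) * fr_transform \<psi> m N \<phi> =
         (\<integral>X. iexp (lin N \<phi> X) * complex_of_real (?e X - ?e' X) \<partial>ipow M N)"
        unfolding gibbs_transform_def frt
        using int[OF ei(1)] int[OF ei(2)] by (subst Bochner_Integration.integral_diff[symmetric]) (auto simp: right_diff_distrib)
      then have "cmod (gibbs_transform N \<phi> - complex_of_real (exp (T / 2 + h / 2)) * fr_transform \<psi> m N \<phi>) \<le>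
         (\<integral>X. cmod (iexp (lin N \<phi> X) * complex_of_real (?e X - ?e' X)) \<partial>ipow M N)"
        by (simp only: integral_norm_bound)
      also have "\<dots> = (\<integral>X. \<bar>?e X - ?e' X\<bar> \<partial>ipow M N)" by (simp add: norm_mult del: of_real_diff)
      also have "\<dots> \<le> \<epsilon> * (D - 1)"
      proof -
        have "ennreal (\<integral>X. \<bar>?e X - ?e' X\<bar> \<partial>ipow M N) = (\<integral>\<^sup>+X. ennreal \<bar>?e X - ?e' X\<bar> \<partial>ipow M N)"
          using ei by (intro nn_integral_eq_integral[symmetric]) auto
        also have "\<dots> \<le> (\<integral>\<^sup>+X. ennreal (1 / (2 * \<epsilon>)) * ennreal ((?Y X - Y' N X)\<^sup>2) +
            (ennreal \<epsilon> * ennreal (exp (2 * ?Y X)) + ennreal \<epsilon> * ennreal (exp (2 * Y' N X))) \<partial>ipow M N)"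
        proof (rule nn_integral_mono)
          fix X
          define a where "a = \<bar>?Y X - Y' N X\<bar>"
          define b where "b = ?e X + ?e' X"
          have "\<bar>?e X - ?e' X\<bar> \<le> a * b" unfolding a_def b_def by (rule abs_exp_diff_le)
          \<comment> \<open>Young's inequality weighted by \<open>\<epsilon>\<close>: the squared
            difference of the exponents has mean of order \<epsilon>^2, so both terms contribute at
            order \<open>\<epsilon>\<close>.\<close>
          also have "a * b \<le> 1 / (2 * \<epsilon>) * a\<^sup>2 + \<epsilon> / 2 * b\<^sup>2"
          proof -
            have "0 \<le> (a - \<epsilon> * b)\<^sup>2 / (2 * \<epsilon>)" using e by auto
            also have "\<dots> = 1 / (2 * \<epsilon>) * a\<^sup>2 + \<epsilon> / 2 * b\<^sup>2 - a * b"
              using e by (simp add: power2_eq_square field_simps)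
            finally show ?thesis by simp
          qed
          also have "b\<^sup>2 \<le> 2 * (?e X)\<^sup>2 + 2 * (?e' X)\<^sup>2"
            using zero_le_power2[of "?e X - ?e' X"] by (simp add: b_def power2_eq_square algebra_simps)
          finally have "\<bar>?e X - ?e' X\<bar> \<le> 1 / (2 * \<epsilon>) * a\<^sup>2 + \<epsilon> / 2 * (2 * (?e X)\<^sup>2 + 2 * (?e' X)\<^sup>2)"
            using e by auto
          also have "\<dots> = 1 / (2 * \<epsilon>) * (?Y X - Y' N X)\<^sup>2 + (\<epsilon> * exp (2 * ?Y X) + \<epsilon> * exp (2 * Y' N X))"
            by (simp add: a_def exp_double distrib_left)
          finally have "ennreal \<bar>?e X - ?e' X\<bar> \<le> ennreal (1 / (2 * \<epsilon>) * (?Y X - Y' N X)\<^sup>2 + (\<epsilon> * exp (2 * ?Y X) + \<epsilon> * exp (2 * Y' N X)))"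
            by (rule ennreal_leI)
          then show "ennreal \<bar>?e X - ?e' X\<bar> \<le> ennreal (1 / (2 * \<epsilon>)) * ennreal ((?Y X - Y' N X)\<^sup>2) +
            (ennreal \<epsilon> * ennreal (exp (2 * ?Y X)) + ennreal \<epsilon> * ennreal (exp (2 * Y' N X)))"
            using e by (simp add: ennreal_mult[symmetric] ennreal_plus[symmetric] del: ennreal_plus)
        qed
        also have "\<dots> = ennreal (1 / (2 * \<epsilon>)) * sqn (ipow M N) (\<lambda>X. ?Y X - Y' N X) +
            (ennreal \<epsilon> * (\<integral>\<^sup>+X. ennreal (exp (2 * ?Y X)) \<partial>ipow M N) + ennreal \<epsilon> * (\<integral>\<^sup>+X. ennreal (exp (2 * Y' N X)) \<partial>ipow M N))"
          unfolding sqn_def by (simp add: nn_integral_add nn_integral_cmult)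
        also have "(\<integral>\<^sup>+X. ennreal (exp (2 * Y' N X)) \<partial>ipow M N) = ennreal (\<integral>X. exp (2 * Y' N X) \<partial>ipow M N)"
          using L2_D(2)[OF e'L] by (intro nn_integral_eq_integral) (auto simp: exp_double)
        also have "ennreal (1 / (2 * \<epsilon>)) * sqn (ipow M N) (\<lambda>X. ?Y X - Y' N X) +
            (ennreal \<epsilon> * (\<integral>\<^sup>+X. ennreal (exp (2 * ?Y X)) \<partial>ipow M N) + ennreal \<epsilon> * ennreal (\<integral>X. exp (2 * Y' N X) \<partial>ipow M N)) \<le>
          ennreal (1 / (2 * \<epsilon>)) * (ennreal (\<epsilon>\<^sup>2) + ennreal (\<epsilon>\<^sup>2)) +
            (ennreal \<epsilon> * ennreal \<bar>C\<bar> + ennreal \<epsilon> * ennreal (exp (2 * KK + 2 + h) + 1))"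
          using elim
          by (intro add_mono mult_left_mono order_trans[OF Ydiff] order_trans[OF exp_bound] ennreal_leI) auto
        also have "\<dots> = ennreal (1 / (2 * \<epsilon>) * (\<epsilon>\<^sup>2 + \<epsilon>\<^sup>2) + (\<epsilon> * \<bar>C\<bar> + \<epsilon> * (exp (2 * KK + 2 + h) + 1)))"
          using e by (simp add: ennreal_mult[symmetric] ennreal_plus[symmetric] add_nonneg_nonneg del: ennreal_plus)
        also have "1 / (2 * \<epsilon>) * (\<epsilon>\<^sup>2 + \<epsilon>\<^sup>2) + (\<epsilon> * \<bar>C\<bar> + \<epsilon> * (exp (2 * KK + 2 + h) + 1)) = \<epsilon> * (D - 1)"
          unfolding D_def KK_def[symmetric] h_def[symmetric] using e by (simp add: power2_eq_square field_simps)
        finally show ?thesis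
          by (subst (asm) ennreal_le_iff) (use e in \<open>auto simp: D_def intro!: mult_nonneg_nonneg add_nonneg_nonneg\<close>)
      qed
      finally show "cmod (gibbs_transform N \<phi> - complex_of_real (exp (T / 2 + h / 2)) * fr_transform \<psi> m N \<phi>) \<le> \<epsilon> * (D - 1)" .
    qed
  qed
  show ?thesis
    unfolding h_def[symmetric] KK_def[symmetric]
  proof (rule exI[of _ c'], intro conjI ballI allI impI)
    have ceq: "c' = (c * exp (T / 2)) * exp (h / 2)" by (simp add: c'_def exp_add)
    show "exp (h / 2) \<le> c'" unfolding ceq using c(2) by simp
    have "c' \<le> exp (S / 4) * exp (h / 2)" unfolding ceq using c(3) by (intro mult_right_mono) auto
    also have "\<dots> \<le> exp (KK / 2 + 1 / 2) * exp (h / 2)" using S_le by (intro mult_right_mono) auto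
    finally show "c' \<le> exp (KK / 2 + 1 / 2 + h / 2)" by (simp add: exp_add)
  next
    fix \<phi> f assume ph: "\<phi> \<in> L20 M" and sf: "solves \<phi> f"
    obtain f' where f': "f' \<in> L20 M" "fr_solves \<psi> m \<phi> f'" using fex ph by blast
    have f'2: "f' \<in> L2 M" and ph2: "\<phi> \<in> L2 M" using f' ph by (auto intro: L20_L2)
    define q where "q = L2_inner M \<phi> f'"
    have "0 \<le> q" unfolding q_def using fr_solves_nonneg[OF f'(2) f'2 psi2] L2_inner_self_nonneg[of M f'] by force
    moreover have "\<bar>q - L2_inner M \<phi> f\<bar> \<le> \<epsilon> * (nrm f * nrm \<phi>)"
      using solves_approx[of m \<psi>, OF psi ap less_imp_le[OF e(1)] f'(2) f'2 ph2 sf] unfolding q_def by (simp add: abs_minus_commute)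
    moreover have "\<forall>\<^sub>F N in sequentially. cmod (gibbs_transform N \<phi> - complex_of_real (c' * exp (- q / 2))) \<le> \<epsilon> * D"
    proof -
      have "(\<lambda>N. complex_of_real (exp (T / 2 + h / 2)) * fr_transform \<psi> m N \<phi>) \<longlonglongrightarrow>
          complex_of_real (exp (T / 2 + h / 2)) * complex_of_real (c * exp (- q / 2))"
        using flim ph f' unfolding q_def by (intro tendsto_intros) blast
      then have "(\<lambda>N. complex_of_real (exp (T / 2 + h / 2)) * fr_transform \<psi> m N \<phi>) \<longlonglongrightarrow> complex_of_real (c' * exp (- q / 2))"
        by (simp add: c'_def mult_ac)
      then have "\<forall>\<^sub>F N in sequentially. dist (complex_of_real (exp (T / 2 + h / 2)) * fr_transform \<psi> m N \<phi>) (complex_of_real (c' * exp (- q / 2))) < \<epsilon>"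
        using e by (intro tendstoD)
      then show ?thesis using main
      proof eventually_elim
        case (elim N)
        have "cmod (gibbs_transform N \<phi> - complex_of_real (c' * exp (- q / 2))) \<le> \<epsilon> * (D - 1) + \<epsilon>"
          using norm_triangle_ineq[of "gibbs_transform N \<phi> - complex_of_real (exp (T / 2 + h / 2)) * fr_transform \<psi> m N \<phi>"
             "complex_of_real (exp (T / 2 + h / 2)) * fr_transform \<psi> m N \<phi> - complex_of_real (c' * exp (- q / 2))"]
             elim(2)[rule_format, OF ph] elim(1) by (simp add: dist_norm)
        then show ?case by (simp add: right_diff_distrib)
      qed
    qed
    ultimately show "\<exists>q\<ge>0. \<bar>q - L2_inner M \<phi> f\<bar> \<le> \<epsilon> * (nrm f * nrm \<phi>) \<and>
       (\<forall>\<^sub>F N in sequentially. cmod (gibbs_transform N \<phi> - complex_of_real (c' * exp (- q / 2))) \<le> \<epsilon> * D)"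
      by blast
  qed
qed


lemma solves_zero: "solves (\<lambda>x. 0) (\<lambda>x. 0)"
  by (simp add: solves_def L2_zero kop_def)

lemma solves_inner_nonneg:
  assumes "\<phi> \<in> L2 M" "solves \<phi> f" shows "0 \<le> L2_inner M \<phi> f"
proof -
  have f: "f \<in> L2 M" using assms by (simp add: solves_def)
  show ?thesis
    using solves_inner[OF assms(2,1) f] kform_nonneg[OF f] L2_inner_self_nonneg[of M f] by simp
qed

lemma abs_exp_minus_diff_le:
  fixes a b :: real assumes "0 \<le> a" "0 \<le> b" shows "\<bar>exp (- a) - exp (- b)\<bar> \<le> \<bar>a - b\<bar>"
proof -
  have "exp (- a) - exp (- b) \<le> b - a" if "0 \<le> a" "a \<le> b" for a b :: real
  proof -
    have "exp (- a) * (1 - exp (- (b - a))) \<le> 1 * (b - a)"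
    proof (rule mult_mono)
      show "1 - exp (- (b - a)) \<le> b - a" using exp_ge_add_one_self[of "- (b - a)"] by linarith
    qed (use that in auto)
    then show ?thesis by (simp add: right_diff_distrib mult_exp_exp)
  qed
  from this[of a b] this[of b a] assms show ?thesis by (cases "a \<le> b") auto
qed

text \<open>The case \<open>\<phi> = 0\<close> of the approximation, with h the mean of
  \<open>H\<close>: the constant is at least exp (h / 2), by the lower bound 1 on the regularised
  determinant factor, and \<open>\<epsilon>\<close> is chosen so that at most half of this is
  lost.\<close>

theorem gibbs_partition_lower:
  "\<forall>\<^sub>F N in sequentially. exp ((\<integral>x. H x \<partial>M) / 2) / 2 \<le> cmod (gibbs_transform N (\<lambda>x. 0))"
proof -
  define h where "h = (\<integral>x. H x \<partial>M)"
  define D where "D = \<bar>C\<bar> + exp (2 * (\<integral>z. (case_prod K z)\<^sup>2 \<partial>(M \<Otimes>\<^sub>M M)) + 2 + h) + 3"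
  have D: "0 < D" unfolding D_def by (intro add_nonneg_pos add_nonneg_nonneg) auto
  define \<epsilon> where "\<epsilon> = min 1 (exp (h / 2) / (2 * D))"
  have e: "0 < \<epsilon>" "\<epsilon> \<le> 1" "\<epsilon> * D \<le> exp (h / 2) / 2"
    using D by (auto simp: \<epsilon>_def min_mult_distrib_right)
  from gibbs_transform_approx[OF e(1,2), folded h_def, folded D_def] L20_zero solves_zero
  obtain c q where c: "exp (h / 2) \<le> c" and q: "0 \<le> q" "\<bar>q - L2_inner M (\<lambda>x. 0) (\<lambda>x. 0)\<bar> \<le> \<epsilon> * (nrm (\<lambda>x. 0) * nrm (\<lambda>x. 0))"
    and ev: "\<forall>\<^sub>F N in sequentially. cmod (gibbs_transform N (\<lambda>x. 0) - complex_of_real (c * exp (- q / 2))) \<le> \<epsilon> * D"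
    by blast
  have q0: "q = 0" using q(2) by (simp add: L2_inner_def)
  from ev show ?thesis unfolding h_def[symmetric]
  proof eventually_elim
    case (elim N)
    have "cmod (complex_of_real c) \<le> cmod (gibbs_transform N (\<lambda>x. 0)) + \<epsilon> * D"
      using elim norm_triangle_ineq2[of "complex_of_real c" "gibbs_transform N (\<lambda>x. 0)"] unfolding q0
      by (simp add: norm_minus_commute)
    moreover have "c \<le> cmod (complex_of_real c)" by simp
    ultimately show ?case using c e(3) by linarith
  qed
qed

text \<open>The constant of the approximation varies with its accuracy and need not be known:
  numerator and denominator are close to multiples of the same constant. Hence their combination in
  \<open>diff0\<close> tends to zero, and the division is safe because the denominator stays away
  from zero.\<close>

theorem gibbs_char_limit:
  assumes ph: "\<phi> \<in> L20 M" and f: "solves \<phi> f"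
  shows "(\<lambda>N. gibbs_transform N \<phi> / gibbs_transform N (\<lambda>x. 0)) \<longlonglongrightarrow> exp (- L2_inner M \<phi> f / 2)"
proof -
  define h where "h = (\<integral>x. H x \<partial>M)"
  define KK where "KK = (\<integral>z. (case_prod K z)\<^sup>2 \<partial>(M \<Otimes>\<^sub>M M))"
  define D where "D = \<bar>C\<bar> + exp (2 * KK + 2 + h) + 3"
  define cm where "cm = exp (KK / 2 + 1 / 2 + h / 2)"
  define Q where "Q = L2_inner M \<phi> f"
  \<comment> \<open>The error budget: one \<open>D\<close> for each of the two transforms, the
    resolvent error multiplied by the largest possible constant \<open>cm\<close>, and a spare
    1.\<close>
  define E where "E = 2 * D + cm * (nrm f * nrm \<phi>) / 2 + 1"
  have ph2: "\<phi> \<in> L2 M" using ph by (rule L20_L2)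
  have Q0: "0 \<le> Q" unfolding Q_def by (rule solves_inner_nonneg[OF ph2 f])
  have D: "0 < D" unfolding D_def by (intro add_nonneg_pos add_nonneg_nonneg) auto
  have E: "0 < E" unfolding E_def using D by (intro add_nonneg_pos add_nonneg_nonneg) (auto simp: cm_def)
  let ?A = "gibbs_transform"
  have diff0: "(\<lambda>N. ?A N \<phi> - ?A N (\<lambda>x. 0) * complex_of_real (exp (- Q / 2))) \<longlonglongrightarrow> 0"
  proof (rule tendstoI)
    fix r :: real assume r: "0 < r"
    define \<epsilon> where "\<epsilon> = min 1 (r / (2 * E))"
    have e: "0 < \<epsilon>" "\<epsilon> \<le> 1" "\<epsilon> * E \<le> r / 2"
      using E r by (auto simp: \<epsilon>_def min_mult_distrib_right)
    note ap = gibbs_transform_approx[OF e(1,2), folded h_def KK_def, folded D_def cm_def]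
    then obtain c where c: "exp (h / 2) \<le> c" "c \<le> cm"
      and cc: "\<And>\<phi> f. \<phi> \<in> L20 M \<Longrightarrow> solves \<phi> f \<Longrightarrow> \<exists>q\<ge>0. \<bar>q - L2_inner M \<phi> f\<bar> \<le> \<epsilon> * (nrm f * nrm \<phi>) \<and>
       (\<forall>\<^sub>F N in sequentially. cmod (gibbs_transform N \<phi> - complex_of_real (c * exp (- q / 2))) \<le> \<epsilon> * D)"
      by blast
    from cc[OF L20_zero solves_zero]
    have ev0: "\<forall>\<^sub>F N in sequentially. cmod (?A N (\<lambda>x. 0) - complex_of_real c) \<le> \<epsilon> * D"
      by (auto simp: L2_inner_def)
    from cc[OF ph f] obtain q where q: "0 \<le> q" "\<bar>q - Q\<bar> \<le> \<epsilon> * (nrm f * nrm \<phi>)"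
      and ev1: "\<forall>\<^sub>F N in sequentially. cmod (?A N \<phi> - complex_of_real (c * exp (- q / 2))) \<le> \<epsilon> * D"
      unfolding Q_def by blast
    have c0: "0 \<le> c" using c(1) exp_ge_zero[of "h / 2"] by linarith
    have ex: "c * \<bar>exp (- q / 2) - exp (- Q / 2)\<bar> \<le> \<epsilon> * (cm * (nrm f * nrm \<phi>) / 2)"
    proof -
      have "\<bar>exp (- q / 2) - exp (- Q / 2)\<bar> \<le> \<bar>q - Q\<bar> / 2"
        using abs_exp_minus_diff_le[of "q / 2" "Q / 2"] q Q0 by (simp add: diff_divide_distrib[symmetric])
      also have "\<dots> \<le> \<epsilon> * (nrm f * nrm \<phi>) / 2" using q by simp
      finally have "c * \<bar>exp (- q / 2) - exp (- Q / 2)\<bar> \<le> cm * (\<epsilon> * (nrm f * nrm \<phi>) / 2)"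
        using c c0 by (intro mult_mono) auto
      then show ?thesis by (simp add: mult_ac)
    qed
    show "\<forall>\<^sub>F N in sequentially. dist (?A N \<phi> - ?A N (\<lambda>x. 0) * complex_of_real (exp (- Q / 2))) 0 < r"
      using ev0 ev1
    proof eventually_elim
      case (elim N)
      have "?A N \<phi> - ?A N (\<lambda>x. 0) * complex_of_real (exp (- Q / 2)) =
         (?A N \<phi> - complex_of_real (c * exp (- q / 2))) + complex_of_real (c * (exp (- q / 2) - exp (- Q / 2)))
          - (?A N (\<lambda>x. 0) - complex_of_real c) * complex_of_real (exp (- Q / 2))" (is "_ = ?x + ?y - ?z")
        by (simp add: algebra_simps)
      also have "cmod (?x + ?y - ?z) \<le> cmod ?x + cmod ?y + cmod ?z"
        by (meson add_mono norm_triangle_ineq norm_triangle_ineq4 order_refl order_trans)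
      also have "cmod ?z \<le> \<epsilon> * D * 1"
        unfolding norm_mult using elim(1) e D Q0 by (intro mult_mono) auto
      also have "cmod ?y = c * \<bar>exp (- q / 2) - exp (- Q / 2)\<bar>"
        using c0 by (simp only: norm_of_real abs_mult abs_of_nonneg)
      finally have "cmod (?A N \<phi> - ?A N (\<lambda>x. 0) * complex_of_real (exp (- Q / 2))) \<le>
         \<epsilon> * D + \<epsilon> * (cm * (nrm f * nrm \<phi>) / 2) + \<epsilon> * D"
        using elim(2) ex by linarith
      also have "\<dots> \<le> \<epsilon> * E" unfolding E_def using e(1) by (simp add: algebra_simps)
      finally show ?case using e(3) r by simp
    qed
  qed
  have lim0: "(\<lambda>N. (?A N \<phi> - ?A N (\<lambda>x. 0) * complex_of_real (exp (- Q / 2))) / ?A N (\<lambda>x. 0)) \<longlonglongrightarrow> 0"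
  proof (rule Lim_null_comparison)
    define \<delta> where "\<delta> = exp (h / 2) / 2"
    have d: "0 < \<delta>" by (simp add: \<delta>_def)
    show "\<forall>\<^sub>F N in sequentially. cmod ((?A N \<phi> - ?A N (\<lambda>x. 0) * complex_of_real (exp (- Q / 2))) / ?A N (\<lambda>x. 0)) \<le>
       cmod (?A N \<phi> - ?A N (\<lambda>x. 0) * complex_of_real (exp (- Q / 2))) / \<delta>"
      using gibbs_partition_lower[folded h_def, folded \<delta>_def]
    proof eventually_elim
      case (elim N)
      then show ?case unfolding norm_divide using d by (intro divide_left_mono) (auto intro!: mult_pos_pos)
    qed
    have "(\<lambda>N. cmod (?A N \<phi> - ?A N (\<lambda>x. 0) * complex_of_real (exp (- Q / 2))) / \<delta>) \<longlonglongrightarrow> cmod 0 / \<delta>"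
      using d by (intro tendsto_intros diff0) auto
    then show "(\<lambda>N. cmod (?A N \<phi> - ?A N (\<lambda>x. 0) * complex_of_real (exp (- Q / 2))) / \<delta>) \<longlonglongrightarrow> 0" by simp
  qed
  have "(\<lambda>N. ?A N \<phi> / ?A N (\<lambda>x. 0) - complex_of_real (exp (- Q / 2))) \<longlonglongrightarrow> 0"
  proof (rule Lim_transform_eventually[OF lim0])
    show "\<forall>\<^sub>F N in sequentially. (?A N \<phi> - ?A N (\<lambda>x. 0) * complex_of_real (exp (- Q / 2))) / ?A N (\<lambda>x. 0) =
       ?A N \<phi> / ?A N (\<lambda>x. 0) - complex_of_real (exp (- Q / 2))"
      using gibbs_partition_lower[folded h_def]
    proof eventually_elim
      case (elim N)
      have "0 < exp (h / 2) / 2" by simp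
      then have "?A N (\<lambda>x. 0) \<noteq> 0" using elim by fastforce
      then show ?case by (simp add: diff_divide_distrib)
    qed
  qed
  then show ?thesis by (simp add: LIM_zero_iff Q_def)
qed

end

section \<open>Exponential moments of degenerate U-statistics\<close>

text \<open>Only an upper bound on \<open>u\<close> is assumed, and arbitrarily negative values are
  allowed. This is why a kernel that is merely bounded below suffices in
  \<open>exp_ustat_bound\<close>.\<close>

lemma exp_le_quadratic: "exp u \<le> 1 + u + u\<^sup>2" if "u \<le> 1" for u :: real
proof (cases "0 \<le> u")
  case True
  then show ?thesis using exp_bound[of u] that by simp
next
  case False
  define w where "w = - u"
  have w: "0 < w" using False by (simp add: w_def)
  have "1 \<le> (1 - w + w\<^sup>2) * (1 + w)"
    using w by (simp add: algebra_simps power2_eq_square)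
  also have "\<dots> \<le> (1 - w + w\<^sup>2) * exp w"
  proof (rule mult_left_mono)
    show "1 + w \<le> exp w" by (rule exp_ge_add_one_self)
    have "1 - w + w\<^sup>2 = (w - 1 / 2)\<^sup>2 + 3 / 4" by (simp add: power2_eq_square field_simps)
    then show "0 \<le> 1 - w + w\<^sup>2" by simp
  qed
  finally have "exp (- w) \<le> 1 - w + w\<^sup>2" by (simp add: exp_minus field_simps)
  then show ?thesis by (simp add: w_def)
qed

context prob_space
begin

text \<open>Hoeffding's lemma on an interval of length 2 b, which turns the usual 1 / 8 into 1 /
  2.\<close>

lemma hoeffding_centred:
  assumes [measurable]: "f \<in> borel_measurable M" and b: "AE x in M. \<bar>f x\<bar> \<le> b" and f0: "(\<integral>x. f x \<partial>M) = 0" and t: "0 \<le> t"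
  shows "(\<integral>\<^sup>+x. ennreal (exp (t * f x)) \<partial>M) \<le> ennreal (exp (t\<^sup>2 * b\<^sup>2 / 2))"
proof (cases "t = 0")
  case True
  then show ?thesis by (simp add: emeasure_space_1)
next
  case False
  interpret F: interval_bounded_random_variable M f "- b" b
    by unfold_locales (use b in \<open>auto simp: abs_le_iff minus_le_iff\<close>)
  have "(\<integral>\<^sup>+x. ennreal (exp (t * f x)) \<partial>M) \<le> ennreal (exp (t\<^sup>2 * (b - - b)\<^sup>2 / 8))"
    using False t f0 by (intro F.Hoeffdings_lemma_nn_integral_0) auto
  also have "t\<^sup>2 * (b - - b)\<^sup>2 / 8 = t\<^sup>2 * b\<^sup>2 / 2" by (simp add: power2_eq_square)
  finally show ?thesis .
qed

text \<open>The last assumption says that \<open>f\<close> depends only on the first k coordinates,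
  whose joint law is the shorter product.\<close>

lemma nn_integral_ipow_restrict:
  assumes "k \<le> n" and f: "f \<in> borel_measurable (ipow M k)" and eq: "\<And>X. f (restrict X {..<k}) = f X"
  shows "(\<integral>\<^sup>+X. f X \<partial>ipow M n) = (\<integral>\<^sup>+X. f X \<partial>ipow M k)"
proof -
  interpret P: product_prob_space "\<lambda>_::nat. M" by unfold_locales
  have "ipow M k = distr (ipow M n) (ipow M k) (\<lambda>X. restrict X {..<k})"
    using assms(1) by (intro P.distr_restrict) auto
  then have "(\<integral>\<^sup>+X. f X \<partial>ipow M k) = (\<integral>\<^sup>+X. f X \<partial>distr (ipow M n) (ipow M k) (\<lambda>X. restrict X {..<k}))"
    by simp
  also have "\<dots> = (\<integral>\<^sup>+X. f (restrict X {..<k}) \<partial>ipow M n)"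
    using assms(1) f by (intro nn_integral_distr) (auto intro!: measurable_restrict_subset)
  finally show ?thesis by (simp add: eq)
qed

text \<open>The sum of the rows \<open>R (X i)\<close> is a random walk in L2. If n2 is its squared
  norm so far, a new point adds 2 \<alpha> times a centred variable bounded by sqrt (n2 * \<kappa>).
  By Hoeffding this costs 2 \<alpha>^2 \<kappa> n2, which is absorbed by enlarging
  \<open>\<alpha>\<close> for the shorter walk. The budget \<open>c / N * (2 - k / N)\<close>
  decreases with k so that this enlargement is available at every step.\<close>

lemma exp_sum_norm_sq_bound:
  fixes R :: "'a \<Rightarrow> 'a \<Rightarrow> real" and c \<kappa> :: real
  assumes [measurable]: "case_prod R \<in> borel_measurable (M \<Otimes>\<^sub>M M)"
    and cent: "\<And>y. y \<in> space M \<Longrightarrow> (\<integral>x. R x y \<partial>M) = 0"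
    and kap: "\<And>x. x \<in> space M \<Longrightarrow> sqn M (R x) \<le> ennreal \<kappa>" and k0: "0 \<le> \<kappa>"
    and c: "0 \<le> c" "8 * \<kappa> * c \<le> 1" and N: "0 < N"
  shows "k \<le> N \<Longrightarrow> 0 \<le> \<alpha> \<Longrightarrow> \<alpha> \<le> c / N * (2 - k / N) \<Longrightarrow>
    (\<integral>\<^sup>+X. ennreal (exp (\<alpha> * (\<integral>y. (\<Sum>i<k. R (X i) y)\<^sup>2 \<partial>M))) \<partial>ipow M k) \<le> ennreal (exp (2 * c * \<kappa> * k / N))"
proof (induction k arbitrary: \<alpha>)
  case 0
  show ?case using prob_space.emeasure_space_1[OF ipow_prob_space[of 0]] by simp
next
  case (Suc k)
  interpret PP: pair_prob_space M M ..
  have RL2: "R x \<in> L2 M" if "x \<in> space M" for x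
    using kap[OF that] that by (auto simp: L2_iff_sqn intro: le_less_trans)
  have Rsq: "(\<integral>y. (R x y)\<^sup>2 \<partial>M) \<le> \<kappa>" if "x \<in> space M" for x
    using kap[OF that] k0 by (simp add: sqn_eq_integral[OF RL2[OF that]])
  have a2: "\<alpha> \<le> 2 * c / N"
  proof -
    have "c / N * (2 - Suc k / N) \<le> c / N * 2" using c N by (intro mult_left_mono) auto
    then show ?thesis using Suc.prems by simp
  qed
  define \<alpha>' where "\<alpha>' = \<alpha> + 2 * \<alpha>\<^sup>2 * \<kappa>"
  have \<alpha>'0: "0 \<le> \<alpha>'" using Suc.prems k0 by (simp add: \<alpha>'_def)
  \<comment> \<open>One step may enlarge \<open>\<alpha>\<close> by at most c / N^2, the decrement
    of the budget. As \<alpha> <= 2 c / N, the enlargement is at most 8 \<kappa> c * c / N^2; this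
    is the origin of the condition \<open>8 * \<kappa> * c \<le> 1\<close>.\<close>
  have \<alpha>'le: "\<alpha>' \<le> c / N * (2 - k / N)"
  proof -
    have "2 * \<alpha>\<^sup>2 * \<kappa> \<le> 2 * (2 * c / N)\<^sup>2 * \<kappa>"
      using a2 Suc.prems k0 by (intro mult_right_mono mult_left_mono power_mono) auto
    also have "\<dots> = (8 * \<kappa> * c) * c / N\<^sup>2" by (simp add: power2_eq_square)
    also have "\<dots> \<le> 1 * c / N\<^sup>2" using c by (intro divide_right_mono mult_right_mono) auto
    finally have "\<alpha>' \<le> c / N * (2 - Suc k / N) + c / N\<^sup>2" using Suc.prems by (simp add: \<alpha>'_def)
    also have "\<dots> = c / N * (2 - k / N)" using N by (simp add: field_simps power2_eq_square)
    finally show ?thesis .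
  qed
  have ak: "\<alpha> * \<kappa> \<le> 2 * c * \<kappa> / N" using mult_right_mono[OF a2 k0] by simp
  have step: "(\<integral>\<^sup>+x. ennreal (exp (\<alpha> * (\<integral>y. (\<Sum>i<Suc k. R ((X(k := x)) i) y)\<^sup>2 \<partial>M))) \<partial>M) \<le>
      ennreal (exp (2 * c * \<kappa> / N)) * ennreal (exp (\<alpha>' * (\<integral>y. (\<Sum>i<k. R (X i) y)\<^sup>2 \<partial>M)))"
    if X: "X \<in> space (ipow M k)" for X
  proof -
    have Xi: "X i \<in> space M" if "i < k" for i using X that by (auto simp: space_PiM)
    define S where "S y = (\<Sum>i<k. R (X i) y)" for y
    have S: "S \<in> L2 M" unfolding S_def[abs_def] by (intro L2_sum RL2 Xi) auto
    then have [measurable]: "S \<in> borel_measurable M" by (rule L2_D)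
    define n2 where "n2 = (\<integral>y. (S y)\<^sup>2 \<partial>M)"
    have n20: "0 \<le> n2" by (simp add: n2_def)
    define Y where "Y x = L2_inner M S (R x)" for x
    have [measurable]: "Y \<in> borel_measurable M" unfolding Y_def L2_inner_def by measurable
    have Yb: "\<bar>Y x\<bar> \<le> sqrt (n2 * \<kappa>)" if x: "x \<in> space M" for x
    proof (rule real_le_rsqrt[of "\<bar>Y x\<bar>", simplified])
      have "(Y x)\<^sup>2 \<le> n2 * (\<integral>y. (R x y)\<^sup>2 \<partial>M)"
        unfolding Y_def n2_def by (rule L2_inner_cauchy_schwarz[OF S RL2[OF x]])
      also have "\<dots> \<le> n2 * \<kappa>" using Rsq[OF x] n20 by (rule mult_left_mono)
      finally show "(Y x)\<^sup>2 \<le> n2 * \<kappa>" .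
    qed
    have Y0: "(\<integral>x. Y x \<partial>M) = 0"
    proof -
      have R2: "case_prod R \<in> L2 (M \<Otimes>\<^sub>M M)"
      proof -
        have "sqn (M \<Otimes>\<^sub>M M) (case_prod R) = (\<integral>\<^sup>+x. sqn M (R x) \<partial>M)"
          unfolding sqn_def by (subst nn_integral_fst[symmetric]) (auto simp: split_beta)
        also have "\<dots> \<le> (\<integral>\<^sup>+x. ennreal \<kappa> \<partial>M)" by (intro nn_integral_mono kap) auto
        finally show ?thesis by (auto simp: L2_iff_sqn emeasure_space_1 intro: le_less_trans)
      qed
      have i: "integrable (M \<Otimes>\<^sub>M M) (\<lambda>(x, y). S y * R x y)"
        using L2_mult_integrable[OF R2 tens_L2(1)[OF L2_const[of 1] S]] by (simp add: tens_def split_beta' mult.commute)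
      have "(\<integral>x. Y x \<partial>M) = (\<integral>y. (\<integral>x. S y * R x y \<partial>M) \<partial>M)"
        unfolding Y_def L2_inner_def by (rule PP.Fubini_integral[OF i, symmetric])
      also have "\<dots> = (\<integral>y. 0 \<partial>M)" by (intro Bochner_Integration.integral_cong) (auto simp: cent)
      finally show ?thesis by simp
    qed
    have pt: "exp (\<alpha> * (\<integral>y. (\<Sum>i<Suc k. R ((X(k := x)) i) y)\<^sup>2 \<partial>M)) \<le>
        exp (2 * c * \<kappa> / N + \<alpha> * n2) * exp ((2 * \<alpha>) * Y x)" if x: "x \<in> space M" for x
    proof -
      have "(\<integral>y. (\<Sum>i<Suc k. R ((X(k := x)) i) y)\<^sup>2 \<partial>M) = L2_inner M (\<lambda>y. S y + R x y) (\<lambda>y. S y + R x y)"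
        by (simp add: L2_inner_self S_def)
      also have "\<dots> = n2 + 2 * Y x + (\<integral>y. (R x y)\<^sup>2 \<partial>M)"
        using S RL2[OF x] L2_add[OF S RL2[OF x]]
        by (simp add: L2_inner_add_left L2_inner_add_right n2_def L2_inner_self[symmetric] Y_def L2_inner_commute)
      also have "\<alpha> * \<dots> \<le> (2 * c * \<kappa> / N + \<alpha> * n2) + (2 * \<alpha>) * Y x"
        using mult_left_mono[OF Rsq[OF x] Suc.prems(2)] ak by (simp add: algebra_simps)
      finally show ?thesis by (simp only: exp_add[symmetric] exp_le_cancel_iff)
    qed
    have "(\<integral>\<^sup>+x. ennreal (exp (\<alpha> * (\<integral>y. (\<Sum>i<Suc k. R ((X(k := x)) i) y)\<^sup>2 \<partial>M))) \<partial>M) \<le>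
        (\<integral>\<^sup>+x. ennreal (exp (2 * c * \<kappa> / N + \<alpha> * n2)) * ennreal (exp ((2 * \<alpha>) * Y x)) \<partial>M)"
      by (intro nn_integral_mono) (simp only: ennreal_mult[symmetric] exp_ge_zero ennreal_leI pt)
    also have "\<dots> = ennreal (exp (2 * c * \<kappa> / N + \<alpha> * n2)) * (\<integral>\<^sup>+x. ennreal (exp ((2 * \<alpha>) * Y x)) \<partial>M)"
      by (rule nn_integral_cmult) measurable
    also have "\<dots> \<le> ennreal (exp (2 * c * \<kappa> / N + \<alpha> * n2)) * ennreal (exp ((2 * \<alpha>)\<^sup>2 * (sqrt (n2 * \<kappa>))\<^sup>2 / 2))"
      using Suc.prems Y0 Yb by (intro mult_left_mono hoeffding_centred AE_I2) auto
    also have "\<dots> = ennreal (exp (2 * c * \<kappa> / N)) * ennreal (exp (\<alpha>' * n2))"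
    proof -
      have "2 * c * \<kappa> / N + \<alpha> * n2 + (2 * \<alpha>)\<^sup>2 * (sqrt (n2 * \<kappa>))\<^sup>2 / 2 = 2 * c * \<kappa> / N + \<alpha>' * n2"
        using n20 k0 by (simp add: \<alpha>'_def power_mult_distrib algebra_simps)
      then show ?thesis
        by (simp only: ennreal_mult[symmetric] exp_ge_zero exp_add[symmetric])
    qed
    finally show ?thesis unfolding n2_def S_def .
  qed
  have "(\<integral>\<^sup>+X. ennreal (exp (\<alpha> * (\<integral>y. (\<Sum>i<Suc k. R (X i) y)\<^sup>2 \<partial>M))) \<partial>ipow M (Suc k)) =
    (\<integral>\<^sup>+X. \<integral>\<^sup>+x. ennreal (exp (\<alpha> * (\<integral>y. (\<Sum>i<Suc k. R ((X(k := x)) i) y)\<^sup>2 \<partial>M))) \<partial>M \<partial>ipow M k)"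
    by (rule nn_integral_ipow_Suc) measurable
  also have "\<dots> \<le> (\<integral>\<^sup>+X. ennreal (exp (2 * c * \<kappa> / N)) * ennreal (exp (\<alpha>' * (\<integral>y. (\<Sum>i<k. R (X i) y)\<^sup>2 \<partial>M))) \<partial>ipow M k)"
    by (intro nn_integral_mono step)
  also have "\<dots> = ennreal (exp (2 * c * \<kappa> / N)) * (\<integral>\<^sup>+X. ennreal (exp (\<alpha>' * (\<integral>y. (\<Sum>i<k. R (X i) y)\<^sup>2 \<partial>M))) \<partial>ipow M k)"
    by (rule nn_integral_cmult) measurable
  also have "\<dots> \<le> ennreal (exp (2 * c * \<kappa> / N)) * ennreal (exp (2 * c * \<kappa> * k / N))"
    using Suc.prems \<alpha>'0 \<alpha>'le by (intro mult_left_mono Suc.IH) auto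
  also have "\<dots> = ennreal (exp (2 * c * \<kappa> * Suc k / N))"
    by (simp add: ennreal_mult[symmetric] exp_add[symmetric] add_divide_distrib[symmetric] algebra_simps)
  finally show ?case .
qed

text \<open>The conditional Laplace transforms are absorbed by compensating with the quadratic
  variation \<open>q\<close>, whose exponential moments come from the previous lemma.\<close>

lemma exp_ustat_bound:
  fixes R :: "'a \<Rightarrow> 'a \<Rightarrow> real" and l m \<kappa> :: real
  assumes Rm [measurable]: "case_prod R \<in> borel_measurable (M \<Otimes>\<^sub>M M)"
    and sym: "\<And>x y. R x y = R y x"
    and cent: "\<And>x. x \<in> space M \<Longrightarrow> (\<integral>y. R x y \<partial>M) = 0"
    and kap: "\<And>x. x \<in> space M \<Longrightarrow> sqn M (R x) \<le> ennreal \<kappa>" and k0: "0 \<le> \<kappa>"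
    and low: "\<And>x y. - m \<le> R x y" and m0: "0 \<le> m"
    and l: "0 \<le> l" "2 * l * m \<le> 1" "32 * \<kappa> * l\<^sup>2 \<le> 1"
  shows "(\<integral>\<^sup>+X. ennreal (exp (- l * ustat R N X / real N)) \<partial>ipow M N) \<le> 2"
proof (cases "N = 0")
  case True
  then show ?thesis using prob_space.emeasure_space_1[OF ipow_prob_space[of 0]] by (simp add: ustat_def)
next
  case False
  then have N: "0 < N" by simp
  interpret PN: prob_space "ipow M N" by (rule ipow_prob_space)
  have RL2: "R x \<in> L2 M" if "x \<in> space M" for x
    using kap[OF that] that by (auto simp: L2_iff_sqn intro: le_less_trans)
  define a where "a = l / N"
  have a0: "0 \<le> a" using l by (simp add: a_def)
  \<comment> \<open>This is the conditional variance of the increment of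
    \<open>2 * a * ustat R\<close> at step k. The exponent carries the factor 2 in anticipation of
    the final splitting into two square roots.\<close>
  define q where "q k X = 4 * a\<^sup>2 * (\<integral>y. (\<Sum>i<k. R (X i) y)\<^sup>2 \<partial>M)" for k :: nat and X
  have qm [measurable]: "q k \<in> borel_measurable (ipow M n)" if "k \<le> n" for k n :: nat
  proof -
    have [measurable]: "(\<lambda>X. X i) \<in> measurable (ipow M n) M" if "i \<in> {..<k}" for i
      by (rule measurable_component_singleton) (use that \<open>k \<le> n\<close> in auto)
    show ?thesis unfolding q_def by measurable
  qed
  have um [measurable]: "ustat R n \<in> borel_measurable (ipow M n)" for n unfolding ustat_def by measurable
  \<comment> \<open>The compensated exponential is a supermartingale: by \<open>low\<close> the
    exponent of an increment is at most 1, so \<open>exp_le_quadratic\<close> applies; its linear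
    term integrates to 0, and 1 + q <= exp q.\<close>
  have super: "(\<integral>\<^sup>+X. ennreal (exp (- 2 * a * ustat R n X - (\<Sum>k<n. q k X))) \<partial>ipow M n) \<le> 1" if "n \<le> N" for n
    using that
  proof (induction n)
    case 0
    then show ?case using prob_space.emeasure_space_1[OF ipow_prob_space[of 0]] by (simp add: ustat_def)
  next
    case (Suc n)
    have qsum [measurable]: "(\<lambda>X. \<Sum>k<n'. q k X) \<in> borel_measurable (ipow M n')" for n'
      by (intro borel_measurable_sum qm) auto
    have step: "(\<integral>\<^sup>+x. ennreal (exp (- 2 * a * ustat R (Suc n) (X(n := x)) - (\<Sum>k<Suc n. q k (X(n := x))))) \<partial>M) \<le>
        ennreal (exp (- 2 * a * ustat R n X - (\<Sum>k<n. q k X)))" if X: "X \<in> space (ipow M n)" for X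
    proof -
      have Xi: "X i \<in> space M" if "i < n" for i using X that by (auto simp: space_PiM)
      define S where "S y = (\<Sum>i<n. R (X i) y)" for y
      have S: "S \<in> L2 M" unfolding S_def[abs_def] by (intro L2_sum RL2 Xi) auto
      have S0: "(\<integral>y. S y \<partial>M) = 0"
        unfolding S_def using L2_integrable[OF RL2[OF Xi]] cent Xi
        by (subst Bochner_Integration.integral_sum) (auto intro!: sum.neutral)
      have Slow: "- 2 * a * S y \<le> 1" for y
      proof -
        have "- S y \<le> (\<Sum>i<n. m)" unfolding S_def sum_negf[symmetric]
          by (intro sum_mono) (use low in \<open>simp add: minus_le_iff\<close>)
        also have "\<dots> \<le> N * m" using Suc.prems m0 by (simp add: mult_right_mono)
        finally have "2 * a * (- S y) \<le> 2 * a * (N * m)" using a0 by (intro mult_left_mono) auto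
        also have "\<dots> = 2 * l * m" using N by (simp add: a_def)
        finally show ?thesis using l by simp
      qed
      have qX: "q k (X(n := x)) = q k X" if "k \<le> n" for k x
      proof -
        have "(\<Sum>i<k. R ((X(n := x)) i) y) = (\<Sum>i<k. R (X i) y)" for y
          using that by (intro sum.cong) auto
        then show ?thesis by (simp only: q_def)
      qed
      have uX: "ustat R (Suc n) (X(n := x)) = ustat R n X + S x" for x
        unfolding ustat_def S_def sum.lessThan_Suc by (intro arg_cong2[where f="(+)"] sum.cong) auto
      have qq: "q n X = (\<integral>y. (2 * a * S y)\<^sup>2 \<partial>M)"
        unfolding q_def S_def power_mult_distrib by simp
      have Si: "integrable M S" "integrable M (\<lambda>y. (S y)\<^sup>2)" using S by (auto intro: L2_integrable L2_D)
      have "(\<integral>\<^sup>+x. ennreal (exp (- 2 * a * S x)) \<partial>M) \<le> (\<integral>\<^sup>+x. ennreal (1 + (- 2 * a * S x) + (- 2 * a * S x)\<^sup>2) \<partial>M)"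
        by (intro nn_integral_mono ennreal_leI exp_le_quadratic Slow)
      also have "\<dots> = ennreal (\<integral>x. 1 + (- 2 * a * S x) + (- 2 * a * S x)\<^sup>2 \<partial>M)"
      proof (rule nn_integral_eq_integral)
        show "integrable M (\<lambda>x. 1 + (- 2 * a * S x) + (- 2 * a * S x)\<^sup>2)" using Si by (simp add: power_mult_distrib)
        show "AE x in M. 0 \<le> 1 + (- 2 * a * S x) + (- 2 * a * S x)\<^sup>2"
          using order_trans[OF exp_ge_zero exp_le_quadratic[OF Slow]] by (intro AE_I2)
      qed
      also have "(\<integral>x. 1 + (- 2 * a * S x) + (- 2 * a * S x)\<^sup>2 \<partial>M) = 1 + q n X"
        unfolding qq using Si S0 by (simp add: power_mult_distrib prob_space)
      also have "ennreal (1 + q n X) \<le> ennreal (exp (q n X))" by (intro ennreal_leI exp_ge_add_one_self)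
      finally have main: "(\<integral>\<^sup>+x. ennreal (exp (- 2 * a * S x)) \<partial>M) \<le> ennreal (exp (q n X))" .
      have "(\<integral>\<^sup>+x. ennreal (exp (- 2 * a * ustat R (Suc n) (X(n := x)) - (\<Sum>k<Suc n. q k (X(n := x))))) \<partial>M) =
         (\<integral>\<^sup>+x. ennreal (exp (- 2 * a * ustat R n X - (\<Sum>k<n. q k X) - q n X)) * ennreal (exp (- 2 * a * S x)) \<partial>M)"
      proof (rule nn_integral_cong)
        fix x
        have "- 2 * a * ustat R (Suc n) (X(n := x)) - (\<Sum>k<Suc n. q k (X(n := x))) =
           (- 2 * a * ustat R n X - (\<Sum>k<n. q k X) - q n X) + - 2 * a * S x"
          unfolding uX sum.lessThan_Suc qX[OF order_refl] using qX by (simp add: algebra_simps)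
        then show "ennreal (exp (- 2 * a * ustat R (Suc n) (X(n := x)) - (\<Sum>k<Suc n. q k (X(n := x))))) =
          ennreal (exp (- 2 * a * ustat R n X - (\<Sum>k<n. q k X) - q n X)) * ennreal (exp (- 2 * a * S x))"
          by (simp only: exp_add ennreal_mult exp_ge_zero)
      qed
      also have "\<dots> = ennreal (exp (- 2 * a * ustat R n X - (\<Sum>k<n. q k X) - q n X)) * (\<integral>\<^sup>+x. ennreal (exp (- 2 * a * S x)) \<partial>M)"
        using L2_D(1)[OF S] by (intro nn_integral_cmult) measurable
      also have "\<dots> \<le> ennreal (exp (- 2 * a * ustat R n X - (\<Sum>k<n. q k X) - q n X)) * ennreal (exp (q n X))"
        by (intro mult_left_mono main) auto
      also have "\<dots> = ennreal (exp (- 2 * a * ustat R n X - (\<Sum>k<n. q k X)))"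
        by (simp add: ennreal_mult[symmetric] exp_add[symmetric])
      finally show ?thesis .
    qed
    have "(\<integral>\<^sup>+X. ennreal (exp (- 2 * a * ustat R (Suc n) X - (\<Sum>k<Suc n. q k X))) \<partial>ipow M (Suc n)) =
      (\<integral>\<^sup>+X. \<integral>\<^sup>+x. ennreal (exp (- 2 * a * ustat R (Suc n) (X(n := x)) - (\<Sum>k<Suc n. q k (X(n := x))))) \<partial>M \<partial>ipow M n)"
      by (rule nn_integral_ipow_Suc) measurable
    also have "\<dots> \<le> (\<integral>\<^sup>+X. ennreal (exp (- 2 * a * ustat R n X - (\<Sum>k<n. q k X))) \<partial>ipow M n)"
      by (intro nn_integral_mono step)
    also have "\<dots> \<le> 1" using Suc by simp
    finally show ?case .
  qed
  \<comment> \<open>\<open>N * q k\<close> is c / N times the squared norm of a walk of k steps,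
    with c = 4 l^2, as in \<open>exp_sum_norm_sq_bound\<close>; since k < N the budget there is at
    least c / N.\<close>
  have qexp: "(\<integral>\<^sup>+X. ennreal (exp (real N * q k X)) \<partial>ipow M N) \<le> ennreal 2" if k: "k < N" for k
  proof -
    define c where "c = 4 * l\<^sup>2"
    have Nq: "real N * q k X = c / N * (\<integral>y. (\<Sum>i<k. R (X i) y)\<^sup>2 \<partial>M)" for X
      using N by (simp add: q_def a_def c_def power_divide power2_eq_square)
    have [measurable]: "q k \<in> borel_measurable (ipow M k)" by (rule qm) simp
    have "(\<integral>\<^sup>+X. ennreal (exp (real N * q k X)) \<partial>ipow M N) = (\<integral>\<^sup>+X. ennreal (exp (real N * q k X)) \<partial>ipow M k)"
      using k by (intro nn_integral_ipow_restrict) (auto simp: q_def)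
    also have "\<dots> \<le> ennreal (exp (2 * c * \<kappa> * k / N))"
      unfolding Nq
    proof (rule exp_sum_norm_sq_bound[OF Rm _ kap k0])
      show "(\<integral>x. R x y \<partial>M) = 0" if "y \<in> space M" for y using cent[OF that] by (simp add: sym[of _ y])
      show "0 \<le> c" "0 \<le> c / N" by (auto simp: c_def)
      show "8 * \<kappa> * c \<le> 1" using l by (simp add: c_def mult_ac)
      have "1 \<le> 2 - real k / N" using k by simp
      then show "c / N \<le> c / N * (2 - k / N)"
        using mult_left_mono[of 1 "2 - real k / N" "c / N"] by (simp add: c_def)
    qed (use k N in auto)
    also have "\<dots> \<le> ennreal 2"
    proof (rule ennreal_leI)
      have "2 * c * \<kappa> * k / N \<le> 2 * c * \<kappa> * 1"
      proof -
        have "real k / N \<le> 1" using k by simp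
        then have "(2 * c * \<kappa>) * (real k / N) \<le> (2 * c * \<kappa>) * 1" using k0 by (intro mult_left_mono) (auto simp: c_def)
        then show ?thesis by simp
      qed
      also have "\<dots> \<le> 1 / 4" using l by (simp add: c_def mult_ac)
      finally have "exp (2 * c * \<kappa> * k / N) \<le> exp (1 / 4)" by simp
      also have "\<dots> \<le> 1 + 1 / 4 + (1 / 4)\<^sup>2" by (rule exp_le_quadratic) simp
      also have "\<dots> \<le> 2" by (simp add: power2_eq_square)
      finally show "exp (2 * c * \<kappa> * k / N) \<le> 2" .
    qed
    finally show ?thesis .
  qed
  have qall [measurable]: "(\<lambda>X. \<Sum>k<N. q k X) \<in> borel_measurable (ipow M N)" 
    by (intro borel_measurable_sum qm) auto
  have qsumexp: "(\<integral>\<^sup>+X. ennreal (exp (\<Sum>k<N. q k X)) \<partial>ipow M N) \<le> 2"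
  proof -
    have [measurable]: "q k \<in> borel_measurable (ipow M N)" if "k \<in> {..<N}" for k using that by (intro qm) auto
    have "(\<integral>\<^sup>+X. ennreal (exp (\<Sum>k<N. q k X)) \<partial>ipow M N) \<le> (\<integral>\<^sup>+X. (\<Sum>k<N. ennreal (1 / N) * ennreal (exp (N * q k X))) \<partial>ipow M N)"
    proof (rule nn_integral_mono)
      fix X
      \<comment> \<open>Jensen for the average over k reduces the exponential of the sum to the
        single terms bounded in \<open>qexp\<close>, without any independence between them.\<close>
      have "exp (\<Sum>k<N. (1 / real N) *\<^sub>R (real N * q k X)) \<le> (\<Sum>k<N. (1 / real N) * exp (real N * q k X))"
        using N by (intro convex_on_sum[OF _ _ exp_convex]) auto
      then have "exp (\<Sum>k<N. q k X) \<le> (\<Sum>k<N. (1 / real N) * exp (real N * q k X))" using N by simp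
      then have "ennreal (exp (\<Sum>k<N. q k X)) \<le> ennreal (\<Sum>k<N. (1 / real N) * exp (real N * q k X))" by (rule ennreal_leI)
      then show "ennreal (exp (\<Sum>k<N. q k X)) \<le> (\<Sum>k<N. ennreal (1 / N) * ennreal (exp (N * q k X)))"
        by (simp add: ennreal_mult[symmetric] sum_ennreal[symmetric] del: sum_ennreal)
    qed
    also have "\<dots> = (\<Sum>k<N. ennreal (1 / N) * (\<integral>\<^sup>+X. ennreal (exp (N * q k X)) \<partial>ipow M N))"
      by (subst nn_integral_sum) (auto simp: nn_integral_cmult)
    also have "\<dots> \<le> (\<Sum>k<N. ennreal (1 / N) * ennreal 2)"
      by (intro sum_mono mult_left_mono qexp) auto
    also have "\<dots> = 2" using N
      by (simp add: ennreal_mult'[symmetric] ennreal_of_nat_eq_real_of_nat del: ennreal_numeral) simp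
    finally show ?thesis .
  qed
  have "(\<integral>\<^sup>+X. ennreal (exp (- l * ustat R N X / real N)) \<partial>ipow M N) \<le>
     (\<integral>\<^sup>+X. ennreal (1 / 2) * (ennreal (exp (- 2 * a * ustat R N X - (\<Sum>k<N. q k X))) + ennreal (exp (\<Sum>k<N. q k X))) \<partial>ipow M N)"
  proof (rule nn_integral_mono)
    fix X
    define u where "u = exp ((- 2 * a * ustat R N X - (\<Sum>k<N. q k X)) / 2)"
    define v where "v = exp ((\<Sum>k<N. q k X) / 2)"
    \<comment> \<open>The compensator is inserted and removed, and u v <= (u^2 + v^2) / 2 separates
      the supermartingale from the compensator. The total is at most (1 + 2) / 2.\<close>
    have "exp (- l * ustat R N X / real N) = u * v"
      unfolding u_def v_def mult_exp_exp by (simp add: a_def field_simps)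
    also have "\<dots> \<le> (1 / 2) * (u\<^sup>2 + v\<^sup>2)"
      using zero_le_power2[of "u - v"] by (simp add: power2_eq_square algebra_simps)
    also have "u\<^sup>2 = exp (- 2 * a * ustat R N X - (\<Sum>k<N. q k X))"
      unfolding u_def exp_double[symmetric] by simp
    also have "v\<^sup>2 = exp (\<Sum>k<N. q k X)" unfolding v_def exp_double[symmetric] by simp
    finally have "ennreal (exp (- l * ustat R N X / real N)) \<le>
       ennreal ((1 / 2) * (exp (- 2 * a * ustat R N X - (\<Sum>k<N. q k X)) + exp (\<Sum>k<N. q k X)))" by (rule ennreal_leI)
    then show "ennreal (exp (- l * ustat R N X / real N)) \<le>
      ennreal (1 / 2) * (ennreal (exp (- 2 * a * ustat R N X - (\<Sum>k<N. q k X))) + ennreal (exp (\<Sum>k<N. q k X)))"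
      by (simp only: ennreal_mult ennreal_plus exp_ge_zero add_nonneg_nonneg)
  qed
  also have "\<dots> = ennreal (1 / 2) * ((\<integral>\<^sup>+X. ennreal (exp (- 2 * a * ustat R N X - (\<Sum>k<N. q k X))) \<partial>ipow M N) +
      (\<integral>\<^sup>+X. ennreal (exp (\<Sum>k<N. q k X)) \<partial>ipow M N))"
    by (subst nn_integral_cmult, measurable, subst nn_integral_add) auto
  also have "\<dots> \<le> ennreal (1 / 2) * (1 + 2)"
    by (intro mult_left_mono add_mono super qsumexp) auto
  also have "\<dots> \<le> 2"
  proof -
    have three: "(1 + 2 :: ennreal) = ennreal 3" by simp
    have "ennreal (1 / 2) * (1 + 2) = ennreal (1 / 2 * 3)"
      unfolding three by (rule ennreal_mult'[symmetric]) simp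
    also have "\<dots> = ennreal (3 / 2)" by simp
    also have "ennreal (3 / 2) \<le> ennreal 2" by (rule ennreal_leI) simp
    finally show ?thesis by simp
  qed
  finally show ?thesis .
qed

end

section \<open>Riesz kernels as mixtures of Gaussians\<close>

text \<open>Subtracting 1 for t < 1 makes the mixture converge near t = 0 also for s = 0, where the
  weight is 1 / t. The subtraction is constant in z and therefore disappears under double
  centring.\<close>

definition gd :: "real \<Rightarrow> 'a::euclidean_space \<Rightarrow> real" where
  "gd t z = exp (- (t * norm z)\<^sup>2) - indicator {..<1} t"

definition gmix :: "real \<Rightarrow> real set \<Rightarrow> 'a::euclidean_space \<Rightarrow> real" where
  "gmix s A z = (\<integral>t. indicator A t * (t powr (s - 1) * gd t z) \<partial>lborel)"

text \<open>Integrability is tracked separately because a divergent mixture, such as the one over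
  large t at z = 0 when s >= 0, would have the Bochner value 0.\<close>

definition gint :: "real \<Rightarrow> real set \<Rightarrow> 'a::euclidean_space \<Rightarrow> bool" where
  "gint s A z \<longleftrightarrow> integrable lborel (\<lambda>t. indicator A t * (t powr (s - 1) * gd t z))"

lemma measurable_gd [measurable]: "(\<lambda>(t, z). gd t z) \<in> borel_measurable (borel \<Otimes>\<^sub>M borel)"
  unfolding gd_def by measurable

lemma measurable_gmix [measurable]:
  assumes [measurable]: "A \<in> sets borel"
  shows "gmix s A \<in> borel_measurable borel"
  unfolding gmix_def by measurable

lemma abs_gd_le: "\<bar>gd t z\<bar> \<le> 1"
proof -
  have "0 < exp (- (t * norm z)\<^sup>2)" "exp (- (t * norm z)\<^sup>2) \<le> 1" by auto
  then show ?thesis unfolding gd_def by (auto simp: indicator_def abs_if)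
qed

lemma gd_low:
  assumes "t < 1" shows "gd t z \<le> 0" "- (t * norm z)\<^sup>2 \<le> gd t z"
  using assms exp_ge_add_one_self[of "- (t * norm z)\<^sup>2"] by (auto simp: gd_def)

lemma gd_high: "1 \<le> t \<Longrightarrow> gd t z = exp (- (t * norm z)\<^sup>2)"
  by (simp add: gd_def)

lemma gd_minus: "gd t (- z) = gd t z" by (simp add: gd_def)

lemma gmix_minus: "gmix s A (- z) = gmix s A z" by (simp add: gmix_def gd_minus)

text \<open>From -u <= exp (-u) - 1 <= 0 with u = (t |z|)^2. The factor t^2 compensates the weight,
  since t powr (s + 1) <= 1 below t = 1.\<close>

lemma gint_low:
  fixes z :: "'a::euclidean_space"
  assumes [measurable]: "A \<in> sets borel" and A: "A \<subseteq> {0<..<1}" and s: "0 \<le> s"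
  shows "gint s A z" "gmix s A z \<le> 0" "- (norm z)\<^sup>2 \<le> gmix s A z"
proof -
  have b: "- (indicator {0..1} t * (norm z)\<^sup>2) \<le> indicator A t * (t powr (s - 1) * gd t z)"
    "indicator A t * (t powr (s - 1) * gd t z) \<le> 0" for t
  proof -
    show "indicator A t * (t powr (s - 1) * gd t z) \<le> 0"
      using A gd_low(1)[of t z] by (auto simp: indicator_def mult_nonneg_nonpos)
    show "- (indicator {0..1} t * (norm z)\<^sup>2) \<le> indicator A t * (t powr (s - 1) * gd t z)"
    proof (cases "t \<in> A")
      case True
      then have t: "0 < t" "t < 1" using A by auto
      have "t powr (s - 1) * t\<^sup>2 = t powr (s + 1)"
        using t by (simp add: powr_numeral[symmetric] powr_add[symmetric] add.commute del: powr_numeral)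
      also have "\<dots> \<le> t powr 0" using t s by (intro powr_mono') auto
      finally have "t powr (s - 1) * t\<^sup>2 \<le> 1" using t by simp
      then have "t powr (s - 1) * t\<^sup>2 * (norm z)\<^sup>2 \<le> 1 * (norm z)\<^sup>2" by (rule mult_right_mono) simp
      moreover have "t powr (s - 1) * - (t * norm z)\<^sup>2 \<le> t powr (s - 1) * gd t z"
        using gd_low(2)[of t z] t by (intro mult_left_mono) auto
      ultimately show ?thesis using True t by (simp add: power_mult_distrib mult.assoc)
    qed (auto simp: indicator_def)
  qed
  have i: "integrable lborel (\<lambda>t::real. indicator {0..1} t * (norm z)\<^sup>2 :: real)"
    by (intro integrable_mult_left integrable_real_indicator) auto
  show gi: "gint s A z" unfolding gint_def
  proof (rule Bochner_Integration.integrable_bound[OF i])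
    show "AE t in lborel. norm (indicator A t * (t powr (s - 1) * gd t z)) \<le> norm (indicator {0..1} t * (norm z)\<^sup>2)"
    proof (rule AE_I2)
      fix t :: real
      have "\<bar>indicator A t * (t powr (s - 1) * gd t z)\<bar> = - (indicator A t * (t powr (s - 1) * gd t z))"
        using b(2)[of t] by (rule abs_of_nonpos)
      also have "\<dots> \<le> indicator {0..1} t * (norm z)\<^sup>2" using b(1)[of t] by linarith
      also have "\<dots> \<le> \<bar>indicator {0..1} t * (norm z)\<^sup>2\<bar>" by (rule abs_ge_self)
      finally show "norm (indicator A t * (t powr (s - 1) * gd t z)) \<le> norm (indicator {0..1} t * (norm z)\<^sup>2)"
        by (simp only: real_norm_def)
    qed
  qed (unfold gd_def, measurable)
  show "gmix s A z \<le> 0" unfolding gmix_def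
    using integral_mono[OF gi[unfolded gint_def] integrable_zero] b(2) by simp
  have "(\<integral>(t::real). - (indicator {0..1} t * (norm z)\<^sup>2) \<partial>lborel) \<le> gmix s A z"
    unfolding gmix_def by (rule integral_mono) (use i gi b(1) in \<open>auto simp: gint_def\<close>)
  then show "- (norm z)\<^sup>2 \<le> gmix s A z" by simp
qed

lemma nn_integral_powr_tail:
  assumes "0 < a" "e < -1"
  shows "(\<integral>\<^sup>+t. ennreal (indicator {a..} t * t powr e) \<partial>lborel) = ennreal (a powr (e + 1) / (- (e + 1)))"
proof -
  have "(\<integral>\<^sup>+t. ennreal (t powr e) * indicator {a..} t \<partial>lborel) = ennreal (0 - a powr (e + 1) / (e + 1))"
  proof (rule nn_integral_FTC_atLeast)
    show "DERIV (\<lambda>t. t powr (e + 1) / (e + 1)) x :> x powr e" if "a \<le> x" for x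
      using that assms by (auto intro!: derivative_eq_intros)
    have "((\<lambda>t. t powr (e + 1) / (e + 1)) \<longlongrightarrow> 0 / (e + 1)) at_top"
      using assms by (intro tendsto_divide tendsto_neg_powr filterlim_ident tendsto_const) auto
    then show "((\<lambda>t. t powr (e + 1) / (e + 1)) \<longlongrightarrow> 0) at_top" by simp
  qed auto
  also have "(\<integral>\<^sup>+t. ennreal (t powr e) * indicator {a..} t \<partial>lborel) = (\<integral>\<^sup>+t. ennreal (indicator {a..} t * t powr e) \<partial>lborel)"
    by (intro nn_integral_cong) (auto simp: indicator_def)
  finally show ?thesis by (simp add: minus_divide_right)
qed

text \<open>At fixed nonzero z a Gaussian beats every power of t. With 2 k >= s + 1 the k-th term of
  the exponential series alone already yields the integrable bound t^(-2), whatever s is.\<close>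

lemma gint_high:
  fixes z :: "'a::euclidean_space"
  assumes [measurable]: "A \<in> sets borel" and A: "A \<subseteq> {1..}" and z: "z \<noteq> 0"
  shows "gint s A z"
proof -
  obtain k :: nat where "(s + 1) / 2 \<le> real k" using real_arch_simple by blast
  then have k: "s + 1 \<le> 2 * real k" by simp
  define r where "r = norm z"
  have r: "0 < r" using z by (simp add: r_def)
  define C where "C = fact k / r ^ (2 * k)"
  have C: "0 \<le> C" using r by (simp add: C_def)
  have b: "\<bar>indicator A t * (t powr (s - 1) * gd t z)\<bar> \<le> C * (indicator {1..} t * t powr (- 2))" for t
  proof (cases "t \<in> A")
    case True
    then have t: "1 \<le> t" using A by auto
    have e: "0 \<le> (t * r)\<^sup>2" by simp
    have "((t * r)\<^sup>2) ^ k / fact k \<le> exp ((t * r)\<^sup>2)"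
    proof -
      have "((t * r)\<^sup>2) ^ k / fact k = (\<Sum>n\<in>{k}. inverse (fact n) *\<^sub>R ((t * r)\<^sup>2) ^ n)" by (simp add: field_simps)
      also have "\<dots> \<le> (\<Sum>n. inverse (fact n) *\<^sub>R ((t * r)\<^sup>2) ^ n)"
        by (intro sum_le_suminf summable_exp_generic) (auto intro!: mult_nonneg_nonneg)
      finally show ?thesis by (simp add: exp_def)
    qed
    then have "exp (- (t * r)\<^sup>2) \<le> fact k / ((t * r)\<^sup>2) ^ k"
      using t r by (simp add: exp_minus field_simps)
    also have "((t * r)\<^sup>2) ^ k = t ^ (2 * k) * r ^ (2 * k)" by (simp add: power_mult[symmetric] power_mult_distrib)
    finally have g: "exp (- (t * r)\<^sup>2) \<le> C / t ^ (2 * k)" by (simp add: C_def mult.commute)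
    have "t powr (s - 1) * exp (- (t * r)\<^sup>2) \<le> t powr (s - 1) * (C / t ^ (2 * k))"
      using g by (intro mult_left_mono) auto
    also have "\<dots> = C * t powr (s - 1 - 2 * real k)"
      using t by (simp add: powr_diff powr_realpow[symmetric])
    also have "\<dots> \<le> C * t powr (- 2)"
      using t k C by (intro mult_left_mono powr_mono) auto
    finally show ?thesis using True t by (simp add: gd_high r_def abs_mult)
  next
    case False
    then show ?thesis using C by (auto simp: indicator_def)
  qed
  have i: "integrable lborel (\<lambda>t. C * (indicator {1..} t * t powr (- 2)) :: real)"
  proof (rule integrable_mult_right, rule integrableI_nonneg)
    show "(\<integral>\<^sup>+t. ennreal (indicator {1..} t * t powr (- 2)) \<partial>lborel) < \<infinity>"
      by (subst nn_integral_powr_tail) auto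
  qed auto
  show ?thesis unfolding gint_def
  proof (rule Bochner_Integration.integrable_bound[OF i])
    show "AE t in lborel. norm (indicator A t * (t powr (s - 1) * gd t z)) \<le> norm (C * (indicator {1..} t * t powr (- 2)))"
      using b C by (intro AE_I2) simp
  qed (unfold gd_def, measurable)
qed

text \<open>The constant adds the values of the weight at both endpoints because the direction in
  which it is monotone depends on s.\<close>

lemma gint_middle:
  fixes z :: "'a::euclidean_space"
  assumes [measurable]: "A \<in> sets borel" and A: "A \<subseteq> {a..<b}" and a: "0 < a"
  shows "gint s A z" "\<bar>gmix s A z\<bar> \<le> (a powr (s - 1) + b powr (s - 1)) * measure lborel {a..b}"
proof -
  define C where "C = a powr (s - 1) + b powr (s - 1)"
  have bd: "\<bar>indicator A t * (t powr (s - 1) * gd t z)\<bar> \<le> C * indicator {a..b} t" for t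
  proof (cases "t \<in> A")
    case True
    then have t: "a \<le> t" "t < b" using A by auto
    have "t powr (s - 1) \<le> C"
    proof (cases "0 \<le> s - 1")
      case True
      then have "t powr (s - 1) \<le> b powr (s - 1)" using t a by (intro powr_mono2) auto
      then show ?thesis by (simp add: C_def add_increasing)
    next
      case False
      then have "t powr (s - 1) \<le> a powr (s - 1)" using t a by (intro powr_mono2') auto
      then show ?thesis by (simp add: C_def add_increasing2)
    qed
    then have "t powr (s - 1) * \<bar>gd t z\<bar> \<le> C * 1" by (intro mult_mono abs_gd_le) (auto simp: C_def)
    then show ?thesis using True t by (simp add: abs_mult)
  qed (auto simp: indicator_def C_def)
  have i: "integrable lborel (\<lambda>t. C * indicator {a..b} t :: real)" by (intro integrable_mult_right integrable_real_indicator) (auto simp: emeasure_lborel_Icc_eq)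
  show gi: "gint s A z" unfolding gint_def
  proof (rule Bochner_Integration.integrable_bound[OF i])
    show "AE t in lborel. norm (indicator A t * (t powr (s - 1) * gd t z)) \<le> norm (C * indicator {a..b} t)"
      using bd by (intro AE_I2) (simp add: C_def)
  qed (unfold gd_def, measurable)
  have "\<bar>gmix s A z\<bar> \<le> (\<integral>t. \<bar>indicator A t * (t powr (s - 1) * gd t z)\<bar> \<partial>lborel)"
    unfolding gmix_def by (rule integral_abs_bound)
  also have "\<dots> \<le> (\<integral>t. C * indicator {a..b} t \<partial>lborel)"
    using i gi bd by (intro integral_mono) (auto simp: gint_def intro: integrable_abs)
  finally show "\<bar>gmix s A z\<bar> \<le> (a powr (s - 1) + b powr (s - 1)) * measure lborel {a..b}"
    by (simp add: C_def)
qed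

lemma gmix_Un:
  assumes "gint s A z" "gint s B z" "A \<inter> B = {}"
  shows "gint s (A \<union> B) z" "gmix s (A \<union> B) z = gmix s A z + gmix s B z"
proof -
  have e: "indicator (A \<union> B) t * (t powr (s - 1) * gd t z) =
     indicator A t * (t powr (s - 1) * gd t z) + indicator B t * (t powr (s - 1) * gd t z)" for t
    using assms(3) by (auto simp: indicator_def)
  show "gint s (A \<union> B) z" "gmix s (A \<union> B) z = gmix s A z + gmix s B z"
    using assms unfolding gint_def gmix_def e by auto
qed

lemma gint_low_middle:
  assumes "0 \<le> s" "1 \<le> b"
  shows "gint s {0<..<b} z" "gmix s {0<..<b} z = gmix s {0<..<1} z + gmix s {1..<b} z"
proof -
  have e: "{0<..<b} = {0<..<1} \<union> {1..<b}" using assms by auto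
  have l: "gint s {0<..<1} z" using assms by (intro gint_low) auto
  have m: "gint s {1..<b} z" by (rule gint_middle[of _ 1 b]) auto
  show "gint s {0<..<b} z" "gmix s {0<..<b} z = gmix s {0<..<1} z + gmix s {1..<b} z"
    unfolding e by (rule gmix_Un[OF l m]; auto)+
qed

lemma gmix_total:
  assumes "0 \<le> s" "1 \<le> b" "z \<noteq> 0"
  shows "gint s {0<..} z" "gmix s {0<..} z = gmix s {0<..<b} z + gmix s {b..} z"
proof -
  have e: "{0<..} = {0<..<b} \<union> {b..}" using assms by auto
  have h: "gint s {b..} z" using assms by (intro gint_high) auto
  show "gint s {0<..} z" "gmix s {0<..} z = gmix s {0<..<b} z + gmix s {b..} z"
    unfolding e by (rule gmix_Un[OF gint_low_middle(1)[OF assms(1,2)] h]; auto)+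
qed

lemma integral_powr_interval:
  fixes a b s :: real
  assumes "0 < a" "a \<le> b" "0 \<le> s"
  defines "G \<equiv> \<lambda>u. if s = 0 then ln u else u powr s / s"
  shows "integrable lborel (\<lambda>u. indicator {a..b} u * u powr (s - 1))"
    and "(\<integral>u. indicator {a..b} u * u powr (s - 1) \<partial>lborel) = G b - G a"
proof -
  have c: "continuous_on {a..b} (\<lambda>u. u powr (s - 1))" using assms by (intro continuous_intros) auto
  show "integrable lborel (\<lambda>u. indicator {a..b} u * u powr (s - 1))"
    using borel_integrable_atLeastAtMost'[OF c] by (simp add: set_integrable_def)
  have d: "(G has_vector_derivative u powr (s - 1)) (at u within {a..b})" if "a \<le> u" "u \<le> b" for u
  proof (cases "s = 0")
    case True
    have "(ln has_real_derivative inverse u) (at u within {a..b})"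
      using that assms by (intro has_field_derivative_at_within[OF DERIV_ln]) auto
    then show ?thesis using True that assms
      by (simp add: G_def has_real_derivative_iff_has_vector_derivative[symmetric] powr_minus)
  next
    case False
    have "((\<lambda>u. u powr s / s) has_real_derivative (u powr (s - 1))) (at u within {a..b})"
      using that assms False by (auto intro!: derivative_eq_intros)
    then show ?thesis using False by (simp add: G_def has_real_derivative_iff_has_vector_derivative[symmetric])
  qed
  show "(\<integral>u. indicator {a..b} u * u powr (s - 1) \<partial>lborel) = G b - G a"
    using integral_FTC_atLeastAtMost[OF assms(2) d c] by simp
qed

text \<open>After the substitution the subtracted indicator is cut at |z| instead of 1. The interval
  between the two cuts contributes an increment of \<open>G\<close>, a primitive of u powr (s - 1).
  The unit vector \<open>e\<close> only fixes the reference value.\<close>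

lemma gmix_scaling:
  fixes z e :: "'a::euclidean_space"
  assumes s: "0 \<le> s" and z: "z \<noteq> 0" and e: "norm e = 1"
  defines "G \<equiv> \<lambda>u. if s = 0 then ln u else u powr s / s"
  shows "gmix s {0<..} z = norm z powr (- s) * (gmix s {0<..} e + G 1 - G (norm z))"
proof -
  define r where "r = norm z"
  have r: "0 < r" using z by (simp add: r_def)
  define f where "f c u = indicator {0<..} u * (u powr (s - 1) * (exp (- u\<^sup>2) - indicator {..<c} u))" for c u :: real
  have "gmix s {0<..} z = \<bar>1 / r\<bar> *\<^sub>R (\<integral>u. indicator {0<..} (0 + 1 / r * u) * ((0 + 1 / r * u) powr (s - 1) * gd (0 + 1 / r * u) z) \<partial>lborel)"
    unfolding gmix_def using r by (intro lborel_integral_real_affine) auto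
  also have "\<dots> = (1 / r) * (\<integral>u. r powr (1 - s) * f r u \<partial>lborel)"
  proof -
    have "indicator {0<..} (0 + 1 / r * u) * ((0 + 1 / r * u) powr (s - 1) * gd (0 + 1 / r * u) z) = r powr (1 - s) * f r u" for u
    proof (cases "0 < u")
      case True
      have "(u / r) powr (s - 1) = r powr (1 - s) * u powr (s - 1)"
        using True r by (simp add: powr_divide powr_minus_divide powr_diff field_simps)
      moreover have "gd (u / r) z = exp (- u\<^sup>2) - indicator {..<r} u"
        using r by (auto simp: gd_def r_def[symmetric] indicator_def)
      ultimately show ?thesis using True r by (simp add: f_def)
    next
      case False
      then show ?thesis using r by (auto simp: f_def indicator_def zero_less_divide_iff)
    qed
    then show ?thesis using r by simp
  qed
  also have "\<dots> = r powr (- s) * (\<integral>u. f r u \<partial>lborel)"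
    using r by (simp add: powr_diff powr_minus field_simps)
  finally have sc: "gmix s {0<..} z = r powr (- s) * (\<integral>u. f r u \<partial>lborel)" .
  have f1: "f 1 u = indicator {0<..} u * (u powr (s - 1) * gd u e)" for u using e by (simp add: f_def gd_def)
  have e0: "e \<noteq> 0" using e by auto
  have i1: "integrable lborel (f 1)" using gmix_total(1)[OF s _ e0, of 1] unfolding gint_def f1 by simp
  have I1: "(\<integral>u. f 1 u \<partial>lborel) = gmix s {0<..} e" unfolding gmix_def f1 ..
  have "(\<integral>u. f r u \<partial>lborel) = (\<integral>u. f 1 u \<partial>lborel) + (G 1 - G r)"
  proof (cases "r \<le> 1")
    case True
    have "(\<integral>u. f r u \<partial>lborel) = (\<integral>u. f 1 u + indicator {r..1} u * u powr (s - 1) \<partial>lborel)"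
    proof (rule integral_cong_AE)
      have "AE u in lborel. u \<noteq> (1::real)" by (rule AE_lborel_singleton)
      then show "AE u in lborel. f r u = f 1 u + indicator {r..1} u * u powr (s - 1)"
        by eventually_elim (use True r in \<open>auto simp: f_def indicator_def algebra_simps\<close>)
    qed (auto simp: f_def)
    then show ?thesis
      using integral_powr_interval[OF r True s] i1 unfolding G_def by simp
  next
    case False
    then have r1: "1 \<le> r" by simp
    have "(\<integral>u. f r u \<partial>lborel) = (\<integral>u. f 1 u - indicator {1..r} u * u powr (s - 1) \<partial>lborel)"
    proof (rule integral_cong_AE)
      have "AE u in lborel. u \<noteq> r" by (rule AE_lborel_singleton)
      then show "AE u in lborel. f r u = f 1 u - indicator {1..r} u * u powr (s - 1)"
        by eventually_elim (use False r in \<open>auto simp: f_def indicator_def algebra_simps\<close>)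
    qed (auto simp: f_def)
    then show ?thesis
      using integral_powr_interval[OF zero_less_one r1 s] i1 unfolding G_def by simp
  qed
  then show ?thesis unfolding sc I1 r_def by simp
qed

text \<open>Substituting \<open>u = t |z|\<close> reduces the mixture to \<open>|z| = 1\<close>; the cut-off moved by the substitution
  produces \<open>ln |z|\<close>, respectively a multiple of \<open>1 - |z| powr s\<close>.\<close>

lemma gker_eq_gmix:
  assumes s: "0 \<le> s"
  shows "\<exists>c>0. \<exists>\<kappa>. \<forall>z::'a::euclidean_space. z \<noteq> 0 \<longrightarrow> gker s z = \<kappa> + c * gmix s {0<..} z"
proof -
  obtain e :: 'a where eB: "e \<in> Basis" by (metis nonempty_Basis ex_in_conv)
  have e: "norm e = 1" using eB by simp
  define \<Phi> where "\<Phi> = gmix s {0<..} e"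
  show ?thesis
  proof (cases "s = 0")
    case True
    have "gker s z = - \<Phi> + 1 * gmix s {0<..} z" if "z \<noteq> 0" for z :: 'a
      using gmix_scaling[OF s that e] that True by (simp add: gker_def \<Phi>_def)
    then show ?thesis by (intro exI[of _ 1] conjI exI[of _ "- \<Phi>"]) auto
  next
    case False
    then have s0: "0 < s" using s by simp
    have rep: "gmix s {0<..} z = norm z powr (- s) * (\<Phi> + 1 / s) - 1 / s" if z: "z \<noteq> 0" for z :: 'a
    proof -
      have "gmix s {0<..} z = norm z powr (- s) * (\<Phi> + 1 / s - norm z powr s / s)"
        using gmix_scaling[OF s z e] False by (simp add: \<Phi>_def)
      also have "\<dots> = norm z powr (- s) * (\<Phi> + 1 / s) - (norm z powr (- s) * norm z powr s) / s"
        by (simp add: algebra_simps)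
      also have "norm z powr (- s) * norm z powr s = 1" using z by (simp add: powr_add[symmetric])
      finally show ?thesis .
    qed
    \<comment> \<open>If the coefficient were not positive, the mixture would be at most -1 / s at
      every nonzero z. But the large t part is nonnegative and the small t part is at least -|z|^2,
      which contradicts this for small z.\<close>
    have pos: "0 < \<Phi> + 1 / s"
    proof (rule ccontr)
      assume neg: "\<not> 0 < \<Phi> + 1 / s"
      obtain \<delta> :: real where d: "0 < \<delta>" "\<delta>\<^sup>2 < 1 / s"
      proof
        show "0 < sqrt (1 / (2 * s))" using s0 by simp
        show "(sqrt (1 / (2 * s)))\<^sup>2 < 1 / s" using s0 by (simp add: field_simps)
      qed
      define z where "z = \<delta> *\<^sub>R e"
      have z: "z \<noteq> 0" "norm z = \<delta>" using d e by (auto simp: z_def)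
      have "gmix s {0<..} z \<le> - 1 / s"
        using rep[OF z(1)] neg by (simp add: mult_nonneg_nonpos)
      moreover have "gmix s {0<..} z = gmix s {0<..<1} z + gmix s {1..} z"
        using gmix_total(2)[OF s _ z(1), of 1] by simp
      moreover have "- \<delta>\<^sup>2 \<le> gmix s {0<..<1} z" using gint_low(3)[of "{0<..<1}" s z] s z by simp
      moreover have "0 \<le> gmix s {1..} z"
        unfolding gmix_def by (intro integral_nonneg_AE AE_I2) (auto simp: indicator_def gd_def)
      ultimately show False using d by simp
    qed
    define c where "c = 1 / (s * (\<Phi> + 1 / s))"
    have "gker s z = c / s + c * gmix s {0<..} z" if z: "z \<noteq> 0" for z :: 'a
    proof -
      have "c * (\<Phi> + 1 / s) = 1 / s" unfolding c_def using pos s0 by simp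
      moreover have "c / s + c * gmix s {0<..} z = c * (\<Phi> + 1 / s) * norm z powr (- s)"
        unfolding rep[OF z] by (simp add: algebra_simps)
      ultimately show ?thesis using False by (simp add: gker_def)
    qed
    moreover have "0 < c" using pos s0 by (simp add: c_def)
    ultimately show ?thesis by blast
  qed
qed

section \<open>Lebesgue norms of the large t tail\<close>

lemma nn_integral_gaussian:
  assumes w: "0 < w"
  shows "(\<integral>\<^sup>+(z::'a::euclidean_space). ennreal (exp (- (w * (norm z)\<^sup>2))) \<partial>lborel) = ennreal (sqrt (pi / w) ^ DIM('a))"
proof -
  have one: "(\<integral>\<^sup>+(x::real). ennreal (exp (- (w * x\<^sup>2))) \<partial>lborel) = ennreal (sqrt (pi / w))"
  proof -
    define \<sigma> where "\<sigma> = 1 / sqrt (2 * w)"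
    have sg: "0 < \<sigma>" "\<sigma>\<^sup>2 = 1 / (2 * w)" using w by (auto simp: \<sigma>_def power_divide)
    have nd: "exp (- (w * x\<^sup>2)) = sqrt (pi / w) * normal_density 0 \<sigma> x" for x
      unfolding normal_density_def sg using w by (simp add: real_sqrt_divide field_simps)
    interpret N: prob_space "density lborel (normal_density 0 \<sigma>)" by (rule prob_space_normal_density[OF sg(1)])
    have "(\<integral>\<^sup>+x. ennreal (normal_density 0 \<sigma> x) \<partial>lborel) = 1"
      using N.emeasure_space_1 by (simp add: emeasure_density)
    then show ?thesis unfolding nd using w by (simp add: ennreal_mult nn_integral_cmult)
  qed
  have "(\<integral>\<^sup>+(z::'a). ennreal (exp (- (w * (norm z)\<^sup>2))) \<partial>lborel) =
     (\<integral>\<^sup>+(z::'a). (\<Prod>b\<in>Basis. ennreal (exp (- (w * (z \<bullet> b)\<^sup>2)))) \<partial>lborel)"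
  proof (rule nn_integral_cong)
    fix z :: 'a
    have "(norm z)\<^sup>2 = (\<Sum>b\<in>Basis. (z \<bullet> b)\<^sup>2)"
      unfolding power2_norm_eq_inner by (subst euclidean_inner) (simp add: power2_eq_square)
    then show "ennreal (exp (- (w * (norm z)\<^sup>2))) = (\<Prod>b\<in>Basis. ennreal (exp (- (w * (z \<bullet> b)\<^sup>2))))"
      by (simp add: prod_ennreal sum_distrib_left exp_sum[symmetric] sum_negf[symmetric])
  qed
  also have "\<dots> = (\<Prod>b\<in>(Basis::'a set). (\<integral>\<^sup>+x. ennreal (exp (- (w * x\<^sup>2))) \<partial>lborel))"
    by (rule nn_integral_lborel_prod) auto
  also have "\<dots> = ennreal (sqrt (pi / w) ^ DIM('a))"
    unfolding one using w by (simp add: ennreal_power)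
  finally show ?thesis .
qed

text \<open>The mixture over t >= b with values in \<open>ennreal\<close>: for s >= 0 it is infinite
  at the origin, where the Bochner integral would give 0, and Tonelli applies to it freely.\<close>

definition gtail :: "real \<Rightarrow> real \<Rightarrow> 'a::euclidean_space \<Rightarrow> ennreal" where
  "gtail s b z = (\<integral>\<^sup>+t. ennreal (indicator {b..} t * (t powr (s - 1) * exp (- (t * norm z)\<^sup>2))) \<partial>lborel)"

lemma measurable_gtail [measurable]: "gtail s b \<in> borel_measurable borel"
  unfolding gtail_def by measurable

lemma gmix_le_gtail:
  assumes "1 \<le> b"
  shows "0 \<le> gmix s {b..} z" "ennreal (gmix s {b..} z) \<le> gtail s b z"
proof -
  have e: "indicator {b..} t * (t powr (s - 1) * gd t z) = indicator {b..} t * (t powr (s - 1) * exp (- (t * norm z)\<^sup>2))" for t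
    using assms by (auto simp: indicator_def gd_def)
  show "0 \<le> gmix s {b..} z" unfolding gmix_def e by (intro integral_nonneg_AE AE_I2) auto
  show "ennreal (gmix s {b..} z) \<le> gtail s b z"
  proof (cases "integrable lborel (\<lambda>t. indicator {b..} t * (t powr (s - 1) * exp (- (t * norm z)\<^sup>2)))")
    case True
    then show ?thesis unfolding gmix_def e gtail_def by (subst nn_integral_eq_integral) auto
  next
    case False
    then show ?thesis unfolding gmix_def e by (simp add: not_integrable_integral_eq)
  qed
qed

text \<open>With d = \<open>DIM('a)\<close>, Tonelli and the Gaussian integral produce the factor
  t^(-d); the remaining exponent s - 1 - d is integrable at infinity because s < d.\<close>

lemma nn_integral_gtail:
  fixes s b :: real
  assumes s: "s < real DIM('a)" and b: "0 < b"
  shows "(\<integral>\<^sup>+(z::'a::euclidean_space). gtail s b z \<partial>lborel) =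
    ennreal (sqrt pi ^ DIM('a)) * ennreal (b powr (s - DIM('a)) / (DIM('a) - s))"
proof -
  let ?d = "real DIM('a)"
  have "(\<integral>\<^sup>+(z::'a). gtail s b z \<partial>lborel) = 
     (\<integral>\<^sup>+t. \<integral>\<^sup>+(z::'a). ennreal (indicator {b..} t * (t powr (s - 1) * exp (- (t * norm z)\<^sup>2))) \<partial>lborel \<partial>lborel)"
    unfolding gtail_def by (rule pair_sigma_finite.Fubini') (auto simp: pair_sigma_finite_def sigma_finite_lborel)
  also have "\<dots> = (\<integral>\<^sup>+t. ennreal (sqrt pi ^ DIM('a)) * ennreal (indicator {b..} t * t powr (s - 1 - ?d)) \<partial>lborel)"
  proof (rule nn_integral_cong)
    fix t :: real
    show "(\<integral>\<^sup>+(z::'a). ennreal (indicator {b..} t * (t powr (s - 1) * exp (- (t * norm z)\<^sup>2))) \<partial>lborel) =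
       ennreal (sqrt pi ^ DIM('a)) * ennreal (indicator {b..} t * t powr (s - 1 - ?d))"
    proof (cases "b \<le> t")
      case True
      then have t: "0 < t" using b by simp
      have "(\<integral>\<^sup>+(z::'a). ennreal (indicator {b..} t * (t powr (s - 1) * exp (- (t * norm z)\<^sup>2))) \<partial>lborel) =
         ennreal (t powr (s - 1)) * (\<integral>\<^sup>+(z::'a). ennreal (exp (- (t\<^sup>2 * (norm z)\<^sup>2))) \<partial>lborel)"
        using True by (subst nn_integral_cmult[symmetric]) (auto simp: ennreal_mult power_mult_distrib)
      also have "\<dots> = ennreal (t powr (s - 1) * (sqrt (pi / t\<^sup>2)) ^ DIM('a))"
        using t by (subst nn_integral_gaussian) (auto simp: ennreal_mult)
      also have "t powr (s - 1) * (sqrt (pi / t\<^sup>2)) ^ DIM('a) = sqrt pi ^ DIM('a) * t powr (s - 1 - ?d)"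
        using t by (simp add: real_sqrt_divide power_divide powr_diff powr_realpow)
      finally show ?thesis using True by (simp add: ennreal_mult)
    qed (auto simp: indicator_def)
  qed
  also have "\<dots> = ennreal (sqrt pi ^ DIM('a)) * ennreal (b powr (s - 1 - ?d + 1) / (- (s - 1 - ?d + 1)))"
    using b s by (subst nn_integral_cmult) (auto simp: nn_integral_powr_tail simp del: ennreal_mult)
  finally show ?thesis by (simp add: algebra_simps)
qed

text \<open>Squaring gives a double integral in t and u. Two Gaussians multiply to one with
  parameter t^2 + u^2 >= t u, and the resulting bound (t u)^(-d / 2) factorises, d being
  \<open>DIM('a)\<close>. Each factor is the integral of t powr (s - 1 - d / 2) over t >= b: this is
  where s < d / 2 enters and makes the tail small for large b.\<close>

lemma nn_integral_gtail_sq: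
  fixes s b :: real
  assumes s: "s < real DIM('a) / 2" and b: "0 < b"
  shows "(\<integral>\<^sup>+(z::'a::euclidean_space). (gtail s b z)\<^sup>2 \<partial>lborel) \<le>
    ennreal (sqrt pi ^ DIM('a)) * (ennreal (b powr (s - DIM('a) / 2) / (DIM('a) / 2 - s)))\<^sup>2"
proof -
  let ?d = "real DIM('a)"
  have L: "pair_sigma_finite (lborel :: real measure) (lborel :: 'a measure)"
    by (intro pair_sigma_finite.intro lborel.sigma_finite_measure_axioms)
  let ?h = "\<lambda>t z. ennreal (indicator {b..} t * (t powr (s - 1) * exp (- (t * norm z)\<^sup>2)))"
  let ?w = "\<lambda>t. ennreal (indicator {b..} t * t powr (s - 1 - ?d / 2))"
  have pt: "(\<integral>\<^sup>+(z::'a). ?h t z * ?h u z \<partial>lborel) \<le> ennreal (sqrt pi ^ DIM('a)) * (?w t * ?w u)" for t u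
  proof (cases "b \<le> t \<and> b \<le> u")
    case True
    then have t: "0 < t" and u: "0 < u" using b by auto
    have "(\<integral>\<^sup>+(z::'a). ?h t z * ?h u z \<partial>lborel) =
       (\<integral>\<^sup>+(z::'a). ennreal (t powr (s - 1) * u powr (s - 1)) * ennreal (exp (- ((t\<^sup>2 + u\<^sup>2) * (norm z)\<^sup>2))) \<partial>lborel)"
      using True by (intro nn_integral_cong)
        (simp add: ennreal_mult[symmetric] power_mult_distrib exp_add[symmetric] algebra_simps mult_exp_exp)
    also have "\<dots> = ennreal (t powr (s - 1) * u powr (s - 1)) * ennreal (sqrt (pi / (t\<^sup>2 + u\<^sup>2)) ^ DIM('a))"
      using t u by (subst nn_integral_cmult) (auto simp: nn_integral_gaussian add_pos_pos)
    also have "\<dots> \<le> ennreal (t powr (s - 1) * u powr (s - 1)) * ennreal (sqrt (pi / (t * u)) ^ DIM('a))"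
    proof (intro mult_left_mono ennreal_leI power_mono real_sqrt_le_mono divide_left_mono)
      have "2 * (t * u) \<le> t\<^sup>2 + u\<^sup>2" using zero_le_power2[of "t - u"] by (simp add: power2_eq_square algebra_simps)
      moreover have "0 < t * u" using t u by simp
      ultimately show "t * u \<le> t\<^sup>2 + u\<^sup>2" by linarith
    qed (use t u in \<open>auto intro!: mult_pos_pos add_pos_pos\<close>)
    also have "sqrt (pi / (t * u)) ^ DIM('a) = sqrt pi ^ DIM('a) * (t powr (- (?d / 2)) * u powr (- (?d / 2)))"
    proof -
      have h: "sqrt x ^ DIM('a) = x powr (?d / 2)" if "0 < x" for x
      proof -
        have "sqrt x ^ DIM('a) = (x powr (1 / 2)) ^ DIM('a)" using that by (simp add: powr_half_sqrt)
        also have "\<dots> = (x powr (1 / 2)) powr real DIM('a)" using that by (subst powr_realpow) auto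
        finally show ?thesis by (simp add: powr_powr)
      qed
      have "sqrt (pi / (t * u)) ^ DIM('a) = sqrt pi ^ DIM('a) / (sqrt t ^ DIM('a) * sqrt u ^ DIM('a))"
        unfolding real_sqrt_divide real_sqrt_mult power_divide power_mult_distrib ..
      also have "\<dots> = sqrt pi ^ DIM('a) / (t powr (?d / 2) * u powr (?d / 2))"
        unfolding h[OF t] h[OF u] ..
      also have "\<dots> = sqrt pi ^ DIM('a) * (t powr (- (?d / 2)) * u powr (- (?d / 2)))"
        unfolding powr_minus divide_inverse inverse_mult_distrib ..
      finally show ?thesis .
    qed
    also have "ennreal (t powr (s - 1) * u powr (s - 1)) * ennreal (sqrt pi ^ DIM('a) * (t powr (- (?d / 2)) * u powr (- (?d / 2)))) =
        ennreal (sqrt pi ^ DIM('a)) * (?w t * ?w u)"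
    proof -
      have "t powr (s - 1) * u powr (s - 1) * (sqrt pi ^ DIM('a) * (t powr (- (?d / 2)) * u powr (- (?d / 2)))) =
         sqrt pi ^ DIM('a) * ((t powr (s - 1) * t powr (- (?d / 2))) * (u powr (s - 1) * u powr (- (?d / 2))))" by simp
      also have "\<dots> = sqrt pi ^ DIM('a) * (t powr (s - 1 - ?d / 2) * u powr (s - 1 - ?d / 2))"
        by (simp add: powr_add[symmetric])
      finally show ?thesis using True by (simp add: ennreal_mult[symmetric])
    qed
    finally show ?thesis .
  qed (auto simp: indicator_def)
  have sq: "(\<integral>\<^sup>+t. f t \<partial>lborel)\<^sup>2 = (\<integral>\<^sup>+t. \<integral>\<^sup>+u. f t * f u \<partial>lborel \<partial>lborel)"
    if [measurable]: "f \<in> borel_measurable borel" for f :: "real \<Rightarrow> ennreal"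
    by (simp add: nn_integral_cmult nn_integral_multc power2_eq_square)
  have "(\<integral>\<^sup>+(z::'a). (gtail s b z)\<^sup>2 \<partial>lborel) = (\<integral>\<^sup>+(z::'a). \<integral>\<^sup>+t. \<integral>\<^sup>+u. ?h t z * ?h u z \<partial>lborel \<partial>lborel \<partial>lborel)"
    unfolding gtail_def by (intro nn_integral_cong sq) measurable
  also have "\<dots> = (\<integral>\<^sup>+t. \<integral>\<^sup>+(z::'a). \<integral>\<^sup>+u. ?h t z * ?h u z \<partial>lborel \<partial>lborel \<partial>lborel)"
    by (rule pair_sigma_finite.Fubini'[OF L]) measurable
  also have "\<dots> = (\<integral>\<^sup>+t. \<integral>\<^sup>+u. \<integral>\<^sup>+(z::'a). ?h t z * ?h u z \<partial>lborel \<partial>lborel \<partial>lborel)"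
    by (intro nn_integral_cong pair_sigma_finite.Fubini'[OF L]) measurable
  also have "\<dots> \<le> (\<integral>\<^sup>+t. \<integral>\<^sup>+u. ennreal (sqrt pi ^ DIM('a)) * (?w t * ?w u) \<partial>lborel \<partial>lborel)"
    by (intro nn_integral_mono pt)
  also have "\<dots> = ennreal (sqrt pi ^ DIM('a)) * (\<integral>\<^sup>+t. ?w t \<partial>lborel)\<^sup>2"
    by (simp add: nn_integral_cmult nn_integral_multc power2_eq_square mult.assoc)
  also have "(\<integral>\<^sup>+t. ?w t \<partial>lborel) = ennreal (b powr (s - ?d / 2) / (?d / 2 - s))"
    using b s by (subst nn_integral_powr_tail) (auto simp: algebra_simps)
  finally show ?thesis .
qed

section \<open>Approximation by finite sums of squares\<close>

context prob_space
begin

text \<open>The second marginal is taken as \<open>u y z\<close>, so the formula is the double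
  centring of a symmetric kernel. In this form it matches the shape of \<open>gtilde\<close>
  literally.\<close>

definition cen :: "('a \<Rightarrow> 'a \<Rightarrow> real) \<Rightarrow> 'a \<Rightarrow> 'a \<Rightarrow> real" where
  "cen u x y = u x y - (\<integral>z. u x z \<partial>M) - (\<integral>z. u y z \<partial>M) + (\<integral>(x, y). u x y \<partial>(M \<Otimes>\<^sub>M M))"

lemma cen_sym: "(\<And>x y. u x y = u y x) \<Longrightarrow> cen u x y = cen u y x"
  by (simp add: cen_def)

lemma measurable_cen [measurable]:
  assumes [measurable]: "case_prod u \<in> borel_measurable (M \<Otimes>\<^sub>M M)"
  shows "case_prod (cen u) \<in> borel_measurable (M \<Otimes>\<^sub>M M)"
  unfolding cen_def by measurable

lemma cen_add:
  assumes "integrable M (u x)" "integrable M (u y)" "integrable M (v x)" "integrable M (v y)"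
    and "integrable (M \<Otimes>\<^sub>M M) (case_prod u)" "integrable (M \<Otimes>\<^sub>M M) (case_prod v)"
  shows "cen (\<lambda>x y. u x y + v x y) x y = cen u x y + cen v x y"
proof -
  have "(\<integral>(x, y). u x y + v x y \<partial>(M \<Otimes>\<^sub>M M)) = (\<integral>z. case_prod u z + case_prod v z \<partial>(M \<Otimes>\<^sub>M M))"
    by (intro Bochner_Integration.integral_cong) auto
  then show ?thesis using assms by (simp add: cen_def)
qed

lemma cen_add_const:
  assumes "integrable M (u x)" "integrable M (u y)" "integrable (M \<Otimes>\<^sub>M M) (case_prod u)"
  shows "cen (\<lambda>x y. u x y + k) x y = cen u x y"
proof -
  interpret PP: pair_prob_space M M ..
  have "cen (\<lambda>x y. u x y + k) x y = cen u x y + cen (\<lambda>x y. k) x y"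
    using assms by (intro cen_add) (auto simp: split_beta')
  then show ?thesis by (simp add: cen_def prob_space PP.prob_space split_beta')
qed

lemma integral_cen:
  assumes u: "integrable (M \<Otimes>\<^sub>M M) (case_prod u)" and ux: "integrable M (u x)"
  shows "(\<integral>y. cen u x y \<partial>M) = 0"
proof -
  interpret PP: pair_prob_space M M ..
  have i: "integrable M (\<lambda>y. \<integral>z. u y z \<partial>M)" using PP.integrable_fst[OF u] by simp
  have "(\<integral>y. (\<integral>z. u y z \<partial>M) \<partial>M) = (\<integral>(x, y). u x y \<partial>(M \<Otimes>\<^sub>M M))"
    using PP.integral_fst[OF u] by simp
  then show ?thesis unfolding cen_def using ux i by (simp add: prob_space)
qed

lemma sqn_const: "sqn M (\<lambda>x. c) = ennreal (c\<^sup>2)"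
  by (simp add: sqn_def emeasure_space_1)

lemma integral_sq_le_sqn:
  assumes [measurable]: "f \<in> borel_measurable M"
  shows "ennreal ((\<integral>x. f x \<partial>M)\<^sup>2) \<le> sqn M f"
  using L2_inner_sq_le_sqn[of f M "\<lambda>x. 1"] by (simp add: sqn_const)

text \<open>By Jensen each marginal and the mean have at most the norm of \<open>u\<close>. The
  inequality for two terms, applied twice to the four terms, gives 4 * 4.\<close>

lemma sqn_cen_le:
  assumes [measurable]: "case_prod u \<in> borel_measurable (M \<Otimes>\<^sub>M M)"
  shows "sqn (M \<Otimes>\<^sub>M M) (case_prod (cen u)) \<le> 16 * sqn (M \<Otimes>\<^sub>M M) (case_prod u)"
proof -
  interpret PP: pair_prob_space M M ..
  let ?P = "M \<Otimes>\<^sub>M M"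
  let ?Q = "sqn ?P (case_prod u)"
  let ?a = "\<lambda>z. case_prod u z" and ?b = "\<lambda>z. (\<integral>w. u (fst z) w \<partial>M)" and ?c = "\<lambda>z. (\<integral>w. u (snd z) w \<partial>M)"
    and ?d = "\<lambda>z::'a \<times> 'a. (\<integral>(x, y). u x y \<partial>?P)"
  have b: "(\<integral>\<^sup>+x. ennreal ((\<integral>w. u x w \<partial>M)\<^sup>2) \<partial>M) \<le> ?Q"
  proof -
    have "(\<integral>\<^sup>+x. ennreal ((\<integral>w. u x w \<partial>M)\<^sup>2) \<partial>M) \<le> (\<integral>\<^sup>+x. sqn M (u x) \<partial>M)"
      by (intro nn_integral_mono integral_sq_le_sqn) auto
    also have "\<dots> = ?Q" unfolding sqn_def by (subst nn_integral_fst[symmetric]) (auto simp: split_beta)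
    finally show ?thesis .
  qed
  have sb: "sqn ?P ?b \<le> ?Q"
  proof -
    have "sqn ?P ?b = (\<integral>\<^sup>+x. \<integral>\<^sup>+y. ennreal ((\<integral>w. u x w \<partial>M)\<^sup>2) \<partial>M \<partial>M)"
      unfolding sqn_def by (subst nn_integral_fst[symmetric]) auto
    then show ?thesis using b by (simp add: emeasure_space_1)
  qed
  have sc: "sqn ?P ?c \<le> ?Q"
  proof -
    have "sqn ?P ?c = (\<integral>\<^sup>+x. \<integral>\<^sup>+y. ennreal ((\<integral>w. u y w \<partial>M)\<^sup>2) \<partial>M \<partial>M)"
      unfolding sqn_def by (subst nn_integral_fst[symmetric]) auto
    then show ?thesis using b by (simp add: emeasure_space_1)
  qed
  have sd: "sqn ?P ?d \<le> ?Q"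
    using PP.integral_sq_le_sqn[of "case_prod u"] by (simp add: PP.sqn_const)
  have "sqn ?P (case_prod (cen u)) = sqn ?P (\<lambda>z. (?a z - ?b z) - (?c z - ?d z))"
    unfolding cen_def by (intro arg_cong2[where f=sqn] refl ext) (auto simp: split_beta)
  also have "\<dots> \<le> 2 * sqn ?P (\<lambda>z. ?a z - ?b z) + 2 * sqn ?P (\<lambda>z. ?c z - ?d z)"
    by (rule sqn_diff_le) measurable
  also have "\<dots> \<le> 2 * (2 * sqn ?P ?a + 2 * sqn ?P ?b) + 2 * (2 * sqn ?P ?c + 2 * sqn ?P ?d)"
    by (intro add_mono mult_left_mono sqn_diff_le) auto
  also have "\<dots> \<le> 2 * (2 * ?Q + 2 * ?Q) + 2 * (2 * ?Q + 2 * ?Q)"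
    by (intro add_mono mult_left_mono sb sc sd) auto
  also have "\<dots> = 16 * ?Q"
  proof -
    have "x + x = 2 * x" for x :: ennreal by (simp add: mult_2)
    then show ?thesis by (simp add: mult.assoc[symmetric])
  qed
  finally show ?thesis .
qed

end

lemma exists_le_zero_of_integral_zero:
  fixes f :: "'b \<Rightarrow> real"
  assumes "integrable P f" "(\<integral>x. f x \<partial>P) = 0" "emeasure P (space P) \<noteq> 0"
  shows "\<exists>x\<in>space P. f x \<le> 0"
proof (rule ccontr)
  assume "\<not> ?thesis"
  then have pos: "\<And>x. x \<in> space P \<Longrightarrow> 0 < f x" by force
  have nn: "AE x in P. 0 \<le> f x" using pos by (intro AE_I2 less_imp_le) auto
  have "AE x in P. f x = 0"
    using integral_nonneg_eq_0_iff_AE[OF assms(1) nn] assms(2) by simp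
  with AE_space have "AE x in P. False"
  proof eventually_elim
    case (elim x)
    then show ?case using pos[of x] by simp
  qed
  then show False using assms(3) AE_iff_null[of P "\<lambda>x. False"] by (simp add: null_sets_def)
qed

text \<open>A derandomised Monte Carlo argument: the cross term with the current error averages to zero,
  so some sample \<open>w\<close> makes it nonpositive.\<close>

lemma greedy_average:
  fixes a :: "'w \<Rightarrow> 'z \<Rightarrow> real"
  assumes L: "finite_measure \<Lambda>" and Z: "prob_space Z"
    and am: "(\<lambda>(w, z). a w z) \<in> borel_measurable (\<Lambda> \<Otimes>\<^sub>M Z)" and ab: "\<And>w z. \<bar>a w z\<bar> \<le> B"
    and pos: "emeasure \<Lambda> (space \<Lambda>) \<noteq> 0"
  defines "T \<equiv> measure \<Lambda> (space \<Lambda>)" and "A \<equiv> \<lambda>z. \<integral>w. a w z \<partial>\<Lambda>"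
  shows "\<exists>w. (\<forall>k<m. w k \<in> space \<Lambda>) \<and> (\<integral>z. ((\<Sum>k<m. T * a (w k) z) - real m * A z)\<^sup>2 \<partial>Z) \<le> real m * (2 * T * B)\<^sup>2"
proof (induction m)
  case 0
  then show ?case by simp
next
  case (Suc m)
  interpret Z: prob_space Z by (rule Z)
  interpret L: finite_measure \<Lambda> by (rule L)
  interpret LZ: pair_sigma_finite \<Lambda> Z ..
  note [measurable] = am
  have T0: "0 \<le> T" by (simp add: T_def)
  have B0: "0 \<le> B" using ab[of undefined undefined] by linarith
  have Am [measurable]: "A \<in> borel_measurable Z" unfolding A_def by measurable
  have Ab: "\<bar>A z\<bar> \<le> T * B" for z
  proof -
    have "\<bar>A z\<bar> \<le> (\<integral>w. \<bar>a w z\<bar> \<partial>\<Lambda>)" unfolding A_def by (rule integral_abs_bound)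
    also have "\<dots> \<le> (\<integral>w. B \<partial>\<Lambda>)"
      by (rule integral_mono') (use ab B0 in auto)
    finally show ?thesis by (simp add: T_def)
  qed
  obtain w where w: "\<forall>k<m. w k \<in> space \<Lambda>" and IH: "(\<integral>z. ((\<Sum>k<m. T * a (w k) z) - real m * A z)\<^sup>2 \<partial>Z) \<le> real m * (2 * T * B)\<^sup>2"
    using Suc.IH by blast
  define S where "S z = (\<Sum>k<m. T * a (w k) z) - real m * A z" for z
  define D where "D v z = T * a v z - A z" for v z
  have wm: "a (w k) \<in> borel_measurable Z" if "k < m" for k
  proof -
    have "w k \<in> space \<Lambda>" using w that by blast
    then show ?thesis by measurable
  qed
  have Sm [measurable]: "S \<in> borel_measurable Z"
    unfolding S_def using wm by (intro borel_measurable_diff borel_measurable_sum borel_measurable_times) auto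
  have Db: "\<bar>D v z\<bar> \<le> 2 * T * B" for v z
  proof -
    have "\<bar>T * a v z\<bar> \<le> T * B" using mult_left_mono[OF ab[of v z] T0] T0 by (simp add: abs_mult)
    moreover have "\<bar>D v z\<bar> \<le> \<bar>T * a v z\<bar> + \<bar>A z\<bar>" unfolding D_def by (rule abs_triangle_ineq4)
    ultimately show ?thesis using Ab[of z] by simp
  qed
  have Sb: "\<bar>S z\<bar> \<le> real m * (2 * T * B)" for z
  proof -
    have "S z = (\<Sum>k<m. D (w k) z)" by (simp add: S_def D_def sum_subtractf)
    also have "\<bar>\<dots>\<bar> \<le> (\<Sum>k<m. 2 * T * B)" by (intro order_trans[OF sum_abs] sum_mono Db)
    finally show ?thesis by simp
  qed
  have SL: "S \<in> L2 Z" by (rule Z.L2_bounded[OF Sm Sb])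
  have Dm: "D v \<in> borel_measurable Z" if "v \<in> space \<Lambda>" for v
    using that unfolding D_def by measurable
  have DL: "D v \<in> L2 Z" if "v \<in> space \<Lambda>" for v by (rule Z.L2_bounded[OF Dm[OF that] Db])
  have i: "integrable (\<Lambda> \<Otimes>\<^sub>M Z) (\<lambda>(v, z). S z * D v z)"
  proof -
    interpret LZf: finite_measure "\<Lambda> \<Otimes>\<^sub>M Z"
      by (intro finite_measure_pair_measure L Z.finite_measure_axioms)
    show ?thesis
    proof (rule LZf.integrable_const_bound[where B="real m * (2 * T * B) * (2 * T * B)"])
      show "AE x in \<Lambda> \<Otimes>\<^sub>M Z. norm (case x of (v, z) \<Rightarrow> S z * D v z) \<le> real m * (2 * T * B) * (2 * T * B)"
        using mult_mono[OF Sb Db] T0 B0 by (intro AE_I2) (auto simp: abs_mult split_beta)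
      show "(\<lambda>(v, z). S z * D v z) \<in> borel_measurable (\<Lambda> \<Otimes>\<^sub>M Z)" unfolding D_def by measurable
    qed
  qed
  have "(\<integral>v. (\<integral>z. S z * D v z \<partial>Z) \<partial>\<Lambda>) = (\<integral>z. (\<integral>v. S z * D v z \<partial>\<Lambda>) \<partial>Z)"
    by (rule LZ.Fubini_integral[OF i, symmetric])
  also have "\<dots> = (\<integral>z. 0 \<partial>Z)"
  proof (rule Bochner_Integration.integral_cong[OF refl])
    fix z assume z: "z \<in> space Z"
    have [measurable]: "(\<lambda>v. a v z) \<in> borel_measurable \<Lambda>" using z by measurable
    have ia: "integrable \<Lambda> (\<lambda>v. a v z)" by (rule L.integrable_const_bound[where B=B]) (use ab in auto)
    have "(\<integral>v. D v z \<partial>\<Lambda>) = T * A z - T * A z"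
      unfolding D_def using ia by (simp add: A_def T_def)
    then show "(\<integral>v. S z * D v z \<partial>\<Lambda>) = 0" by simp
  qed
  finally have z0: "(\<integral>v. (\<integral>z. S z * D v z \<partial>Z) \<partial>\<Lambda>) = 0" by simp
  have i1: "integrable \<Lambda> (\<lambda>v. \<integral>z. S z * D v z \<partial>Z)" using LZ.integrable_fst[OF i] by simp
  obtain v where v: "v \<in> space \<Lambda>" "(\<integral>z. S z * D v z \<partial>Z) \<le> 0"
    using exists_le_zero_of_integral_zero[OF i1 z0 pos] by blast
  define w' where "w' k = (if k = m then v else w k)" for k
  have "(\<Sum>k<Suc m. T * a (w' k) z) - real (Suc m) * A z = S z + D v z" for z
  proof -
    have "(\<Sum>k<m. T * a (w' k) z) = (\<Sum>k<m. T * a (w k) z)" by (intro sum.cong) (auto simp: w'_def)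
    then show ?thesis by (simp add: S_def D_def w'_def algebra_simps)
  qed
  then have "(\<integral>z. ((\<Sum>k<Suc m. T * a (w' k) z) - real (Suc m) * A z)\<^sup>2 \<partial>Z) = L2_inner Z (\<lambda>z. S z + D v z) (\<lambda>z. S z + D v z)"
    by (simp add: L2_inner_self)
  also have "\<dots> = (\<integral>z. (S z)\<^sup>2 \<partial>Z) + 2 * L2_inner Z S (D v) + (\<integral>z. (D v z)\<^sup>2 \<partial>Z)"
    using SL DL[OF v(1)] L2_add[OF SL DL[OF v(1)]]
    by (simp add: L2_inner_add_left L2_inner_add_right L2_inner_self[symmetric] L2_inner_commute)
  \<comment> \<open>Dropping the cross term makes the squared error grow linearly in m instead of
    quadratically; for the average over m samples it is then of order 1 / m.\<close>
  also have "L2_inner Z S (D v) \<le> 0" using v(2) by (simp add: L2_inner_def)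
  also have "(\<integral>z. (S z)\<^sup>2 \<partial>Z) \<le> real m * (2 * T * B)\<^sup>2" using IH by (simp add: S_def)
  also have "(\<integral>z. (D v z)\<^sup>2 \<partial>Z) \<le> (2 * T * B)\<^sup>2"
  proof (rule Z.integral_le_const)
    show "integrable Z (\<lambda>z. (D v z)\<^sup>2)" using DL[OF v(1)] by (rule L2_D)
    show "AE z in Z. (D v z)\<^sup>2 \<le> (2 * T * B)\<^sup>2"
      using power_mono[OF Db, of _ _ 2] by (intro AE_I2) simp
  qed
  finally have "(\<integral>z. ((\<Sum>k<Suc m. T * a (w' k) z) - real (Suc m) * A z)\<^sup>2 \<partial>Z) \<le> real (Suc m) * (2 * T * B)\<^sup>2"
    by (simp add: algebra_simps)
  moreover have "\<forall>k<Suc m. w' k \<in> space \<Lambda>" using w v(1) by (auto simp: w'_def less_Suc_eq)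
  ultimately show ?case by blast
qed

text \<open>A quantitative form of positive semidefiniteness, with bounded centred functions. The
  class is stable under sums and nonnegative multiples, which is how the interaction is assembled.
  \<open>prob_space.sosk\<close> takes no measure argument because it does not depend on the
  measure.\<close>

definition sos_approximable :: "'b measure \<Rightarrow> ('b \<Rightarrow> 'b \<Rightarrow> real) \<Rightarrow> bool" where
  "sos_approximable M u \<longleftrightarrow> case_prod u \<in> borel_measurable (M \<Otimes>\<^sub>M M) \<and>
    (\<forall>\<epsilon>>0. \<exists>m \<psi>. (\<forall>k<m. \<psi> k \<in> L20 M \<and> (\<exists>B. \<forall>x. \<bar>\<psi> k x\<bar> \<le> B)) \<and>
      sqn (M \<Otimes>\<^sub>M M) (\<lambda>(x, y). u x y - prob_space.sosk \<psi> m x y) \<le> ennreal \<epsilon>)"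

context prob_space
begin

lemma sosk_append:
  "sosk (\<lambda>k. if k < m then \<psi> k else \<psi>' (k - m)) (m + m') x y = sosk \<psi> m x y + sosk \<psi>' m' x y"
proof -
  let ?\<psi> = "\<lambda>k. if k < m then \<psi> k else \<psi>' (k - m)"
  have "sosk ?\<psi> (m + n) x y = sosk \<psi> m x y + sosk \<psi>' n x y" for n
    by (induction n) (auto simp: sosk_def intro!: sum.cong)
  then show ?thesis .
qed

lemma measurable_sosk:
  "(\<And>k. k < m \<Longrightarrow> \<psi> k \<in> borel_measurable M) \<Longrightarrow> case_prod (sosk \<psi> m) \<in> borel_measurable (M \<Otimes>\<^sub>M M)"
proof -
  assume *: "\<And>k. k < m \<Longrightarrow> \<psi> k \<in> borel_measurable M"
  have "(\<lambda>z. \<Sum>k<m. \<psi> k (fst z) * \<psi> k (snd z)) \<in> borel_measurable (M \<Otimes>\<^sub>M M)"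
    using * by (intro borel_measurable_sum borel_measurable_times measurable_compose[OF measurable_fst] measurable_compose[OF measurable_snd]) auto
  then show ?thesis by (simp add: sosk_def split_beta')
qed

lemma sos_approximable_add:
  assumes u: "sos_approximable M u" and v: "sos_approximable M v"
  shows "sos_approximable M (\<lambda>x y. u x y + v x y)"
  unfolding sos_approximable_def
proof (intro conjI allI impI)
  have [measurable]: "case_prod u \<in> borel_measurable (M \<Otimes>\<^sub>M M)" "case_prod v \<in> borel_measurable (M \<Otimes>\<^sub>M M)"
    using u v by (auto simp: sos_approximable_def)
  show "(\<lambda>(x, y). u x y + v x y) \<in> borel_measurable (M \<Otimes>\<^sub>M M)" by measurable
  fix \<epsilon> :: real assume e: "0 < \<epsilon>"
  obtain m \<psi> where m: "\<forall>k<m. \<psi> k \<in> L20 M \<and> (\<exists>B. \<forall>x. \<bar>\<psi> k x\<bar> \<le> B)"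
      "sqn (M \<Otimes>\<^sub>M M) (\<lambda>(x, y). u x y - sosk \<psi> m x y) \<le> ennreal (\<epsilon> / 4)"
    using u e unfolding sos_approximable_def by (meson divide_pos_pos zero_less_numeral)
  obtain m' \<psi>' where m': "\<forall>k<m'. \<psi>' k \<in> L20 M \<and> (\<exists>B. \<forall>x. \<bar>\<psi>' k x\<bar> \<le> B)"
      "sqn (M \<Otimes>\<^sub>M M) (\<lambda>(x, y). v x y - sosk \<psi>' m' x y) \<le> ennreal (\<epsilon> / 4)"
    using v e unfolding sos_approximable_def by (meson divide_pos_pos zero_less_numeral)
  have [measurable]: "case_prod (sosk \<psi> m) \<in> borel_measurable (M \<Otimes>\<^sub>M M)" "case_prod (sosk \<psi>' m') \<in> borel_measurable (M \<Otimes>\<^sub>M M)"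
    using m(1) m'(1) L2_D(1)[OF L20_L2] by (intro measurable_sosk; blast)+
  define \<psi>'' where "\<psi>'' k = (if k < m then \<psi> k else \<psi>' (k - m))" for k
  have "sqn (M \<Otimes>\<^sub>M M) (\<lambda>(x, y). u x y + v x y - sosk \<psi>'' (m + m') x y) =
     sqn (M \<Otimes>\<^sub>M M) (\<lambda>z. (case z of (x, y) \<Rightarrow> u x y - sosk \<psi> m x y) + (case z of (x, y) \<Rightarrow> v x y - sosk \<psi>' m' x y))"
    unfolding \<psi>''_def[abs_def] sosk_append by (intro arg_cong2[where f=sqn] refl ext) auto
  also have "\<dots> \<le> 2 * sqn (M \<Otimes>\<^sub>M M) (\<lambda>(x, y). u x y - sosk \<psi> m x y) + 2 * sqn (M \<Otimes>\<^sub>M M) (\<lambda>(x, y). v x y - sosk \<psi>' m' x y)"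
    by (rule sqn_add_le) measurable
  also have "\<dots> \<le> 2 * ennreal (\<epsilon> / 4) + 2 * ennreal (\<epsilon> / 4)"
    by (intro add_mono mult_left_mono m m') auto
  also have "\<dots> = ennreal \<epsilon>"
  proof -
    have "2 * ennreal (\<epsilon> / 4) = ennreal (2 * (\<epsilon> / 4))" using e by (subst ennreal_mult') auto
    then show ?thesis using e by (simp add: ennreal_plus[symmetric] del: ennreal_plus)
  qed
  finally have "sqn (M \<Otimes>\<^sub>M M) (\<lambda>(x, y). u x y + v x y - sosk \<psi>'' (m + m') x y) \<le> ennreal \<epsilon>" .
  moreover have "\<forall>k<m + m'. \<psi>'' k \<in> L20 M \<and> (\<exists>B. \<forall>x. \<bar>\<psi>'' k x\<bar> \<le> B)"
    using m(1) m'(1) by (auto simp: \<psi>''_def)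
  ultimately show "\<exists>m \<psi>. (\<forall>k<m. \<psi> k \<in> L20 M \<and> (\<exists>B. \<forall>x. \<bar>\<psi> k x\<bar> \<le> B)) \<and>
      sqn (M \<Otimes>\<^sub>M M) (\<lambda>(x, y). u x y + v x y - sosk \<psi> m x y) \<le> ennreal \<epsilon>" by blast
qed

end

section \<open>Mixtures of rank one kernels\<close>

locale bounded_mixture = prob_space M + L: finite_measure \<Lambda>
  for M :: "'a measure" and \<Lambda> :: "'w measure" +
  fixes v :: "'w \<Rightarrow> 'a \<Rightarrow> real"
  assumes v_meas: "(\<lambda>(w, x). v w x) \<in> borel_measurable (\<Lambda> \<Otimes>\<^sub>M M)" and v_bd: "\<And>w x. \<bar>v w x\<bar> \<le> 1"
begin

text \<open>An average over \<open>\<Lambda>\<close> of rank one kernels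
  \<open>v w x * v w y\<close>; its doubly centred version averages the products of the centred
  functions \<open>vc w\<close> instead.\<close>

definition mixk :: "'a \<Rightarrow> 'a \<Rightarrow> real" where "mixk x y = (\<integral>w. v w x * v w y \<partial>\<Lambda>)"

definition vc :: "'w \<Rightarrow> 'a \<Rightarrow> real" where "vc w x = v w x - (\<integral>z. v w z \<partial>M)"

lemma vv_bd: "\<bar>v w x * v w y\<bar> \<le> 1"
  using mult_mono[OF v_bd[of w x] v_bd[of w y]] by (simp add: abs_mult)

lemma v_meas1: "x \<in> space M \<Longrightarrow> (\<lambda>w. v w x) \<in> borel_measurable \<Lambda>"
  using v_meas by measurable

lemma v_meas2: "w \<in> space \<Lambda> \<Longrightarrow> v w \<in> borel_measurable M"
  using v_meas by measurable

lemma measurable_mixk [measurable]: "case_prod mixk \<in> borel_measurable (M \<Otimes>\<^sub>M M)"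
proof -
  note [measurable] = v_meas
  show ?thesis unfolding mixk_def by measurable
qed

lemma mixk_bd: "\<bar>mixk x y\<bar> \<le> measure \<Lambda> (space \<Lambda>)"
proof -
  have "\<bar>mixk x y\<bar> \<le> (\<integral>w. \<bar>v w x * v w y\<bar> \<partial>\<Lambda>)" unfolding mixk_def by (rule integral_abs_bound)
  also have "\<dots> \<le> (\<integral>w. 1 \<partial>\<Lambda>)" by (rule integral_mono') (use vv_bd in auto)
  finally show ?thesis by simp
qed

lemma mixk_integrable: "integrable (M \<Otimes>\<^sub>M M) (case_prod mixk)" "x \<in> space M \<Longrightarrow> integrable M (mixk x)"
proof -
  interpret PP: pair_prob_space M M ..
  show "integrable (M \<Otimes>\<^sub>M M) (case_prod mixk)"
    by (rule PP.P.integrable_const_bound[where B="measure \<Lambda> (space \<Lambda>)"]) (use mixk_bd in auto)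
  show "integrable M (mixk x)" if "x \<in> space M"
    using that by (intro integrable_const_bound[where B="measure \<Lambda> (space \<Lambda>)"]) (use mixk_bd in auto)
qed

lemma vc_bd: "\<bar>vc w x\<bar> \<le> 2"
proof -
  have "\<bar>\<integral>z. v w z \<partial>M\<bar> \<le> (\<integral>z. \<bar>v w z\<bar> \<partial>M)" by (rule integral_abs_bound)
  also have "\<dots> \<le> (\<integral>z. 1 \<partial>M)" by (rule integral_mono') (use v_bd in auto)
  finally have "\<bar>\<integral>z. v w z \<partial>M\<bar> \<le> 1" by (simp add: prob_space)
  then show ?thesis unfolding vc_def using v_bd[of w x] by linarith
qed

lemma measurable_vc [measurable]: "(\<lambda>(w, x). vc w x) \<in> borel_measurable (\<Lambda> \<Otimes>\<^sub>M M)"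
proof -
  note [measurable] = v_meas
  show ?thesis unfolding vc_def by measurable
qed

lemma vc_L20: "w \<in> space \<Lambda> \<Longrightarrow> vc w \<in> L20 M"
proof -
  assume w: "w \<in> space \<Lambda>"
  have [measurable]: "v w \<in> borel_measurable M" using w by (rule v_meas2)
  have i: "integrable M (v w)" by (rule integrable_const_bound[where B=1]) (use v_bd in auto)
  have "vc w \<in> L2 M" by (rule L2_bounded[OF _ vc_bd]) (simp add: vc_def)
  moreover have "(\<integral>x. vc w x \<partial>M) = 0" unfolding vc_def using i by (simp add: prob_space)
  ultimately show ?thesis by (simp add: L20_def)
qed

text \<open>Double centring is linear in the kernel, and on a rank one kernel it centres the
  function; Fubini exchanges it with the mixture.\<close>

lemma cen_mixk:
  assumes x: "x \<in> space M" and y: "y \<in> space M"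
  shows "cen mixk x y = (\<integral>w. vc w x * vc w y \<partial>\<Lambda>)"
proof -
  interpret LM: pair_sigma_finite \<Lambda> M ..
  interpret PP: pair_prob_space M M ..
  interpret LMM: pair_sigma_finite \<Lambda> "M \<Otimes>\<^sub>M M" ..
  note [measurable] = v_meas v_meas1[OF x] v_meas1[OF y]
  define e where "e w = (\<integral>z. v w z \<partial>M)" for w
  have [measurable]: "e \<in> borel_measurable \<Lambda>" unfolding e_def by measurable
  have eb: "\<bar>e w\<bar> \<le> 1" for w
  proof -
    have "\<bar>\<integral>z. v w z \<partial>M\<bar> \<le> (\<integral>z. \<bar>v w z\<bar> \<partial>M)" by (rule integral_abs_bound)
    also have "\<dots> \<le> (\<integral>z. 1 \<partial>M)" by (rule integral_mono') (use v_bd in auto)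
    finally show ?thesis by (simp add: e_def prob_space)
  qed
  have le1: "\<bar>a * b\<bar> \<le> 1" if "\<bar>a\<bar> \<le> 1" "\<bar>b\<bar> \<le> 1" for a b :: real
    using mult_mono[OF that] by (simp add: abs_mult)
  have fin: "integrable \<Lambda> f" if "f \<in> borel_measurable \<Lambda>" "\<And>w. \<bar>f w\<bar> \<le> 1" for f :: "'w \<Rightarrow> real"
    by (rule L.integrable_const_bound[where B=1]) (use that in auto)
  have one: "(\<integral>z. mixk x z \<partial>M) = (\<integral>w. v w x * e w \<partial>\<Lambda>)" if x': "x \<in> space M" for x
  proof -
    note [measurable] = v_meas1[OF x']
    interpret LMf: finite_measure "\<Lambda> \<Otimes>\<^sub>M M"
      by (intro finite_measure_pair_measure L.finite_measure_axioms finite_measure_axioms)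
    have "integrable (\<Lambda> \<Otimes>\<^sub>M M) (\<lambda>(w, z). v w x * v w z)"
      by (rule LMf.integrable_const_bound[where B=1]) (use vv_bd in auto)
    from LM.Fubini_integral[OF this] show ?thesis
      by (simp add: mixk_def e_def)
  qed
  have two: "(\<integral>(x, y). mixk x y \<partial>(M \<Otimes>\<^sub>M M)) = (\<integral>w. e w * e w \<partial>\<Lambda>)"
  proof -
    have "(\<integral>(x, y). mixk x y \<partial>(M \<Otimes>\<^sub>M M)) = (\<integral>x. (\<integral>z. mixk x z \<partial>M) \<partial>M)"
      using PP.integral_fst[OF mixk_integrable(1)] by simp
    also have "\<dots> = (\<integral>x. (\<integral>w. v w x * e w \<partial>\<Lambda>) \<partial>M)"
      by (intro Bochner_Integration.integral_cong one) auto
    also have "\<dots> = (\<integral>w. (\<integral>x. v w x * e w \<partial>M) \<partial>\<Lambda>)"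
    proof (rule LM.Fubini_integral)
      interpret LMf: finite_measure "\<Lambda> \<Otimes>\<^sub>M M"
        by (intro finite_measure_pair_measure L.finite_measure_axioms finite_measure_axioms)
      show "integrable (\<Lambda> \<Otimes>\<^sub>M M) (\<lambda>(w, x). v w x * e w)"
        by (rule LMf.integrable_const_bound[where B=1]) (use le1[OF v_bd eb] in auto)
    qed
    finally show ?thesis by (simp add: e_def)
  qed
  have "(\<integral>w. vc w x * vc w y \<partial>\<Lambda>) = (\<integral>w. v w x * v w y - v w x * e w - v w y * e w + e w * e w \<partial>\<Lambda>)"
    by (intro Bochner_Integration.integral_cong) (auto simp: vc_def e_def[symmetric] algebra_simps)
  also have "\<dots> = (\<integral>w. v w x * v w y \<partial>\<Lambda>) - (\<integral>w. v w x * e w \<partial>\<Lambda>) - (\<integral>w. v w y * e w \<partial>\<Lambda>) + (\<integral>w. e w * e w \<partial>\<Lambda>)"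
  proof -
    have 1: "integrable \<Lambda> (\<lambda>w. v w x * v w y)" "integrable \<Lambda> (\<lambda>w. v w x * e w)"
       "integrable \<Lambda> (\<lambda>w. v w y * e w)" "integrable \<Lambda> (\<lambda>w. e w * e w)"
      by (intro fin le1 v_bd eb; measurable)+
    then show ?thesis by simp
  qed
  finally show ?thesis unfolding cen_def two one[OF x] one[OF y] by (simp add: mixk_def)
qed

text \<open>The double sum is the integral over w of the square of
  \<open>\<Sum>i<N. vc w (X i)\<close>. The diagonal terms are part of this square, so the sign is
  lost once they are omitted.\<close>

lemma cen_mixk_psd:
  assumes X: "\<And>i. i < N \<Longrightarrow> X i \<in> space M"
  shows "0 \<le> (\<Sum>i<N. \<Sum>j<N. cen mixk (X i) (X j :: 'a))"
proof -
  have i: "integrable \<Lambda> (\<lambda>w. vc w (X i) * vc w (X j))" if "i < N" "j < N" for i j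
  proof (rule L.integrable_const_bound[where B="2 * 2"])
    show "AE w in \<Lambda>. norm (vc w (X i) * vc w (X j)) \<le> 2 * 2"
      unfolding real_norm_def abs_mult by (intro AE_I2 mult_mono vc_bd) auto
    show "(\<lambda>w. vc w (X i) * vc w (X j)) \<in> borel_measurable \<Lambda>"
      using X[OF that(1)] X[OF that(2)] by measurable
  qed
  have "(\<Sum>i<N. \<Sum>j<N. cen mixk (X i) (X j)) = (\<Sum>i<N. \<Sum>j<N. (\<integral>w. vc w (X i) * vc w (X j) \<partial>\<Lambda>))"
    by (intro sum.cong refl cen_mixk X) auto
  also have "\<dots> = (\<integral>w. (\<Sum>i<N. \<Sum>j<N. vc w (X i) * vc w (X j)) \<partial>\<Lambda>)"
  proof -
    have "(\<integral>w. (\<Sum>i<N. \<Sum>j<N. vc w (X i) * vc w (X j)) \<partial>\<Lambda>) = (\<Sum>i<N. (\<integral>w. (\<Sum>j<N. vc w (X i) * vc w (X j)) \<partial>\<Lambda>))"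
      by (rule Bochner_Integration.integral_sum) (auto intro!: Bochner_Integration.integrable_sum i)
    also have "\<dots> = (\<Sum>i<N. \<Sum>j<N. (\<integral>w. vc w (X i) * vc w (X j) \<partial>\<Lambda>))"
      by (intro sum.cong refl Bochner_Integration.integral_sum i) auto
    finally show ?thesis ..
  qed
  also have "\<dots> = (\<integral>w. (\<Sum>i<N. vc w (X i))\<^sup>2 \<partial>\<Lambda>)"
    by (simp add: power2_eq_square sum_product)
  also have "\<dots> \<ge> 0" by simp
  finally show ?thesis .
qed

text \<open>Sampling the parameter as in \<open>greedy_average\<close> replaces the integral by an
  average over m parameters, which is a sum of m rank one kernels; its squared error is of order 1 /
  m.\<close>

lemma cen_mixk_approximable: "sos_approximable M (cen mixk)"
  unfolding sos_approximable_def
proof (intro conjI allI impI)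
  show "case_prod (cen mixk) \<in> borel_measurable (M \<Otimes>\<^sub>M M)" by measurable
  fix \<epsilon> :: real assume e: "0 < \<epsilon>"
  interpret PP: pair_prob_space M M ..
  define T where "T = measure \<Lambda> (space \<Lambda>)"
  have T0: "0 \<le> T" by (simp add: T_def)
  show "\<exists>m \<psi>. (\<forall>k<m. \<psi> k \<in> L20 M \<and> (\<exists>B. \<forall>x. \<bar>\<psi> k x\<bar> \<le> B)) \<and>
      sqn (M \<Otimes>\<^sub>M M) (\<lambda>(x, y). cen mixk x y - sosk \<psi> m x y) \<le> ennreal \<epsilon>"
  proof (cases "emeasure \<Lambda> (space \<Lambda>) = 0")
    \<comment> \<open>Sampling requires positive mass; for a null \<open>\<Lambda>\<close> the
      centred kernel vanishes and the empty sum serves.\<close>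
    case True
    have "cen mixk x y = 0" if "x \<in> space M" "y \<in> space M" for x y
      unfolding cen_mixk[OF that]
      by (rule integral_eq_zero_AE) (use True in \<open>auto intro!: AE_I[where N="space \<Lambda>"]\<close>)
    then have "sqn (M \<Otimes>\<^sub>M M) (\<lambda>(x, y). cen mixk x y - sosk (\<lambda>_ _. 0) 0 x y) = sqn (M \<Otimes>\<^sub>M M) (\<lambda>z. 0)"
      unfolding sqn_def by (intro nn_integral_cong) (auto simp: sosk_def space_pair_measure)
    then show ?thesis by (intro exI[of _ 0] exI[of _ "\<lambda>_ _. 0"]) (simp add: sqn_def)
  next
    case False
    define a where "a w z = (case z of (x, y) \<Rightarrow> vc w x * vc w y)" for w z
    have am: "(\<lambda>(w, z). a w z) \<in> borel_measurable (\<Lambda> \<Otimes>\<^sub>M (M \<Otimes>\<^sub>M M))"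
      unfolding a_def by measurable
    have ab: "\<bar>a w z\<bar> \<le> 2 * 2" for w z
      unfolding a_def split_beta abs_mult by (intro mult_mono vc_bd) auto
    define A where "A z = (\<integral>w. a w z \<partial>\<Lambda>)" for z
    obtain m :: nat where m: "(2 * T * 4)\<^sup>2 / \<epsilon> < real m" "0 < m"
      using reals_Archimedean2[of "max 0 ((2 * T * 4)\<^sup>2 / \<epsilon>)"] by auto
    obtain w where w: "\<forall>k<m. w k \<in> space \<Lambda>"
      and wle: "(\<integral>z. ((\<Sum>k<m. T * a (w k) z) - real m * A z)\<^sup>2 \<partial>(M \<Otimes>\<^sub>M M)) \<le> real m * (2 * T * (2 * 2))\<^sup>2"
      using greedy_average[OF L.finite_measure_axioms PP.P.prob_space_axioms am ab False, of m]
      unfolding T_def A_def by blast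
    \<comment> \<open>A sample has weight T / m, and the square root splits this weight between the
      two arguments.\<close>
    define \<psi> where "\<psi> k x = sqrt (T / m) * vc (w k) x" for k x
    have psi: "\<psi> k \<in> L20 M" if "k < m" for k
      unfolding \<psi>_def[abs_def] using w that by (intro L20_cmult vc_L20) auto
    have psib: "\<exists>B. \<forall>x. \<bar>\<psi> k x\<bar> \<le> B" for k
    proof (intro exI allI)
      show "\<bar>\<psi> k x\<bar> \<le> sqrt (T / m) * 2" for x
        unfolding \<psi>_def abs_mult using T0 by (intro mult_mono vc_bd) auto
    qed
    have [measurable]: "case_prod (sosk \<psi> m) \<in> borel_measurable (M \<Otimes>\<^sub>M M)"
      using psi L2_D(1)[OF L20_L2] by (intro measurable_sosk) blast
    define E where "E z = (\<Sum>k<m. T * a (w k) z) - real m * A z" for z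
    have eq: "(case z of (x, y) \<Rightarrow> cen mixk x y - sosk \<psi> m x y) = (- 1 / m) * E z" if z: "z \<in> space (M \<Otimes>\<^sub>M M)" for z
    proof -
      obtain x y where xy: "z = (x, y)" "x \<in> space M" "y \<in> space M" using z by (auto simp: space_pair_measure)
      have 1: "cen mixk x y = A z" unfolding cen_mixk[OF xy(2,3)] A_def a_def xy(1) by simp
      have sq: "sqrt (T / m) * sqrt (T / m) = T / m" using T0 by simp
      have "sosk \<psi> m x y = (\<Sum>k<m. (sqrt (T / m) * sqrt (T / m)) * a (w k) z)"
        unfolding sosk_def \<psi>_def a_def xy(1) prod.case by (intro sum.cong refl) (simp only: mult_ac)
      also have "\<dots> = (1 / m) * (\<Sum>k<m. T * a (w k) z)"
        unfolding sq sum_distrib_left by (intro sum.cong) auto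
      finally show ?thesis unfolding xy(1) using 1 m(2) by (simp add: E_def xy(1) field_simps)
    qed
    have [measurable]: "A \<in> borel_measurable (M \<Otimes>\<^sub>M M)" unfolding A_def using am by measurable
    have Em [measurable]: "E \<in> borel_measurable (M \<Otimes>\<^sub>M M)"
    proof -
      have "a (w k) \<in> borel_measurable (M \<Otimes>\<^sub>M M)" if "k < m" for k
      proof -
        note [measurable] = am
        have "w k \<in> space \<Lambda>" using w that by blast
        then show ?thesis by measurable
      qed
      then show ?thesis unfolding E_def by (intro borel_measurable_diff borel_measurable_sum borel_measurable_times) auto
    qed
    have EL: "E \<in> L2 (M \<Otimes>\<^sub>M M)"
    proof (rule PP.P.L2_bounded[OF Em])
      fix z
      have "\<bar>A z\<bar> \<le> (\<integral>w. \<bar>a w z\<bar> \<partial>\<Lambda>)" unfolding A_def by (rule integral_abs_bound)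
      also have "\<dots> \<le> (\<integral>w. 2 * 2 \<partial>\<Lambda>)" by (rule integral_mono') (use ab in auto)
      finally have 1: "\<bar>A z\<bar> \<le> 4 * T" by (simp add: T_def mult.commute)
      have 2: "\<bar>\<Sum>k<m. T * a (w k) z\<bar> \<le> (\<Sum>k<m. T * 4)"
      proof (intro order_trans[OF sum_abs] sum_mono)
        show "\<bar>T * a (w k) z\<bar> \<le> T * 4" for k
          using mult_left_mono[OF ab[of "w k" z] T0] T0 by (simp add: abs_mult)
      qed
      have 3: "\<bar>real m * A z\<bar> \<le> real m * (4 * T)" using mult_left_mono[OF 1, of "real m"] by (simp add: abs_mult)
      show "\<bar>E z\<bar> \<le> (\<Sum>k<m. T * 4) + real m * (4 * T)" unfolding E_def using 2 3 by linarith
    qed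
    have "sqn (M \<Otimes>\<^sub>M M) (\<lambda>(x, y). cen mixk x y - sosk \<psi> m x y) = sqn (M \<Otimes>\<^sub>M M) (\<lambda>z. (- 1 / m) * E z)"
      unfolding sqn_def by (intro nn_integral_cong) (simp only: eq)
    also have "\<dots> = ennreal ((- 1 / m)\<^sup>2) * ennreal (\<integral>z. (E z)\<^sup>2 \<partial>(M \<Otimes>\<^sub>M M))"
      by (simp only: sqn_cmult[OF Em] sqn_eq_integral[OF EL])
    also have "\<dots> = ennreal ((- 1 / m)\<^sup>2 * (\<integral>z. (E z)\<^sup>2 \<partial>(M \<Otimes>\<^sub>M M)))"
      by (rule ennreal_mult[symmetric]) auto
    also have "\<dots> \<le> ennreal ((- 1 / m)\<^sup>2 * (real m * (2 * T * (2 * 2))\<^sup>2))"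
      using wle unfolding E_def by (intro ennreal_leI mult_left_mono) auto
    also have "\<dots> \<le> ennreal \<epsilon>"
    proof (rule ennreal_leI)
      have "(- 1 / m)\<^sup>2 * (real m * (2 * T * (2 * 2))\<^sup>2) = (2 * T * 4)\<^sup>2 / m"
        using m(2) by (simp add: power2_eq_square field_simps)
      also have "\<dots> \<le> \<epsilon>" using m e by (simp add: field_simps)
      finally show "(- 1 / m)\<^sup>2 * (real m * (2 * T * (2 * 2))\<^sup>2) \<le> \<epsilon>" .
    qed
    finally show ?thesis using psi psib by blast
  qed
qed

end

lemma (in prob_space) sos_approximable_cmult:
  assumes u: "sos_approximable M u" and k: "0 \<le> k"
  shows "sos_approximable M (\<lambda>x y. k * u x y)"
  unfolding sos_approximable_def
proof (intro conjI allI impI)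
  have [measurable]: "case_prod u \<in> borel_measurable (M \<Otimes>\<^sub>M M)" using u by (auto simp: sos_approximable_def)
  show "(\<lambda>(x, y). k * u x y) \<in> borel_measurable (M \<Otimes>\<^sub>M M)" by measurable
  fix \<epsilon> :: real assume e: "0 < \<epsilon>"
  define \<delta> where "\<delta> = \<epsilon> / (k\<^sup>2 + 1)"
  have d: "0 < \<delta>" "k\<^sup>2 * \<delta> \<le> \<epsilon>"
    using e by (auto simp: \<delta>_def field_simps add_pos_nonneg)
  obtain m \<psi> where m: "\<forall>k<m. \<psi> k \<in> L20 M \<and> (\<exists>B. \<forall>x. \<bar>\<psi> k x\<bar> \<le> B)"
      "sqn (M \<Otimes>\<^sub>M M) (\<lambda>(x, y). u x y - sosk \<psi> m x y) \<le> ennreal \<delta>"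
    using u d(1) unfolding sos_approximable_def by meson
  have [measurable]: "case_prod (sosk \<psi> m) \<in> borel_measurable (M \<Otimes>\<^sub>M M)"
    using m(1) L2_D(1)[OF L20_L2] by (intro measurable_sosk) blast
  define \<psi>' where "\<psi>' j x = sqrt k * \<psi> j x" for j x
  have 1: "sosk \<psi>' m x y = k * sosk \<psi> m x y" for x y
  proof -
    have "sosk \<psi>' m x y = (\<Sum>j<m. (sqrt k * sqrt k) * (\<psi> j x * \<psi> j y))"
      unfolding sosk_def \<psi>'_def by (intro sum.cong refl) (simp only: mult_ac)
    then show ?thesis using k by (simp add: sosk_def sum_distrib_left)
  qed
  have "sqn (M \<Otimes>\<^sub>M M) (\<lambda>(x, y). k * u x y - sosk \<psi>' m x y) = sqn (M \<Otimes>\<^sub>M M) (\<lambda>z. k * (case z of (x, y) \<Rightarrow> u x y - sosk \<psi> m x y))"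
    unfolding 1 by (intro arg_cong2[where f=sqn] refl ext) (auto simp: right_diff_distrib)
  also have "\<dots> = ennreal (k\<^sup>2) * sqn (M \<Otimes>\<^sub>M M) (\<lambda>(x, y). u x y - sosk \<psi> m x y)"
    by (rule sqn_cmult) measurable
  also have "\<dots> \<le> ennreal (k\<^sup>2) * ennreal \<delta>" by (intro mult_left_mono m) auto
  also have "\<dots> = ennreal (k\<^sup>2 * \<delta>)" using d by (intro ennreal_mult[symmetric]) auto
  also have "\<dots> \<le> ennreal \<epsilon>" using d by (intro ennreal_leI)
  finally have "sqn (M \<Otimes>\<^sub>M M) (\<lambda>(x, y). k * u x y - sosk \<psi>' m x y) \<le> ennreal \<epsilon>" .
  moreover have "\<psi>' j \<in> L20 M \<and> (\<exists>B. \<forall>x. \<bar>\<psi>' j x\<bar> \<le> B)" if j: "j < m" for j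
  proof
    show "\<psi>' j \<in> L20 M" unfolding \<psi>'_def[abs_def] using m(1) j by (intro L20_cmult) auto
    obtain B where "\<forall>x. \<bar>\<psi> j x\<bar> \<le> B" using m(1) j by blast
    then have "\<forall>x. \<bar>\<psi>' j x\<bar> \<le> sqrt k * B" using k by (auto simp: \<psi>'_def abs_mult intro!: mult_left_mono)
    then show "\<exists>B. \<forall>x. \<bar>\<psi>' j x\<bar> \<le> B" by blast
  qed
  ultimately show "\<exists>m \<psi>. (\<forall>k<m. \<psi> k \<in> L20 M \<and> (\<exists>B. \<forall>x. \<bar>\<psi> k x\<bar> \<le> B)) \<and>
      sqn (M \<Otimes>\<^sub>M M) (\<lambda>(x, y). k * u x y - sosk \<psi> m x y) \<le> ennreal \<epsilon>" by blast
qed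


section \<open>Gaussians as averages of characters\<close>

abbreviation gauss_dir :: "('a::euclidean_space \<Rightarrow> real) measure" where
  "gauss_dir \<equiv> Pi\<^sub>M Basis (\<lambda>_. std_normal_distribution)"

lemma prob_space_gauss_dir: "prob_space gauss_dir"
  by (intro prob_space_PiM prob_space_normal_density) simp

text \<open>The factor sqrt 2 matches two normalisations: the characteristic function of a standard
  normal is exp (- u^2 / 2), while the mixture uses exp (- (t |z|)^2).\<close>

definition phase :: "real \<times> ('a::euclidean_space \<Rightarrow> real) \<Rightarrow> 'a \<Rightarrow> real" where
  "phase w x = sqrt 2 * fst w * (\<Sum>b\<in>Basis. snd w b * (x \<bullet> b))"

lemma phase_diff: "phase w x - phase w y = phase w (x - y)"
  by (simp add: phase_def inner_diff_left right_diff_distrib sum_subtractf)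

lemma integral_cos_phase:
  fixes z :: "'a::euclidean_space"
  shows "(\<integral>\<xi>. cos (phase (t, \<xi>) z) \<partial>gauss_dir) = exp (- (t * norm z)\<^sup>2)"
proof -
  interpret G: prob_space "gauss_dir :: ('a \<Rightarrow> real) measure" by (rule prob_space_gauss_dir)
  interpret P: product_sigma_finite "\<lambda>_::'a. std_normal_distribution"
    unfolding product_sigma_finite_def by (intro allI prob_space_imp_sigma_finite prob_space_normal_density) simp
  interpret N: prob_space std_normal_distribution by (rule prob_space_normal_density) simp
  let ?c = "\<lambda>b. sqrt 2 * t * (z \<bullet> b)"
  have "(\<integral>\<xi>. iexp (phase (t, \<xi>) z) \<partial>gauss_dir) = (\<integral>\<xi>. (\<Prod>b\<in>Basis. iexp (?c b * \<xi> b)) \<partial>(gauss_dir :: ('a \<Rightarrow> real) measure))"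
    by (intro Bochner_Integration.integral_cong refl)
      (simp add: phase_def exp_sum[symmetric] sum_distrib_left mult_ac)
  also have "\<dots> = (\<Prod>b\<in>Basis. \<integral>x. iexp (?c b * x) \<partial>std_normal_distribution)"
    by (rule P.product_integral_prod) (auto intro!: N.integrable_const_bound[where B=1])
  also have "\<dots> = (\<Prod>b\<in>Basis. complex_of_real (exp (- (?c b)\<^sup>2 / 2)))"
    by (intro prod.cong refl fun_cong[OF char_std_normal_distribution, unfolded char_def])
  also have "\<dots> = complex_of_real (exp (\<Sum>b\<in>Basis. - (?c b)\<^sup>2 / 2))"
    by (simp add: exp_sum)
  also have "(\<Sum>b\<in>Basis. - (?c b)\<^sup>2 / 2) = - (t * norm z)\<^sup>2"
  proof -
    have "(\<Sum>b\<in>Basis. - (?c b)\<^sup>2 / 2) = - (t\<^sup>2 * (\<Sum>b\<in>Basis. (z \<bullet> b)\<^sup>2))"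
      by (simp add: power_mult_distrib sum_distrib_left sum_negf)
    also have "(\<Sum>b\<in>Basis. (z \<bullet> b)\<^sup>2) = (norm z)\<^sup>2"
      using euclidean_inner[of z z] unfolding power2_norm_eq_inner by (simp add: power2_eq_square)
    finally show ?thesis by (simp add: power_mult_distrib)
  qed
  finally have c: "(\<integral>\<xi>. iexp (phase (t, \<xi>) z) \<partial>gauss_dir) = complex_of_real (exp (- (t * norm z)\<^sup>2))" .
  have [measurable]: "(\<lambda>\<xi>. phase (t, \<xi>) z) \<in> borel_measurable gauss_dir" unfolding phase_def fst_conv snd_conv by measurable
  have i: "integrable gauss_dir (\<lambda>\<xi>. iexp (phase (t, \<xi>) z))"
    by (rule G.integrable_const_bound[where B=1]) auto
  have "(\<integral>\<xi>. cos (phase (t, \<xi>) z) \<partial>gauss_dir) = (\<integral>\<xi>. Re (iexp (phase (t, \<xi>) z)) \<partial>gauss_dir)"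
    by (simp add: cis_conv_exp[symmetric])
  also have "\<dots> = Re (\<integral>\<xi>. iexp (phase (t, \<xi>) z) \<partial>gauss_dir)" using i by (rule integral_Re)
  finally show ?thesis unfolding c by simp
qed

lemma measurable_phase [measurable]:
  "(\<lambda>(w, x). phase w x) \<in> borel_measurable ((borel \<Otimes>\<^sub>M gauss_dir) \<Otimes>\<^sub>M borel)"
  unfolding phase_def by measurable

definition scale_measure_on :: "real \<Rightarrow> real set \<Rightarrow> real measure" where
  "scale_measure_on s A = density lborel (\<lambda>t. ennreal (indicator A t * t powr (s - 1)))"

lemma sets_scale_measure_on [measurable_cong, simp]: "sets (scale_measure_on s A) = sets borel"
  by (simp add: scale_measure_on_def)

text \<open>The mass diverges at infinity for every s >= 0, and at 0 for s = 0. This is why only the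
  middle range of scales is treated as a bounded mixture.\<close>

lemma finite_scale_measure_on:
  assumes "0 < a" "a < b" shows "finite_measure (scale_measure_on s {a..<b})"
proof
  have c: "continuous_on {a..b} (\<lambda>t. t powr (s - 1))" using assms by (intro continuous_intros) auto
  have i: "integrable lborel (\<lambda>t. indicator {a..b} t * t powr (s - 1))"
    using borel_integrable_atLeastAtMost'[OF c] by (simp add: set_integrable_def)
  have "emeasure (scale_measure_on s {a..<b}) (space (scale_measure_on s {a..<b})) =
      (\<integral>\<^sup>+t. ennreal (indicator {a..<b} t * t powr (s - 1)) \<partial>lborel)"
    by (simp add: scale_measure_on_def emeasure_density)
  also have "\<dots> \<le> (\<integral>\<^sup>+t. ennreal (indicator {a..b} t * t powr (s - 1)) \<partial>lborel)"
    by (intro nn_integral_mono ennreal_leI) (auto simp: indicator_def)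
  also have "\<dots> = ennreal (\<integral>t. indicator {a..b} t * t powr (s - 1) \<partial>lborel)"
    using i by (intro nn_integral_eq_integral) auto
  finally show "emeasure (scale_measure_on s {a..<b}) (space (scale_measure_on s {a..<b})) \<noteq> \<infinity>"
    by (auto simp: top_unique)
qed

text \<open>For s > 0 the weight t powr (s - 1) is integrable at 0, and the truncated Gaussian is at
  most 1 in absolute value. For s = 0 the small t part instead grows logarithmically in |z|, and its
  integrability has to come from the logarithmic moment.\<close>

lemma gmix_low_bounded:
  assumes s: "0 < s" shows "\<bar>gmix s {0<..<1} z\<bar> \<le> 1 / s"
proof -
  have h: "((\<lambda>t. t powr (s - 1)) has_integral (1 powr (s - 1 + 1) / (s - 1 + 1))) {0..1}"
    using s by (intro has_integral_powr_from_0) auto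
  have h': "((\<lambda>t::real. if t \<in> {0..1} then t powr (s - 1) else 0) has_integral (1 / s)) UNIV"
    using h by (subst has_integral_restrict_UNIV) simp
  have nn: "(\<integral>\<^sup>+t. ennreal (if t \<in> {0..1} then t powr (s - 1) else 0) \<partial>lborel) = ennreal (1 / s)"
    by (rule nn_integral_has_integral_lborel[OF _ _ h']) auto
  have i: "integrable lborel (\<lambda>t::real. if t \<in> {0..1} then t powr (s - 1) else 0)"
  proof (rule integrableI_nonneg)
    show "(\<integral>\<^sup>+t. ennreal (if t \<in> {0..1} then t powr (s - 1) else 0) \<partial>lborel) < \<infinity>" unfolding nn by simp
  qed auto
  have v: "(\<integral>t. (if t \<in> {0..1} then t powr (s - 1) else 0) \<partial>lborel) = 1 / s"
    using nn_integral_eq_integral[OF i] nn s by simp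
  have "\<bar>gmix s {0<..<1} z\<bar> \<le> (\<integral>t. \<bar>indicator {0<..<1} t * (t powr (s - 1) * gd t z)\<bar> \<partial>lborel)"
    unfolding gmix_def by (rule integral_abs_bound)
  also have "\<dots> \<le> (\<integral>t. (if t \<in> {0..1} then t powr (s - 1) else 0) \<partial>lborel)"
  proof (rule integral_mono'[OF i])
    show "\<bar>indicator {0<..<1} t * (t powr (s - 1) * gd t z)\<bar> \<le> (if t \<in> {0..1} then t powr (s - 1) else 0)" for t
      using mult_left_mono[OF abs_gd_le[of t z], of "t powr (s - 1)"] by (auto simp: indicator_def abs_mult)
  qed auto
  finally show ?thesis unfolding v .
qed

text \<open>All pieces below t = 1 have the same sign, so each of them is dominated by the whole
  small t part, independently of the lower cut-off 1 / (n + 1).\<close>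

lemma gmix_lower_limit:
  assumes s: "0 \<le> s" and b: "1 \<le> b"
  shows "(\<lambda>n. gmix s {1 / real (Suc n)..<b} z) \<longlonglongrightarrow> gmix s {0<..<b} z"
    and "\<bar>gmix s {1 / real (Suc n)..<b} z\<bar> \<le> \<bar>gmix s {0<..<1} z\<bar> + (1 powr (s - 1) + b powr (s - 1)) * measure lborel {1..b}"
    and "gint s {0<..<1 / real (Suc n)} z"
    and "gmix s {0<..<b} z = gmix s {0<..<1 / real (Suc n)} z + gmix s {1 / real (Suc n)..<b} z"
    and "\<bar>gmix s {0<..<1 / real (Suc n)} z\<bar> \<le> \<bar>gmix s {0<..<1} z\<bar>"
    and "(\<lambda>n. gmix s {0<..<1 / real (Suc n)} z) \<longlonglongrightarrow> 0"
proof -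
  define a where "a n = 1 / real (Suc n)" for n
  have a: "0 < a n" "a n \<le> 1" for n by (auto simp: a_def)
  have alim: "a \<longlonglongrightarrow> 0" unfolding a_def using LIMSEQ_inverse_real_of_nat by (simp add: inverse_eq_divide)
  have g0: "integrable lborel (\<lambda>t. indicator {0<..<b} t * (t powr (s - 1) * gd t z))"
    using gint_low_middle(1)[OF s b] by (simp add: gint_def)
  show lim: "(\<lambda>n. gmix s {1 / real (Suc n)..<b} z) \<longlonglongrightarrow> gmix s {0<..<b} z"
    unfolding gmix_def
  proof (rule integral_dominated_convergence[where w="\<lambda>t. \<bar>indicator {0<..<b} t * (t powr (s - 1) * gd t z)\<bar>"])
    show "integrable lborel (\<lambda>t. \<bar>indicator {0<..<b} t * (t powr (s - 1) * gd t z)\<bar>)" using g0 by (rule integrable_abs)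
    show "AE t in lborel. (\<lambda>n. indicator {1 / real (Suc n)..<b} t * (t powr (s - 1) * gd t z)) \<longlonglongrightarrow> indicator {0<..<b} t * (t powr (s - 1) * gd t z)"
    proof (rule AE_I2, intro tendsto_mult tendsto_const)
      fix t :: real
      show "(\<lambda>n. indicator {1 / real (Suc n)..<b} t :: real) \<longlonglongrightarrow> indicator {0<..<b} t"
      proof (cases "0 < t \<and> t < b")
        case True
        then have "\<forall>\<^sub>F n in sequentially. a n < t" using order_tendstoD(2)[OF alim] by simp
        then have "\<forall>\<^sub>F n in sequentially. indicator {1 / real (Suc n)..<b} t = (indicator {0<..<b} t :: real)"
          by eventually_elim (use True in \<open>auto simp: a_def indicator_def\<close>)
        then show ?thesis by (rule tendsto_eventually)
      next
        case False
        then have "t \<notin> {1 / real (Suc n)..<b}" for n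
          using less_le_trans[OF a(1)[of n], of t] unfolding a_def by (metis atLeastLessThan_iff)
        then have z: "indicator {1 / real (Suc n)..<b} t = (0::real)" for n unfolding indicator_def by (simp only: of_bool_eq)
        have z': "indicator {0<..<b} t = (0::real)" using False by (auto simp: indicator_def)
        show ?thesis unfolding z z' by (rule tendsto_const)
      qed
    qed
    show "AE t in lborel. norm (indicator {1 / real (Suc n)..<b} t * (t powr (s - 1) * gd t z)) \<le> \<bar>indicator {0<..<b} t * (t powr (s - 1) * gd t z)\<bar>" for n
    proof (rule AE_I2)
      fix t
      have "t \<in> {0<..<b}" if "t \<in> {1 / real (Suc n)..<b}"
      proof -
        have "a n \<le> t" "t < b" using that by (auto simp: a_def)
        with a(1)[of n] show ?thesis by (auto intro: less_le_trans)
      qed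
      then show "norm (indicator {1 / real (Suc n)..<b} t * (t powr (s - 1) * gd t z)) \<le> \<bar>indicator {0<..<b} t * (t powr (s - 1) * gd t z)\<bar>"
        by (auto simp: indicator_def)
    qed
  qed (unfold gd_def, measurable)
  have gl: "gint s {0<..<a n} z" "gmix s {0<..<a n} z \<le> 0" for n
    using a[of n] s by (auto intro!: gint_low)
  have gm: "gint s {a n..<1} z" "gmix s {a n..<1} z \<le> 0" for n
    using a(1)[of n] s by (auto intro!: gint_low)
  show "gint s {0<..<1 / real (Suc n)} z" using gl(1)[of n] by (simp add: a_def)
  have e1: "gmix s {0<..<1} z = gmix s {0<..<a n} z + gmix s {a n..<1} z" for n
  proof -
    have e: "{0<..<1} = {0<..<a n} \<union> {a n..<1}" using a[of n] by auto
    show ?thesis by (subst e, rule gmix_Un(2)[OF gl(1) gm(1)]) auto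
  qed
  have m: "gint s {1..<b} z" "\<bar>gmix s {1..<b} z\<bar> \<le> (1 powr (s - 1) + b powr (s - 1)) * measure lborel {1..b}"
    using gint_middle[of "{1..<b}" 1 b s z] by auto
  have e2: "gmix s {a n..<b} z = gmix s {a n..<1} z + gmix s {1..<b} z" for n
  proof -
    have e: "{a n..<b} = {a n..<1} \<union> {1..<b}" using a[of n] b by auto
    show ?thesis by (subst e, rule gmix_Un(2)[OF gm(1) m(1)]) auto
  qed
  show "\<bar>gmix s {1 / real (Suc n)..<b} z\<bar> \<le> \<bar>gmix s {0<..<1} z\<bar> + (1 powr (s - 1) + b powr (s - 1)) * measure lborel {1..b}"
    using e1[of n] e2[of n] gl(2)[of n] gm(2)[of n] m(2) unfolding a_def by linarith
  show e3: "gmix s {0<..<b} z = gmix s {0<..<1 / real (Suc n)} z + gmix s {1 / real (Suc n)..<b} z" for n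
    using gint_low_middle(2)[OF s b, of z] e1[of n] e2[of n] unfolding a_def by linarith
  show "\<bar>gmix s {0<..<1 / real (Suc n)} z\<bar> \<le> \<bar>gmix s {0<..<1} z\<bar>"
    using e1[of n] gl(2)[of n] gm(2)[of n] unfolding a_def by linarith
  have "(\<lambda>n. gmix s {0<..<b} z - gmix s {1 / real (Suc n)..<b} z) \<longlonglongrightarrow> gmix s {0<..<b} z - gmix s {0<..<b} z"
    by (intro tendsto_diff tendsto_const lim)
  moreover have "(\<lambda>n. gmix s {0<..<b} z - gmix s {1 / real (Suc n)..<b} z) = (\<lambda>n. gmix s {0<..<1 / real (Suc n)} z)"
  proof
    fix n
    show "gmix s {0<..<b} z - gmix s {1 / real (Suc n)..<b} z = gmix s {0<..<1 / real (Suc n)} z"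
      using e3[of n] by linarith
  qed
  ultimately show "(\<lambda>n. gmix s {0<..<1 / real (Suc n)} z) \<longlonglongrightarrow> 0" by (simp only: diff_self)
qed

section \<open>Riesz interactions with bounded densities\<close>

text \<open>\<open>c\<close> and \<open>\<kappa>\<close> are the constants relating the kernel to
  its mixture. The relation excludes z = 0, where \<open>gker\<close> has a conventional value; with
  a density this concerns only a null set of pairs.\<close>

locale riesz_base = prob_space \<mu> for \<mu> :: "'a::euclidean_space measure" +
  fixes s B c \<kappa> :: real and \<rho> :: "'a \<Rightarrow> real"
  assumes s0: "0 \<le> s" and s1: "s < real DIM('a) / 2" and B0: "0 \<le> B" and c0: "0 < c"
    and rho_meas [measurable]: "\<rho> \<in> borel_measurable borel"
    and rho_bd: "AE x in lborel. \<rho> x \<le> B"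
    and mu_eq: "\<mu> = density lborel (\<lambda>x. ennreal (\<rho> x))"
    and gker_eq: "\<And>z::'a. z \<noteq> 0 \<Longrightarrow> gker s z = \<kappa> + c * gmix s {0<..} z"
begin

lemma sets_mu [measurable_cong, simp]: "sets \<mu> = sets borel"
  by (subst mu_eq) simp

lemma space_mu [simp]: "space \<mu> = UNIV"
  by (subst mu_eq) simp

lemma measure_UNIV [simp]: "emeasure \<mu> UNIV = 1" "prob UNIV = 1"
  using emeasure_space_1 prob_space by simp_all

lemma dens_le:
  assumes [measurable]: "f \<in> borel_measurable borel"
  shows "(\<integral>\<^sup>+x. f x \<partial>\<mu>) \<le> ennreal B * (\<integral>\<^sup>+x. f x \<partial>lborel)"
proof -
  have "(\<integral>\<^sup>+x. f x \<partial>\<mu>) = (\<integral>\<^sup>+x. ennreal (\<rho> x) * f x \<partial>lborel)"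
    by (subst mu_eq, subst nn_integral_density) auto
  also have "\<dots> \<le> (\<integral>\<^sup>+x. ennreal B * f x \<partial>lborel)"
    using rho_bd by (intro nn_integral_mono_AE) (auto elim!: eventually_mono intro!: mult_right_mono ennreal_leI)
  also have "\<dots> = ennreal B * (\<integral>\<^sup>+x. f x \<partial>lborel)" by (rule nn_integral_cmult) simp
  finally show ?thesis .
qed

text \<open>Reflection and translation invariance of Lebesgue measure make the bound uniform in x,
  so the rows of the tail are controlled at every point and not only on average.\<close>

lemma conv_le:
  assumes [measurable]: "f \<in> borel_measurable borel"
  shows "(\<integral>\<^sup>+y. f (x - y) \<partial>\<mu>) \<le> ennreal B * (\<integral>\<^sup>+z. f z \<partial>lborel)"
proof -
  have "(\<integral>\<^sup>+z. f z \<partial>lborel) = (\<integral>\<^sup>+z. f z \<partial>density (distr lborel borel (\<lambda>y. x + (-1) *\<^sub>R y)) (\<lambda>_. ennreal (\<bar>- 1\<bar> ^ DIM('a))))"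
    by (subst lborel_affine[of "-1" x]) auto
  also have "\<dots> = (\<integral>\<^sup>+y. f (x - y) \<partial>lborel)"
    by (subst nn_integral_density) (auto simp: nn_integral_distr)
  finally show ?thesis using dens_le[of "\<lambda>y. f (x - y)"] by simp
qed

lemma AE_neq: "AE y in \<mu>. y \<noteq> x"
proof -
  have "(\<integral>\<^sup>+y. indicator {x} y \<partial>\<mu>) \<le> ennreal B * (\<integral>\<^sup>+y. indicator {x} y \<partial>lborel)"
    by (rule dens_le) simp
  then have "emeasure \<mu> {x} = 0" by simp
  then show ?thesis by (intro AE_I[of _ _ "{x}"]) auto
qed

lemma AE_pair_neq: "AE z in \<mu> \<Otimes>\<^sub>M \<mu>. fst z \<noteq> snd z"
proof -
  interpret PP: pair_prob_space \<mu> \<mu> ..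
  have "AE z in \<mu> \<Otimes>\<^sub>M \<mu>. norm (fst z - snd z) \<noteq> 0"
  proof (rule PP.AE_pair_measure)
    show "AE x in \<mu>. AE y in \<mu>. norm (fst (x, y) - snd (x, y)) \<noteq> 0"
    proof (rule AE_I2)
      fix x
      show "AE y in \<mu>. norm (fst (x, y) - snd (x, y)) \<noteq> 0"
        using AE_neq[of x] by eventually_elim auto
    qed
  qed measurable
  then show ?thesis by eventually_elim auto
qed

definition gx :: "real set \<Rightarrow> 'a \<Rightarrow> 'a \<Rightarrow> real" where "gx A x y = gmix s A (x - y)"

lemma gx_sym: "gx A x y = gx A y x"
  unfolding gx_def using gmix_minus[of s A "x - y"] by simp

lemma measurable_gx [measurable]:
  assumes [measurable]: "A \<in> sets borel" shows "(\<lambda>(x, y). gx A x y) \<in> borel_measurable (\<mu> \<Otimes>\<^sub>M \<mu>)"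
  unfolding gx_def by measurable

lemma measurable_gx1 [measurable]:
  assumes [measurable]: "A \<in> sets borel" shows "gx A x \<in> borel_measurable \<mu>"
  unfolding gx_def by measurable

text \<open>\<open>T1\<close> bounds the integral of every tail row and \<open>T2\<close> the
  integral of its square; both are fixed multiples of negative powers of b.\<close>

definition T1 :: "real \<Rightarrow> real" where
  "T1 b = B * (sqrt pi ^ DIM('a) * (b powr (s - DIM('a)) / (DIM('a) - s)))"

definition T2 :: "real \<Rightarrow> real" where
  "T2 b = B * (sqrt pi ^ DIM('a) * (b powr (s - DIM('a) / 2) / (DIM('a) / 2 - s))\<^sup>2)"

lemma T_nonneg: "0 \<le> T1 b" "0 \<le> T2 b"
proof -
  have "0 \<le> real DIM('a) - s" using s0 s1 by simp
  then show "0 \<le> T1 b" using B0 unfolding T1_def by (intro mult_nonneg_nonneg divide_nonneg_nonneg) auto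
  show "0 \<le> T2 b" using B0 unfolding T2_def by (intro mult_nonneg_nonneg) auto
qed

lemma T_lim: "(T1 \<longlongrightarrow> 0) at_top" "(T2 \<longlongrightarrow> 0) at_top"
proof -
  have d: "0 < real DIM('a)" by simp
  have 1: "((\<lambda>b::real. b powr (s - DIM('a))) \<longlongrightarrow> 0) at_top"
    using s0 s1 d by (intro tendsto_neg_powr filterlim_ident) linarith
  have 2: "((\<lambda>b::real. b powr (s - DIM('a) / 2)) \<longlongrightarrow> 0) at_top"
    using s1 by (intro tendsto_neg_powr filterlim_ident) linarith
  have "(T1 \<longlongrightarrow> B * (sqrt pi ^ DIM('a) * (0 / (DIM('a) - s)))) at_top"
    unfolding T1_def[abs_def] using s0 s1 d by (intro tendsto_intros 1) linarith
  then show "(T1 \<longlongrightarrow> 0) at_top" by simp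
  have "(T2 \<longlongrightarrow> B * (sqrt pi ^ DIM('a) * (0 / (DIM('a) / 2 - s))\<^sup>2)) at_top"
    unfolding T2_def[abs_def] using s1 by (intro tendsto_intros 2) linarith
  then show "(T2 \<longlongrightarrow> 0) at_top" by simp
qed

lemma tail_nn1:
  assumes b: "1 \<le> b" shows "(\<integral>\<^sup>+y. ennreal (gx {b..} x y) \<partial>\<mu>) \<le> ennreal (T1 b)"
proof -
  have "(\<integral>\<^sup>+y. ennreal (gx {b..} x y) \<partial>\<mu>) \<le> (\<integral>\<^sup>+y. gtail s b (x - y) \<partial>\<mu>)"
    unfolding gx_def by (intro nn_integral_mono gmix_le_gtail b)
  also have "\<dots> \<le> ennreal B * (\<integral>\<^sup>+(z::'a). gtail s b z \<partial>lborel)" by (rule conv_le) simp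
  also have "\<dots> = ennreal (T1 b)"
  proof -
    have d: "s < real DIM('a)" using s0 s1 by simp
    have m3: "ennreal a * (ennreal b * ennreal c) = ennreal (a * (b * c))" if "0 \<le> a" "0 \<le> b" "0 \<le> c" for a b c
      using that by (simp add: ennreal_mult)
    have "0 \<le> b powr (s - DIM('a)) / (DIM('a) - s)" using d by simp
    then show ?thesis
      unfolding T1_def nn_integral_gtail[OF d less_le_trans[OF zero_less_one b]]
      using B0 by (intro m3) auto
  qed
  finally show ?thesis .
qed

lemma tail_nn2:
  assumes b: "1 \<le> b" shows "sqn \<mu> (gx {b..} x) \<le> ennreal (T2 b)"
proof -
  have "sqn \<mu> (gx {b..} x) \<le> (\<integral>\<^sup>+y. (gtail s b (x - y))\<^sup>2 \<partial>\<mu>)"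
    unfolding sqn_def gx_def
  proof (rule nn_integral_mono)
    fix y
    have "ennreal ((gmix s {b..} (x - y))\<^sup>2) = (ennreal (gmix s {b..} (x - y)))\<^sup>2"
      by (rule ennreal_power[symmetric]) (rule gmix_le_gtail(1)[OF b])
    also have "\<dots> \<le> (gtail s b (x - y))\<^sup>2" by (intro power_mono gmix_le_gtail b) auto
    finally show "ennreal ((gmix s {b..} (x - y))\<^sup>2) \<le> (gtail s b (x - y))\<^sup>2" .
  qed
  also have "\<dots> \<le> ennreal B * (\<integral>\<^sup>+(z::'a). (gtail s b z)\<^sup>2 \<partial>lborel)" by (rule conv_le) simp
  also have "\<dots> \<le> ennreal B * (ennreal (sqrt pi ^ DIM('a)) * (ennreal (b powr (s - DIM('a) / 2) / (DIM('a) / 2 - s)))\<^sup>2)"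
    using s1 b by (intro mult_left_mono nn_integral_gtail_sq) auto
  also have "\<dots> = ennreal (T2 b)"
    using s1 B0 unfolding T2_def by (simp add: ennreal_mult ennreal_power)
  finally show ?thesis .
qed

lemma tail_nonneg: "1 \<le> b \<Longrightarrow> 0 \<le> gx {b..} x y"
  unfolding gx_def by (rule gmix_le_gtail)

lemma tail_integrable:
  assumes b: "1 \<le> b"
  shows "integrable \<mu> (gx {b..} x)" "0 \<le> (\<integral>y. gx {b..} x y \<partial>\<mu>)" "(\<integral>y. gx {b..} x y \<partial>\<mu>) \<le> T1 b"
proof -
  have "(\<integral>\<^sup>+y. ennreal (gx {b..} x y) \<partial>\<mu>) < \<infinity>" using tail_nn1[OF b] by (rule le_less_trans) simp
  then show i: "integrable \<mu> (gx {b..} x)" using tail_nonneg[OF b] by (intro integrableI_nonneg) auto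
  show "0 \<le> (\<integral>y. gx {b..} x y \<partial>\<mu>)" using tail_nonneg[OF b] by simp
  have "ennreal (\<integral>y. gx {b..} x y \<partial>\<mu>) \<le> ennreal (T1 b)"
    using tail_nn1[OF b, of x] nn_integral_eq_integral[OF i] tail_nonneg[OF b] by simp
  then show "(\<integral>y. gx {b..} x y \<partial>\<mu>) \<le> T1 b" using T_nonneg by simp
qed

lemma tail_pair:
  assumes b: "1 \<le> b"
  shows "sqn (\<mu> \<Otimes>\<^sub>M \<mu>) (case_prod (gx {b..})) \<le> ennreal (T2 b)"
    and "integrable (\<mu> \<Otimes>\<^sub>M \<mu>) (case_prod (gx {b..}))"
    and "0 \<le> (\<integral>(x, y). gx {b..} x y \<partial>(\<mu> \<Otimes>\<^sub>M \<mu>))"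
proof -
  interpret PP: pair_prob_space \<mu> \<mu> ..
  have "sqn (\<mu> \<Otimes>\<^sub>M \<mu>) (case_prod (gx {b..})) = (\<integral>\<^sup>+x. sqn \<mu> (gx {b..} x) \<partial>\<mu>)"
    unfolding sqn_def by (subst nn_integral_fst[symmetric]) (auto simp: split_beta)
  also have "\<dots> \<le> (\<integral>\<^sup>+x. ennreal (T2 b) \<partial>\<mu>)" by (intro nn_integral_mono tail_nn2 b)
  finally show 1: "sqn (\<mu> \<Otimes>\<^sub>M \<mu>) (case_prod (gx {b..})) \<le> ennreal (T2 b)" by (simp add: emeasure_space_1)
  have "case_prod (gx {b..}) \<in> L2 (\<mu> \<Otimes>\<^sub>M \<mu>)" using 1 by (auto simp: L2_iff_sqn intro: le_less_trans)
  then show "integrable (\<mu> \<Otimes>\<^sub>M \<mu>) (case_prod (gx {b..}))" by (rule PP.P.L2_integrable)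
  show "0 \<le> (\<integral>(x, y). gx {b..} x y \<partial>(\<mu> \<Otimes>\<^sub>M \<mu>))" using tail_nonneg[OF b] by (intro integral_nonneg_AE AE_I2) auto
qed

lemma gker_split_one: "x \<noteq> y \<Longrightarrow> gker s (x - y) = \<kappa> + c * (gx {0<..<1} x y + gx {1..} x y)"
  using gker_eq[of "x - y"] gmix_total(2)[OF s0 order_refl, of "x - y"] by (simp add: gx_def)

lemma AE_low_eq:
  "AE z in \<mu> \<Otimes>\<^sub>M \<mu>. case_prod (gx {0<..<1}) z = ((case z of (x, y) \<Rightarrow> gker s (x - y)) - \<kappa>) / c - case_prod (gx {1..}) z"
  using AE_pair_neq by eventually_elim (use c0 in \<open>auto simp: gker_split_one split_beta\<close>)

lemma measurable_gker_diff [measurable]: "(\<lambda>(x, y). gker s (x - y)) \<in> borel_measurable (\<mu> \<Otimes>\<^sub>M \<mu>)"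
  unfolding gker_def by measurable

lemma low_integrable_of_gker:
  assumes g: "integrable (\<mu> \<Otimes>\<^sub>M \<mu>) (\<lambda>(x, y). gker s (x - y))"
  shows "integrable (\<mu> \<Otimes>\<^sub>M \<mu>) (\<lambda>(x, y). gx {0<..<1} x y)"
proof (rule integrable_cong_AE_imp)
  interpret PP: pair_prob_space \<mu> \<mu> ..
  show "integrable (\<mu> \<Otimes>\<^sub>M \<mu>) (\<lambda>z. ((case z of (x, y) \<Rightarrow> gker s (x - y)) - \<kappa>) / c - case_prod (gx {1..}) z)"
    by (intro Bochner_Integration.integrable_diff integrable_divide_zero g tail_pair(2)) auto
  show "AE z in \<mu> \<Otimes>\<^sub>M \<mu>. ((case z of (x, y) \<Rightarrow> gker s (x - y)) - \<kappa>) / c - case_prod (gx {1..}) z = (case z of (x, y) \<Rightarrow> gx {0<..<1} x y)"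
    using AE_low_eq by eventually_elim simp
qed measurable

lemma low_integrable_pos:
  assumes "0 < s" shows "integrable (\<mu> \<Otimes>\<^sub>M \<mu>) (\<lambda>(x, y). gx {0<..<1} x y)"
proof -
  interpret PP: pair_prob_space \<mu> \<mu> ..
  show ?thesis
  proof (rule PP.P.integrable_const_bound[where B="1 / s"])
    show "AE z in \<mu> \<Otimes>\<^sub>M \<mu>. norm (case z of (x, y) \<Rightarrow> gx {0<..<1} x y) \<le> 1 / s"
    proof (rule AE_I2)
      fix z :: "'a \<times> 'a"
      show "norm (case z of (x, y) \<Rightarrow> gx {0<..<1} x y) \<le> 1 / s"
        using gmix_low_bounded[OF assms, of "fst z - snd z"] by (simp add: gx_def split_beta)
    qed
  qed simp
qed

end

text \<open>A first moment condition common to both cases: the small t part is bounded for s > 0,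
  and for s = 0 it inherits integrability from the logarithmic moment.\<close>

locale riesz_measure = riesz_base +
  assumes low_pair: "integrable (\<mu> \<Otimes>\<^sub>M \<mu>) (\<lambda>(x, y). gx {0<..<1} x y)"
begin

text \<open>At other points a row integral takes the conventional value 0, so the decomposition of
  \<open>hpot\<close> is stated on these only; they have full measure.\<close>

definition good :: "'a \<Rightarrow> bool" where "good x \<longleftrightarrow> integrable \<mu> (gx {0<..<1} x)"

lemma AE_good: "AE x in \<mu>. good x"
proof -
  interpret PP: pair_prob_space \<mu> \<mu> ..
  show ?thesis using PP.AE_integrable_fst'[OF low_pair] by (simp add: good_def)
qed

lemma mid_bounded: "\<exists>C. \<forall>x y. \<bar>gx {1..<b} x y\<bar> \<le> C"
  unfolding gx_def using gint_middle(2)[of "{1..<b}" 1 b s] by auto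

lemma mid_integrable: "integrable \<mu> (gx {1..<b} x)" "integrable (\<mu> \<Otimes>\<^sub>M \<mu>) (case_prod (gx {1..<b}))"
proof -
  interpret PP: pair_prob_space \<mu> \<mu> ..
  obtain C where C: "\<And>x y. \<bar>gx {1..<b} x y\<bar> \<le> C" using mid_bounded by blast
  show "integrable \<mu> (gx {1..<b} x)" by (rule integrable_const_bound[where B=C]) (use C in auto)
  show "integrable (\<mu> \<Otimes>\<^sub>M \<mu>) (case_prod (gx {1..<b}))"
    by (rule PP.P.integrable_const_bound[where B=C]) (use C in auto)
qed

lemma gx_low_mid: "1 \<le> b \<Longrightarrow> gx {0<..<b} x y = gx {0<..<1} x y + gx {1..<b} x y"
  unfolding gx_def using gint_low_middle(2)[OF s0] by auto

lemma lowb_integrable: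
  assumes "1 \<le> b"
  shows "good x \<Longrightarrow> integrable \<mu> (gx {0<..<b} x)" "integrable (\<mu> \<Otimes>\<^sub>M \<mu>) (case_prod (gx {0<..<b}))"
proof -
  have e: "gx {0<..<b} = (\<lambda>x y. gx {0<..<1} x y + gx {1..<b} x y)" using gx_low_mid[OF assms] by auto
  show "integrable \<mu> (gx {0<..<b} x)" if "good x"
    unfolding e using that mid_integrable(1)[of b x] by (simp add: good_def)
  show "integrable (\<mu> \<Otimes>\<^sub>M \<mu>) (case_prod (gx {0<..<b}))"
    unfolding e using low_pair mid_integrable(2)[of b] by (simp add: split_beta')
qed

lemma gker_split:
  assumes "1 \<le> b" "x \<noteq> y"
  shows "gker s (x - y) = \<kappa> + c * (gx {0<..<b} x y + gx {b..} x y)"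
  using gker_eq[of "x - y"] gmix_total(2)[OF s0 assms(1), of "x - y"] assms by (simp add: gx_def)

lemma hpot_split:
  assumes b: "1 \<le> b" and g: "good x"
  shows "hpot s \<mu> x = \<kappa> + c * ((\<integral>y. gx {0<..<b} x y \<partial>\<mu>) + (\<integral>y. gx {b..} x y \<partial>\<mu>))"
proof -
  have [measurable]: "(\<lambda>y. gker s (x - y)) \<in> borel_measurable \<mu>" unfolding gker_def by measurable
  have "hpot s \<mu> x = (\<integral>y. \<kappa> + c * (gx {0<..<b} x y + gx {b..} x y) \<partial>\<mu>)"
    unfolding hpot_def using AE_neq[of x]
    by (intro integral_cong_AE) (auto elim!: eventually_mono simp: gker_split[OF b])
  then show ?thesis
    using lowb_integrable(1)[OF b g] tail_integrable(1)[OF b, of x] by (simp add: prob_space)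
qed

lemma Ien_split:
  assumes b: "1 \<le> b"
  shows "2 * Ien s \<mu> = \<kappa> + c * ((\<integral>(x, y). gx {0<..<b} x y \<partial>(\<mu> \<Otimes>\<^sub>M \<mu>)) + (\<integral>(x, y). gx {b..} x y \<partial>(\<mu> \<Otimes>\<^sub>M \<mu>)))"
    and "integrable (\<mu> \<Otimes>\<^sub>M \<mu>) (\<lambda>(x, y). gker s (x - y))"
proof -
  interpret PP: pair_prob_space \<mu> \<mu> ..
  have [measurable]: "(\<lambda>(x, y). gker s (x - y)) \<in> borel_measurable (\<mu> \<Otimes>\<^sub>M \<mu>)" unfolding gker_def by measurable
  have ae: "AE z in \<mu> \<Otimes>\<^sub>M \<mu>. (case z of (x, y) \<Rightarrow> gker s (x - y)) = \<kappa> + c * (case_prod (gx {0<..<b}) z + case_prod (gx {b..}) z)"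
    using AE_pair_neq by eventually_elim (auto simp: gker_split[OF b] split_beta)
  have i: "integrable (\<mu> \<Otimes>\<^sub>M \<mu>) (\<lambda>z. \<kappa> + c * (case_prod (gx {0<..<b}) z + case_prod (gx {b..}) z))"
    using lowb_integrable(2)[OF b] tail_pair(2)[OF b] by (simp add: split_beta')
  show "integrable (\<mu> \<Otimes>\<^sub>M \<mu>) (\<lambda>(x, y). gker s (x - y))"
    by (rule integrable_cong_AE_imp[OF i]) (use ae in \<open>auto elim!: eventually_mono\<close>)
  have "2 * Ien s \<mu> = (\<integral>z. \<kappa> + c * (case_prod (gx {0<..<b}) z + case_prod (gx {b..}) z) \<partial>(\<mu> \<Otimes>\<^sub>M \<mu>))"
    unfolding Ien_def using ae by (simp, intro integral_cong_AE) auto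
  also have "\<dots> = \<kappa> + c * ((\<integral>(x, y). gx {0<..<b} x y \<partial>(\<mu> \<Otimes>\<^sub>M \<mu>)) + (\<integral>(x, y). gx {b..} x y \<partial>(\<mu> \<Otimes>\<^sub>M \<mu>)))"
    using lowb_integrable(2)[OF b] tail_pair(2)[OF b] by (simp add: PP.P.prob_space split_beta')
  finally show "2 * Ien s \<mu> = \<kappa> + c * ((\<integral>(x, y). gx {0<..<b} x y \<partial>(\<mu> \<Otimes>\<^sub>M \<mu>)) + (\<integral>(x, y). gx {b..} x y \<partial>(\<mu> \<Otimes>\<^sub>M \<mu>)))" .
qed

text \<open>The constant \<open>\<kappa>\<close> occurs with the signs +, -, -, + and cancels, so
  off the diagonal the centred interaction is \<open>c\<close> times a centred mixture.\<close>

lemma gtilde_split: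
  assumes b: "1 \<le> b" and x: "good x" and y: "good y" and xy: "x \<noteq> y"
  shows "gtilde s \<mu> x y = c * (cen (gx {0<..<b}) x y + cen (gx {b..}) x y)"
  unfolding gtilde_def cen_def hpot_split[OF b x] hpot_split[OF b y] Ien_split(1)[OF b] gker_split[OF b xy]
  by (simp add: algebra_simps)

lemma gtilde_eq_cen: "gtilde s \<mu> = cen (\<lambda>x y. gker s (x - y))"
  by (intro ext) (simp add: gtilde_def cen_def hpot_def Ien_def)

lemma gker_sym: "gker s (x - y) = gker s (y - x)"
  by (simp add: gker_def norm_minus_commute)

lemma gtilde_sym: "gtilde s \<mu> x y = gtilde s \<mu> y x"
  unfolding gtilde_eq_cen by (rule cen_sym) (rule gker_sym)

lemma measurable_gtilde [measurable]: "(\<lambda>(x, y). gtilde s \<mu> x y) \<in> borel_measurable (\<mu> \<Otimes>\<^sub>M \<mu>)"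
proof -
  have [measurable]: "(\<lambda>(x, y). gker s (x - y)) \<in> borel_measurable (\<mu> \<Otimes>\<^sub>M \<mu>)" unfolding gker_def by measurable
  show ?thesis unfolding gtilde_eq_cen by measurable
qed

lemma measurable_hpot [measurable]: "hpot s \<mu> \<in> borel_measurable \<mu>"
proof -
  have [measurable]: "(\<lambda>(x, y). gker s (x - y)) \<in> borel_measurable (\<mu> \<Otimes>\<^sub>M \<mu>)" unfolding gker_def by measurable
  show ?thesis unfolding hpot_def by measurable
qed

lemma gtilde_centred: "AE x in \<mu>. (\<integral>y. gtilde s \<mu> x y \<partial>\<mu>) = 0"
proof -
  interpret PP: pair_prob_space \<mu> \<mu> ..
  have i: "integrable (\<mu> \<Otimes>\<^sub>M \<mu>) (\<lambda>(x, y). gker s (x - y))" by (rule Ien_split(2)[OF order_refl])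
  have "AE x in \<mu>. integrable \<mu> (\<lambda>y. gker s (x - y))" using PP.AE_integrable_fst'[OF i] by simp
  then show ?thesis
    unfolding gtilde_eq_cen by eventually_elim (rule integral_cen[OF i])
qed

lemma integral_hpot: "(\<integral>x. hpot s \<mu> x \<partial>\<mu>) = 2 * Ien s \<mu>"
proof -
  interpret PP: pair_prob_space \<mu> \<mu> ..
  show ?thesis
    unfolding hpot_def Ien_def using PP.integral_fst'[OF Ien_split(2)[OF order_refl]] by simp
qed

text \<open>The addition formula splits the cosine of a phase difference into a product of cosines
  and a product of sines, hence two bounded mixtures. The constant \<open>k\<close> collects the
  subtracted indicator and is removed by centring.\<close>

lemma gx_mixture:
  assumes a: "0 < a" "a < b"
  shows "\<exists>(\<Lambda> :: (real \<times> ('a \<Rightarrow> real)) measure) v1 v2 k.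
     bounded_mixture \<mu> \<Lambda> v1 \<and> bounded_mixture \<mu> \<Lambda> v2 \<and>
     gx {a..<b} = (\<lambda>x y. (bounded_mixture.mixk \<Lambda> v1 x y + bounded_mixture.mixk \<Lambda> v2 x y) + k)"
proof -
  let ?\<nu> = "scale_measure_on s {a..<b}"
  define \<Lambda> where "\<Lambda> = ?\<nu> \<Otimes>\<^sub>M (gauss_dir :: ('a \<Rightarrow> real) measure)"
  interpret nu: finite_measure ?\<nu> by (rule finite_scale_measure_on[OF a])
  interpret G: prob_space "gauss_dir :: ('a \<Rightarrow> real) measure" by (rule prob_space_gauss_dir)
  interpret NG: pair_sigma_finite ?\<nu> "gauss_dir :: ('a \<Rightarrow> real) measure" ..
  interpret Lf: finite_measure \<Lambda>
    unfolding \<Lambda>_def by (intro finite_measure_pair_measure nu.finite_measure_axioms G.finite_measure_axioms)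
  have sL [measurable_cong]: "sets \<Lambda> = sets (borel \<Otimes>\<^sub>M (gauss_dir :: ('a \<Rightarrow> real) measure))"
    unfolding \<Lambda>_def by (intro sets_pair_measure_cong) auto
  define v1 v2 where "v1 w x = cos (phase w x)" and "v2 w x = sin (phase w x)" for w and x :: 'a
  have m: "(\<lambda>(w, x). phase w x) \<in> borel_measurable (\<Lambda> \<Otimes>\<^sub>M \<mu>)" by measurable
  have b1: "bounded_mixture \<mu> \<Lambda> v1" "bounded_mixture \<mu> \<Lambda> v2"
    unfolding bounded_mixture_def bounded_mixture_axioms_def v1_def v2_def
    using m prob_space_axioms Lf.finite_measure_axioms by (auto simp: split_beta')
  interpret V1: bounded_mixture \<mu> \<Lambda> v1 by (rule b1)
  interpret V2: bounded_mixture \<mu> \<Lambda> v2 by (rule b1)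
  define k where "k = - (\<integral>t. indicator {a..<b} t * (t powr (s - 1) * indicator {..<1} t) \<partial>lborel)"
  have "gx {a..<b} x y = (V1.mixk x y + V2.mixk x y) + k" for x y
  proof -
    have mx: "(\<lambda>w. phase w z) \<in> borel_measurable \<Lambda>" for z :: 'a
    proof -
      have "(\<lambda>w. (w, z)) \<in> measurable \<Lambda> (\<Lambda> \<Otimes>\<^sub>M \<mu>)" by measurable
      from measurable_compose[OF this m] show ?thesis by simp
    qed
    have i1: "integrable \<Lambda> (\<lambda>w. v1 w x * v1 w y)" "integrable \<Lambda> (\<lambda>w. v2 w x * v2 w y)"
      using mx[of x] mx[of y] V1.vv_bd V2.vv_bd
      by (auto intro!: Lf.integrable_const_bound[where B=1] simp: v1_def v2_def)
    have ic: "integrable \<Lambda> (\<lambda>w. cos (phase w (x - y)))"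
      using mx[of "x - y"] by (auto intro!: Lf.integrable_const_bound[where B=1])
    have "V1.mixk x y + V2.mixk x y = (\<integral>w. v1 w x * v1 w y + v2 w x * v2 w y \<partial>\<Lambda>)"
      unfolding V1.mixk_def V2.mixk_def using i1 by simp
    also have "\<dots> = (\<integral>w. cos (phase w (x - y)) \<partial>\<Lambda>)"
      by (intro Bochner_Integration.integral_cong refl) (simp add: v1_def v2_def cos_diff phase_diff[symmetric])
    also have "\<dots> = (\<integral>t. (\<integral>\<xi>. cos (phase (t, \<xi>) (x - y)) \<partial>gauss_dir) \<partial>?\<nu>)"
      using NG.integral_fst'[OF ic[unfolded \<Lambda>_def]] by (simp add: \<Lambda>_def)
    also have "\<dots> = (\<integral>t. exp (- (t * norm (x - y))\<^sup>2) \<partial>?\<nu>)"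
      unfolding integral_cos_phase ..
    also have "\<dots> = (\<integral>t. indicator {a..<b} t * t powr (s - 1) * exp (- (t * norm (x - y))\<^sup>2) \<partial>lborel)"
      unfolding scale_measure_on_def by (subst integral_density) auto
    finally have 1: "V1.mixk x y + V2.mixk x y = (\<integral>t. indicator {a..<b} t * t powr (s - 1) * exp (- (t * norm (x - y))\<^sup>2) \<partial>lborel)" .
    have gi: "integrable lborel (\<lambda>t. indicator {a..<b} t * (t powr (s - 1) * gd t (x - y)))"
      using gint_middle(1)[of "{a..<b}" a b s "x - y"] a by (simp add: gint_def)
    have ki: "integrable lborel (\<lambda>t. indicator {a..<b} t * (t powr (s - 1) * indicator {..<1} t) :: real)"
    proof (rule Bochner_Integration.integrable_bound)
      have c: "continuous_on {a..b} (\<lambda>t. t powr (s - 1))" using a by (intro continuous_intros) auto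
      show "integrable lborel (\<lambda>t. indicator {a..b} t * t powr (s - 1))"
        using borel_integrable_atLeastAtMost'[OF c] by (simp add: set_integrable_def)
    qed (auto intro!: AE_I2 simp: indicator_def)
    have "gx {a..<b} x y - k = (\<integral>t. indicator {a..<b} t * (t powr (s - 1) * gd t (x - y)) + indicator {a..<b} t * (t powr (s - 1) * indicator {..<1} t) \<partial>lborel)"
      unfolding gx_def gmix_def k_def using gi ki by simp
    also have "\<dots> = (\<integral>t. indicator {a..<b} t * t powr (s - 1) * exp (- (t * norm (x - y))\<^sup>2) \<partial>lborel)"
      by (intro Bochner_Integration.integral_cong refl) (simp add: gd_def algebra_simps)
    finally show ?thesis using 1 by simp
  qed
  then have "gx {a..<b} = (\<lambda>x y. (V1.mixk x y + V2.mixk x y) + k)" by blast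
  then show ?thesis using b1 by blast
qed

text \<open>Positivity and approximability of the middle range are both read off from its
  representation by the two mixtures.\<close>

lemma gx_mid_cen:
  assumes a: "0 < a" "a < b"
  shows "0 \<le> (\<Sum>i<N. \<Sum>j<N. cen (gx {a..<b}) (X i) (X j))" "sos_approximable \<mu> (cen (gx {a..<b}))"
proof -
  obtain \<Lambda> :: "(real \<times> ('a \<Rightarrow> real)) measure" and v1 v2 k where
    V: "bounded_mixture \<mu> \<Lambda> v1" "bounded_mixture \<mu> \<Lambda> v2"
    and g: "gx {a..<b} = (\<lambda>x y. (bounded_mixture.mixk \<Lambda> v1 x y + bounded_mixture.mixk \<Lambda> v2 x y) + k)"
    using gx_mixture[OF a] by blast
  interpret V1: bounded_mixture \<mu> \<Lambda> v1 by (rule V)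
  interpret V2: bounded_mixture \<mu> \<Lambda> v2 by (rule V)
  have e: "cen (gx {a..<b}) x y = cen V1.mixk x y + cen V2.mixk x y" for x y
  proof -
    have i: "integrable \<mu> (V1.mixk x)" "integrable \<mu> (V2.mixk x)" for x
      by (auto intro: V1.mixk_integrable V2.mixk_integrable)
    have ip: "integrable (\<mu> \<Otimes>\<^sub>M \<mu>) (\<lambda>(x, y). V1.mixk x y + V2.mixk x y)"
      using V1.mixk_integrable(1) V2.mixk_integrable(1) by (simp add: split_beta')
    have "cen (gx {a..<b}) x y = cen (\<lambda>x y. V1.mixk x y + V2.mixk x y) x y"
      unfolding g by (rule cen_add_const) (use i ip in auto)
    also have "\<dots> = cen V1.mixk x y + cen V2.mixk x y"
      by (rule cen_add) (use i V1.mixk_integrable(1) V2.mixk_integrable(1) in auto)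
    finally show ?thesis .
  qed
  show "0 \<le> (\<Sum>i<N. \<Sum>j<N. cen (gx {a..<b}) (X i) (X j))"
    unfolding e sum.distrib by (intro add_nonneg_nonneg V1.cen_mixk_psd V2.cen_mixk_psd) auto
  have e': "cen (gx {a..<b}) = (\<lambda>x y. cen V1.mixk x y + cen V2.mixk x y)" using e by blast
  show "sos_approximable \<mu> (cen (gx {a..<b}))"
    unfolding e' by (intro sos_approximable_add V1.cen_mixk_approximable V2.cen_mixk_approximable)
qed

end

section \<open>Uniform integrability and approximation of the interaction\<close>

context riesz_measure
begin

text \<open>Positivity on ranges bounded away from 0 passes to the limit in the lower cut-off. The
  points must be good for their row integrals to converge; they may coincide, because the mixture
  without its tail is finite on the diagonal.\<close>

lemma cen_low_psd:
  assumes b: "1 \<le> b" and X: "\<And>i. i < N \<Longrightarrow> good (X i)"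
  shows "0 \<le> (\<Sum>i<N. \<Sum>j<N. cen (gx {0<..<b}) (X i) (X j))"
proof -
  \<comment> \<open>The double \<open>Suc\<close> keeps \<open>a n\<close> strictly below 1, hence
    below b even when b = 1.\<close>
  define a where "a n = 1 / real (Suc (Suc n))" for n
  have a: "0 < a n" "a n < b" for n
  proof -
    show "0 < a n" by (simp add: a_def)
    have "a n < 1" by (simp add: a_def)
    then show "a n < b" using b by linarith
  qed
  define Cb where "Cb = (1 powr (s - 1) + b powr (s - 1)) * measure lborel {1..b}"
  have lim: "(\<lambda>n. gx {a n..<b} x y) \<longlonglongrightarrow> gx {0<..<b} x y" for x y
    unfolding gx_def a_def using gmix_lower_limit(1)[OF s0 b, of "x - y"] by (rule LIMSEQ_Suc)
  have bd: "\<bar>gx {a n..<b} x y\<bar> \<le> \<bar>gx {0<..<1} x y\<bar> + Cb" for n x y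
    unfolding gx_def a_def Cb_def by (rule gmix_lower_limit(2)[OF s0 b])
  interpret PP: pair_prob_space \<mu> \<mu> ..
  have l1: "(\<lambda>n. \<integral>z. gx {a n..<b} x z \<partial>\<mu>) \<longlonglongrightarrow> (\<integral>z. gx {0<..<b} x z \<partial>\<mu>)" if "good x" for x
    by (rule integral_dominated_convergence[where w="\<lambda>z. \<bar>gx {0<..<1} x z\<bar> + Cb"])
       (use that lim bd in \<open>auto simp: good_def intro!: integrable_abs\<close>)
  have l2: "(\<lambda>n. \<integral>(x, y). gx {a n..<b} x y \<partial>(\<mu> \<Otimes>\<^sub>M \<mu>)) \<longlonglongrightarrow> (\<integral>(x, y). gx {0<..<b} x y \<partial>(\<mu> \<Otimes>\<^sub>M \<mu>))"
  proof (rule integral_dominated_convergence[where w="\<lambda>z. \<bar>case_prod (gx {0<..<1}) z\<bar> + Cb"])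
    show "integrable (\<mu> \<Otimes>\<^sub>M \<mu>) (\<lambda>z. \<bar>case_prod (gx {0<..<1}) z\<bar> + Cb)"
      using low_pair by (intro Bochner_Integration.integrable_add integrable_abs) auto
    show "AE z in \<mu> \<Otimes>\<^sub>M \<mu>. norm (case_prod (gx {a n..<b}) z) \<le> \<bar>case_prod (gx {0<..<1}) z\<bar> + Cb" for n
      using bd by (intro AE_I2) (auto simp: split_beta)
  qed (use lim in \<open>auto simp: split_beta\<close>)
  have "(\<lambda>n. \<Sum>i<N. \<Sum>j<N. cen (gx {a n..<b}) (X i) (X j)) \<longlonglongrightarrow> (\<Sum>i<N. \<Sum>j<N. cen (gx {0<..<b}) (X i) (X j))"
    unfolding cen_def using X by (intro tendsto_sum tendsto_add tendsto_diff lim l1 l2) auto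
  then show ?thesis
    by (rule LIMSEQ_le_const) (use gx_mid_cen(1)[OF a] in blast)
qed

text \<open>On the diagonal the mixture is constant, and its row integral times \<open>c\<close> is
  the potential up to a constant and a bounded tail integral. The restored diagonal therefore
  carries -2 times the potential, which is what cancels the potential in the Gibbs exponent.\<close>

lemma cen_low_diag:
  assumes b: "1 \<le> b"
  shows "\<exists>D. \<forall>x. good x \<longrightarrow> c * cen (gx {0<..<b}) x x \<le> D - 2 * hpot s \<mu> x"
proof (intro exI allI impI)
  fix x assume x: "good x"
  let ?I = "\<integral>(x, y). gx {0<..<b} x y \<partial>(\<mu> \<Otimes>\<^sub>M \<mu>)"
  have h: "c * (\<integral>y. gx {0<..<b} x y \<partial>\<mu>) = hpot s \<mu> x - \<kappa> - c * (\<integral>y. gx {b..} x y \<partial>\<mu>)"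
    using hpot_split[OF b x] by (simp add: algebra_simps)
  have t: "c * (\<integral>y. gx {b..} x y \<partial>\<mu>) \<le> c * T1 b" using tail_integrable(3)[OF b] c0 by simp
  have "c * cen (gx {0<..<b}) x x = c * gmix s {0<..<b} (0::'a) - 2 * (c * (\<integral>y. gx {0<..<b} x y \<partial>\<mu>)) + c * ?I"
    unfolding cen_def gx_def by (simp add: algebra_simps)
  also have "\<dots> = c * gmix s {0<..<b} (0::'a) - 2 * (hpot s \<mu> x - \<kappa> - c * (\<integral>y. gx {b..} x y \<partial>\<mu>)) + c * ?I"
    unfolding h ..
  also have "\<dots> \<le> (c * gmix s {0<..<b} (0::'a) + 2 * \<kappa> + 2 * (c * T1 b) + c * ?I) - 2 * hpot s \<mu> x"
    using t by (simp add: algebra_simps)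
  finally show "c * cen (gx {0<..<b}) x x \<le> (c * gmix s {0<..<b} (0::'a) + 2 * \<kappa> + 2 * (c * T1 b) + c * ?I) - 2 * hpot s \<mu> x" .
qed

text \<open>The tail is nonnegative with row integrals between 0 and \<open>T1 b\<close>, so
  centring lowers it by at most \<open>2 * T1 b\<close>. From above it is controlled in L2 only,
  being singular near the diagonal.\<close>

lemma cen_tail_bounds:
  assumes b: "1 \<le> b"
  shows "- (2 * T1 b) \<le> cen (gx {b..}) x y" "sqn \<mu> (cen (gx {b..}) x) \<le> ennreal (2 * T2 b + 8 * (T1 b)\<^sup>2)"
    and "(\<integral>y. cen (gx {b..}) x y \<partial>\<mu>) = 0"
proof -
  interpret PP: pair_prob_space \<mu> \<mu> ..
  let ?I = "\<integral>(x, y). gx {b..} x y \<partial>(\<mu> \<Otimes>\<^sub>M \<mu>)"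
  have I1: "?I \<le> T1 b"
  proof -
    have "?I = (\<integral>x. (\<integral>y. gx {b..} x y \<partial>\<mu>) \<partial>\<mu>)" using PP.integral_fst[OF tail_pair(2)[OF b]] by simp
    also have "\<dots> \<le> T1 b"
      using PP.integrable_fst[OF tail_pair(2)[OF b]] tail_integrable(3)[OF b]
      by (intro integral_le_const) auto
    finally show ?thesis .
  qed
  define k where "k y = - (\<integral>z. gx {b..} x z \<partial>\<mu>) - (\<integral>z. gx {b..} y z \<partial>\<mu>) + ?I" for y
  have ck: "cen (gx {b..}) x y = gx {b..} x y + k y" for y by (simp add: cen_def k_def)
  have kb: "- (2 * T1 b) \<le> k y" "k y \<le> 2 * T1 b" for y
    using tail_integrable(2,3)[OF b, of x] tail_integrable(2,3)[OF b, of y] tail_pair(3)[OF b] I1 T_nonneg(1)[of b]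
    unfolding k_def by linarith+
  show "- (2 * T1 b) \<le> cen (gx {b..}) x y"
    unfolding ck using kb(1)[of y] tail_nonneg[OF b, of x y] by linarith
  have km [measurable]: "k \<in> borel_measurable \<mu>" unfolding k_def by measurable
  have "sqn \<mu> (cen (gx {b..}) x) = sqn \<mu> (\<lambda>y. gx {b..} x y + k y)" using ck by (simp add: sqn_def)
  also have "\<dots> \<le> 2 * sqn \<mu> (gx {b..} x) + 2 * sqn \<mu> k" by (rule sqn_add_le) measurable
  also have "\<dots> \<le> 2 * ennreal (T2 b) + 2 * ennreal ((2 * T1 b)\<^sup>2)"
  proof (intro add_mono mult_left_mono tail_nn2 b)
    have "sqn \<mu> k \<le> (\<integral>\<^sup>+y. ennreal ((2 * T1 b)\<^sup>2) \<partial>\<mu>)"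
      unfolding sqn_def
    proof (intro nn_integral_mono ennreal_leI)
      fix y
      have "\<bar>k y\<bar> \<le> 2 * T1 b" using kb[of y] by linarith
      then show "(k y)\<^sup>2 \<le> (2 * T1 b)\<^sup>2" by (metis abs_ge_zero power2_abs power_mono)
    qed
    then show "sqn \<mu> k \<le> ennreal ((2 * T1 b)\<^sup>2)" by simp
  qed auto
  also have "\<dots> = ennreal (2 * T2 b) + ennreal (2 * (2 * T1 b)\<^sup>2)"
    using T_nonneg(2)[of b] by (simp add: ennreal_mult')
  also have "\<dots> = ennreal (2 * T2 b + 2 * (2 * T1 b)\<^sup>2)"
    using T_nonneg(2)[of b] by (intro ennreal_plus[symmetric]) auto
  also have "2 * T2 b + 2 * (2 * T1 b)\<^sup>2 = 2 * T2 b + 8 * (T1 b)\<^sup>2" by (simp add: power2_eq_square)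
  finally show "sqn \<mu> (cen (gx {b..}) x) \<le> ennreal (2 * T2 b + 8 * (T1 b)\<^sup>2)" .
  show "(\<integral>y. cen (gx {b..}) x y \<partial>\<mu>) = 0"
    by (rule integral_cen[OF tail_pair(2)[OF b] tail_integrable(1)[OF b]])
qed

lemma AE_configuration:
  "AE X in ipow \<mu> N. (\<forall>i<N. good (X i)) \<and> (\<forall>j<N. \<forall>i<j. X i \<noteq> X j)"
proof -
  have 1: "AE X in ipow \<mu> N. \<forall>i\<in>{..<N}. good (X i)"
    using AE_good by (intro AE_finite_allI) (auto intro: AE_PiM_component[of "{..<N}" "\<lambda>_. \<mu>"] prob_space_axioms)
  \<comment> \<open>Distinctness is phrased through the norm of a difference, a measurable condition
    on the product space.\<close>
  have 2: "AE X in ipow \<mu> N. \<forall>j\<in>{..<N}. \<forall>i\<in>{..<j}. norm (X i - X j) \<noteq> 0"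
  proof (induction N)
    case 0
    then show ?case by simp
  next
    case (Suc N)
    show ?case
    proof (rule AE_ipow_Suc)
      have [measurable]: "(\<lambda>X. X i) \<in> measurable (ipow \<mu> (Suc N)) \<mu>" if "i \<in> {..<Suc N}" for i
        using that by (rule measurable_component_singleton)
      have m: "Measurable.pred (ipow \<mu> (Suc N)) (\<lambda>X. norm (X i - X j) \<noteq> 0)" if "j \<in> {..<Suc N}" "i \<in> {..<j}" for i j
      proof -
        have "i \<in> {..<Suc N}" using that by auto
        then show ?thesis using that(1) by measurable
      qed
      show "Measurable.pred (ipow \<mu> (Suc N)) (\<lambda>X. \<forall>j\<in>{..<Suc N}. \<forall>i\<in>{..<j}. norm (X i - X j) \<noteq> 0)"
        by (intro pred_intros_finite m) auto
      show "AE X in ipow \<mu> N. AE x in \<mu>. \<forall>j\<in>{..<Suc N}. \<forall>i\<in>{..<j}. norm ((X(N := x)) i - (X(N := x)) j) \<noteq> 0"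
        using Suc
      proof eventually_elim
        case (elim X)
        have "AE x in \<mu>. \<forall>i\<in>{..<N}. x \<noteq> X i" by (intro AE_finite_allI AE_neq) auto
        then show ?case
        proof eventually_elim
          case (elim x)
          with \<open>\<forall>j\<in>{..<N}. \<forall>i\<in>{..<j}. norm (X i - X j) \<noteq> 0\<close> show ?case
            by (auto simp: less_Suc_eq)
        qed
      qed
    qed
  qed
  from 1 2 show ?thesis by eventually_elim auto
qed

text \<open>The doubled exponent asks for \<open>exp_ustat_bound\<close> with l = 2 on the tail, and
  this fixes the cut-off b. Below b the double sum with its diagonal is nonnegative, so -2 times the
  U-statistic is at most the diagonal sum; by \<open>cen_low_diag\<close> this sum cancels the
  potential term up to a constant per point, which the division by N makes uniform.\<close>

theorem exp_gibbs_bound: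
  assumes beta: "0 \<le> \<beta>"
  shows "\<exists>C. \<forall>N. (\<integral>\<^sup>+X. ennreal (exp (2 * gibbs_exponent \<mu> (\<lambda>x y. \<beta> * gtilde s \<mu> x y) (\<lambda>x. \<beta> * hpot s \<mu> x) N X)) \<partial>ipow \<mu> N) \<le> ennreal C"
proof -
  define k where "k = \<beta> * c"
  have k0: "0 \<le> k" using beta c0 by (simp add: k_def)
  \<comment> \<open>The conditions 2 l m <= 1 and 32 \<kappa> l^2 <= 1 of
    \<open>exp_ustat_bound\<close> hold for large b because \<open>T1\<close> and \<open>T2\<close>
    tend to 0.\<close>
  have "((\<lambda>b. 2 * 2 * (k * (2 * T1 b))) \<longlongrightarrow> 2 * 2 * (k * (2 * 0))) at_top"
    by (intro tendsto_intros T_lim)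
  then have e1: "\<forall>\<^sub>F b in at_top. 2 * 2 * (k * (2 * T1 b)) < 1" by (rule order_tendstoD) simp
  have "((\<lambda>b. 32 * (k\<^sup>2 * (2 * T2 b + 8 * (T1 b)\<^sup>2)) * 2\<^sup>2) \<longlongrightarrow> 32 * (k\<^sup>2 * (2 * 0 + 8 * 0\<^sup>2)) * 2\<^sup>2) at_top"
    by (intro tendsto_intros T_lim)
  then have e2: "\<forall>\<^sub>F b in at_top. 32 * (k\<^sup>2 * (2 * T2 b + 8 * (T1 b)\<^sup>2)) * 2\<^sup>2 < 1" by (rule order_tendstoD) simp
  obtain b where b: "1 \<le> b" "2 * 2 * (k * (2 * T1 b)) < 1" "32 * (k\<^sup>2 * (2 * T2 b + 8 * (T1 b)\<^sup>2)) * 2\<^sup>2 < 1"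
    using eventually_happens'[OF _ eventually_conj[OF eventually_ge_at_top[of 1] eventually_conj[OF e1 e2]]] by auto
  define R where "R x y = k * cen (gx {b..}) x y" for x y
  have Rm: "case_prod R \<in> borel_measurable (\<mu> \<Otimes>\<^sub>M \<mu>)" unfolding R_def by measurable
  have Rint: "(\<integral>\<^sup>+X. ennreal (exp (- 2 * ustat R N X / real N)) \<partial>ipow \<mu> N) \<le> 2" for N
  proof (rule exp_ustat_bound[OF Rm, where m="k * (2 * T1 b)" and \<kappa>="k\<^sup>2 * (2 * T2 b + 8 * (T1 b)\<^sup>2)" and l=2])
    show "R x y = R y x" for x y unfolding R_def by (subst cen_sym[OF gx_sym]) simp
    show "(\<integral>y. R x y \<partial>\<mu>) = 0" for x unfolding R_def using cen_tail_bounds(3)[OF b(1)] by simp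
    show "sqn \<mu> (R x) \<le> ennreal (k\<^sup>2 * (2 * T2 b + 8 * (T1 b)\<^sup>2))" for x
    proof -
      have "cen (gx {b..}) x \<in> borel_measurable \<mu>" by measurable
      then have "sqn \<mu> (R x) = ennreal (k\<^sup>2) * sqn \<mu> (cen (gx {b..}) x)"
        unfolding R_def[abs_def] by (rule sqn_cmult)
      also have "\<dots> \<le> ennreal (k\<^sup>2) * ennreal (2 * T2 b + 8 * (T1 b)\<^sup>2)"
        by (intro mult_left_mono cen_tail_bounds(2) b) auto
      also have "\<dots> = ennreal (k\<^sup>2 * (2 * T2 b + 8 * (T1 b)\<^sup>2))"
        using T_nonneg(2)[of b] by (intro ennreal_mult[symmetric]) auto
      finally show ?thesis .
    qed
    show "- (k * (2 * T1 b)) \<le> R x y" for x y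
      unfolding R_def using mult_left_mono[OF cen_tail_bounds(1)[OF b(1)] k0, of x y] by simp
  qed (use b k0 T_nonneg in \<open>auto intro!: mult_nonneg_nonneg add_nonneg_nonneg\<close>)
  obtain D where D: "\<And>x. good x \<Longrightarrow> c * cen (gx {0<..<b}) x x \<le> D - 2 * hpot s \<mu> x"
    using cen_low_diag[OF b(1)] by blast
  define h where "h = (\<integral>x. \<beta> * hpot s \<mu> x \<partial>\<mu>)"
  let ?Y = "gibbs_exponent \<mu> (\<lambda>x y. \<beta> * gtilde s \<mu> x y) (\<lambda>x. \<beta> * hpot s \<mu> x)"
  have pt: "2 * ?Y N X \<le> (\<beta> * \<bar>D\<bar> - h) + - 2 * ustat R N X / real N"
    if X: "\<And>i. i < N \<Longrightarrow> good (X i)" "\<And>i j. j < N \<Longrightarrow> i < j \<Longrightarrow> X i \<noteq> X j" for N X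
  proof (cases "N = 0")
    case True
    then show ?thesis using beta by (simp add: gibbs_exponent_def ustat_def h_def)
  next
    case False
    define K0 where "K0 x y = k * cen (gx {0<..<b}) x y" for x y
    have K0sym: "K0 x y = K0 y x" for x y unfolding K0_def by (subst cen_sym[OF gx_sym]) simp
    have us: "ustat (\<lambda>x y. \<beta> * gtilde s \<mu> x y) N X = ustat R N X + ustat K0 N X"
      unfolding ustat_def sum.distrib[symmetric]
    proof (intro sum.cong refl)
      fix j i assume ij: "j \<in> {..<N}" "i \<in> {..<j}"
      then have "good (X i)" "good (X j)" "X i \<noteq> X j" using X by auto
      then show "\<beta> * gtilde s \<mu> (X i) (X j) = R (X i) (X j) + K0 (X i) (X j)"
        by (simp add: gtilde_split[OF b(1)] R_def K0_def k_def algebra_simps)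
    qed
    have sq: "(\<Sum>i<n. \<Sum>j<n. K0 (X i) (X j)) = (\<Sum>i<n. K0 (X i) (X i)) + 2 * ustat K0 n X" for n
    proof (induction n)
      case (Suc n)
      have "(\<Sum>j<n. K0 (X n) (X j)) = (\<Sum>i<n. K0 (X i) (X n))" by (intro sum.cong refl K0sym)
      then show ?case using Suc by (simp add: ustat_def sum.distrib)
    qed (simp add: ustat_def)
    have "0 \<le> k * (\<Sum>i<N. \<Sum>j<N. cen (gx {0<..<b}) (X i) (X j))"
      using k0 cen_low_psd[OF b(1) X(1)] by (intro mult_nonneg_nonneg) auto
    then have "0 \<le> (\<Sum>i<N. \<Sum>j<N. K0 (X i) (X j))" by (simp add: K0_def sum_distrib_left)
    then have "- 2 * ustat K0 N X \<le> (\<Sum>i<N. K0 (X i) (X i))" unfolding sq by linarith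
    also have "\<dots> \<le> (\<Sum>i<N. \<beta> * (\<bar>D\<bar> - 2 * hpot s \<mu> (X i)))"
    proof (rule sum_mono)
      fix i assume "i \<in> {..<N}"
      then have "c * cen (gx {0<..<b}) (X i) (X i) \<le> \<bar>D\<bar> - 2 * hpot s \<mu> (X i)" using D[OF X(1)] by force
      then have "\<beta> * (c * cen (gx {0<..<b}) (X i) (X i)) \<le> \<beta> * (\<bar>D\<bar> - 2 * hpot s \<mu> (X i))" using beta by (rule mult_left_mono)
      then show "K0 (X i) (X i) \<le> \<beta> * (\<bar>D\<bar> - 2 * hpot s \<mu> (X i))" by (simp add: K0_def k_def mult.assoc)
    qed
    also have "\<dots> = real N * (\<beta> * \<bar>D\<bar>) - 2 * (\<Sum>i<N. \<beta> * hpot s \<mu> (X i))"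
      by (simp add: right_diff_distrib sum_subtractf sum_distrib_left mult.left_commute)
    finally have "(- 2 * ustat K0 N X + 2 * (\<Sum>i<N. \<beta> * hpot s \<mu> (X i))) / real N \<le> real N * (\<beta> * \<bar>D\<bar>) / real N"
      by (intro divide_right_mono) auto
    then have "(- 2 * ustat K0 N X + 2 * (\<Sum>i<N. \<beta> * hpot s \<mu> (X i))) / real N \<le> \<beta> * \<bar>D\<bar>" using False by simp
    moreover have "2 * ?Y N X = (- 2 * ustat K0 N X + 2 * (\<Sum>i<N. \<beta> * hpot s \<mu> (X i))) / real N - h + - 2 * ustat R N X / real N"
      unfolding gibbs_exponent_def us h_def using False by (simp add: field_simps)
    ultimately show ?thesis by linarith
  qed
  have Ym: "?Y N \<in> borel_measurable (ipow \<mu> N)" for N unfolding gibbs_exponent_def ustat_def by measurable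
  have "(\<integral>\<^sup>+X. ennreal (exp (2 * ?Y N X)) \<partial>ipow \<mu> N) \<le> ennreal (exp (\<beta> * \<bar>D\<bar> - h) * 2)" for N
  proof -
    have "(\<integral>\<^sup>+X. ennreal (exp (2 * ?Y N X)) \<partial>ipow \<mu> N) \<le> (\<integral>\<^sup>+X. ennreal (exp (\<beta> * \<bar>D\<bar> - h)) * ennreal (exp (- 2 * ustat R N X / real N)) \<partial>ipow \<mu> N)"
      using AE_configuration[of N]
    proof (intro nn_integral_mono_AE, eventually_elim)
      case (elim X)
      then have "exp (2 * ?Y N X) \<le> exp ((\<beta> * \<bar>D\<bar> - h) + - 2 * ustat R N X / real N)"
        using pt[of N X] by (subst exp_le_cancel_iff) auto
      also have "\<dots> = exp (\<beta> * \<bar>D\<bar> - h) * exp (- 2 * ustat R N X / real N)" by (rule exp_add)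
      finally show ?case by (subst ennreal_mult[symmetric]) (auto intro: ennreal_leI)
    qed
    also have "\<dots> = ennreal (exp (\<beta> * \<bar>D\<bar> - h)) * (\<integral>\<^sup>+X. ennreal (exp (- 2 * ustat R N X / real N)) \<partial>ipow \<mu> N)"
    proof (rule nn_integral_cmult)
      note [measurable] = Rm
      show "(\<lambda>X. ennreal (exp (- 2 * ustat R N X / real N))) \<in> borel_measurable (ipow \<mu> N)"
        unfolding ustat_def by measurable
    qed
    also have "\<dots> \<le> ennreal (exp (\<beta> * \<bar>D\<bar> - h)) * 2" by (intro mult_left_mono Rint) auto
    also have "\<dots> = ennreal (exp (\<beta> * \<bar>D\<bar> - h) * 2)" by (simp add: ennreal_mult)
    finally show ?thesis .
  qed
  then show ?thesis by blast
qed

text \<open>The middle scales form a bounded mixture; the scales below \<open>a n\<close> and above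
  b are the error. The former are small by dominated convergence under the square integrable small t
  part, the latter by \<open>T2\<close>. The error is estimated before centring, which costs only a
  constant factor.\<close>

lemma gtilde_approximable:
  assumes beta: "0 \<le> \<beta>" and low2: "0 < \<beta> \<Longrightarrow> sqn (\<mu> \<Otimes>\<^sub>M \<mu>) (case_prod (gx {0<..<1})) < \<infinity>"
  shows "sos_approximable \<mu> (\<lambda>x y. \<beta> * gtilde s \<mu> x y)"
proof (cases "\<beta> = 0")
  case True
  show ?thesis unfolding sos_approximable_def True
    by (intro conjI allI impI exI[of _ 0] exI[of _ "\<lambda>_ _. 0"]) (auto simp: sosk_def sqn_def)
next
  case False
  then have L: "sqn (\<mu> \<Otimes>\<^sub>M \<mu>) (case_prod (gx {0<..<1})) < \<infinity>" using beta low2 by simp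
  interpret PP: pair_prob_space \<mu> \<mu> ..
  define k where "k = \<beta> * c"
  have k0: "0 \<le> k" using beta c0 by (simp add: k_def)
  let ?P = "\<mu> \<Otimes>\<^sub>M \<mu>"
  define a where "a n = 1 / real (Suc (Suc n))" for n
  have a: "0 < a n" "a n < 1" for n by (auto simp: a_def)
  have lowlim: "(\<lambda>n. sqn ?P (case_prod (gx {0<..<a n}))) \<longlonglongrightarrow> 0"
  proof -
    have "(\<lambda>n. \<integral>\<^sup>+z. ennreal ((case_prod (gx {0<..<a n}) z)\<^sup>2) \<partial>?P) \<longlonglongrightarrow> (\<integral>\<^sup>+z. 0 \<partial>?P)"
    proof (rule nn_integral_dominated_convergence[where w="\<lambda>z. ennreal ((case_prod (gx {0<..<1}) z)\<^sup>2)"])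
      show "(\<integral>\<^sup>+z. ennreal ((case_prod (gx {0<..<1}) z)\<^sup>2) \<partial>?P) < \<infinity>" using L by (simp add: sqn_def)
      show "AE z in ?P. ennreal ((case_prod (gx {0<..<a n}) z)\<^sup>2) \<le> ennreal ((case_prod (gx {0<..<1}) z)\<^sup>2)" for n
      proof (rule AE_I2)
        fix z
        have "\<bar>case_prod (gx {0<..<a n}) z\<bar> \<le> \<bar>case_prod (gx {0<..<1}) z\<bar>"
          unfolding gx_def a_def split_beta by (rule gmix_lower_limit(5)[OF s0 order_refl])
        then show "ennreal ((case_prod (gx {0<..<a n}) z)\<^sup>2) \<le> ennreal ((case_prod (gx {0<..<1}) z)\<^sup>2)"
          by (intro ennreal_leI) (simp only: abs_le_square_iff)
      qed
      show "AE z in ?P. (\<lambda>n. ennreal ((case_prod (gx {0<..<a n}) z)\<^sup>2)) \<longlonglongrightarrow> 0"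
      proof (rule AE_I2)
        fix z
        have "(\<lambda>n. case_prod (gx {0<..<a n}) z) \<longlonglongrightarrow> 0"
          unfolding gx_def a_def split_beta using gmix_lower_limit(6)[OF s0 order_refl] by (rule LIMSEQ_Suc)
        then have "(\<lambda>n. (case_prod (gx {0<..<a n}) z)\<^sup>2) \<longlonglongrightarrow> 0\<^sup>2" by (intro tendsto_power)
        then have "(\<lambda>n. ennreal ((case_prod (gx {0<..<a n}) z)\<^sup>2)) \<longlonglongrightarrow> ennreal (0\<^sup>2)" by (intro tendsto_ennrealI)
        then show "(\<lambda>n. ennreal ((case_prod (gx {0<..<a n}) z)\<^sup>2)) \<longlonglongrightarrow> 0" by simp
      qed
    qed auto
    then show ?thesis by (simp add: sqn_def)
  qed
  show ?thesis unfolding sos_approximable_def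
  proof (intro conjI allI impI)
    show "(\<lambda>(x, y). \<beta> * gtilde s \<mu> x y) \<in> borel_measurable ?P" by measurable
    fix \<epsilon> :: real assume e: "0 < \<epsilon>"
    \<comment> \<open>Sized for the factors met below: 2 from separating the error, 16 from centring
      and 4 from its two pieces give 128 k^2 \<delta>, which is at most \<epsilon> / 2.\<close>
    define \<delta> where "\<delta> = \<epsilon> / (4 * (k\<^sup>2 * 64 + 1))"
    have d: "0 < \<delta>" unfolding \<delta>_def using e by (intro divide_pos_pos mult_pos_pos add_nonneg_pos) auto
    have "\<forall>\<^sub>F b in at_top. T2 b < \<delta>" using order_tendstoD(2)[OF T_lim(2) d] .
    then obtain b where b: "1 \<le> b" "T2 b < \<delta>"
      using eventually_happens'[OF _ eventually_conj[OF eventually_ge_at_top[of 1] _]] by (metis (no_types, lifting) trivial_limit_at_top_linorder)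
    have "\<forall>\<^sub>F n in sequentially. sqn ?P (case_prod (gx {0<..<a n})) < ennreal \<delta>"
      using order_tendstoD(2)[OF lowlim] d by simp
    then obtain n where n: "sqn ?P (case_prod (gx {0<..<a n})) < ennreal \<delta>"
      by (auto simp: eventually_sequentially)
    define u where "u x y = gx {0<..<a n} x y + gx {b..} x y" for x y
    have um [measurable]: "case_prod u \<in> borel_measurable ?P" unfolding u_def by measurable
    have ab: "a n < b" using a(2)[of n] b(1) by linarith
    have "sos_approximable \<mu> (\<lambda>x y. k * cen (gx {a n..<b}) x y)"
      by (intro sos_approximable_cmult gx_mid_cen(2) a ab k0)
    then obtain m \<psi> where m: "\<forall>k<m. \<psi> k \<in> L20 \<mu> \<and> (\<exists>B. \<forall>x. \<bar>\<psi> k x\<bar> \<le> B)"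
      "sqn ?P (\<lambda>(x, y). k * cen (gx {a n..<b}) x y - sosk \<psi> m x y) \<le> ennreal (\<epsilon> / 4)"
      using e unfolding sos_approximable_def by (meson divide_pos_pos zero_less_numeral)
    have [measurable]: "case_prod (sosk \<psi> m) \<in> borel_measurable ?P"
      using m(1) L2_D(1)[OF L20_L2] by (intro measurable_sosk) blast
    have su: "sqn ?P (case_prod u) \<le> 4 * ennreal \<delta>"
    proof -
      have "sqn ?P (case_prod u) = sqn ?P (\<lambda>z. case_prod (gx {0<..<a n}) z + case_prod (gx {b..}) z)"
        by (intro arg_cong2[where f=sqn] refl ext) (auto simp: u_def)
      also have "\<dots> \<le> 2 * sqn ?P (case_prod (gx {0<..<a n})) + 2 * sqn ?P (case_prod (gx {b..}))"
        by (rule sqn_add_le) measurable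
      also have "\<dots> \<le> 2 * ennreal \<delta> + 2 * ennreal \<delta>"
        using n b(2) tail_pair(1)[OF b(1)]
        by (intro add_mono mult_left_mono) (auto intro: less_imp_le order_trans ennreal_leI)
      also have "\<dots> = 4 * ennreal \<delta>"
      proof -
        have "2 * x + 2 * x = 4 * x" for x :: ennreal
          by (simp add: distrib_right[symmetric])
        then show ?thesis .
      qed
      finally show ?thesis .
    qed
    have ae: "AE z in ?P. (case z of (x, y) \<Rightarrow> \<beta> * gtilde s \<mu> x y - sosk \<psi> m x y) =
       (case z of (x, y) \<Rightarrow> k * cen (gx {a n..<b}) x y - sosk \<psi> m x y) + k * case_prod (cen u) z"
    proof -
      have g1: "AE z in ?P. good (fst z)" and g2: "AE z in ?P. good (snd z)"
      proof -
        have [measurable]: "Measurable.pred \<mu> good"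
        proof -
          have "good = (\<lambda>x. (\<integral>\<^sup>+y. ennreal (norm (gx {0<..<1} x y)) \<partial>\<mu>) < \<infinity>)"
            unfolding good_def by (intro ext) (auto simp: integrable_iff_bounded)
          then show ?thesis by simp
        qed
        have "{z \<in> space ?P. good (fst z)} \<in> sets ?P" "{z \<in> space ?P. good (snd z)} \<in> sets ?P"
          by measurable
        from this[THEN PP.AE_pair_measure] show "AE z in ?P. good (fst z)" "AE z in ?P. good (snd z)"
          using AE_good by auto
      qed
      show ?thesis using g1 g2 AE_pair_neq
      proof eventually_elim
        case (elim z)
        obtain x y where z: "z = (x, y)" by (cases z)
        have x: "good x" and y: "good y" and xy: "x \<noteq> y" using elim by (auto simp: z)
        have split: "gx {0<..<b} = (\<lambda>x y. gx {0<..<a n} x y + gx {a n..<b} x y)"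
          unfolding gx_def a_def by (intro ext gmix_lower_limit(4)[OF s0 b(1)])
        have mid: "integrable \<mu> (gx {a n..<b} x)" "integrable ?P (case_prod (gx {a n..<b}))" for x
        proof -
          have bd: "\<bar>gx {a n..<b} x y\<bar> \<le> (a n powr (s - 1) + b powr (s - 1)) * measure lborel {a n..b}" for x y
            unfolding gx_def by (rule gint_middle(2)[OF _ order_refl]) (use a in auto)
          show "integrable \<mu> (gx {a n..<b} x)" by (rule integrable_const_bound[OF AE_I2]) (use bd in auto)
          show "integrable ?P (case_prod (gx {a n..<b}))"
            by (rule PP.P.integrable_const_bound[OF AE_I2]) (use bd in auto)
        qed
        have lowi: "integrable \<mu> (gx {0<..<a n} x)" if "good x" for x
        proof -
          have "gx {0<..<a n} x = (\<lambda>y. gx {0<..<b} x y - gx {a n..<b} x y)" unfolding split by auto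
          then show ?thesis using lowb_integrable(1)[OF b(1) that] mid(1)[of x] by simp
        qed
        have lowp: "integrable ?P (case_prod (gx {0<..<a n}))"
        proof -
          have e: "case_prod (gx {0<..<a n}) = (\<lambda>z. case_prod (gx {0<..<b}) z - case_prod (gx {a n..<b}) z)" unfolding split by auto
          show ?thesis unfolding e by (rule Bochner_Integration.integrable_diff[OF lowb_integrable(2)[OF b(1)] mid(2)])
        qed
        have c1: "cen (gx {0<..<b}) x y = cen (gx {0<..<a n}) x y + cen (gx {a n..<b}) x y"
          unfolding split by (rule cen_add) (use lowi x y mid lowp in auto)
        have c2: "cen u x y = cen (gx {0<..<a n}) x y + cen (gx {b..}) x y"
          unfolding u_def by (rule cen_add) (use lowi x y lowp tail_integrable(1)[OF b(1)] tail_pair(2)[OF b(1)] in auto)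
        show ?case
          using gtilde_split[OF b(1) x y xy] unfolding z c1 c2 by (simp add: c2 k_def algebra_simps)
      qed
    qed
    have "sqn ?P (\<lambda>(x, y). \<beta> * gtilde s \<mu> x y - sosk \<psi> m x y) =
        sqn ?P (\<lambda>z. (case z of (x, y) \<Rightarrow> k * cen (gx {a n..<b}) x y - sosk \<psi> m x y) + k * case_prod (cen u) z)"
      unfolding sqn_def using ae by (intro nn_integral_cong_AE) (auto simp: add_diff_eq diff_add_eq elim!: eventually_mono)
    also have "\<dots> \<le> 2 * sqn ?P (\<lambda>(x, y). k * cen (gx {a n..<b}) x y - sosk \<psi> m x y) + 2 * sqn ?P (\<lambda>z. k * case_prod (cen u) z)"
      by (rule sqn_add_le) measurable
    also have "\<dots> \<le> 2 * ennreal (\<epsilon> / 4) + 2 * (ennreal (k\<^sup>2) * (16 * (4 * ennreal \<delta>)))"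
    proof (intro add_mono mult_left_mono m)
      have "sqn ?P (\<lambda>z. k * case_prod (cen u) z) = ennreal (k\<^sup>2) * sqn ?P (case_prod (cen u))"
        by (rule sqn_cmult) measurable
      also have "\<dots> \<le> ennreal (k\<^sup>2) * (16 * (4 * ennreal \<delta>))"
        by (intro mult_left_mono order_trans[OF sqn_cen_le] su um) auto
      finally show "sqn ?P (\<lambda>z. k * case_prod (cen u) z) \<le> ennreal (k\<^sup>2) * (16 * (4 * ennreal \<delta>))" .
    qed auto
    also have "\<dots> \<le> ennreal \<epsilon>"
    proof -
      have 1: "2 * ennreal (\<epsilon> / 4) = ennreal (2 * (\<epsilon> / 4))" using e by (subst ennreal_mult') auto
      have 16: "16 * (4 * ennreal \<delta>) = ennreal (16 * (4 * \<delta>))" using d by (simp add: ennreal_mult')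
      have 2: "2 * (ennreal (k\<^sup>2) * (16 * (4 * ennreal \<delta>))) = ennreal (2 * (k\<^sup>2 * (16 * (4 * \<delta>))))"
      proof -
        have "ennreal (k\<^sup>2) * ennreal (16 * (4 * \<delta>)) = ennreal (k\<^sup>2 * (16 * (4 * \<delta>)))"
          using d by (intro ennreal_mult[symmetric]) auto
        then show ?thesis unfolding 16 using d by (subst ennreal_mult'[where a=2]) auto
      qed
      have le: "2 * (k\<^sup>2 * (16 * (4 * \<delta>))) \<le> \<epsilon> / 2"
      proof -
        have "2 * (k\<^sup>2 * (16 * (4 * \<delta>))) \<le> 2 * ((k\<^sup>2 * 64 + 1) * \<delta>)" using d by (simp add: algebra_simps)
        also have "(k\<^sup>2 * 64 + 1) * \<delta> = \<epsilon> / 4"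
        proof -
          have "0 < k\<^sup>2 * 64 + 1" by (intro add_nonneg_pos) auto
          then show ?thesis unfolding \<delta>_def by (simp add: field_simps)
        qed
        finally show ?thesis by simp
      qed
      have "2 * ennreal (\<epsilon> / 4) + 2 * (ennreal (k\<^sup>2) * (16 * (4 * ennreal \<delta>))) = ennreal (2 * (\<epsilon> / 4) + 2 * (k\<^sup>2 * (16 * (4 * \<delta>))))"
        unfolding 1 2 using e d by (intro ennreal_plus[symmetric]) auto
      also have "\<dots> \<le> ennreal \<epsilon>" using le by (intro ennreal_leI) simp
      finally show ?thesis .
    qed
    finally have "sqn ?P (\<lambda>(x, y). \<beta> * gtilde s \<mu> x y - sosk \<psi> m x y) \<le> ennreal \<epsilon>" .
    then show "\<exists>m \<psi>. (\<forall>k<m. \<psi> k \<in> L20 \<mu> \<and> (\<exists>B. \<forall>x. \<bar>\<psi> k x\<bar> \<le> B)) \<and>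
      sqn ?P (\<lambda>(x, y). \<beta> * gtilde s \<mu> x y - sosk \<psi> m x y) \<le> ennreal \<epsilon>"
      using m(1) by blast
  qed
qed

theorem degenerate_gibbs_riesz:
  assumes beta: "0 \<le> \<beta>"
    and low2: "0 < \<beta> \<Longrightarrow> sqn (\<mu> \<Otimes>\<^sub>M \<mu>) (case_prod (gx {0<..<1})) < \<infinity>"
    and g2: "case_prod (gtilde s \<mu>) \<in> L2 (\<mu> \<Otimes>\<^sub>M \<mu>)"
    and H: "(\<lambda>x. \<beta> * hpot s \<mu> x) \<in> L2 \<mu>"
  shows "\<exists>C. degenerate_gibbs \<mu> (\<lambda>x y. \<beta> * gtilde s \<mu> x y) (\<lambda>x. \<beta> * hpot s \<mu> x) C"
proof -
  obtain C where C: "\<And>N. (\<integral>\<^sup>+X. ennreal (exp (2 * gibbs_exponent \<mu> (\<lambda>x y. \<beta> * gtilde s \<mu> x y) (\<lambda>x. \<beta> * hpot s \<mu> x) N X)) \<partial>ipow \<mu> N) \<le> ennreal C"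
    using exp_gibbs_bound[OF beta] by blast
  let ?K = "\<lambda>x y. \<beta> * gtilde s \<mu> x y"
  have K2: "case_prod ?K \<in> L2 (\<mu> \<Otimes>\<^sub>M \<mu>)"
    using L2_cmult[OF g2, of \<beta>] by (simp add: split_beta')
  have "degenerate_gibbs \<mu> ?K (\<lambda>x. \<beta> * hpot s \<mu> x) C"
  proof (intro degenerate_gibbs.intro degenerate_gibbs_axioms.intro prob_space_axioms K2 H C)
    show "\<beta> * gtilde s \<mu> x y = \<beta> * gtilde s \<mu> y x" for x y using gtilde_sym by simp
    show "AE x in \<mu>. (\<integral>y. \<beta> * gtilde s \<mu> x y \<partial>\<mu>) = 0"
      using gtilde_centred by eventually_elim simp
    fix \<epsilon> :: real assume e: "0 < \<epsilon>"
    obtain m \<psi> where m: "\<forall>k<m. \<psi> k \<in> L20 \<mu> \<and> (\<exists>B. \<forall>x. \<bar>\<psi> k x\<bar> \<le> B)"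
      "sqn (\<mu> \<Otimes>\<^sub>M \<mu>) (\<lambda>(x, y). ?K x y - sosk \<psi> m x y) \<le> ennreal (\<epsilon>\<^sup>2)"
      using gtilde_approximable[OF beta low2] e unfolding sos_approximable_def by (meson zero_less_power)
    have [measurable]: "case_prod (sosk \<psi> m) \<in> borel_measurable (\<mu> \<Otimes>\<^sub>M \<mu>)"
      using m(1) L2_D(1)[OF L20_L2] by (intro measurable_sosk) blast
    have L: "(\<lambda>(x, y). ?K x y - sosk \<psi> m x y) \<in> L2 (\<mu> \<Otimes>\<^sub>M \<mu>)"
      using m(2) by (auto simp: L2_iff_sqn intro: le_less_trans)
    have "(\<integral>(x, y). (?K x y - sosk \<psi> m x y)\<^sup>2 \<partial>(\<mu> \<Otimes>\<^sub>M \<mu>)) \<le> \<epsilon>\<^sup>2"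
      using m(2) unfolding sqn_eq_integral[OF L] by (simp add: split_beta')
    then show "\<exists>m \<psi>. (\<forall>k<m. \<psi> k \<in> L20 \<mu> \<and> (\<exists>B. \<forall>x. \<bar>\<psi> k x\<bar> \<le> B)) \<and>
        (\<integral>(x, y). (?K x y - sosk \<psi> m x y)\<^sup>2 \<partial>(\<mu> \<Otimes>\<^sub>M \<mu>)) \<le> \<epsilon>\<^sup>2"
      using m(1) by blast
  qed
  then show ?thesis by blast
qed

end

section \<open>Gaussian vectors\<close>

text \<open>Cholesky factorisation: the Schur complement of the pivot \<open>C k k\<close> is again
  nonnegative, and the pivot column supplies one more factor.\<close>

lemma psd_factor:
  fixes C :: "'i \<Rightarrow> 'i \<Rightarrow> real"
  assumes "finite I" and "\<And>i j. i \<in> I \<Longrightarrow> j \<in> I \<Longrightarrow> C i j = C j i"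
    and "\<And>\<theta>. 0 \<le> (\<Sum>i\<in>I. \<Sum>j\<in>I. \<theta> i * \<theta> j * C i j)"
  shows "\<exists>(m::nat) (a::nat \<Rightarrow> 'i \<Rightarrow> real). \<forall>i\<in>I. \<forall>j\<in>I. C i j = (\<Sum>l<m. a l i * a l j)"
  using assms
proof (induction I arbitrary: C rule: finite_induct)
  case empty
  show ?case by simp
next
  case (insert k I)
  define S where "S \<theta> = (\<Sum>i\<in>I. \<theta> i * C i k)" for \<theta>
  define Q where "Q \<theta> = (\<Sum>i\<in>I. \<Sum>j\<in>I. \<theta> i * \<theta> j * C i j)" for \<theta>
  have sym: "C k j = C j k" if "j \<in> I" for j using insert.prems(1) that by auto
  have expand: "0 \<le> t\<^sup>2 * C k k + 2 * t * S \<theta> + Q \<theta>" for \<theta> t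
  proof -
    define \<eta> where "\<eta> = \<theta>(k := t)"
    have e: "\<eta> k = t" "i \<in> I \<Longrightarrow> \<eta> i = \<theta> i" for i using insert.hyps by (auto simp: \<eta>_def)
    have "(\<Sum>i\<in>insert k I. \<Sum>j\<in>insert k I. \<eta> i * \<eta> j * C i j) =
        t * t * C k k + (\<Sum>j\<in>I. t * \<theta> j * C k j) + ((\<Sum>i\<in>I. \<theta> i * t * C i k) + (\<Sum>i\<in>I. \<Sum>j\<in>I. \<theta> i * \<theta> j * C i j))"
      using insert.hyps e by (simp add: sum.distrib cong: sum.cong)
    also have "(\<Sum>j\<in>I. t * \<theta> j * C k j) = t * S \<theta>"
      unfolding S_def sum_distrib_left by (intro sum.cong) (auto simp: sym)
    also have "(\<Sum>i\<in>I. \<theta> i * t * C i k) = t * S \<theta>"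
      unfolding S_def sum_distrib_left by (intro sum.cong) auto
    finally show ?thesis using insert.prems(2)[of \<eta>] by (simp add: Q_def power2_eq_square)
  qed
  have Ckk: "0 \<le> C k k"
  proof -
    have "S (\<lambda>_. 0) = 0" "Q (\<lambda>_. 0) = 0" by (simp_all add: S_def Q_def)
    then show ?thesis using expand[of 1 "\<lambda>_. 0"] by simp
  qed
  \<comment> \<open>With a vanishing pivot the polynomial in t is affine; being nonnegative for all
    t, it has no linear term.\<close>
  have zero: "C i k = 0" if "C k k = 0" and i: "i \<in> I" for i
  proof (rule ccontr)
    assume n: "C i k \<noteq> 0"
    define \<theta> where "\<theta> j = (if j = i then 1 else 0 :: real)" for j
    have "S \<theta> = (\<Sum>j\<in>I. if j = i then C j k else 0)"
      unfolding S_def \<theta>_def by (intro sum.cong) auto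
    then have "S \<theta> = C i k" using i insert.hyps by simp
    then have "0 \<le> 2 * t * C i k + Q \<theta>" for t using expand[of t \<theta>] that(1) by simp
    from this[of "- (Q \<theta> + 1) / (2 * C i k)"] show False using n by (simp add: field_simps)
  qed
  \<comment> \<open>For a zero pivot the quotient is 0 by convention, so \<open>D\<close> is then
    \<open>C\<close> itself and one formula covers both cases.\<close>
  define D where "D i j = C i j - C i k * C j k / C k k" for i j
  have "\<exists>(m::nat) (a::nat \<Rightarrow> 'i \<Rightarrow> real). \<forall>i\<in>I. \<forall>j\<in>I. D i j = (\<Sum>l<m. a l i * a l j)"
  proof (rule insert.IH)
    show "D i j = D j i" if "i \<in> I" "j \<in> I" for i j using insert.prems(1)[of i j] that by (simp add: D_def)
    fix \<theta> :: "'i \<Rightarrow> real"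
    have "(\<Sum>i\<in>I. \<Sum>j\<in>I. \<theta> i * \<theta> j * D i j) = Q \<theta> - (\<Sum>i\<in>I. \<Sum>j\<in>I. (\<theta> i * C i k) * (\<theta> j * C j k) / C k k)"
      unfolding D_def Q_def by (simp add: right_diff_distrib sum_subtractf mult_ac)
    also have "(\<Sum>i\<in>I. \<Sum>j\<in>I. (\<theta> i * C i k) * (\<theta> j * C j k) / C k k) = (S \<theta>)\<^sup>2 / C k k"
      unfolding S_def power2_eq_square sum_product sum_divide_distrib ..
    finally have eq: "(\<Sum>i\<in>I. \<Sum>j\<in>I. \<theta> i * \<theta> j * D i j) = Q \<theta> - (S \<theta>)\<^sup>2 / C k k" .
    show "0 \<le> (\<Sum>i\<in>I. \<Sum>j\<in>I. \<theta> i * \<theta> j * D i j)"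
      unfolding eq using expand[of "- S \<theta> / C k k" \<theta>] Ckk
      by (cases "C k k = 0") (auto simp: power2_eq_square field_simps)
  qed
  then obtain m :: nat and a :: "nat \<Rightarrow> 'i \<Rightarrow> real"
    where a: "\<And>i j. i \<in> I \<Longrightarrow> j \<in> I \<Longrightarrow> D i j = (\<Sum>l<m. a l i * a l j)" by blast
  define b where "b l i = (if l < m then (if i = k then 0 else a l i) else C i k / sqrt (C k k))" for l i
  have s: "sqrt (C k k) * sqrt (C k k) = C k k" using Ckk by simp
  have b: "(\<Sum>l<Suc m. b l i * b l j) = (if i = k \<or> j = k then 0 else \<Sum>l<m. a l i * a l j) + C i k * C j k / C k k" for i j
  proof -
    have "(\<Sum>l<m. b l i * b l j) = (if i = k \<or> j = k then 0 else \<Sum>l<m. a l i * a l j)"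
      by (auto simp: b_def)
    moreover have "b m i * b m j = C i k * C j k / C k k" using s by (simp add: b_def)
    ultimately show ?thesis by simp
  qed
  have "\<forall>i\<in>insert k I. \<forall>j\<in>insert k I. C i j = (\<Sum>l<Suc m. b l i * b l j)"
  proof (intro ballI)
    fix i j assume ij: "i \<in> insert k I" "j \<in> insert k I"
    show "C i j = (\<Sum>l<Suc m. b l i * b l j)"
    proof (cases "i = k \<or> j = k")
      case True
      then have "C i j = C i k * C j k / C k k"
      proof (cases "C k k = 0")
        case zero_pivot: True
        have "C i j = 0"
        proof (cases "i = k")
          case i: True
          show ?thesis
          proof (cases "j = k")
            case False
            then have "j \<in> I" using ij by auto
            then show ?thesis using i sym zero[OF zero_pivot] by metis
          qed (use i zero_pivot in simp)
        next
          case False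
          then have "i \<in> I" "j = k" using ij True by auto
          then show ?thesis using zero[OF zero_pivot] by metis
        qed
        then show ?thesis using zero_pivot by simp
      next
        case False
        have "C k j = C j k" using ij sym by (cases "j = k") auto
        then show ?thesis using True False by auto
      qed
      then show ?thesis using True unfolding b by simp
    next
      case False
      then have "i \<in> I" "j \<in> I" using ij by auto
      then have "C i j = (\<Sum>l<m. a l i * a l j) + C i k * C j k / C k k"
        using a[of i j] unfolding D_def by linarith
      then show ?thesis using False unfolding b by simp
    qed
  qed
  then show ?case by blast
qed

lemma real_distribution_normal_scaled: "real_distribution (distr std_normal_distribution borel (\<lambda>x. c * x))"
proof -
  interpret prob_space std_normal_distribution by (rule prob_space_normal_density) simp
  show ?thesis by (intro real_distribution.intro prob_space_distr real_distribution_axioms.intro) auto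
qed

text \<open>Comparing characteristic functions avoids convolutions and any case distinction for
  vanishing coefficients.\<close>

lemma distr_normal_combination:
  fixes t :: "nat \<Rightarrow> real"
  shows "distr (ipow std_normal_distribution m) borel (\<lambda>Z. \<Sum>l<m. t l * Z l) =
    distr std_normal_distribution borel (\<lambda>x. sqrt (\<Sum>l<m. (t l)\<^sup>2) * x)"
proof (rule Levy_uniqueness)
  interpret N: prob_space std_normal_distribution by (rule prob_space_normal_density) simp
  interpret P: prob_space "ipow std_normal_distribution m" by (rule N.ipow_prob_space)
  interpret product_sigma_finite "\<lambda>_::nat. std_normal_distribution"
    unfolding product_sigma_finite_def by (intro allI prob_space_imp_sigma_finite prob_space_normal_density) simp
  have m [measurable]: "(\<lambda>Z. \<Sum>l<m. t l * Z l) \<in> borel_measurable (ipow std_normal_distribution m)"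
    by measurable
  show "real_distribution (distr (ipow std_normal_distribution m) borel (\<lambda>Z. \<Sum>l<m. t l * Z l))"
    by (intro real_distribution.intro P.prob_space_distr real_distribution_axioms.intro) auto
  show "real_distribution (distr std_normal_distribution borel (\<lambda>x. sqrt (\<Sum>l<m. (t l)\<^sup>2) * x))"
    by (rule real_distribution_normal_scaled)
  have N: "(\<integral>x. iexp (u * x) \<partial>std_normal_distribution) = complex_of_real (exp (- u\<^sup>2 / 2))" for u
    using fun_cong[OF char_std_normal_distribution, of u] by (simp add: char_def)
  show "char (distr (ipow std_normal_distribution m) borel (\<lambda>Z. \<Sum>l<m. t l * Z l)) =
      char (distr std_normal_distribution borel (\<lambda>x. sqrt (\<Sum>l<m. (t l)\<^sup>2) * x))"
  proof
    fix u
    have "char (distr (ipow std_normal_distribution m) borel (\<lambda>Z. \<Sum>l<m. t l * Z l)) u =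
        (\<integral>Z. iexp (u * (\<Sum>l<m. t l * Z l)) \<partial>ipow std_normal_distribution m)"
      unfolding char_def by (subst integral_distr) auto
    also have "\<dots> = (\<integral>Z. (\<Prod>l<m. iexp (u * t l * Z l)) \<partial>Pi\<^sub>M {..<m} (\<lambda>_. std_normal_distribution))"
      by (intro Bochner_Integration.integral_cong) (simp_all add: exp_sum[symmetric] sum_distrib_left mult_ac)
    also have "\<dots> = (\<Prod>l<m. \<integral>x. iexp (u * t l * x) \<partial>std_normal_distribution)"
      by (rule product_integral_prod) (auto intro!: N.integrable_const_bound[where B=1])
    also have "\<dots> = complex_of_real (\<Prod>l<m. exp (- (u * t l)\<^sup>2 / 2))"
      unfolding of_real_prod by (intro prod.cong refl N)
    also have "(\<Prod>l<m. exp (- (u * t l)\<^sup>2 / 2)) = exp (- (u * sqrt (\<Sum>l<m. (t l)\<^sup>2))\<^sup>2 / 2)"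
      by (simp add: exp_sum[symmetric] sum_negf sum_divide_distrib sum_distrib_left power_mult_distrib sum_nonneg)
    also have "complex_of_real \<dots> = (\<integral>x. iexp (u * (sqrt (\<Sum>l<m. (t l)\<^sup>2) * x)) \<partial>std_normal_distribution)"
      using N[of "u * sqrt (\<Sum>l<m. (t l)\<^sup>2)"] by (simp add: mult_ac)
    also have "\<dots> = char (distr std_normal_distribution borel (\<lambda>x. sqrt (\<Sum>l<m. (t l)\<^sup>2) * x)) u"
      unfolding char_def by (subst integral_distr) auto
    finally show "char (distr (ipow std_normal_distribution m) borel (\<lambda>Z. \<Sum>l<m. t l * Z l)) u =
        char (distr std_normal_distribution borel (\<lambda>x. sqrt (\<Sum>l<m. (t l)\<^sup>2) * x)) u" .
  qed
qed

lemma gaussian_real_scaled: 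
  assumes "0 \<le> c"
  shows "gaussian_real (distr std_normal_distribution borel (\<lambda>x. c * x))"
proof (cases "c = 0")
  case True
  interpret N: prob_space std_normal_distribution by (rule prob_space_normal_density) simp
  have "distr std_normal_distribution borel (\<lambda>x. c * x) = return borel 0"
    using True N.distr_const[of "0::real" borel] by simp
  then show ?thesis unfolding gaussian_real_def by blast
next
  case False
  interpret N: prob_space std_normal_distribution by (rule prob_space_normal_density) simp
  have "distributed std_normal_distribution lborel (\<lambda>x. x) (normal_density 0 1)"
    unfolding distributed_def by (auto intro!: distr_id2)
  then have "distributed std_normal_distribution lborel (\<lambda>x. 0 + c * x) (normal_density (0 + c * 0) (\<bar>c\<bar> * 1))"
    by (rule N.normal_density_affine) (use False in auto)
  then have "distr std_normal_distribution lborel (\<lambda>x. c * x) = density lborel (normal_density 0 c)"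
    using assms by (simp add: distributed_def)
  moreover have "distr std_normal_distribution lborel (\<lambda>x. c * x) = distr std_normal_distribution borel (\<lambda>x. c * x)"
    by (rule distr_cong) auto
  ultimately show ?thesis unfolding gaussian_real_def using assms False by (metis less_eq_real_def)
qed

lemma std_normal_moments:
  "integrable std_normal_distribution (\<lambda>x. x)" "(\<integral>x. x \<partial>std_normal_distribution) = 0"
  "integrable std_normal_distribution (\<lambda>x. x\<^sup>2)" "(\<integral>x. x\<^sup>2 \<partial>std_normal_distribution) = 1"
  using integrable_std_normal_distribution_moment[of 1] integral_std_normal_distribution_moment_odd[of 1]
    integrable_std_normal_distribution_moment[of 2] std_normal_distribution_even_moments(1)[of 1]
  by auto

lemma std_normal_exp:
  "integrable std_normal_distribution (\<lambda>x. exp (c * x))"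
  "(\<integral>x. exp (c * x) \<partial>std_normal_distribution) = exp (c\<^sup>2 / 2)"
proof -
  have "(\<integral>x. exp (- (0 + 2 * (- c) * x + 0 * x\<^sup>2) / 2) \<partial>std_normal_distribution) = exp (- (0 - (- c)\<^sup>2 / (1 + 0)) / 2) / sqrt (1 + 0)"
    by (rule gaussian_quadratic_integral) simp
  then show e: "(\<integral>x. exp (c * x) \<partial>std_normal_distribution) = exp (c\<^sup>2 / 2)" by simp
  \<comment> \<open>A nonintegrable function would have integral 0, against the positive value just
    found.\<close>
  show "integrable std_normal_distribution (\<lambda>x. exp (c * x))"
    using not_integrable_integral_eq[of std_normal_distribution "\<lambda>x. exp (c * x)"] unfolding e by fastforce
qed

text \<open>The vector is the image of independent standard normals under a factor of
  \<open>C\<close>. The law of every projection is returned as well, since integrals of functions of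
  a projection are later computed from it.\<close>

theorem gaussian_vector:
  fixes C :: "real^'k^'k"
  assumes sym: "\<And>i j. C $ i $ j = C $ j $ i"
    and psd: "\<And>\<theta>::real^'k. 0 \<le> (\<Sum>i\<in>UNIV. \<Sum>j\<in>UNIV. \<theta> $ i * \<theta> $ j * C $ i $ j)"
  obtains \<gamma> where "centred_gaussian \<gamma> C"
    "\<And>\<theta>. distr \<gamma> borel (\<lambda>x. \<theta> \<bullet> x) =
      distr std_normal_distribution borel (\<lambda>x. sqrt (\<Sum>i\<in>UNIV. \<Sum>j\<in>UNIV. \<theta> $ i * \<theta> $ j * C $ i $ j) * x)"
proof -
  have "\<exists>(m::nat) (a::nat \<Rightarrow> 'k \<Rightarrow> real). \<forall>i\<in>UNIV. \<forall>j\<in>UNIV. C $ i $ j = (\<Sum>l<m. a l i * a l j)"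
  proof (rule psd_factor)
    show "0 \<le> (\<Sum>i\<in>UNIV. \<Sum>j\<in>UNIV. \<theta> i * \<theta> j * C $ i $ j)" for \<theta>
      using psd[of "\<chi> i. \<theta> i"] by simp
  qed (use sym in auto)
  then obtain m :: nat and a :: "nat \<Rightarrow> 'k \<Rightarrow> real" where a: "\<And>i j. C $ i $ j = (\<Sum>l<m. a l i * a l j)"
    by auto
  define q where "q \<theta> = (\<Sum>i\<in>UNIV. \<Sum>j\<in>UNIV. \<theta> $ i * \<theta> $ j * C $ i $ j)" for \<theta> :: "real^'k"
  interpret N: prob_space std_normal_distribution by (rule prob_space_normal_density) simp
  interpret P: prob_space "ipow std_normal_distribution m" by (rule N.ipow_prob_space)
  define V where "V Z = (\<chi> i. \<Sum>l<m. a l i * Z l)" for Z :: "nat \<Rightarrow> real"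
  define t where "t \<theta> l = (\<Sum>i\<in>UNIV. \<theta> $ i * a l i)" for \<theta> :: "real^'k" and l
  have V: "\<theta> \<bullet> V Z = (\<Sum>l<m. t \<theta> l * Z l)" for \<theta> Z
  proof -
    have "\<theta> \<bullet> V Z = (\<Sum>i\<in>UNIV. \<Sum>l<m. \<theta> $ i * a l i * Z l)"
      unfolding inner_vec_def V_def by (simp add: sum_distrib_left mult_ac)
    also have "\<dots> = (\<Sum>l<m. \<Sum>i\<in>UNIV. \<theta> $ i * a l i * Z l)" by (rule sum.swap)
    finally show ?thesis by (simp add: t_def sum_distrib_right)
  qed
  have tq: "(\<Sum>l<m. (t \<theta> l)\<^sup>2) = q \<theta>" for \<theta>
  proof -
    have "(\<Sum>l<m. (t \<theta> l)\<^sup>2) = (\<Sum>l<m. \<Sum>i\<in>UNIV. \<Sum>j\<in>UNIV. \<theta> $ i * \<theta> $ j * (a l i * a l j))"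
      unfolding t_def power2_eq_square sum_product by (simp add: mult_ac)
    also have "\<dots> = (\<Sum>i\<in>UNIV. \<Sum>j\<in>UNIV. \<Sum>l<m. \<theta> $ i * \<theta> $ j * (a l i * a l j))"
      by (subst sum.swap, intro sum.cong refl, rule sum.swap)
    finally show ?thesis by (simp add: q_def a sum_distrib_left)
  qed
  have mV [measurable]: "V \<in> borel_measurable (ipow std_normal_distribution m)"
  proof (rule borel_measurable_euclidean_space[THEN iffD2, rule_format])
    fix b :: "real^'k"
    show "(\<lambda>Z. V Z \<bullet> b) \<in> borel_measurable (ipow std_normal_distribution m)"
      unfolding inner_commute[of _ b] V by measurable
  qed
  define \<gamma> where "\<gamma> = distr (ipow std_normal_distribution m) borel V"
  have D: "distr \<gamma> borel (\<lambda>x. \<theta> \<bullet> x) = distr std_normal_distribution borel (\<lambda>x. sqrt (q \<theta>) * x)" for \<theta>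
    unfolding \<gamma>_def by (subst distr_distr) (auto simp: comp_def V distr_normal_combination tq)
  have q0: "0 \<le> q \<theta>" for \<theta> using psd by (simp add: q_def)
  have int: "integrable \<gamma> (\<lambda>x. g (\<theta> \<bullet> x)) \<longleftrightarrow> integrable std_normal_distribution (\<lambda>x. g (sqrt (q \<theta>) * x))"
      "(\<integral>x. g (\<theta> \<bullet> x) \<partial>\<gamma>) = (\<integral>x. g (sqrt (q \<theta>) * x) \<partial>std_normal_distribution)"
    if [measurable]: "g \<in> borel_measurable borel" for g :: "real \<Rightarrow> real" and \<theta>
  proof -
    have [measurable]: "(\<lambda>x. \<theta> \<bullet> x) \<in> borel_measurable \<gamma>" unfolding \<gamma>_def by measurable
    show "(\<integral>x. g (\<theta> \<bullet> x) \<partial>\<gamma>) = (\<integral>x. g (sqrt (q \<theta>) * x) \<partial>std_normal_distribution)"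
      using integral_distr[of "\<lambda>x. \<theta> \<bullet> x" \<gamma> borel g] integral_distr[of "\<lambda>x. sqrt (q \<theta>) * x" std_normal_distribution borel g]
      unfolding D by simp
    show "integrable \<gamma> (\<lambda>x. g (\<theta> \<bullet> x)) \<longleftrightarrow> integrable std_normal_distribution (\<lambda>x. g (sqrt (q \<theta>) * x))"
      using integrable_distr_eq[of "\<lambda>x. \<theta> \<bullet> x" \<gamma> borel g] integrable_distr_eq[of "\<lambda>x. sqrt (q \<theta>) * x" std_normal_distribution borel g]
      unfolding D by simp
  qed
  have sq: "integrable \<gamma> (\<lambda>x. (\<theta> \<bullet> x)\<^sup>2)" "(\<integral>x. (\<theta> \<bullet> x)\<^sup>2 \<partial>\<gamma>) = q \<theta>" for \<theta>
  proof -
    have e: "(sqrt (q \<theta>) * x)\<^sup>2 = q \<theta> * x\<^sup>2" for x using q0 by (simp add: power_mult_distrib)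
    show "integrable \<gamma> (\<lambda>x. (\<theta> \<bullet> x)\<^sup>2)"
      by (subst int(1)) (simp_all only: e integrable_mult_right std_normal_moments borel_measurable_power measurable_ident_sets)
    show "(\<integral>x. (\<theta> \<bullet> x)\<^sup>2 \<partial>\<gamma>) = q \<theta>"
      by (subst int(2)) (simp_all only: e integral_mult_right_zero std_normal_moments(4) mult_1_right borel_measurable_power measurable_ident_sets)
  qed
  have mean: "(\<integral>x. \<theta> \<bullet> x \<partial>\<gamma>) = 0" for \<theta>
    by (subst int(2)[of "\<lambda>x. x"]) (simp_all only: integral_mult_right_zero std_normal_moments(2) mult_zero_right measurable_ident_sets)
  have ax: "axis i 1 \<bullet> x = x $ i" for i :: 'k and x :: "real^'k"
    by (simp add: inner_axis' )
  have qax: "q (axis i 1 + axis j 1) = C $ i $ i + C $ j $ j + 2 * C $ i $ j" "q (axis i 1) = C $ i $ i" for i j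
  proof -
    have ta: "t (axis i 1) l = a l i" for l i
      unfolding t_def axis_def by (simp add: if_distrib[of "\<lambda>x. x * _"] cong: if_cong)
    have tp: "t (axis i 1 + axis j 1) l = a l i + a l j" for l
    proof -
      have "t (axis i 1 + axis j 1) l = t (axis i 1) l + t (axis j 1) l"
        unfolding t_def by (simp add: distrib_right sum.distrib)
      then show ?thesis by (simp only: ta)
    qed
    show "q (axis i 1) = C $ i $ i" by (subst tq[symmetric], unfold ta a) (simp add: power2_eq_square)
    show "q (axis i 1 + axis j 1) = C $ i $ i + C $ j $ j + 2 * C $ i $ j"
    proof -
      have "(\<Sum>l<m. (a l i + a l j)\<^sup>2) = (\<Sum>l<m. a l i * a l i + a l j * a l j + 2 * (a l i * a l j))"
        by (intro sum.cong refl) (simp add: power2_eq_square algebra_simps)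
      then show ?thesis by (subst tq[symmetric], unfold tp a) (simp add: sum.distrib sum_distrib_left)
    qed
  qed
  have "centred_gaussian \<gamma> C"
    unfolding centred_gaussian_def
  proof (intro conjI allI)
    show "prob_space \<gamma>" unfolding \<gamma>_def by (rule P.prob_space_distr[OF mV])
    show "sets \<gamma> = sets borel" by (simp add: \<gamma>_def)
    show "gaussian_real (distr \<gamma> borel (\<lambda>x. \<theta> \<bullet> x))" for \<theta>
      unfolding D by (intro gaussian_real_scaled) (simp add: q0)
    show "(\<integral>x. x $ i \<partial>\<gamma>) = 0" for i using mean[of "axis i 1"] unfolding ax .
    fix i j
    \<comment> \<open>Polarisation reduces mixed moments to second moments of projections.\<close>
    have "(\<integral>x. x $ i * x $ j \<partial>\<gamma>) = (\<integral>x. (((axis i 1 + axis j 1) \<bullet> x)\<^sup>2 - (axis i 1 \<bullet> x)\<^sup>2 - (axis j 1 \<bullet> x)\<^sup>2) / 2 \<partial>\<gamma>)"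
      by (intro Bochner_Integration.integral_cong refl) (simp add: inner_add_left ax power2_eq_square algebra_simps)
    also have "\<dots> = (q (axis i 1 + axis j 1) - q (axis i 1) - q (axis j 1)) / 2"
      using sq by simp
    finally show "(\<integral>x. x $ i * x $ j \<partial>\<gamma>) = C $ i $ j" unfolding qax by simp
  qed
  then show ?thesis using D by (intro that) (auto simp: q_def)
qed

section \<open>Convergence in law from characteristic functions\<close>

text \<open>Complex trigonometric polynomials, generated so that convergence known on characters
  extends to them by induction.\<close>

inductive trig :: "(real^'k \<Rightarrow> complex) \<Rightarrow> bool" where
  trig_exp: "trig (\<lambda>x. c * iexp (\<theta> \<bullet> x))"
| trig_add: "trig f \<Longrightarrow> trig g \<Longrightarrow> trig (\<lambda>x. f x + g x)"

lemma trig_const: "trig (\<lambda>x. c)"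
  using trig_exp[of c 0] by simp

lemma trig_sum: "(\<And>i. i \<in> I \<Longrightarrow> trig (f i)) \<Longrightarrow> trig (\<lambda>x. \<Sum>i\<in>I. f i x)"
  by (induction I rule: infinite_finite_induct) (auto intro: trig_const trig_add)

lemma trig_mult:
  assumes f: "trig f" and g: "trig g"
  shows "trig (\<lambda>x. f x * g x)"
  using f
proof induction
  case (trig_exp c \<theta>)
  show ?case using g
  proof induction
    case (trig_exp d \<eta>)
    have "(\<lambda>x. c * iexp (\<theta> \<bullet> x) * (d * iexp (\<eta> \<bullet> x))) = (\<lambda>x. (c * d) * iexp ((\<theta> + \<eta>) \<bullet> x))"
      by (simp add: inner_add_left exp_add[symmetric] algebra_simps fun_eq_iff)
    then show ?case using trig.trig_exp[of "c * d" "\<theta> + \<eta>"] by simp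
  next
    case (trig_add f g)
    show ?case using trig.trig_add[OF trig_add.IH] by (simp add: algebra_simps)
  qed
next
  case (trig_add f1 f2)
  show ?case using trig.trig_add[OF trig_add.IH] by (simp add: algebra_simps)
qed

lemma trig_sin: "trig (\<lambda>x::real^'k. complex_of_real (sin (x $ i / R)))"
proof -
  have "trig (\<lambda>x::real^'k. (- \<i> / 2) * iexp (axis i (1 / R) \<bullet> x) + (\<i> / 2) * iexp (axis i (- 1 / R) \<bullet> x))"
    by (intro trig_add trig_exp)
  moreover have "(- \<i> / 2) * iexp (axis i (1 / R) \<bullet> x) + (\<i> / 2) * iexp (axis i (- 1 / R) \<bullet> x) = complex_of_real (sin (x $ i / R))"
    for x :: "real^'k"
    unfolding cis_conv_exp[symmetric] by (simp add: complex_eq_iff inner_axis')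
  ultimately show ?thesis by simp
qed

lemma trig_bounded: "trig f \<Longrightarrow> f \<in> borel_measurable borel \<and> (\<exists>B. \<forall>x. norm (f x) \<le> B)"
proof (induction rule: trig.induct)
  case (trig_exp c \<theta>)
  then show ?case by (auto intro!: exI[of _ "norm c"] simp: norm_mult)
next
  case (trig_add f g)
  then obtain A B where "\<forall>x. norm (f x) \<le> A" "\<forall>x. norm (g x) \<le> B" by blast
  then have "\<forall>x. norm (f x + g x) \<le> A + B" by (meson add_mono norm_triangle_le)
  then show ?case using trig_add by auto
qed

lemma trig_polynomial:
  fixes q :: "real^'k \<Rightarrow> real"
  assumes "real_polynomial_function q"
  shows "trig (\<lambda>x. complex_of_real (q (\<chi> i. sin (x $ i / R))))"
  using assms
proof (induction rule: real_polynomial_function.induct)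
  case (linear f)
  then interpret bounded_linear f .
  have "f (\<chi> i. sin (x $ i / R)) = (\<Sum>i\<in>UNIV. sin (x $ i / R) * f (axis i 1))" for x :: "real^'k"
    by (subst basis_expansion[symmetric]) (simp add: sum scaleR scalar_mult_eq_scaleR)
  then show ?case by (auto intro!: trig_sum trig_mult trig_sin trig_const)
qed (auto intro: trig_const trig_add trig_mult)

text \<open>The substitution u_i = sin (x_i / R) maps the whole space into a cube, where f composed
  with R arcsin is continuous and uniformly close to a polynomial; a polynomial in sines is a
  trigonometric polynomial. On the box |x_i| <= R the substitution is inverted exactly. Outside,
  only a crude bound holds, and the growing weight pays for it.\<close>

lemma trig_approx:
  fixes f :: "real^'k \<Rightarrow> real"
  assumes f: "continuous_on UNIV f" "bounded (range f)" and e: "0 < \<epsilon>"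
  shows "\<exists>p. trig (\<lambda>x. complex_of_real (p x)) \<and> (\<forall>x. \<bar>f x - p x\<bar> \<le> \<epsilon> * (1 + (\<Sum>i\<in>UNIV. \<bar>x $ i\<bar>)))"
proof -
  obtain B where B: "\<And>x. \<bar>f x\<bar> \<le> B" using f(2) by (auto simp: bounded_iff)
  have B0: "0 \<le> B" using B[of 0] by linarith
  \<comment> \<open>Chosen so that \<epsilon> R equals the crude bound 2 B + \<epsilon>; outside the
    box some coordinate exceeds R, so the weight dominates this bound.\<close>
  define R where "R = (2 * B + \<epsilon>) / \<epsilon>"
  have R: "0 < R" "\<epsilon> * R = 2 * B + \<epsilon>" using B0 e by (auto simp: R_def field_simps)
  let ?S = "cbox (\<chi> i. - 1) (\<chi> i. 1) :: (real^'k) set"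
  have S: "u \<in> ?S \<longleftrightarrow> (\<forall>i. - 1 \<le> u $ i \<and> u $ i \<le> 1)" for u by (simp add: mem_box_cart)
  have "continuous_on ?S (\<lambda>u. f (\<chi> i. R * arcsin (u $ i)))"
    by (intro continuous_on_compose2[OF f(1)] continuous_intros) (auto simp: S)
  then obtain q where q: "real_polynomial_function q" "\<And>u. u \<in> ?S \<Longrightarrow> \<bar>f (\<chi> i. R * arcsin (u $ i)) - q u\<bar> < \<epsilon>"
    using Stone_Weierstrass_real_polynomial_function[OF compact_cbox _ e] by blast
  define p where "p x = q (\<chi> i. sin (x $ i / R))" for x :: "real^'k"
  have "\<bar>f x - p x\<bar> \<le> \<epsilon> * (1 + (\<Sum>i\<in>UNIV. \<bar>x $ i\<bar>))" for x
  proof -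
    have 1: "\<bar>f (\<chi> i. R * arcsin (sin (x $ i / R))) - p x\<bar> < \<epsilon>"
      using q(2)[of "\<chi> i. sin (x $ i / R)"] by (simp add: S p_def)
    have s0: "0 \<le> (\<Sum>i\<in>UNIV. \<bar>x $ i\<bar>)" by (intro sum_nonneg) simp
    show ?thesis
    proof (cases "\<forall>i. \<bar>x $ i\<bar> \<le> R")
      case True
      have "R * arcsin (sin (x $ i / R)) = x $ i" for i
      proof -
        have "\<bar>x $ i / R\<bar> \<le> 1" using True R by (simp add: abs_divide)
        then have "- (pi / 2) \<le> x $ i / R" "x $ i / R \<le> pi / 2" using pi_gt3 by linarith+
        then show ?thesis using R by (simp add: arcsin_sin)
      qed
      then have "\<bar>f x - p x\<bar> < \<epsilon>" using 1 by simp
      then show ?thesis using mult_nonneg_nonneg[of \<epsilon>, OF _ s0] e unfolding distrib_left by linarith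
    next
      case False
      then obtain i where i: "R < \<bar>x $ i\<bar>" by (auto simp: not_le)
      have "\<bar>x $ i\<bar> \<le> (\<Sum>i\<in>UNIV. \<bar>x $ i\<bar>)" by (rule member_le_sum) auto
      then have "\<epsilon> * R \<le> \<epsilon> * (\<Sum>i\<in>UNIV. \<bar>x $ i\<bar>)" using i e by (intro mult_left_mono) auto
      moreover have "\<bar>f x - p x\<bar> \<le> 2 * B + \<epsilon>"
        using 1 B[of x] B[of "\<chi> i. R * arcsin (sin (x $ i / R))"] by linarith
      ultimately show ?thesis using R(2) e unfolding distrib_left by linarith
    qed
  qed
  moreover have "trig (\<lambda>x. complex_of_real (p x))" unfolding p_def by (rule trig_polynomial[OF q(1)])
  ultimately show ?thesis by blast
qed

text \<open>A first moment bound plays the role of tightness, because it integrates the weight in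
  \<open>trig_approx\<close>.\<close>

definition tight_law :: "real \<Rightarrow> (real^'k) measure \<Rightarrow> bool" where
  "tight_law C M \<longleftrightarrow> prob_space M \<and> sets M = sets borel \<and>
     (\<forall>i. integrable M (\<lambda>x. x $ i) \<and> (\<integral>x. \<bar>x $ i\<bar> \<partial>M) \<le> C)"

lemma tight_law_approx:
  fixes M :: "(real^'k) measure"
  assumes M: "tight_law C M" and f: "f \<in> borel_measurable borel" "\<And>x. \<bar>f x\<bar> \<le> B"
    and p: "trig (\<lambda>x. complex_of_real (p x))" "\<And>x. \<bar>f x - p x\<bar> \<le> \<epsilon> * (1 + (\<Sum>i\<in>UNIV. \<bar>x $ i\<bar>))"
    and e: "0 \<le> \<epsilon>"
  shows "\<bar>(\<integral>x. f x \<partial>M) - (\<integral>x. p x \<partial>M)\<bar> \<le> \<epsilon> * (1 + real CARD('k) * C)"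
proof -
  interpret prob_space M using M by (simp add: tight_law_def)
  have [measurable_cong]: "sets M = sets borel" and i: "\<And>i. integrable M (\<lambda>x. x $ i)" "\<And>i. (\<integral>x. \<bar>x $ i\<bar> \<partial>M) \<le> C"
    using M by (auto simp: tight_law_def)
  obtain D where D: "\<And>x. norm (complex_of_real (p x)) \<le> D" and "(\<lambda>x. complex_of_real (p x)) \<in> borel_measurable borel"
    using trig_bounded[OF p(1)] by blast
  then have "(\<lambda>x. Re (complex_of_real (p x))) \<in> borel_measurable borel" by measurable
  then have [measurable]: "p \<in> borel_measurable borel" by simp
  note f(1) [measurable]
  have fi: "integrable M f" by (rule integrable_const_bound[where B=B]) (use f in auto)
  have pint: "integrable M p" by (rule integrable_const_bound[where B=D]) (use D in auto)
  have "\<bar>(\<integral>x. f x \<partial>M) - (\<integral>x. p x \<partial>M)\<bar> = \<bar>\<integral>x. f x - p x \<partial>M\<bar>" using fi pint by simp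
  also have "\<dots> \<le> (\<integral>x. \<bar>f x - p x\<bar> \<partial>M)" by (rule integral_abs_bound)
  also have "\<dots> \<le> (\<integral>x. \<epsilon> * (1 + (\<Sum>i\<in>UNIV. \<bar>x $ i\<bar>)) \<partial>M)"
    by (intro integral_mono) (use fi pint i p in auto)
  also have "\<dots> = \<epsilon> * (1 + (\<Sum>i\<in>UNIV. \<integral>x. \<bar>x $ i\<bar> \<partial>M))"
    using i by (simp add: prob_space)
  also have "\<dots> \<le> \<epsilon> * (1 + real CARD('k) * C)"
    using sum_bounded_above[of UNIV "\<lambda>i. \<integral>x. \<bar>x $ i\<bar> \<partial>M" C] i e by (intro mult_left_mono add_left_mono) auto
  finally show ?thesis .
qed

text \<open>The moment bound is required eventually only, as the lower bound on the partition
  function behind it is available only for large N.\<close>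

theorem conv_in_law_of_char:
  fixes M :: "nat \<Rightarrow> (real^'k) measure"
  assumes M: "\<forall>\<^sub>F n in sequentially. tight_law C (M n)" and \<gamma>: "tight_law C \<gamma>"
    and char: "\<And>\<theta>. (\<lambda>n. \<integral>x. iexp (\<theta> \<bullet> x) \<partial>M n) \<longlonglongrightarrow> (\<integral>x. iexp (\<theta> \<bullet> x) \<partial>\<gamma>)"
  shows "conv_in_law M \<gamma>"
  unfolding conv_in_law_def
proof (intro allI impI)
  fix f :: "real^'k \<Rightarrow> real" assume f: "continuous_on UNIV f \<and> bounded (range f)"
  have integrable_trig: "integrable L g" if L: "tight_law C L" and g: "trig g" for L :: "(real^'k) measure" and g
  proof -
    interpret prob_space L using L by (simp add: tight_law_def)
    have [measurable_cong]: "sets L = sets borel" using L by (simp add: tight_law_def)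
    obtain B where "\<And>x. norm (g x) \<le> B" "g \<in> borel_measurable borel" using trig_bounded[OF g] by blast
    then show ?thesis by (intro integrable_const_bound[where B=B]) auto
  qed
  have trig_lim: "(\<lambda>n. \<integral>x. g x \<partial>M n) \<longlonglongrightarrow> (\<integral>x. g x \<partial>\<gamma>)" if "trig g" for g
    using that
  proof induction
    case (trig_exp c \<theta>)
    show ?case using tendsto_mult_left[OF char[of \<theta>], of c] by simp
  next
    case (trig_add g h)
    have "\<forall>\<^sub>F n in sequentially. (\<integral>x. g x \<partial>M n) + (\<integral>x. h x \<partial>M n) = (\<integral>x. g x + h x \<partial>M n)"
      using M by eventually_elim (use trig_add integrable_trig in auto)
    then show ?case
      using tendsto_cong[THEN iffD1, OF _ tendsto_add[OF trig_add.IH]] integrable_trig[OF \<gamma>] trig_add.hyps by simp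
  qed
  obtain B where B: "\<And>x. \<bar>f x\<bar> \<le> B" using f by (auto simp: bounded_iff)
  have fm: "f \<in> borel_measurable borel" using f by (intro borel_measurable_continuous_onI) auto
  define A where "A = 1 + real CARD('k) * \<bar>C\<bar>"
  have A: "0 < A" "1 + real CARD('k) * C \<le> A" by (auto simp: A_def intro!: add_pos_nonneg mult_left_mono)
  show "(\<lambda>n. \<integral>x. f x \<partial>M n) \<longlonglongrightarrow> (\<integral>x. f x \<partial>\<gamma>)"
  proof (rule LIMSEQ_I, unfold real_norm_def)
    fix r :: real assume r: "0 < r"
    define \<epsilon> where "\<epsilon> = r / (3 * A)"
    have e: "0 < \<epsilon>" "\<epsilon> * A = r / 3" using r A by (auto simp: \<epsilon>_def)
    have eA: "\<epsilon> * (1 + real CARD('k) * C) \<le> r / 3" using mult_left_mono[OF A(2), of \<epsilon>] e by simp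
    obtain p where p: "trig (\<lambda>x. complex_of_real (p x))" "\<And>x. \<bar>f x - p x\<bar> \<le> \<epsilon> * (1 + (\<Sum>i\<in>UNIV. \<bar>x $ i\<bar>))"
      using trig_approx[of f \<epsilon>] f e by blast
    have "(\<lambda>n. complex_of_real (\<integral>x. p x \<partial>M n)) \<longlonglongrightarrow> complex_of_real (\<integral>x. p x \<partial>\<gamma>)"
      using trig_lim[OF p(1)] by simp
    then have "(\<lambda>n. \<integral>x. p x \<partial>M n) \<longlonglongrightarrow> (\<integral>x. p x \<partial>\<gamma>)" by (simp only: tendsto_of_real_iff)
    then have "\<forall>\<^sub>F n in sequentially. dist (\<integral>x. p x \<partial>M n) (\<integral>x. p x \<partial>\<gamma>) < r / 3"
      using r by (intro tendstoD) auto
    then have "\<forall>\<^sub>F n in sequentially. \<bar>(\<integral>x. f x \<partial>M n) - (\<integral>x. f x \<partial>\<gamma>)\<bar> < r"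
      using M
    proof eventually_elim
      case (elim n)
      have "\<bar>(\<integral>x. f x \<partial>M n) - (\<integral>x. p x \<partial>M n)\<bar> \<le> r / 3"
        using tight_law_approx[OF elim(2) fm B p] e eA by fastforce
      moreover have "\<bar>(\<integral>x. f x \<partial>\<gamma>) - (\<integral>x. p x \<partial>\<gamma>)\<bar> \<le> r / 3"
        using tight_law_approx[OF \<gamma> fm B p] e eA by fastforce
      ultimately show ?case using elim(1) unfolding dist_real_def by linarith
    qed
    then show "\<exists>n0. \<forall>n\<ge>n0. \<bar>(\<integral>x. f x \<partial>M n) - (\<integral>x. f x \<partial>\<gamma>)\<bar> < r" by (simp add: eventually_sequentially)
  qed
qed

section \<open>Fluctuations under the Gibbs measure\<close>

text \<open>Uniform integrability by truncation: where the exponential exceeds L it is at most its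
  square divided by L, and the square has a bounded mean.\<close>

lemma conv_in_law_exp_moment:
  fixes M :: "nat \<Rightarrow> (real^'k) measure"
  assumes law: "conv_in_law M \<gamma>"
    and M: "\<forall>\<^sub>F n in sequentially. prob_space (M n) \<and> sets (M n) = sets borel \<and>
        integrable (M n) (\<lambda>x. exp (2 * (\<theta> \<bullet> x))) \<and> (\<integral>x. exp (2 * (\<theta> \<bullet> x)) \<partial>M n) \<le> D"
    and \<gamma>: "prob_space \<gamma>" "sets \<gamma> = sets borel" "integrable \<gamma> (\<lambda>x. exp (2 * (\<theta> \<bullet> x)))"
  shows "(\<lambda>n. \<integral>x. exp (\<theta> \<bullet> x) \<partial>M n) \<longlonglongrightarrow> (\<integral>x. exp (\<theta> \<bullet> x) \<partial>\<gamma>)"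
proof -
  have trunc: "\<bar>(\<integral>x. exp (\<theta> \<bullet> x) \<partial>P) - (\<integral>x. min (exp (\<theta> \<bullet> x)) L \<partial>P)\<bar> \<le> E / L"
    if P: "prob_space P" "sets P = sets borel" "integrable P (\<lambda>x. exp (2 * (\<theta> \<bullet> x)))" "(\<integral>x. exp (2 * (\<theta> \<bullet> x)) \<partial>P) \<le> E" and L: "0 < L"
    for P :: "(real^'k) measure" and E L
  proof -
    interpret prob_space P by fact
    have [measurable_cong]: "sets P = sets borel" by fact
    have sq: "exp (2 * (\<theta> \<bullet> x)) = exp (\<theta> \<bullet> x) * exp (\<theta> \<bullet> x)" for x by (simp add: exp_add[symmetric])
    have i1: "integrable P (\<lambda>x. exp (\<theta> \<bullet> x))"
    proof (rule Bochner_Integration.integrable_bound[of P "\<lambda>x. 1 + exp (2 * (\<theta> \<bullet> x))"])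
      show "AE x in P. norm (exp (\<theta> \<bullet> x)) \<le> norm (1 + exp (2 * (\<theta> \<bullet> x)))"
      proof (rule AE_I2)
        fix x
        have "exp (\<theta> \<bullet> x) \<le> 1 + exp (\<theta> \<bullet> x) * exp (\<theta> \<bullet> x)"
          using zero_le_square[of "exp (\<theta> \<bullet> x) - 1"] by (simp add: algebra_simps) (smt (verit) exp_gt_zero)
        then show "norm (exp (\<theta> \<bullet> x)) \<le> norm (1 + exp (2 * (\<theta> \<bullet> x)))" unfolding sq by simp
      qed
    qed (use P in auto)
    have i2: "integrable P (\<lambda>x. min (exp (\<theta> \<bullet> x)) L)"
      by (rule integrable_const_bound[where B=L]) (use L in auto)
    have "\<bar>(\<integral>x. exp (\<theta> \<bullet> x) \<partial>P) - (\<integral>x. min (exp (\<theta> \<bullet> x)) L \<partial>P)\<bar> = \<bar>\<integral>x. exp (\<theta> \<bullet> x) - min (exp (\<theta> \<bullet> x)) L \<partial>P\<bar>"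
      using i1 i2 by simp
    also have "\<dots> \<le> (\<integral>x. \<bar>exp (\<theta> \<bullet> x) - min (exp (\<theta> \<bullet> x)) L\<bar> \<partial>P)" by (rule integral_abs_bound)
    also have "\<dots> \<le> (\<integral>x. exp (2 * (\<theta> \<bullet> x)) / L \<partial>P)"
    proof (intro integral_mono integrable_abs Bochner_Integration.integrable_diff i1 i2 integrable_divide P(3))
      fix x
      show "\<bar>exp (\<theta> \<bullet> x) - min (exp (\<theta> \<bullet> x)) L\<bar> \<le> exp (2 * (\<theta> \<bullet> x)) / L"
      proof (cases "exp (\<theta> \<bullet> x) \<le> L")
        case False
        then have "exp (\<theta> \<bullet> x) * L \<le> exp (\<theta> \<bullet> x) * exp (\<theta> \<bullet> x)" by (intro mult_left_mono) auto
        then have "exp (\<theta> \<bullet> x) \<le> exp (2 * (\<theta> \<bullet> x)) / L" unfolding sq using L by (simp add: pos_le_divide_eq)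
        then show ?thesis using False L by simp
      qed (use L in simp)
    qed
    also have "\<dots> \<le> E / L" using P(4) L by (simp add: divide_right_mono)
    finally show ?thesis .
  qed
  define E where "E = \<bar>D\<bar> + (\<integral>x. exp (2 * (\<theta> \<bullet> x)) \<partial>\<gamma>) + 1"
  have g0: "0 \<le> (\<integral>x. exp (2 * (\<theta> \<bullet> x)) \<partial>\<gamma>)" by simp
  have E: "0 < E" "D \<le> E" "(\<integral>x. exp (2 * (\<theta> \<bullet> x)) \<partial>\<gamma>) \<le> E" using g0 unfolding E_def by linarith+
  show ?thesis
  proof (rule LIMSEQ_I, unfold real_norm_def)
    fix r :: real assume r: "0 < r"
    define L where "L = 3 * E / r"
    have L: "0 < L" "E / L = r / 3" using E r by (auto simp: L_def)
    have c: "continuous_on UNIV (\<lambda>x. min (exp (\<theta> \<bullet> x)) L)" by (intro continuous_intros)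
    have b: "bounded (range (\<lambda>x. min (exp (\<theta> \<bullet> x)) L))"
      unfolding bounded_iff using L by (intro exI[of _ L]) auto
    have "(\<lambda>n. \<integral>x. min (exp (\<theta> \<bullet> x)) L \<partial>M n) \<longlonglongrightarrow> (\<integral>x. min (exp (\<theta> \<bullet> x)) L \<partial>\<gamma>)"
      using law c b unfolding conv_in_law_def by blast
    then have "\<forall>\<^sub>F n in sequentially. dist (\<integral>x. min (exp (\<theta> \<bullet> x)) L \<partial>M n) (\<integral>x. min (exp (\<theta> \<bullet> x)) L \<partial>\<gamma>) < r / 3"
      using r by (intro tendstoD) auto
    then have "\<forall>\<^sub>F n in sequentially. \<bar>(\<integral>x. exp (\<theta> \<bullet> x) \<partial>M n) - (\<integral>x. exp (\<theta> \<bullet> x) \<partial>\<gamma>)\<bar> < r"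
      using M
    proof eventually_elim
      case (elim n)
      have "\<bar>(\<integral>x. exp (\<theta> \<bullet> x) \<partial>M n) - (\<integral>x. min (exp (\<theta> \<bullet> x)) L \<partial>M n)\<bar> \<le> E / L"
        using elim(2) E by (intro trunc L) auto
      moreover have "\<bar>(\<integral>x. exp (\<theta> \<bullet> x) \<partial>\<gamma>) - (\<integral>x. min (exp (\<theta> \<bullet> x)) L \<partial>\<gamma>)\<bar> \<le> E / L"
        by (intro trunc L \<gamma> E)
      ultimately show ?case using elim(1) unfolding dist_real_def L(2) by linarith
    qed
    then show "\<exists>n0. \<forall>n\<ge>n0. \<bar>(\<integral>x. exp (\<theta> \<bullet> x) \<partial>M n) - (\<integral>x. exp (\<theta> \<bullet> x) \<partial>\<gamma>)\<bar> < r" by (simp add: eventually_sequentially)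
  qed
qed

section \<open>Normalised sums under the product law\<close>

lemma lin_sum: "lin N (\<lambda>x. \<Sum>i\<in>I. \<theta> i * f i x) X = (\<Sum>i\<in>I. \<theta> i * lin N (f i) X)"
proof -
  have "(\<Sum>k<N. \<Sum>i\<in>I. \<theta> i * f i (X k)) = (\<Sum>i\<in>I. \<Sum>k<N. \<theta> i * f i (X k))" by (rule sum.swap)
  then show ?thesis by (simp add: lin_def sum_divide_distrib sum_distrib_left)
qed

context prob_space
begin

lemma lin_L2:
  assumes f: "f \<in> L20 M"
  shows "lin N f \<in> L2 (ipow M N)" "(\<integral>X. (lin N f X)\<^sup>2 \<partial>ipow M N) \<le> (\<integral>x. (f x)\<^sup>2 \<partial>M)"
proof -
  have f2: "f \<in> L2 M" and f0: "(\<integral>x. f x \<partial>M) = 0" using f by (auto simp: L20_def)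
  have [measurable]: "f \<in> borel_measurable M" using f2 by (rule L2_D)
  have le: "sqn (ipow M N) (lin N f) \<le> ennreal (\<integral>x. (f x)\<^sup>2 \<partial>M)"
  proof (cases "N = 0")
    case True
    then show ?thesis by (simp add: sqn_def lin_def)
  next
    case False
    have "sqn (ipow M N) (lin N f) = sqn (ipow M N) (\<lambda>X. (1 / sqrt (real N)) * (\<Sum>i<N. f (X i)))"
      by (intro arg_cong2[where f=sqn] refl ext) (simp add: lin_def)
    also have "\<dots> = ennreal ((1 / sqrt (real N))\<^sup>2) * sqn (ipow M N) (\<lambda>X. \<Sum>i<N. f (X i))"
      by (rule sqn_cmult) measurable
    also have "\<dots> \<le> ennreal ((1 / sqrt (real N))\<^sup>2) * (of_nat N * sqn M f)"
      unfolding sqn_def[of "ipow M N"] by (intro mult_left_mono nn_integral_iid_sum_sq f0) auto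
    also have "\<dots> = ennreal ((1 / sqrt (real N))\<^sup>2 * (real N * (\<integral>x. (f x)\<^sup>2 \<partial>M)))"
      unfolding sqn_eq_integral[OF f2] by (simp add: ennreal_mult ennreal_of_nat_eq_real_of_nat)
    also have "(1 / sqrt (real N))\<^sup>2 * (real N * (\<integral>x. (f x)\<^sup>2 \<partial>M)) = (\<integral>x. (f x)\<^sup>2 \<partial>M)"
      using False by (simp add: power_divide)
    finally show ?thesis .
  qed
  then show l2: "lin N f \<in> L2 (ipow M N)" by (auto simp: L2_iff_sqn intro: le_less_trans)
  show "(\<integral>X. (lin N f X)\<^sup>2 \<partial>ipow M N) \<le> (\<integral>x. (f x)\<^sup>2 \<partial>M)"
    using le unfolding sqn_eq_integral[OF l2] by simp
qed

text \<open>Hoeffding for each factor with parameter t / sqrt N; the N factors multiply to a bound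
  independent of N.\<close>

lemma exp_lin_bound:
  assumes [measurable]: "f \<in> borel_measurable M" and b: "AE x in M. \<bar>f x\<bar> \<le> b" and f0: "(\<integral>x. f x \<partial>M) = 0" and t: "0 \<le> t"
  shows "(\<integral>\<^sup>+X. ennreal (exp (t * lin N f X)) \<partial>ipow M N) \<le> ennreal (exp (t\<^sup>2 * b\<^sup>2 / 2))"
proof -
  have sum: "(\<integral>\<^sup>+X. ennreal (exp (u * (\<Sum>i<n. f (X i)))) \<partial>ipow M n) \<le> ennreal (exp (u\<^sup>2 * b\<^sup>2 / 2)) ^ n" if u: "0 \<le> u" for u n
  proof (induction n)
    case 0
    interpret P: prob_space "ipow M 0" by (rule ipow_prob_space)
    show ?case using P.emeasure_space_1 by simp
  next
    case (Suc n)
    have "(\<integral>\<^sup>+X. ennreal (exp (u * (\<Sum>i<Suc n. f (X i)))) \<partial>ipow M (Suc n)) =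
        (\<integral>\<^sup>+X. \<integral>\<^sup>+x. ennreal (exp (u * (\<Sum>i<Suc n. f ((X(n := x)) i)))) \<partial>M \<partial>ipow M n)"
      by (rule nn_integral_ipow_Suc) measurable
    also have "\<dots> = (\<integral>\<^sup>+X. ennreal (exp (u * (\<Sum>i<n. f (X i)))) * (\<integral>\<^sup>+x. ennreal (exp (u * f x)) \<partial>M) \<partial>ipow M n)"
    proof (intro nn_integral_cong)
      fix X :: "nat \<Rightarrow> 'a"
      have "(\<Sum>i<Suc n. f ((X(n := x)) i)) = (\<Sum>i<n. f (X i)) + f x" for x by simp
      then have "ennreal (exp (u * (\<Sum>i<Suc n. f ((X(n := x)) i)))) = ennreal (exp (u * (\<Sum>i<n. f (X i)))) * ennreal (exp (u * f x))" for x
        by (simp only: distrib_left exp_add ennreal_mult exp_ge_zero)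
      then show "(\<integral>\<^sup>+x. ennreal (exp (u * (\<Sum>i<Suc n. f ((X(n := x)) i)))) \<partial>M) =
          ennreal (exp (u * (\<Sum>i<n. f (X i)))) * (\<integral>\<^sup>+x. ennreal (exp (u * f x)) \<partial>M)"
        by (simp only:) (rule nn_integral_cmult, measurable)
    qed
    also have "\<dots> = (\<integral>\<^sup>+X. ennreal (exp (u * (\<Sum>i<n. f (X i)))) \<partial>ipow M n) * (\<integral>\<^sup>+x. ennreal (exp (u * f x)) \<partial>M)"
      by (rule nn_integral_multc) measurable
    also have "\<dots> \<le> ennreal (exp (u\<^sup>2 * b\<^sup>2 / 2)) ^ n * ennreal (exp (u\<^sup>2 * b\<^sup>2 / 2))"
      by (intro mult_mono Suc.IH hoeffding_centred b f0 u) auto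
    finally show ?case by (simp add: mult.commute)
  qed
  show ?thesis
  proof (cases "N = 0")
    case True
    interpret P: prob_space "ipow M N" by (rule ipow_prob_space)
    have "(\<integral>\<^sup>+X. ennreal (exp (t * lin N f X)) \<partial>ipow M N) = ennreal 1"
      using P.emeasure_space_1 True by (simp add: lin_def)
    also have "\<dots> \<le> ennreal (exp (t\<^sup>2 * b\<^sup>2 / 2))" by (rule ennreal_leI) simp
    finally show ?thesis .
  next
    case False
    have "(\<integral>\<^sup>+X. ennreal (exp (t * lin N f X)) \<partial>ipow M N) = (\<integral>\<^sup>+X. ennreal (exp (t / sqrt (real N) * (\<Sum>i<N. f (X i)))) \<partial>ipow M N)"
      by (simp add: lin_def)
    also have "\<dots> \<le> ennreal (exp ((t / sqrt (real N))\<^sup>2 * b\<^sup>2 / 2)) ^ N" using t by (intro sum) auto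
    also have "\<dots> = ennreal (exp (real N * ((t / sqrt (real N))\<^sup>2 * b\<^sup>2 / 2)))"
      by (simp only: ennreal_power exp_ge_zero exp_of_nat_mult)
    also have "real N * ((t / sqrt (real N))\<^sup>2 * b\<^sup>2 / 2) = t\<^sup>2 * b\<^sup>2 / 2" using False by (simp add: power_divide)
    finally show ?thesis .
  qed
qed

end

section \<open>The normalised Gibbs law and its fluctuations\<close>

context degenerate_gibbs
begin

definition partition_fun :: "nat \<Rightarrow> real" where
  "partition_fun N = (\<integral>X. exp (gibbs_exponent M K H N X) \<partial>ipow M N)"

definition gibbs_law :: "nat \<Rightarrow> (nat \<Rightarrow> 'a) measure" where
  "gibbs_law N = density (ipow M N) (\<lambda>X. ennreal (inverse (partition_fun N) * exp (gibbs_exponent M K H N X)))"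

text \<open>Half of the lower bound on the limiting constant. As a hypothesis in later lemmas it
  bounds the normalising constant away from 0 uniformly in N.\<close>

definition partition_bound :: real where
  "partition_bound = exp ((\<integral>x. H x \<partial>M) / 2) / 2"

lemma partition_bound_pos: "0 < partition_bound" by (simp add: partition_bound_def)

lemma gibbs_transform_0: "gibbs_transform N (\<lambda>x. 0) = complex_of_real (partition_fun N)"
  by (simp add: gibbs_transform_def partition_fun_def lin_def)

lemma partition_lower: "\<forall>\<^sub>F N in sequentially. partition_bound \<le> partition_fun N"
  using gibbs_partition_lower
proof eventually_elim
  case (elim N)
  have "0 \<le> partition_fun N" unfolding partition_fun_def by simp
  with elim show ?case by (simp add: gibbs_transform_0 partition_bound_def)
qed

lemma space_gibbs_law [simp]: "sets (gibbs_law N) = sets (ipow M N)" "space (gibbs_law N) = space (ipow M N)"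
  by (auto simp: gibbs_law_def)

lemma integrable_exp_gibbs: "integrable (ipow M N) (\<lambda>X. exp (gibbs_exponent M K H N X))"
proof -
  interpret P: prob_space "ipow M N" by (rule ipow_prob_space)
  show ?thesis by (rule P.L2_integrable[OF exp_gibbs_L2])
qed

lemma prob_space_gibbs_law:
  assumes "partition_bound \<le> partition_fun N"
  shows "prob_space (gibbs_law N)"
proof (rule prob_spaceI)
  have Z: "0 < partition_fun N" using partition_bound_pos assms by linarith
  have "emeasure (gibbs_law N) (space (gibbs_law N)) =
      (\<integral>\<^sup>+X. ennreal (inverse (partition_fun N) * exp (gibbs_exponent M K H N X)) \<partial>ipow M N)"
    unfolding gibbs_law_def by (subst emeasure_density) (auto intro!: nn_integral_cong simp: indicator_def)
  also have "\<dots> = ennreal (\<integral>X. inverse (partition_fun N) * exp (gibbs_exponent M K H N X) \<partial>ipow M N)"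
    using Z integrable_exp_gibbs by (intro nn_integral_eq_integral) auto
  also have "\<dots> = 1" using Z by (simp add: partition_fun_def)
  finally show "emeasure (gibbs_law N) (space (gibbs_law N)) = 1" .
qed

lemma gibbs_law_integral:
  fixes f :: "_ \<Rightarrow> 'c::{banach, second_countable_topology}"
  assumes [measurable]: "f \<in> borel_measurable (ipow M N)" and Z: "partition_bound \<le> partition_fun N"
  shows "(\<integral>X. f X \<partial>gibbs_law N) = inverse (partition_fun N) *\<^sub>R (\<integral>X. exp (gibbs_exponent M K H N X) *\<^sub>R f X \<partial>ipow M N)"
    "integrable (gibbs_law N) f \<longleftrightarrow> integrable (ipow M N) (\<lambda>X. exp (gibbs_exponent M K H N X) *\<^sub>R f X)"
proof -
  have Z0: "0 < partition_fun N" using partition_bound_pos Z by linarith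
  have "(\<integral>X. f X \<partial>gibbs_law N) = (\<integral>X. (inverse (partition_fun N) * exp (gibbs_exponent M K H N X)) *\<^sub>R f X \<partial>ipow M N)"
    unfolding gibbs_law_def using Z0 by (subst integral_density) auto
  then show "(\<integral>X. f X \<partial>gibbs_law N) = inverse (partition_fun N) *\<^sub>R (\<integral>X. exp (gibbs_exponent M K H N X) *\<^sub>R f X \<partial>ipow M N)"
    by (simp only: scaleR_scaleR[symmetric] integral_scaleR_right)
  have "integrable (gibbs_law N) f \<longleftrightarrow> integrable (ipow M N) (\<lambda>X. (inverse (partition_fun N) * exp (gibbs_exponent M K H N X)) *\<^sub>R f X)"
    unfolding gibbs_law_def using Z0 by (subst integrable_density) auto
  also have "\<dots> \<longleftrightarrow> integrable (ipow M N) (\<lambda>X. exp (gibbs_exponent M K H N X) *\<^sub>R f X)"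
  proof
    assume "integrable (ipow M N) (\<lambda>X. (inverse (partition_fun N) * exp (gibbs_exponent M K H N X)) *\<^sub>R f X)"
    then have "integrable (ipow M N) (\<lambda>X. partition_fun N *\<^sub>R ((inverse (partition_fun N) * exp (gibbs_exponent M K H N X)) *\<^sub>R f X))"
      by (rule integrable_scaleR_right)
    then show "integrable (ipow M N) (\<lambda>X. exp (gibbs_exponent M K H N X) *\<^sub>R f X)" using Z0 by (simp add: mult.assoc[symmetric])
  next
    assume "integrable (ipow M N) (\<lambda>X. exp (gibbs_exponent M K H N X) *\<^sub>R f X)"
    then have "integrable (ipow M N) (\<lambda>X. inverse (partition_fun N) *\<^sub>R (exp (gibbs_exponent M K H N X) *\<^sub>R f X))"
      by (rule integrable_scaleR_right)
    then show "integrable (ipow M N) (\<lambda>X. (inverse (partition_fun N) * exp (gibbs_exponent M K H N X)) *\<^sub>R f X)"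
      by simp
  qed
  finally show "integrable (gibbs_law N) f \<longleftrightarrow> integrable (ipow M N) (\<lambda>X. exp (gibbs_exponent M K H N X) *\<^sub>R f X)" .
qed

text \<open>Moments pass from the product law to the Gibbs law by pairing the function with the
  weight, both square integrable, using \<open>exp_bound\<close> and the lower bound on the
  partition function.\<close>

lemma gibbs_law_L2_bound:
  fixes f :: "_ \<Rightarrow> real"
  assumes f: "f \<in> L2 (ipow M N)" "(\<integral>X. (f X)\<^sup>2 \<partial>ipow M N) \<le> D" and Z: "partition_bound \<le> partition_fun N"
  shows "integrable (gibbs_law N) f" "(\<integral>X. \<bar>f X\<bar> \<partial>gibbs_law N) \<le> (D + \<bar>C\<bar>) / partition_bound"
proof -
  let ?e = "\<lambda>X. exp (gibbs_exponent M K H N X)"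
  have Z0: "0 < partition_fun N" using partition_bound_pos Z by linarith
  have [measurable]: "f \<in> borel_measurable (ipow M N)" using f by (auto dest: L2_D)
  have i: "integrable (ipow M N) (\<lambda>X. ?e X * f X)" by (rule L2_mult_integrable[OF exp_gibbs_L2 f(1)])
  then show "integrable (gibbs_law N) f" using Z by (subst gibbs_law_integral(2)) auto
  have e2: "(\<integral>X. (?e X)\<^sup>2 \<partial>ipow M N) \<le> \<bar>C\<bar>"
  proof -
    have "ennreal (\<integral>X. (?e X)\<^sup>2 \<partial>ipow M N) \<le> ennreal C"
      using exp_bound[of N] unfolding sqn_eq_integral[OF exp_gibbs_L2, symmetric] sqn_def by (simp add: exp_double)
    then have "ennreal (\<integral>X. (?e X)\<^sup>2 \<partial>ipow M N) \<le> ennreal \<bar>C\<bar>" by (rule order_trans) (simp add: ennreal_leI)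
    then show ?thesis by simp
  qed
  have D: "0 \<le> D" using f(2) by (rule order_trans[rotated]) simp
  have "(\<integral>X. ?e X * \<bar>f X\<bar> \<partial>ipow M N) \<le> (\<integral>X. (f X)\<^sup>2 + (?e X)\<^sup>2 \<partial>ipow M N)"
  proof (intro integral_mono Bochner_Integration.integrable_add L2_D(2) f exp_gibbs_L2)
    show "integrable (ipow M N) (\<lambda>X. ?e X * \<bar>f X\<bar>)" using integrable_abs[OF i] by (simp add: abs_mult)
    fix X
    have "0 \<le> (\<bar>f X\<bar> - ?e X)\<^sup>2" "0 \<le> ?e X * \<bar>f X\<bar>" by simp_all
    then show "?e X * \<bar>f X\<bar> \<le> (f X)\<^sup>2 + (?e X)\<^sup>2" by (simp only: power2_diff power2_abs mult.assoc mult.commute[of "exp _"])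
  qed
  also have "\<dots> = (\<integral>X. (f X)\<^sup>2 \<partial>ipow M N) + (\<integral>X. (?e X)\<^sup>2 \<partial>ipow M N)"
    by (intro Bochner_Integration.integral_add L2_D(2) f exp_gibbs_L2)
  also have "\<dots> \<le> D + \<bar>C\<bar>" using f(2) e2 by linarith
  finally have le: "(\<integral>X. ?e X * \<bar>f X\<bar> \<partial>ipow M N) \<le> D + \<bar>C\<bar>" .
  have "(\<integral>X. \<bar>f X\<bar> \<partial>gibbs_law N) = (\<integral>X. ?e X * \<bar>f X\<bar> \<partial>ipow M N) / partition_fun N"
    using Z by (subst gibbs_law_integral(1)) (auto simp: field_simps)
  also have "\<dots> \<le> (D + \<bar>C\<bar>) / partition_bound"
    using le Z Z0 partition_bound_pos D by (intro frac_le) auto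
  finally show "(\<integral>X. \<bar>f X\<bar> \<partial>gibbs_law N) \<le> (D + \<bar>C\<bar>) / partition_bound" .
qed

lemma gibbs_law_char:
  assumes ph: "\<phi> \<in> L20 M" and f: "solves \<phi> f"
  shows "(\<lambda>N. \<integral>X. iexp (lin N \<phi> X) \<partial>gibbs_law N) \<longlonglongrightarrow> complex_of_real (exp (- L2_inner M \<phi> f / 2))"
proof (rule tendsto_cong[THEN iffD1, OF _ gibbs_char_limit[OF ph f]])
  have [measurable]: "\<phi> \<in> borel_measurable M" using L20_L2[OF ph] by (rule L2_D)
  show "\<forall>\<^sub>F N in sequentially. gibbs_transform N \<phi> / gibbs_transform N (\<lambda>x. 0) = (\<integral>X. iexp (lin N \<phi> X) \<partial>gibbs_law N)"
    using partition_lower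
  proof eventually_elim
    case (elim N)
    have "(\<integral>X. exp (gibbs_exponent M K H N X) *\<^sub>R iexp (lin N \<phi> X) \<partial>ipow M N) = gibbs_transform N \<phi>"
      unfolding gibbs_transform_def by (intro Bochner_Integration.integral_cong refl) (simp add: scaleR_conv_of_real mult.commute)
    then show ?case
      unfolding gibbs_transform_0 using elim
      by (subst gibbs_law_integral(1)) (auto simp: scaleR_conv_of_real divide_inverse mult.commute)
  qed
qed

lemma solves_combination:
  assumes I: "finite I" and s: "\<And>i. i \<in> I \<Longrightarrow> solves (\<phi> i) (f i)"
  shows "solves (\<lambda>x. \<Sum>i\<in>I. \<theta> i * \<phi> i x) (\<lambda>x. \<Sum>i\<in>I. \<theta> i * f i x)"
  unfolding solves_def
proof
  have f: "f i \<in> L2 M" if "i \<in> I" for i using s[OF that] by (simp add: solves_def)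
  show "(\<lambda>x. \<Sum>i\<in>I. \<theta> i * f i x) \<in> L2 M" by (intro L2_sum L2_cmult f)
  have "AE x in M. \<forall>i\<in>I. f i x + kop K (f i) x = \<phi> i x"
    using I s by (intro AE_finite_allI) (auto simp: solves_def)
  with AE_K_L2 show "AE x in M. (\<Sum>i\<in>I. \<theta> i * f i x) + kop K (\<lambda>x. \<Sum>i\<in>I. \<theta> i * f i x) x = (\<Sum>i\<in>I. \<theta> i * \<phi> i x)"
  proof eventually_elim
    case (elim x)
    have "kop K (\<lambda>x. \<Sum>i\<in>I. \<theta> i * f i x) x = (\<integral>y. (\<Sum>i\<in>I. \<theta> i * (K x y * f i y)) \<partial>M)"
      unfolding kop_def by (simp add: sum_distrib_left mult_ac)
    also have "\<dots> = (\<Sum>i\<in>I. \<theta> i * kop K (f i) x)"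
      unfolding kop_def using L2_mult_integrable[OF elim(1) f] by (subst Bochner_Integration.integral_sum) auto
    finally have "(\<Sum>i\<in>I. \<theta> i * f i x) + kop K (\<lambda>x. \<Sum>i\<in>I. \<theta> i * f i x) x = (\<Sum>i\<in>I. \<theta> i * (f i x + kop K (f i) x))"
      by (simp add: distrib_left sum.distrib)
    then show ?case using elim(2) by simp
  qed
qed

text \<open>Cramer--Wold: for each \<theta> the combination of the \<open>\<phi> i\<close> is a
  single centred function, solved by the same combination of the \<open>f i\<close>, and the limit
  for one function applies. Symmetry and nonnegativity of the covariance, needed to build the
  Gaussian vector, come from symmetry and nonnegativity of the form of \<open>K\<close>.\<close>

theorem gibbs_clt:
  fixes \<phi> f :: "'k::finite \<Rightarrow> 'a \<Rightarrow> real"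
  assumes ph: "\<And>i. \<phi> i \<in> L20 M" and f: "\<And>i. solves (\<phi> i) (f i)"
  shows "(\<forall>\<theta> :: real^'k. (\<lambda>N. \<integral>X. iexp (\<Sum>i\<in>UNIV. \<theta> $ i * lin N (\<phi> i) X) \<partial>gibbs_law N)
      \<longlonglongrightarrow> complex_of_real (exp (- (1 / 2) * (\<Sum>i\<in>UNIV. \<Sum>j\<in>UNIV. \<theta> $ i * \<theta> $ j * L2_inner M (\<phi> i) (f j))))) \<and>
    (\<exists>\<gamma> :: (real^'k) measure. centred_gaussian \<gamma> (\<chi> i j. L2_inner M (\<phi> i) (f j)) \<and>
      conv_in_law (\<lambda>N. distr (gibbs_law N) borel (\<lambda>X. \<chi> i. lin N (\<phi> i) X)) \<gamma>) \<and>
    ((\<forall>i. \<exists>b. AE x in M. \<bar>\<phi> i x\<bar> \<le> b) \<longrightarrow>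
      (\<forall>\<theta> :: real^'k. (\<lambda>N. \<integral>X. exp (\<Sum>i\<in>UNIV. \<theta> $ i * lin N (\<phi> i) X) \<partial>gibbs_law N)
      \<longlonglongrightarrow> exp (1 / 2 * (\<Sum>i\<in>UNIV. \<Sum>j\<in>UNIV. \<theta> $ i * \<theta> $ j * L2_inner M (\<phi> i) (f j)))))"
proof -
  define c :: "real^'k^'k" where "c = (\<chi> i j. L2_inner M (\<phi> i) (f j))"
  define q where "q \<theta> = (\<Sum>i\<in>UNIV. \<Sum>j\<in>UNIV. \<theta> $ i * \<theta> $ j * c $ i $ j)" for \<theta> :: "real^'k"
  define \<phi>c where "\<phi>c \<theta> x = (\<Sum>i\<in>UNIV. \<theta> $ i * \<phi> i x)" for \<theta> :: "real^'k" and x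
  define fc where "fc \<theta> x = (\<Sum>i\<in>UNIV. \<theta> $ i * f i x)" for \<theta> :: "real^'k" and x
  have f2: "f i \<in> L2 M" for i using f[of i] by (simp add: solves_def)
  have ph2: "\<phi> i \<in> L2 M" for i using ph by (rule L20_L2)
  have [measurable]: "\<phi> i \<in> borel_measurable M" for i using ph2 by (rule L2_D)
  have phc: "\<phi>c \<theta> \<in> L20 M" for \<theta>
  proof -
    have "(\<integral>x. \<phi>c \<theta> x \<partial>M) = (\<Sum>i\<in>UNIV. \<theta> $ i * (\<integral>x. \<phi> i x \<partial>M))"
      unfolding \<phi>c_def using L2_integrable[OF ph2] by (subst Bochner_Integration.integral_sum) auto
    moreover have "\<phi>c \<theta> \<in> L2 M" unfolding \<phi>c_def[abs_def] by (intro L2_sum L2_cmult ph2)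
    ultimately show ?thesis using ph by (simp add: L20_def)
  qed
  have [measurable]: "\<phi>c \<theta> \<in> borel_measurable M" for \<theta> using L20_L2[OF phc] by (rule L2_D)
  have fc: "solves (\<phi>c \<theta>) (fc \<theta>)" for \<theta>
    unfolding \<phi>c_def[abs_def] fc_def[abs_def] by (rule solves_combination) (auto intro: f)
  have q: "L2_inner M (\<phi>c \<theta>) (fc \<theta>) = q \<theta>" for \<theta>
  proof -
    have "L2_inner M (\<phi>c \<theta>) (fc \<theta>) = (\<integral>x. (\<Sum>i\<in>UNIV. \<Sum>j\<in>UNIV. \<theta> $ i * \<theta> $ j * (\<phi> i x * f j x)) \<partial>M)"
      unfolding L2_inner_def \<phi>c_def fc_def by (simp add: sum_product mult_ac)
    also have "\<dots> = q \<theta>"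
      unfolding q_def c_def L2_inner_def using L2_mult_integrable[OF ph2 f2]
      by (simp add: Bochner_Integration.integral_sum Bochner_Integration.integrable_sum)
    finally show ?thesis .
  qed
  have sym: "c $ i $ j = c $ j $ i" for i j
  proof -
    have "L2_inner M (\<phi> i) (f j) = L2_inner M (\<phi> j) (f i)"
      using solves_inner[OF f ph2 f2, of i j] solves_inner[OF f ph2 f2, of j i] kform_symmetric[OF K_L2k K_sym f2 f2, of i j]
      by (simp add: L2_inner_commute[of M "f i" "f j"])
    then show ?thesis by (simp add: c_def)
  qed
  have q0: "0 \<le> q \<theta>" for \<theta> using solves_inner_nonneg[OF L20_L2[OF phc] fc] unfolding q .
  have lin_phc: "(\<Sum>i\<in>UNIV. \<theta> $ i * lin N (\<phi> i) X) = lin N (\<phi>c \<theta>) X" for \<theta> N X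
    unfolding \<phi>c_def[abs_def] lin_sum ..
  define V where "V N X = (\<chi> i. lin N (\<phi> i) X)" for N X
  have V: "\<theta> \<bullet> V N X = lin N (\<phi>c \<theta>) X" for \<theta> N X
    unfolding lin_phc[symmetric] by (simp add: V_def inner_vec_def)
  have Vm: "V N \<in> borel_measurable (ipow M N)" for N
  proof (rule borel_measurable_euclidean_space[THEN iffD2, rule_format])
    show "(\<lambda>X. V N X \<bullet> b) \<in> borel_measurable (ipow M N)" for b
      unfolding inner_commute[of _ b] V by measurable
  qed
  then have Vm' [measurable]: "V N \<in> measurable (gibbs_law N) borel" for N
    by (simp cong: measurable_cong_sets)
  define L where "L N = distr (gibbs_law N) borel (V N)" for N
  have claim1: "(\<lambda>N. \<integral>X. iexp (\<Sum>i\<in>UNIV. \<theta> $ i * lin N (\<phi> i) X) \<partial>gibbs_law N)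
      \<longlonglongrightarrow> complex_of_real (exp (- (1 / 2) * q \<theta>))" for \<theta>
    using gibbs_law_char[OF phc fc, of \<theta>] unfolding lin_phc q by simp
  obtain \<gamma> where \<gamma>: "centred_gaussian \<gamma> c"
      "\<And>\<theta>. distr \<gamma> borel (\<lambda>x. \<theta> \<bullet> x) = distr std_normal_distribution borel (\<lambda>x. sqrt (q \<theta>) * x)"
    using gaussian_vector[OF sym q0[unfolded q_def]] unfolding q_def[abs_def] by blast
  have gp: "prob_space \<gamma>" and gs [measurable_cong]: "sets \<gamma> = sets borel" using \<gamma>(1) by (auto simp: centred_gaussian_def)
  have g_int: "integrable \<gamma> (\<lambda>x. g (\<theta> \<bullet> x)) \<longleftrightarrow> integrable std_normal_distribution (\<lambda>x. g (sqrt (q \<theta>) * x))"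
      "(\<integral>x. g (\<theta> \<bullet> x) \<partial>\<gamma>) = (\<integral>x. g (sqrt (q \<theta>) * x) \<partial>std_normal_distribution)"
    if [measurable]: "g \<in> borel_measurable borel" for g :: "real \<Rightarrow> 'c::{banach, second_countable_topology}" and \<theta>
  proof -
    have [measurable]: "(\<lambda>x. \<theta> \<bullet> x) \<in> borel_measurable \<gamma>" by measurable
    show "(\<integral>x. g (\<theta> \<bullet> x) \<partial>\<gamma>) = (\<integral>x. g (sqrt (q \<theta>) * x) \<partial>std_normal_distribution)"
      using integral_distr[of "\<lambda>x. \<theta> \<bullet> x" \<gamma> borel g] integral_distr[of "\<lambda>x. sqrt (q \<theta>) * x" std_normal_distribution borel g]
      unfolding \<gamma>(2) by simp
    show "integrable \<gamma> (\<lambda>x. g (\<theta> \<bullet> x)) \<longleftrightarrow> integrable std_normal_distribution (\<lambda>x. g (sqrt (q \<theta>) * x))"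
      using integrable_distr_eq[of "\<lambda>x. \<theta> \<bullet> x" \<gamma> borel g] integrable_distr_eq[of "\<lambda>x. sqrt (q \<theta>) * x" std_normal_distribution borel g]
      unfolding \<gamma>(2) by simp
  qed
  have ax: "axis i 1 \<bullet> x = x $ i" for i :: 'k and x :: "real^'k" by (simp add: inner_axis')
  have gi: "integrable \<gamma> (\<lambda>x. x $ i)" for i
  proof -
    have "integrable \<gamma> (\<lambda>x. axis i 1 \<bullet> x)"
      by (subst g_int(1)[of "\<lambda>x. x"]) (auto intro: std_normal_moments)
    then show ?thesis unfolding ax .
  qed
  \<comment> \<open>A common first moment bound for the Gaussian limit and for all large N; summing
    over the coordinates dominates each of them.\<close>
  define T where "T = (\<Sum>i\<in>UNIV. \<integral>x. \<bar>x $ i\<bar> \<partial>\<gamma>) + (\<Sum>i\<in>UNIV. (\<integral>x. (\<phi> i x)\<^sup>2 \<partial>M) + \<bar>C\<bar>) / partition_bound"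
  have T0: "0 \<le> (\<Sum>i\<in>UNIV. \<integral>x. \<bar>x $ i\<bar> \<partial>\<gamma>)" "0 \<le> (\<Sum>i\<in>UNIV. (\<integral>x. (\<phi> i x)\<^sup>2 \<partial>M) + \<bar>C\<bar>) / partition_bound"
    using partition_bound_pos by (auto intro!: sum_nonneg divide_nonneg_nonneg add_nonneg_nonneg)
  have tight_\<gamma>: "tight_law T \<gamma>"
    unfolding tight_law_def
  proof (intro conjI allI gp gs gi)
    fix i
    have "(\<integral>x. \<bar>x $ i\<bar> \<partial>\<gamma>) \<le> (\<Sum>i\<in>UNIV. \<integral>x. \<bar>x $ i\<bar> \<partial>\<gamma>)" by (rule member_le_sum) auto
    then show "(\<integral>x. \<bar>x $ i\<bar> \<partial>\<gamma>) \<le> T" unfolding T_def using T0(2) by linarith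
  qed
  have L_prob: "prob_space (L N)" "sets (L N) = sets borel" if "partition_bound \<le> partition_fun N" for N
    unfolding L_def using prob_space.prob_space_distr[OF prob_space_gibbs_law[OF that] Vm'] by auto
  have tight_L: "\<forall>\<^sub>F N in sequentially. tight_law T (L N)"
    using partition_lower
  proof eventually_elim
    case (elim N)
    show ?case unfolding tight_law_def
    proof (intro conjI allI L_prob elim)
      fix i
      note b = gibbs_law_L2_bound[OF lin_L2[OF ph[of i], of N] elim]
      have [measurable]: "lin N (\<phi> i) \<in> borel_measurable (gibbs_law N)" using b(1) by auto
      show "integrable (L N) (\<lambda>x. x $ i)"
        unfolding L_def by (subst integrable_distr_eq) (use b(1) in \<open>auto simp: V_def\<close>)
      have "(\<integral>x. \<bar>x $ i\<bar> \<partial>L N) = (\<integral>X. \<bar>lin N (\<phi> i) X\<bar> \<partial>gibbs_law N)"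
        unfolding L_def by (subst integral_distr) (auto simp: V_def)
      also have "\<dots> \<le> ((\<integral>x. (\<phi> i x)\<^sup>2 \<partial>M) + \<bar>C\<bar>) / partition_bound" by (rule b(2))
      also have "\<dots> \<le> (\<Sum>i\<in>UNIV. (\<integral>x. (\<phi> i x)\<^sup>2 \<partial>M) + \<bar>C\<bar>) / partition_bound"
        using partition_bound_pos by (intro divide_right_mono member_le_sum) auto
      also have "\<dots> \<le> T" unfolding T_def using T0(1) by linarith
      finally show "(\<integral>x. \<bar>x $ i\<bar> \<partial>L N) \<le> T" .
    qed
  qed
  have law: "conv_in_law L \<gamma>"
  proof (rule conv_in_law_of_char[OF tight_L tight_\<gamma>])
    fix \<theta>
    have N: "(\<integral>x. iexp (u * x) \<partial>std_normal_distribution) = complex_of_real (exp (- u\<^sup>2 / 2))" for u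
      using fun_cong[OF char_std_normal_distribution, of u] by (simp add: char_def)
    have "(\<integral>x. iexp (\<theta> \<bullet> x) \<partial>\<gamma>) = complex_of_real (exp (- (1 / 2) * q \<theta>))"
      using N[of "sqrt (q \<theta>)"] q0 by (subst g_int(2)[of "\<lambda>x. iexp x"]) auto
    moreover have "(\<integral>x. iexp (\<theta> \<bullet> x) \<partial>L N) = (\<integral>X. iexp (\<Sum>i\<in>UNIV. \<theta> $ i * lin N (\<phi> i) X) \<partial>gibbs_law N)" for N
      unfolding L_def lin_phc V[symmetric] by (subst integral_distr) auto
    ultimately show "(\<lambda>n. \<integral>x. iexp (\<theta> \<bullet> x) \<partial>L n) \<longlonglongrightarrow> (\<integral>x. iexp (\<theta> \<bullet> x) \<partial>\<gamma>)"
      using claim1[of \<theta>] by simp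
  qed
  have claim3: "(\<lambda>N. \<integral>X. exp (\<Sum>i\<in>UNIV. \<theta> $ i * lin N (\<phi> i) X) \<partial>gibbs_law N) \<longlonglongrightarrow> exp (1 / 2 * q \<theta>)"
    if bd: "\<forall>i. \<exists>b. AE x in M. \<bar>\<phi> i x\<bar> \<le> b" for \<theta>
  proof -
    obtain b where b: "\<And>i. AE x in M. \<bar>\<phi> i x\<bar> \<le> b i" using bd by metis
    define B where "B = (\<Sum>i\<in>UNIV. \<bar>\<theta> $ i\<bar> * b i)"
    have "AE x in M. \<forall>i\<in>UNIV. \<bar>\<phi> i x\<bar> \<le> b i" using b by (intro AE_finite_allI) auto
    then have B: "AE x in M. \<bar>\<phi>c \<theta> x\<bar> \<le> B"
    proof eventually_elim
      case (elim x)
      have "\<bar>\<phi>c \<theta> x\<bar> \<le> (\<Sum>i\<in>UNIV. \<bar>\<theta> $ i * \<phi> i x\<bar>)" unfolding \<phi>c_def by (rule sum_abs)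
      also have "\<dots> \<le> B" unfolding B_def abs_mult using elim by (intro sum_mono mult_left_mono) auto
      finally show ?case .
    qed
    \<comment> \<open>The function exp (2 lin) has to be square integrable under the product law
      before it is integrated under the Gibbs law, which calls for the exponent 4.\<close>
    define D where "D = exp (4\<^sup>2 * B\<^sup>2 / 2)"
    have exp_L2: "(\<lambda>X. exp (2 * lin N (\<phi>c \<theta>) X)) \<in> L2 (ipow M N)" "(\<integral>X. (exp (2 * lin N (\<phi>c \<theta>) X))\<^sup>2 \<partial>ipow M N) \<le> D" for N
    proof -
      have "sqn (ipow M N) (\<lambda>X. exp (2 * lin N (\<phi>c \<theta>) X)) = (\<integral>\<^sup>+X. ennreal (exp (4 * lin N (\<phi>c \<theta>) X)) \<partial>ipow M N)"
        unfolding sqn_def by (simp add: exp_double[symmetric])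
      also have "\<dots> \<le> ennreal D"
        unfolding D_def by (rule exp_lin_bound) (use B phc in \<open>auto simp: L20_def\<close>)
      finally have le: "sqn (ipow M N) (\<lambda>X. exp (2 * lin N (\<phi>c \<theta>) X)) \<le> ennreal D" .
      then show l2: "(\<lambda>X. exp (2 * lin N (\<phi>c \<theta>) X)) \<in> L2 (ipow M N)" by (auto simp: L2_iff_sqn intro: le_less_trans)
      show "(\<integral>X. (exp (2 * lin N (\<phi>c \<theta>) X))\<^sup>2 \<partial>ipow M N) \<le> D"
        using le unfolding sqn_eq_integral[OF l2] by (simp add: D_def)
    qed
    have "(\<lambda>N. \<integral>x. exp (\<theta> \<bullet> x) \<partial>L N) \<longlonglongrightarrow> (\<integral>x. exp (\<theta> \<bullet> x) \<partial>\<gamma>)"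
    proof (rule conv_in_law_exp_moment[OF law _ gp gs])
      show "\<forall>\<^sub>F N in sequentially. prob_space (L N) \<and> sets (L N) = sets borel \<and>
          integrable (L N) (\<lambda>x. exp (2 * (\<theta> \<bullet> x))) \<and> (\<integral>x. exp (2 * (\<theta> \<bullet> x)) \<partial>L N) \<le> (D + \<bar>C\<bar>) / partition_bound"
        using partition_lower
      proof eventually_elim
        case (elim N)
        note b = gibbs_law_L2_bound[OF exp_L2[of N] elim]
        have "integrable (L N) (\<lambda>x. exp (2 * (\<theta> \<bullet> x)))"
          unfolding L_def by (subst integrable_distr_eq) (use b(1) in \<open>auto simp: V\<close>)
        moreover have "(\<integral>x. exp (2 * (\<theta> \<bullet> x)) \<partial>L N) = (\<integral>X. \<bar>exp (2 * lin N (\<phi>c \<theta>) X)\<bar> \<partial>gibbs_law N)"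
          unfolding L_def by (subst integral_distr) (auto simp: V)
        ultimately show ?case using b(2) L_prob[OF elim] by simp
      qed
      show "integrable \<gamma> (\<lambda>x. exp (2 * (\<theta> \<bullet> x)))"
        using std_normal_exp(1)[of "2 * sqrt (q \<theta>)"] by (subst g_int(1)[of "\<lambda>x. exp (2 * x)"]) (auto simp: mult_ac)
    qed
    moreover have "(\<integral>x. exp (\<theta> \<bullet> x) \<partial>\<gamma>) = exp (1 / 2 * q \<theta>)"
      using std_normal_exp(2)[of "sqrt (q \<theta>)"] q0 by (subst g_int(2)[of exp]) auto
    moreover have "(\<integral>x. exp (\<theta> \<bullet> x) \<partial>L N) = (\<integral>X. exp (\<Sum>i\<in>UNIV. \<theta> $ i * lin N (\<phi> i) X) \<partial>gibbs_law N)" for N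
      unfolding L_def lin_phc V[symmetric] by (subst integral_distr) auto
    ultimately show ?thesis by simp
  qed
  have cv: "L2_inner M (\<phi> i) (f j) = c $ i $ j" for i j by (simp add: c_def)
  show ?thesis
    unfolding cv q_def[symmetric] V_def[symmetric]
    using claim1 claim3 \<gamma>(1) law unfolding c_def[symmetric] L_def[abs_def]
    by (auto simp: vec_lambda_eta)
qed

end

section \<open>Transfer to the Riesz interaction\<close>

lemma sum_offdiag_ustat:
  assumes sym: "\<And>x y. K x y = K y x"
  shows "(\<Sum>i<N. \<Sum>j\<in>{..<N} - {i}. K (X i) (X j)) = 2 * ustat K N X"
proof (induction N)
  case 0
  show ?case by (simp add: ustat_def)
next
  case (Suc N)
  have "(\<Sum>j\<in>{..<Suc N} - {i}. K (X i) (X j)) = (\<Sum>j\<in>{..<N} - {i}. K (X i) (X j)) + K (X i) (X N)" if "i < N" for i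
  proof -
    have "{..<Suc N} - {i} = insert N ({..<N} - {i})" using that by auto
    then show ?thesis by simp
  qed
  moreover have "{..<Suc N} - {N} = {..<N}" by auto
  ultimately have "(\<Sum>i<Suc N. \<Sum>j\<in>{..<Suc N} - {i}. K (X i) (X j)) =
      (\<Sum>i<N. \<Sum>j\<in>{..<N} - {i}. K (X i) (X j)) + (\<Sum>i<N. K (X i) (X N)) + (\<Sum>j<N. K (X N) (X j))"
    by (simp add: sum.distrib)
  also have "(\<Sum>j<N. K (X N) (X j)) = (\<Sum>i<N. K (X i) (X N))" by (intro sum.cong refl sym)
  finally show ?case unfolding Suc by (simp add: ustat_def)
qed

lemma gmix_low_nonpos: "gmix s {0<..<1} z \<le> 0"
proof -
  have "0 \<le> (\<integral>t. - (indicator {0<..<1} t * (t powr (s - 1) * gd t z)) \<partial>lborel)"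
  proof (rule integral_nonneg_AE, rule AE_I2)
    fix t :: real
    show "0 \<le> - (indicator {0<..<1} t * (t powr (s - 1) * gd t z))"
      by (auto simp: indicator_def gd_def mult_nonneg_nonpos)
  qed
  then show ?thesis unfolding gmix_def by simp
qed

context riesz_measure
begin

text \<open>The double sum in \<open>FN\<close> counts each pair twice, and
  \<open>integral_hpot\<close> turns half the mean of the potential into the energy. For N = 0
  division by zero removes the constant term from \<open>FN\<close>, hence the restriction to N >
  0.\<close>

lemma gibbs_exponent_FN:
  assumes N: "0 < N"
  shows "- \<beta> * real N * FN s \<mu> N X = gibbs_exponent \<mu> (\<lambda>x y. \<beta> * gtilde s \<mu> x y) (\<lambda>x. \<beta> * hpot s \<mu> x) N X"
proof -
  have u: "ustat (\<lambda>x y. \<beta> * gtilde s \<mu> x y) N X = \<beta> * ustat (gtilde s \<mu>) N X"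
    by (simp add: ustat_def sum_distrib_left)
  have h: "(\<integral>x. \<beta> * hpot s \<mu> x \<partial>\<mu>) / 2 = \<beta> * Ien s \<mu>" by (simp add: integral_hpot)
  have hs: "(\<Sum>i<N. \<beta> * hpot s \<mu> (X i)) = \<beta> * (\<Sum>i<N. hpot s \<mu> (X i))" by (simp add: sum_distrib_left)
  show ?thesis
    unfolding FN_def gibbs_exponent_def u h hs sum_offdiag_ustat[of "gtilde s \<mu>", OF gtilde_sym]
    using N by (simp add: field_simps power2_eq_square)
qed

text \<open>Square integrability of the uncentred kernel, from which that of the potential, the
  centred kernel and the small t part is derived.\<close>

abbreviation gpair_L2 :: bool where
  "gpair_L2 \<equiv> (\<lambda>(x, y). gker s (x - y)) \<in> L2 (\<mu> \<Otimes>\<^sub>M \<mu>)"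

lemma hpot_L2: "gpair_L2 \<Longrightarrow> hpot s \<mu> \<in> L2 \<mu>"
  using kop_L2[of "\<lambda>x y. gker s (x - y)" "\<lambda>_. 1"] L2_const[of 1] by (simp add: kop_def[abs_def] hpot_def[abs_def])

lemma gtilde_L2_of_gker: "gpair_L2 \<Longrightarrow> case_prod (gtilde s \<mu>) \<in> L2 (\<mu> \<Otimes>\<^sub>M \<mu>)"
proof -
  assume g: gpair_L2
  have "sqn (\<mu> \<Otimes>\<^sub>M \<mu>) (case_prod (gtilde s \<mu>)) \<le> 16 * sqn (\<mu> \<Otimes>\<^sub>M \<mu>) (\<lambda>(x, y). gker s (x - y))"
    unfolding gtilde_eq_cen by (rule sqn_cen_le) measurable
  also have "\<dots> < \<infinity>" using g by (simp add: L2_iff_sqn ennreal_mult_less_top)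
  finally show ?thesis by (auto simp: L2_iff_sqn)
qed

lemma tail_pair_L2: "case_prod (gx {1..}) \<in> L2 (\<mu> \<Otimes>\<^sub>M \<mu>)"
  using le_less_trans[OF tail_pair(1)[OF order_refl]] by (auto simp: L2_iff_sqn)

lemma low_sqn: 
  assumes g: gpair_L2
  shows "sqn (\<mu> \<Otimes>\<^sub>M \<mu>) (case_prod (gx {0<..<1})) < \<infinity>"
proof -
  interpret PP: pair_prob_space \<mu> \<mu> ..
  let ?f = "\<lambda>z. (1 / c) * ((case z of (x, y) \<Rightarrow> gker s (x - y)) - \<kappa>) - case_prod (gx {1..}) z"
  have "?f \<in> L2 (\<mu> \<Otimes>\<^sub>M \<mu>)"
    by (intro L2_diff L2_cmult g PP.P.L2_const tail_pair_L2)
  moreover have "sqn (\<mu> \<Otimes>\<^sub>M \<mu>) (case_prod (gx {0<..<1})) = sqn (\<mu> \<Otimes>\<^sub>M \<mu>) ?f"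
    unfolding sqn_def using AE_low_eq by (intro nn_integral_cong_AE) (auto elim!: eventually_mono)
  ultimately show ?thesis by (simp add: L2_iff_sqn)
qed

lemma gpair_L2_pos:
  assumes s: "0 < s"
  shows gpair_L2
proof -
  interpret PP: pair_prob_space \<mu> \<mu> ..
  let ?f = "\<lambda>z. \<kappa> + c * (case_prod (gx {0<..<1}) z + case_prod (gx {1..}) z)"
  have low: "case_prod (gx {0<..<1}) \<in> L2 (\<mu> \<Otimes>\<^sub>M \<mu>)"
  proof (rule PP.P.L2_bounded)
    show "\<bar>case_prod (gx {0<..<1}) z\<bar> \<le> 1 / s" for z
      using gmix_low_bounded[OF s, of "fst z - snd z"] by (simp add: gx_def split_beta)
  qed simp
  have f: "?f \<in> L2 (\<mu> \<Otimes>\<^sub>M \<mu>)"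
    by (intro L2_add L2_cmult PP.P.L2_const low tail_pair_L2)
  have "sqn (\<mu> \<Otimes>\<^sub>M \<mu>) (\<lambda>(x, y). gker s (x - y)) = sqn (\<mu> \<Otimes>\<^sub>M \<mu>) ?f"
    unfolding sqn_def using AE_pair_neq
    by (intro nn_integral_cong_AE) (auto elim!: eventually_mono simp: gker_split_one split_beta)
  then show ?thesis using f by (simp add: L2_iff_sqn)
qed

text \<open>The small t part is nonpositive and the tail integral is at most \<open>T1 1\<close>, so
  only negative values of the potential can be large.\<close>

lemma hpot_le: "AE x in \<mu>. hpot s \<mu> x \<le> \<kappa> + c * T1 1"
  using AE_good
proof eventually_elim
  case (elim x)
  have "(\<integral>y. gx {0<..<1} x y \<partial>\<mu>) \<le> 0"
  proof -
    have "0 \<le> (\<integral>y. - gx {0<..<1} x y \<partial>\<mu>)"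
      by (intro integral_nonneg_AE AE_I2) (simp add: gx_def gmix_low_nonpos)
    then show ?thesis by simp
  qed
  then have "(\<integral>y. gx {0<..<1} x y \<partial>\<mu>) + (\<integral>y. gx {1..} x y \<partial>\<mu>) \<le> T1 1"
    using tail_integrable(3)[of 1 x] by simp
  then show ?case unfolding hpot_split[OF order_refl elim] using c0 by simp
qed

text \<open>The potential v is bounded above, so only its negative part needs a moment; there (4
  \<beta> v)^2 / 2 <= exp (-4 \<beta> v) gives square integrability. The uncentred kernel is the
  centred one plus functions of one variable and a constant.\<close>

lemma gpair_L2_exp:
  assumes beta: "0 < \<beta>" and e: "integrable \<mu> (\<lambda>x. exp (- 4 * \<beta> * hpot s \<mu> x))"
    and g: "case_prod (gtilde s \<mu>) \<in> L2 (\<mu> \<Otimes>\<^sub>M \<mu>)"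
  shows gpair_L2
proof -
  interpret PP: pair_prob_space \<mu> \<mu> ..
  define U where "U = \<kappa> + c * T1 1"
  have h: "hpot s \<mu> \<in> L2 \<mu>"
    unfolding L2_def
  proof (rule CollectI, rule conjI[OF measurable_hpot])
    show "integrable \<mu> (\<lambda>x. (hpot s \<mu> x)\<^sup>2)"
    proof (rule Bochner_Integration.integrable_bound)
      show "integrable \<mu> (\<lambda>x. U\<^sup>2 + exp (- 4 * \<beta> * hpot s \<mu> x) / (8 * \<beta>\<^sup>2))"
        by (intro Bochner_Integration.integrable_add integrable_divide e) auto
      show "AE x in \<mu>. norm ((hpot s \<mu> x)\<^sup>2) \<le> norm (U\<^sup>2 + exp (- 4 * \<beta> * hpot s \<mu> x) / (8 * \<beta>\<^sup>2))"
        using hpot_le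
      proof eventually_elim
        case (elim x)
        define v where "v = hpot s \<mu> x"
        have "v\<^sup>2 \<le> U\<^sup>2 + exp (- 4 * \<beta> * v) / (8 * \<beta>\<^sup>2)"
        proof (cases "0 \<le> v")
          case True
          then have "v\<^sup>2 \<le> U\<^sup>2" using elim by (intro power_mono) (simp_all add: v_def U_def)
          then show ?thesis using beta by (simp add: add_increasing2)
        next
          case False
          then have t: "0 \<le> - 4 * \<beta> * v" using beta by (simp add: mult_nonneg_nonpos)
          have "(- 4 * \<beta> * v)\<^sup>2 / 2 \<le> exp (- 4 * \<beta> * v)"
            using exp_lower_Taylor_quadratic[OF t] t by linarith
          then have "v\<^sup>2 * (8 * \<beta>\<^sup>2) \<le> exp (- 4 * \<beta> * v)" by (simp add: power_mult_distrib mult_ac)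
          then have "v\<^sup>2 \<le> exp (- 4 * \<beta> * v) / (8 * \<beta>\<^sup>2)" using beta by (simp add: pos_le_divide_eq)
          then show ?thesis by (simp add: add_increasing)
        qed
        then show ?case unfolding v_def real_norm_def abs_power2 by (rule order_trans[OF _ abs_ge_self])
      qed
    qed measurable
  qed
  have one: "(\<lambda>_. 1) \<in> L2 \<mu>" by (rule L2_const)
  have t1: "(\<lambda>z. hpot s \<mu> (fst z)) \<in> L2 (\<mu> \<Otimes>\<^sub>M \<mu>)" "(\<lambda>z. hpot s \<mu> (snd z)) \<in> L2 (\<mu> \<Otimes>\<^sub>M \<mu>)"
    using tens_L2(1)[OF h one] tens_L2(1)[OF one h] by (simp_all add: tens_def split_beta')
  have "(\<lambda>z. case_prod (gtilde s \<mu>) z + hpot s \<mu> (fst z) + hpot s \<mu> (snd z) - 2 * Ien s \<mu>) \<in> L2 (\<mu> \<Otimes>\<^sub>M \<mu>)"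
    by (intro L2_diff L2_add g t1 PP.P.L2_const)
  moreover have "(\<lambda>z. case_prod (gtilde s \<mu>) z + hpot s \<mu> (fst z) + hpot s \<mu> (snd z) - 2 * Ien s \<mu>) = (\<lambda>(x, y). gker s (x - y))"
    by (auto simp: gtilde_def)
  ultimately show ?thesis by simp
qed

end

lemma riesz_measure_exists:
  fixes \<mu> :: "'a::euclidean_space measure"
  assumes s: "0 \<le> s" "s < real DIM('a) / 2"
    and mu: "prob_space \<mu>" "bounded_density \<mu>"
    and log_int: "s = 0 \<Longrightarrow> integrable (\<mu> \<Otimes>\<^sub>M \<mu>) (\<lambda>(x, y). \<bar>ln (norm (x - y))\<bar>)"
  shows "\<exists>B c \<kappa> \<rho>. riesz_measure \<mu> s B c \<kappa> \<rho>"
proof -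
  obtain \<rho> B where r: "\<rho> \<in> borel_measurable lborel" "AE x in lborel. \<bar>\<rho> x\<bar> \<le> B" "\<mu> = density lborel (\<lambda>x. ennreal (\<rho> x))"
    using mu(2) by (auto simp: bounded_density_def Linf_def)
  obtain c \<kappa> where c: "0 < c" "\<And>z::'a. z \<noteq> 0 \<Longrightarrow> gker s z = \<kappa> + c * gmix s {0<..} z"
    using gker_eq_gmix[OF s(1), where 'a='a] by blast
  have base: "riesz_base \<mu> s \<bar>B\<bar> c \<kappa> \<rho>"
  proof (intro riesz_base.intro mu(1) riesz_base_axioms.intro s c r(3))
    show "\<rho> \<in> borel_measurable borel" using r(1) by simp
    show "AE x in lborel. \<rho> x \<le> \<bar>B\<bar>" using r(2) by eventually_elim linarith
  qed auto
  interpret riesz_base \<mu> s "\<bar>B\<bar>" c \<kappa> \<rho> by (rule base)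
  have "integrable (\<mu> \<Otimes>\<^sub>M \<mu>) (\<lambda>(x, y). gx {0<..<1} x y)"
  proof (cases "s = 0")
    case True
    have "integrable (\<mu> \<Otimes>\<^sub>M \<mu>) (\<lambda>(x, y). gker s (x - y))"
    proof (rule Bochner_Integration.integrable_bound[OF log_int[OF True]])
      show "AE z in \<mu> \<Otimes>\<^sub>M \<mu>. norm (case z of (x, y) \<Rightarrow> gker s (x - y)) \<le> norm (case z of (x, y) \<Rightarrow> \<bar>ln (norm (x - y))\<bar>)"
        using True by (intro AE_I2) (auto simp: gker_def)
    qed measurable
    then show ?thesis by (rule low_integrable_of_gker)
  next
    case False
    then show ?thesis using s by (intro low_integrable_pos) simp
  qed
  then have "riesz_measure \<mu> s \<bar>B\<bar> c \<kappa> \<rho>" by (intro riesz_measure.intro base riesz_measure_axioms.intro)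
  then show ?thesis by blast
qed

lemma conv_in_law_cong:
  assumes "\<forall>\<^sub>F n in sequentially. M n = M' n"
  shows "conv_in_law M \<gamma> \<longleftrightarrow> conv_in_law M' \<gamma>"
proof -
  have "(\<lambda>n. \<integral>x. f x \<partial>M n) \<longlonglongrightarrow> l \<longleftrightarrow> (\<lambda>n. \<integral>x. f x \<partial>M' n) \<longlonglongrightarrow> l" for f :: "_ \<Rightarrow> real" and l
    using assms by (intro tendsto_cong) (auto elim!: eventually_mono)
  then show ?thesis unfolding conv_in_law_def by simp
qed

lemma SN_eq_lin:
  fixes \<phi> :: "'a::euclidean_space \<Rightarrow> real"
  assumes "\<phi> \<in> borel_measurable borel" and N: "0 < N"
  shows "SN \<mu> N \<phi> X = lin N (centred \<mu> \<phi>) X"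
proof -
  have "lin N (centred \<mu> \<phi>) X = ((\<Sum>i<N. \<phi> (X i)) - real N * (\<integral>y. \<phi> y \<partial>\<mu>)) / sqrt (real N)"
    by (simp add: lin_def centred_def sum_subtractf)
  also have "\<dots> = sqrt (real N) * ((\<Sum>i<N. \<phi> (X i)) / real N - (\<integral>y. \<phi> y \<partial>\<mu>))"
  proof -
    have "(a - r * r * b) / r = r * (a / (r * r) - b)" if "r \<noteq> 0" for a b r :: real
      using that by (simp add: field_simps)
    from this[of "sqrt (real N)"] show ?thesis using N by simp
  qed
  finally show ?thesis unfolding SN_def integral_empirical[OF assms(1)] by simp
qed

theorem proposition2p11:
  fixes \<mu> :: "'a::euclidean_space measure"
    and s \<beta> :: real
    and \<phi> :: "'k::finite \<Rightarrow> 'a \<Rightarrow> real"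
  assumes beta: "0 \<le> \<beta>"
    and s: "0 \<le> s" "s < real DIM('a) / 2"
    and mu: "prob_space \<mu>" "sets \<mu> = sets borel" "bounded_density \<mu>"
    and log_int: "s = 0 \<Longrightarrow> integrable (\<mu> \<Otimes>\<^sub>M \<mu>) (\<lambda>(x, y). \<bar>ln (norm (x - y))\<bar>)"
    and exp_int: "s = 0 \<Longrightarrow> integrable \<mu> (\<lambda>x. exp (- 4 * \<beta> * hpot s \<mu> x))"
    and gtilde_L2: "s = 0 \<Longrightarrow> (\<lambda>(x, y). gtilde s \<mu> x y) \<in> L2 (\<mu> \<Otimes>\<^sub>M \<mu>)"
    and phi: "\<And>i. \<phi> i \<in> L2 \<mu>"
  shows "(\<forall>\<theta> :: real^'k.
            (\<lambda>N. \<integral>X. exp (\<i> * complex_of_real (\<Sum>i\<in>UNIV. \<theta> $ i * SN \<mu> N (\<phi> i) X)) \<partial>(QN s \<beta> \<mu> N))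
            \<longlonglongrightarrow> complex_of_real (exp (- (1 / 2) *
                  (\<Sum>i\<in>UNIV. \<Sum>j\<in>UNIV. \<theta> $ i * \<theta> $ j * Sigma_cov s \<beta> \<mu> (\<phi> i) (\<phi> j)))))
       \<and> (\<exists>\<gamma> :: (real^'k) measure.
            centred_gaussian \<gamma> (\<chi> i j. Sigma_cov s \<beta> \<mu> (\<phi> i) (\<phi> j)) \<and>
            conv_in_law (\<lambda>N. distr (QN s \<beta> \<mu> N) borel (\<lambda>X. \<chi> i. SN \<mu> N (\<phi> i) X)) \<gamma>)
       \<and> ((\<forall>i. \<phi> i \<in> Linf \<mu>) \<longrightarrow>
           (\<forall>\<theta> :: real^'k.
             (\<lambda>N. \<integral>X. exp (\<Sum>i\<in>UNIV. \<theta> $ i * SN \<mu> N (\<phi> i) X) \<partial>(QN s \<beta> \<mu> N))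
             \<longlonglongrightarrow> exp (1 / 2 *
                  (\<Sum>i\<in>UNIV. \<Sum>j\<in>UNIV. \<theta> $ i * \<theta> $ j * Sigma_cov s \<beta> \<mu> (\<phi> i) (\<phi> j)))))"
proof -
  obtain B c \<kappa> \<rho> where "riesz_measure \<mu> s B c \<kappa> \<rho>"
    using riesz_measure_exists[OF s mu(1,3) log_int] by blast
  then interpret riesz_measure \<mu> s B c \<kappa> \<rho> .
  \<comment> \<open>In the remaining case s = 0 and \<beta> = 0 both \<open>?K\<close> and
    \<open>?H\<close> vanish, so square integrability of the uncentred kernel is not called
    upon.\<close>
  have g: gpair_L2 if "s \<noteq> 0 \<or> 0 < \<beta>"
  proof (cases "s = 0")
    case True
    then show ?thesis using that exp_int gtilde_L2 by (intro gpair_L2_exp) auto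
  next
    case False
    then show ?thesis using s by (intro gpair_L2_pos) simp
  qed
  let ?K = "\<lambda>x y. \<beta> * gtilde s \<mu> x y" and ?H = "\<lambda>x. \<beta> * hpot s \<mu> x"
  have "\<exists>C. degenerate_gibbs \<mu> ?K ?H C"
  proof (rule degenerate_gibbs_riesz[OF beta])
    show "0 < \<beta> \<Longrightarrow> sqn (\<mu> \<Otimes>\<^sub>M \<mu>) (case_prod (gx {0<..<1})) < \<infinity>" using g by (intro low_sqn) auto
    show "case_prod (gtilde s \<mu>) \<in> L2 (\<mu> \<Otimes>\<^sub>M \<mu>)"
      using g gtilde_L2 gtilde_L2_of_gker by (cases "s = 0") auto
    show "?H \<in> L2 \<mu>"
    proof (cases "\<beta> = 0")
      case False
      then show ?thesis using g beta by (intro L2_cmult hpot_L2) auto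
    qed (simp add: L2_zero)
  qed
  then obtain C where "degenerate_gibbs \<mu> ?K ?H C" ..
  then interpret G: degenerate_gibbs \<mu> ?K ?H C .
  define \<psi> f where "\<psi> i = centred \<mu> (\<phi> i)" and "f i = resolvent s \<beta> \<mu> (\<psi> i)" for i
  have phi_m: "\<phi> i \<in> borel_measurable borel" for i
    using L2_D(1)[OF phi[of i]] by simp
  have \<psi>: "\<psi> i \<in> L20 \<mu>" for i
  proof -
    have "(\<integral>x. \<psi> i x \<partial>\<mu>) = 0"
      unfolding \<psi>_def centred_def using L2_integrable[OF phi] by (simp add: prob_space)
    moreover have "\<psi> i \<in> L2 \<mu>"
      unfolding \<psi>_def centred_def[abs_def] by (intro L2_diff phi L2_const)
    ultimately show ?thesis by (simp add: L20_def)
  qed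
  have solves_iff: "G.solves \<eta> h \<longleftrightarrow> h \<in> L2 \<mu> \<and> (AE x in \<mu>. h x + \<beta> * Top s \<mu> h x = \<eta> x)" for \<eta> h
    unfolding G.solves_def kop_def Top_def by (simp add: mult.assoc)
  \<comment> \<open>\<open>resolvent\<close> is a choice; existence of a solution makes the chosen
    function one, and the limits are valid for any solution.\<close>
  have f: "G.solves (\<psi> i) (f i)" for i
    unfolding f_def resolvent_def solves_iff
    using G.solves_exists[OF \<psi>[of i]] unfolding solves_iff by (rule someI_ex)
  have Sigma: "L2_inner \<mu> (\<psi> i) (f j) = Sigma_cov s \<beta> \<mu> (\<phi> i) (\<phi> j)" for i j
    by (simp add: Sigma_cov_def \<psi>_def f_def)
  have Q: "QN s \<beta> \<mu> N = G.gibbs_law N" if "0 < N" for N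
    unfolding QN_def G.gibbs_law_def KN_def G.partition_fun_def gibbs_exponent_FN[OF that] ..
  have S: "SN \<mu> N (\<phi> i) X = lin N (\<psi> i) X" if "0 < N" for N i X
    unfolding \<psi>_def by (rule SN_eq_lin[OF phi_m that])
  \<comment> \<open>At N = 0 the conventions for division can make the Gibbs densities differ, so
    the two descriptions are identified only eventually.\<close>
  have pos: "\<forall>\<^sub>F N in sequentially. 0 < N" by (rule eventually_gt_at_top)
  have 1: "(\<lambda>N. \<integral>X. exp (\<i> * complex_of_real (\<Sum>i\<in>UNIV. \<theta> $ i * SN \<mu> N (\<phi> i) X)) \<partial>(QN s \<beta> \<mu> N)) \<longlonglongrightarrow> l \<longleftrightarrow>
      (\<lambda>N. \<integral>X. iexp (\<Sum>i\<in>UNIV. \<theta> $ i * lin N (\<psi> i) X) \<partial>G.gibbs_law N) \<longlonglongrightarrow> l" for \<theta> :: "real^'k" and l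
    by (intro tendsto_cong eventually_mono[OF pos]) (simp only: Q S)
  have 2: "conv_in_law (\<lambda>N. distr (QN s \<beta> \<mu> N) borel (\<lambda>X. \<chi> i. SN \<mu> N (\<phi> i) X)) \<gamma> \<longleftrightarrow>
      conv_in_law (\<lambda>N. distr (G.gibbs_law N) borel (\<lambda>X. \<chi> i. lin N (\<psi> i) X)) \<gamma>" for \<gamma> :: "(real^'k) measure"
    by (intro conv_in_law_cong eventually_mono[OF pos]) (simp only: Q S)
  have 3: "(\<lambda>N. \<integral>X. exp (\<Sum>i\<in>UNIV. \<theta> $ i * SN \<mu> N (\<phi> i) X) \<partial>(QN s \<beta> \<mu> N)) \<longlonglongrightarrow> l \<longleftrightarrow>
      (\<lambda>N. \<integral>X. exp (\<Sum>i\<in>UNIV. \<theta> $ i * lin N (\<psi> i) X) \<partial>G.gibbs_law N) \<longlonglongrightarrow> l" for \<theta> :: "real^'k" and l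
    by (intro tendsto_cong eventually_mono[OF pos]) (simp only: Q S)
  have bd: "\<exists>b. AE x in \<mu>. \<bar>\<psi> i x\<bar> \<le> b" if Li: "\<phi> i \<in> Linf \<mu>" for i
  proof -
    obtain b where "AE x in \<mu>. \<bar>\<phi> i x\<bar> \<le> b" using Li by (auto simp: Linf_def)
    then have "AE x in \<mu>. \<bar>\<psi> i x\<bar> \<le> b + \<bar>\<integral>y. \<phi> i y \<partial>\<mu>\<bar>"
      by eventually_elim (simp add: \<psi>_def centred_def)
    then show ?thesis ..
  qed
  show ?thesis
    unfolding 1 2 3 using G.gibbs_clt[of \<psi> f, OF \<psi> f] bd unfolding Sigma by blast
qed

end
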